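(* Let $\mathcal{G}^\nu$ be a $\nu$-graph satisfying the standing assumptions below. Then the center of $\mathcal{G}^\nu$ lies in a single $\nu$-block.
   Context: Transfinite graphs are in the sense of Zemanian (Transfinite Graphs and Electrical Networks). A $0$-graph is a conventional graph of branches and $0$-nodes; no self-loops. A $0$-path is a finite, one-ended or endless alternating sequence of distinct $0$-nodes and branches; a $0$-tip is a class of one-ended $0$-paths that eventually coincide. Recursively, a $\mu$-node shorts together tips of ranks $<\mu$ (at least one of rank $\mu-1$) and may embrace one node of lower rank; a $\mu$-path alternates $\mu$-nodes and $\alpha$-paths ($\alpha<\mu$), no node met twice; $\mu$-tips are classes of one-ended $\mu$-paths; the arrow rank $\vec\omega$ is used for paths/tips built from paths of all finite ranks; $\omega$-nodes contain $\vec\omega$-tips; for $\nu=\omega$, $\nu-1$ means $\vec\omega$. "Node" means maximal node. Standing assumptions: $1\le\nu\le\omega$, $\nu\ne\vec\omega$; $\mathcal{G}^\nu$ is $\nu$-connected (every two branches met by a two-ended path of rank $\le\nu$); Condition (C): two nondisconnectable tips are either embraced by the same node or at least one is the sole member of a singleton node; a fixed metrizable node set $\mathcal{M}$ (all nonsingleton nodes plus possibly singleton nodes such that appending end branches to them preserves (C)); every $\nu$-node is pristine (embraces no lower-rank node); only finitely many boundary $\nu$-nodes ($\nu$-nodes containing $(\nu-1)$-tips of two or more $(\nu-1)$-sections, a $(\nu-1)$-section being the subgraph induced by a maximal set of branches pairwise joined by two-ended paths of rank $\le\nu-1$). Lengths (natural sums): two-ended $0$-path: number of branches; one-ended (resp.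 endless) $\mu$-path: $\omega^{\mu+1}$ (resp. $\omega^{\mu+1}\cdot2$), with $\omega^\omega$, $\omega^\omega\cdot2$ for $\vec\omega$-paths; two-ended $\mu$-path: natural sum of lengths of constituent lower-rank paths. $d(x,y)$ is the minimum length of a two-ended path terminating at $x,y$; eccentricity $e(x)=\sup\{d(x,y):y\in\mathcal{M}\}$; the center is the set of nodes of $\mathcal{M}$ of minimum eccentricity. A component of a subgraph $\mathcal{H}$ is the subgraph induced by a maximal set of branches of $\mathcal{H}$ pairwise $\nu$-connected within $\mathcal{H}$. Removal of a nonsingleton $\nu$-node $x^\nu$: replace it by singleton $\nu$-nodes, one per $(\nu-1)$-tip of $x^\nu$, giving $\mathcal{G}^\nu-x^\nu$. A $\nu$-block is a maximal $\nu$-connected subgraph $\mathcal{H}$ such that for every $\nu$-node $x^\nu$ all branches of $\mathcal{H}$ lie in the same component of $\mathcal{G}^\nu-x^\nu$; a $\nu$-block contains the nodes incident to its branches. *)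

theory Defs
  imports Main "HOL-Library.Multiset_Order" "HOL-Library.Product_Lexorder"
begin

section \<open>Ranks\<close>

text \<open>
  The ranks are -1 (\<open>Elem\<close>, the rank of branches and of their elementary tips),
  the natural numbers, the arrow rank (\<open>Arr\<close>), and \<open>\<omega>\<close> (\<open>Om\<close>), in this order.
  Ordinals below \<open>\<omega>\<^sup>2\<close> are written as lexicographically ordered pairs, \<open>(a, b)\<close> standing for
  \<open>\<omega> * a + b\<close>.  With this convention \<open>expo \<mu>\<close> is the ordinal \<open>\<mu> + 1\<close> that occurs
  in the length \<open>\<omega>\<^bsup>\<mu>+1\<^esup>\<close> of a one-ended path of rank \<open>\<mu>\<close>; for the arrow rank it is \<open>\<omega>\<close>.
\<close>

datatype rank = Elem | Rk nat | Arr | Om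

primrec expo :: "rank \<Rightarrow> nat \<times> nat" where
  "expo Elem = (0, 0)"
| "expo (Rk n) = (0, Suc n)"
| "expo Arr = (1, 0)"
| "expo Om = (1, 1)"

lemma expo_inject: "expo \<mu> = expo \<rho> \<longleftrightarrow> \<mu> = \<rho>"
  by (cases \<mu>; cases \<rho>) auto

instantiation rank :: linorder
begin

definition less_eq_rank :: "rank \<Rightarrow> rank \<Rightarrow> bool" where
  "\<mu> \<le> \<rho> \<longleftrightarrow> expo \<mu> \<le> expo \<rho>"

definition less_rank :: "rank \<Rightarrow> rank \<Rightarrow> bool" where
  "\<mu> < \<rho> \<longleftrightarrow> expo \<mu> < expo \<rho>"

instance
  by standard (auto simp: less_eq_rank_def less_rank_def expo_inject[symmetric]
      less_le_not_le simp del: less_eq_prod_def less_prod_def)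

end

text \<open>
  \<open>rpred \<mu>\<close> is \<open>\<mu> - 1\<close>, the rank of the tips that a \<open>\<mu>\<close>-node contains.  There are no nodes of
  the ranks \<open>Elem\<close> and \<open>Arr\<close>, for which the value is irrelevant.
\<close>

primrec rpred :: "rank \<Rightarrow> rank" where
  "rpred (Rk n) = (case n of 0 \<Rightarrow> Elem | Suc m \<Rightarrow> Rk m)"
| "rpred Om = Arr"
| "rpred Elem = Elem"
| "rpred Arr = Arr"

section \<open>Paths, tips, nodes and graphs\<close>

text \<open>
  A path is recorded as the sequence of its constituents, indexed by a set of consecutive
  integers: \<open>Two n\<close> is a two-ended path with \<open>n\<close> constituents, \<open>Out\<close> and \<open>In\<close> are one-ended paths
  read from and towards their terminal node, \<open>Endless\<close> is an endless path.  Entries outside the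
  index set are irrelevant.  The nodes of the alternating sequence are not stored, since they are
  determined by the ends of the constituents; they reappear in \<open>tracing\<close> below.
  \<open>Br b s\<close> is the branch \<open>b\<close> traversed so as to leave it through its end \<open>s\<close>.
\<close>

datatype shape = Two nat | Out | In | Endless

fun idx :: "shape \<Rightarrow> int set" where
  "idx (Two n) = {0..<int n}"
| "idx Out = {0..}"
| "idx In = {..<0}"
| "idx Endless = UNIV"

datatype 'b tpath = Br 'b bool | Seq rank shape "int \<Rightarrow> 'b tpath"

primrec prank :: "'b tpath \<Rightarrow> rank" where
  "prank (Br b s) = Elem"
| "prank (Seq \<mu> s f) = \<mu>"

primrec pbranches :: "'b tpath \<Rightarrow> 'b set" where
  "pbranches (Br b s) = {b}"
| "pbranches (Seq \<mu> s f) = (\<Union>i\<in>idx s. pbranches (f i))"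

definition two_ended :: "'b tpath \<Rightarrow> bool" where
  "two_ended P \<longleftrightarrow> (\<exists>\<mu> n f. P = Seq \<mu> (Two n) f)"

definition one_ended :: "'b tpath \<Rightarrow> bool" where
  "one_ended P \<longleftrightarrow> (\<exists>\<mu> s f. P = Seq \<mu> s f \<and> s \<in> {Out, In})"

text \<open>
  Following a path to its right (left) end, one eventually leaves it through a tip: an elementary
  tip of its last branch, or the tip of a one-ended path.  \<open>rend\<close> and \<open>lend\<close> give a representative
  of that tip.  The elementary tip of branch \<open>b\<close> at its end \<open>s\<close> is represented by \<open>Br b s\<close>.
\<close>

primrec rend :: "'b tpath \<Rightarrow> 'b tpath" where
  "rend (Br b s) = Br b s"
| "rend (Seq \<mu> s f) = (case s of
      Two n \<Rightarrow> rend (f (int n - 1))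
    | In \<Rightarrow> rend (f (- 1))
    | Out \<Rightarrow> Seq \<mu> Out f
    | Endless \<Rightarrow> Seq \<mu> Out f)"

primrec lend :: "'b tpath \<Rightarrow> 'b tpath" where
  "lend (Br b s) = Br b (\<not> s)"
| "lend (Seq \<mu> s f) = (case s of
      Two n \<Rightarrow> lend (f 0)
    | Out \<Rightarrow> lend (f 0)
    | In \<Rightarrow> Seq \<mu> In f
    | Endless \<Rightarrow> Seq \<mu> In f)"

text \<open>
  A tip is a set of paths: \<open>{Br b s}\<close> for an elementary tip, and otherwise a class of one-ended
  paths of equal rank.  A node of rank \<open>\<mu>\<close> consists of tips of rank \<open>\<mu> - 1\<close> and possibly one node
  of lower rank.
\<close>

type_synonym 'b tip = "'b tpath set"

datatype 'b node = Node (nrank: rank) (ntips: "'b tip set") (nexc: "'b node option")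

record 'b tgraph =
  branches :: "'b set"
  nodes :: "'b node set"

fun etips :: "'b node \<Rightarrow> 'b tip set" \<comment> \<open>all tips embraced by a node\<close> where
  "etips (Node \<mu> T None) = T"
| "etips (Node \<mu> T (Some y)) = T \<union> etips y"

definition maxnode :: "'b tgraph \<Rightarrow> 'b node \<Rightarrow> bool" where
  "maxnode G x \<longleftrightarrow> x \<in> nodes G \<and> (\<forall>y\<in>nodes G. nexc y \<noteq> Some x)"

definition singleton_node :: "'b node \<Rightarrow> bool" where
  "singleton_node x \<longleftrightarrow> nexc x = None \<and> (\<exists>t. ntips x = {t})"

text \<open>\<open>at_node G p x\<close>: the (maximal) node \<open>x\<close> embraces the tip represented by \<open>p\<close>.\<close>

definition at_node :: "'b tgraph \<Rightarrow> 'b tpath \<Rightarrow> 'b node \<Rightarrow> bool" where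
  "at_node G p x \<longleftrightarrow> maxnode G x \<and> p \<in> \<Union>(etips x)"

text \<open>The nodes met by a path strictly between its two ends.\<close>

primrec inner :: "'b tgraph \<Rightarrow> 'b tpath \<Rightarrow> 'b node set" where
  "inner G (Br b s) = {}"
| "inner G (Seq \<mu> s f) = (\<Union>i\<in>idx s. inner G (f i)) \<union>
     {x. \<exists>i. i - 1 \<in> idx s \<and> i \<in> idx s \<and> at_node G (lend (f i)) x}"

text \<open>
  The alternating sequence of nodes \<open>x i\<close> and constituents \<open>f i\<close>, the latter lying between \<open>x i\<close>
  and \<open>x (i + 1)\<close>, in which no node is met twice, neither among the \<open>x i\<close> nor inside the
  constituents.
\<close>

definition tracing :: "'b tgraph \<Rightarrow> shape \<Rightarrow> (int \<Rightarrow> 'b tpath) \<Rightarrow> bool" where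
  "tracing G s f \<longleftrightarrow> (\<exists>x.
     (\<forall>i\<in>idx s. at_node G (lend (f i)) (x i) \<and> at_node G (rend (f i)) (x (i + 1))) \<and>
     inj_on x (idx s \<union> (\<lambda>i. i + 1) ` idx s) \<and>
     (\<forall>i\<in>idx s \<union> (\<lambda>i. i + 1) ` idx s. \<forall>j\<in>idx s. x i \<notin> inner G (f j)) \<and>
     (\<forall>i\<in>idx s. \<forall>j\<in>idx s. i \<noteq> j \<longrightarrow> inner G (f i) \<inter> inner G (f j) = {}))"

text \<open>
  \<open>jrank f i\<close> is the larger of the ranks of the two tips through which the constituents
  \<open>f (i - 1)\<close> and \<open>f i\<close> reach the node between them.  That a \<open>\<mu>\<close>-path passes through
  \<open>\<mu>\<close>-nodes means that one of these tips has rank \<open>\<mu> - 1\<close>.  A one-ended path of arrow rank passes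
  through nodes of strictly increasing finite ranks; an endless one consists of two
  one-ended ones with a common terminal node, which has index \<open>0\<close>; there are no two-ended ones.
\<close>

definition jrank :: "(int \<Rightarrow> 'b tpath) \<Rightarrow> int \<Rightarrow> rank" where
  "jrank f i = max (prank (rend (f (i - 1)))) (prank (lend (f i)))"

definition junctions :: "shape \<Rightarrow> int set" where
  "junctions s = {i. i - 1 \<in> idx s \<and> i \<in> idx s}"

definition junction_ranks :: "rank \<Rightarrow> shape \<Rightarrow> (int \<Rightarrow> 'b tpath) \<Rightarrow> bool" where
  "junction_ranks \<mu> s f \<longleftrightarrow>
     (if \<mu> = Arr
      then (\<forall>n. s \<noteq> Two n) \<and>
        (\<forall>i\<in>junctions s. \<forall>j\<in>junctions s.
           0 < i \<and> i < j \<or> j < i \<and> i < 0 \<longrightarrow> jrank f i < jrank f j)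
      else (\<forall>i\<in>junctions s. jrank f i = rpred \<mu>))"

inductive gpath :: "'b tgraph \<Rightarrow> 'b tpath \<Rightarrow> bool" for G where
  branch: "b \<in> branches G \<Longrightarrow> gpath G (Br b s)"
| sequence: "\<mu> \<noteq> Elem \<Longrightarrow> s \<noteq> Two 0 \<Longrightarrow>
    (\<forall>i\<in>idx s. gpath G (f i) \<and> prank (f i) < \<mu> \<and> (prank (f i) = Elem \<longrightarrow> \<mu> = Rk 0)) \<Longrightarrow>
    tracing G s f \<Longrightarrow> junction_ranks \<mu> s f \<Longrightarrow> gpath G (Seq \<mu> s f)"

text \<open>
  Two one-ended paths of equal rank eventually coincide if each contains all but finitely
  many constituents of the other.  As a path meets no node twice, it is determined by the branches
  it traverses, so this is expressed by branches; a comparison constituent by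
  constituent would not do for the arrow rank, where one tracing can be cut at different nodes.
  \<open>tail_branches P m\<close> are the branches beyond the first \<open>m\<close> constituents from the terminal node.
\<close>

fun tail_branches :: "'b tpath \<Rightarrow> nat \<Rightarrow> 'b set" where
  "tail_branches (Seq \<mu> Out f) m = (\<Union>k\<in>{m..}. pbranches (f (int k)))"
| "tail_branches (Seq \<mu> In f) m = (\<Union>k\<in>{m..}. pbranches (f (- 1 - int k)))"
| "tail_branches P m = {}"

definition coincide :: "'b tpath \<Rightarrow> 'b tpath \<Rightarrow> bool" where
  "coincide P Q \<longleftrightarrow>
     (\<exists>m. tail_branches P m \<subseteq> pbranches Q) \<and> (\<exists>m. tail_branches Q m \<subseteq> pbranches P)"

definition tips :: "'b tgraph \<Rightarrow> rank \<Rightarrow> 'b tip set" where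
  "tips G \<rho> = (if \<rho> = Elem then {{Br b s} | b s. b \<in> branches G}
     else {{Q. gpath G Q \<and> one_ended Q \<and> prank Q = \<rho> \<and> coincide P Q} | P.
             gpath G P \<and> one_ended P \<and> prank P = \<rho>})"

text \<open>
  A \<open>\<nu>\<close>-graph: the nodes of each rank up to \<open>\<nu>\<close> partition the tips of the preceding rank, no
  node is embraced twice, every node is embraced by a maximal one (which can fail
  only for \<open>\<nu> = \<omega>\<close>, by an infinite ascending chain of nodes of finite rank),
  there are no self-loops, and there is a node of rank \<open>\<nu>\<close>.
\<close>

definition embraced_in :: "'b tgraph \<Rightarrow> ('b node \<times> 'b node) set" where
  "embraced_in G = {(x, y). x \<in> nodes G \<and> y \<in> nodes G \<and> nexc y = Some x}"

definition transfinite_graph :: "rank \<Rightarrow> 'b tgraph \<Rightarrow> bool" where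
  "transfinite_graph \<nu> G \<longleftrightarrow>
     \<nu> \<noteq> Elem \<and> \<nu> \<noteq> Arr \<and>
     (\<forall>x\<in>nodes G. nrank x \<noteq> Elem \<and> nrank x \<noteq> Arr \<and> nrank x \<le> \<nu> \<and>
        ntips x \<noteq> {} \<and> ntips x \<subseteq> tips G (rpred (nrank x))) \<and>
     (\<forall>x\<in>nodes G. \<forall>y. nexc x = Some y \<longrightarrow> y \<in> nodes G \<and> nrank y < nrank x) \<and>
     (\<forall>x\<in>nodes G. \<forall>y\<in>nodes G. nexc x = nexc y \<and> nexc x \<noteq> None \<longrightarrow> x = y) \<and>
     (\<forall>\<rho><\<nu>. \<forall>t\<in>tips G \<rho>. \<exists>!x. x \<in> nodes G \<and> t \<in> ntips x) \<and>
     (\<forall>x\<in>nodes G. \<exists>y. maxnode G y \<and> (x, y) \<in> (embraced_in G)\<^sup>*) \<and>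
     (\<forall>x\<in>nodes G. \<forall>b. \<not> ({Br b True} \<in> ntips x \<and> {Br b False} \<in> ntips x)) \<and>
     (\<exists>x\<in>nodes G. nrank x = \<nu>)"

definition pristine :: "rank \<Rightarrow> 'b tgraph \<Rightarrow> bool" where
  "pristine \<nu> G \<longleftrightarrow> (\<forall>x\<in>nodes G. nrank x = \<nu> \<longrightarrow> nexc x = None)"

section \<open>Connectedness, components, sections\<close>

definition left_terminal :: "'b tgraph \<Rightarrow> 'b tpath \<Rightarrow> 'b node \<Rightarrow> bool" where
  "left_terminal G P x \<longleftrightarrow>
     (\<exists>\<mu> s f. P = Seq \<mu> s f \<and> s \<noteq> In \<and> s \<noteq> Endless) \<and> at_node G (lend P) x"

definition right_terminal :: "'b tgraph \<Rightarrow> 'b tpath \<Rightarrow> 'b node \<Rightarrow> bool" where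
  "right_terminal G P x \<longleftrightarrow>
     (\<exists>\<mu> s f. P = Seq \<mu> s f \<and> s \<noteq> Out \<and> s \<noteq> Endless) \<and> at_node G (rend P) x"

definition met :: "'b tgraph \<Rightarrow> 'b tpath \<Rightarrow> 'b node set" where
  "met G P = inner G P \<union> {x. left_terminal G P x} \<union> {x. right_terminal G P x}"

definition meets_branch :: "'b tgraph \<Rightarrow> 'b tpath \<Rightarrow> 'b \<Rightarrow> bool" where
  "meets_branch G P b \<longleftrightarrow> (\<exists>x\<in>met G P. \<exists>s. {Br b s} \<in> etips x)"

text \<open>
  A subgraph is given by the set \<open>H\<close> of its branches; the paths of the subgraph induced by \<open>H\<close> are
  the paths of \<open>G\<close> all of whose branches are in \<open>H\<close>.
\<close>

definition connected_within :: "'b tgraph \<Rightarrow> rank \<Rightarrow> 'b set \<Rightarrow> 'b set \<Rightarrow> bool" where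
  "connected_within G \<rho> H C \<longleftrightarrow> (\<forall>b\<in>C. \<forall>c\<in>C. \<exists>P. gpath G P \<and> two_ended P \<and> prank P \<le> \<rho> \<and>
      pbranches P \<subseteq> H \<and> meets_branch G P b \<and> meets_branch G P c)"

definition component :: "'b tgraph \<Rightarrow> rank \<Rightarrow> 'b set \<Rightarrow> 'b set \<Rightarrow> bool" where
  "component G \<rho> H C \<longleftrightarrow> C \<subseteq> H \<and> connected_within G \<rho> H C \<and>
     (\<forall>D. C \<subseteq> D \<and> D \<subseteq> H \<and> connected_within G \<rho> H D \<longrightarrow> D = C)"

definition nu_connected :: "rank \<Rightarrow> 'b tgraph \<Rightarrow> bool" where
  "nu_connected \<nu> G \<longleftrightarrow> connected_within G \<nu> (branches G) (branches G)"

text \<open>\<open>\<rho>\<close>-sections, used for \<open>\<rho> = \<nu> - 1\<close>.\<close>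

definition rsection :: "rank \<Rightarrow> 'b tgraph \<Rightarrow> 'b set \<Rightarrow> bool" where
  "rsection \<rho> G S \<longleftrightarrow> component G \<rho> (branches G) S"

definition tip_of_subgraph :: "'b tip \<Rightarrow> 'b set \<Rightarrow> bool" where
  "tip_of_subgraph t H \<longleftrightarrow> (\<exists>P\<in>t. pbranches P \<subseteq> H)"

definition boundary_node :: "rank \<Rightarrow> 'b tgraph \<Rightarrow> 'b node \<Rightarrow> bool" where
  "boundary_node \<nu> G x \<longleftrightarrow> x \<in> nodes G \<and> nrank x = \<nu> \<and>
     (\<exists>S S'. rsection (rpred \<nu>) G S \<and> rsection (rpred \<nu>) G S' \<and> S \<noteq> S' \<and>
        (\<exists>t\<in>ntips x. tip_of_subgraph t S) \<and> (\<exists>t\<in>ntips x. tip_of_subgraph t S'))"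

section \<open>Condition (C) and metrizable node sets\<close>

text \<open>
  Two tips are nondisconnectable if every representative of one meets every representative of the
  other at infinitely many nodes.  For elementary tips this never holds.
\<close>

definition nondisconnectable :: "'b tgraph \<Rightarrow> 'b tip \<Rightarrow> 'b tip \<Rightarrow> bool" where
  "nondisconnectable G t u \<longleftrightarrow> (\<forall>P\<in>t. \<forall>Q\<in>u. infinite (met G P \<inter> met G Q))"

definition open_tip :: "'b tgraph \<Rightarrow> 'b tip \<Rightarrow> bool" where
  "open_tip G t \<longleftrightarrow> (\<exists>x. maxnode G x \<and> nexc x = None \<and> ntips x = {t})"

definition condition_C :: "rank \<Rightarrow> 'b tgraph \<Rightarrow> bool" where
  "condition_C \<nu> G \<longleftrightarrow>
     (\<forall>\<rho><\<nu>. \<forall>\<rho>'<\<nu>. \<forall>t\<in>tips G \<rho>. \<forall>u\<in>tips G \<rho>'. t \<noteq> u \<and> nondisconnectable G t u \<longrightarrow>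
        (\<exists>x. maxnode G x \<and> t \<in> etips x \<and> u \<in> etips x) \<or> open_tip G t \<or> open_tip G u)"

text \<open>
  \<open>G'\<close> arises from \<open>G\<close> by appending an end branch \<open>Inr x\<close> at every node \<open>x \<in> S\<close>, where \<open>S\<close> is a set
  of singleton nodes.  The end \<open>False\<close> of \<open>Inr x\<close> is attached to \<open>x\<close>: directly if \<open>x\<close> is a
  0-node, and otherwise through a new 0-node that \<open>x\<close> embraces.  The end \<open>True\<close> lies in a new
  singleton 0-node.  The map \<open>\<phi>\<close> sends the nodes of \<open>G\<close> to the corresponding nodes of \<open>G'\<close>, and
  a tip of \<open>G\<close> corresponds to the tip of \<open>G'\<close> that has the same paths among its
  representatives (in \<open>G'\<close> there may be more, starting with an end branch).
\<close>

definition end_node :: "'b node \<Rightarrow> bool \<Rightarrow> ('b + 'b node) node" where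
  "end_node x s = Node (Rk 0) {{Br (Inr x) s}} None"

definition append_end_branches ::
    "rank \<Rightarrow> 'b tgraph \<Rightarrow> 'b node set \<Rightarrow> ('b + 'b node) tgraph \<Rightarrow> bool" where
  "append_end_branches \<nu> G S G' \<longleftrightarrow>
     transfinite_graph \<nu> G' \<and>
     branches G' = Inl ` branches G \<union> Inr ` S \<and>
     (\<exists>\<phi>. inj_on \<phi> (nodes G) \<and>
        nodes G' = \<phi> ` nodes G \<union> {end_node x True | x. x \<in> S} \<union>
          {end_node x False | x. x \<in> S \<and> nrank x \<noteq> Rk 0} \<and>
        (\<forall>x\<in>nodes G.
           nrank (\<phi> x) = nrank x \<and>
           ntips (\<phi> x) = {t'. \<exists>\<rho><\<nu>. t' \<in> tips G' \<rho> \<and> (\<exists>t\<in>ntips x. map_tpath Inl ` t \<subseteq> t')} \<union>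
             (if x \<in> S \<and> nrank x = Rk 0 then {{Br (Inr x) False}} else {}) \<and>
           nexc (\<phi> x) = (if x \<in> S \<and> nrank x \<noteq> Rk 0 then Some (end_node x False)
             else map_option \<phi> (nexc x))))"

definition metrizable :: "rank \<Rightarrow> 'b tgraph \<Rightarrow> 'b node set \<Rightarrow> bool" where
  "metrizable \<nu> G M \<longleftrightarrow>
     M \<subseteq> {x. maxnode G x} \<and>
     {x. maxnode G x \<and> \<not> singleton_node x} \<subseteq> M \<and>
     (\<exists>G'. append_end_branches \<nu> G {x\<in>M. singleton_node x} G' \<and> condition_C \<nu> G')"

section \<open>Lengths, distances, eccentricities, center\<close>

text \<open>
  An ordinal below \<open>\<omega>\<close> to the power \<open>\<omega>\<^sup>2\<close> is represented by the multiset of the exponents in its Cantor normal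
  form.  The natural sum of ordinals is then the sum of multisets, and the order of the ordinals is
  the multiset order.  The lengths of the two-ended paths of rank at most \<open>\<omega>\<close> are below \<open>\<omega>\<^bsup>\<omega>+1\<^esup>\<close>, so
  suprema of lengths exist here and agree with those in the class of all ordinals.
\<close>

type_synonym cnf = "(nat \<times> nat) multiset"

primrec plength :: "'b tpath \<Rightarrow> cnf" where
  "plength (Br b s) = {#expo Elem#}" \<comment> \<open>\<open>\<omega>\<close> to the power \<open>0\<close>, that is, \<open>1\<close>\<close>
| "plength (Seq \<mu> s f) = (case s of
      Two n \<Rightarrow> (\<Sum>i\<in>{0..<int n}. plength (f i))
    | Out \<Rightarrow> {#expo \<mu>#}
    | In \<Rightarrow> {#expo \<mu>#}
    | Endless \<Rightarrow> {#expo \<mu>, expo \<mu>#})"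

definition terminates :: "'b tgraph \<Rightarrow> 'b tpath \<Rightarrow> 'b node \<Rightarrow> 'b node \<Rightarrow> bool" where
  "terminates G P x y \<longleftrightarrow> left_terminal G P x \<and> right_terminal G P y \<or>
                          left_terminal G P y \<and> right_terminal G P x"

text \<open>The distance of a node from itself is the length of a trivial path, which is not a \<open>gpath\<close>.\<close>

definition ndist :: "rank \<Rightarrow> 'b tgraph \<Rightarrow> 'b node \<Rightarrow> 'b node \<Rightarrow> cnf" where
  "ndist \<nu> G x y = (if x = y then {#} else
     (LEAST l. \<exists>P. gpath G P \<and> two_ended P \<and> prank P \<le> \<nu> \<and> terminates G P x y \<and> l = plength P))"

text \<open>The supremum is taken in a well-order, as the least upper bound.\<close>

definition ecc :: "rank \<Rightarrow> 'b tgraph \<Rightarrow> 'b node set \<Rightarrow> 'b node \<Rightarrow> cnf" where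
  "ecc \<nu> G M x = (LEAST u. \<forall>y\<in>M. ndist \<nu> G x y \<le> u)"

definition center :: "rank \<Rightarrow> 'b tgraph \<Rightarrow> 'b node set \<Rightarrow> 'b node set" where
  "center \<nu> G M = {x\<in>M. \<forall>y\<in>M. ecc \<nu> G M x \<le> ecc \<nu> G M y}"

section \<open>Blocks\<close>

definition remove_node :: "'b tgraph \<Rightarrow> 'b node \<Rightarrow> 'b tgraph" where
  "remove_node G x = G\<lparr>nodes := (nodes G - {x}) \<union> {Node (nrank x) {t} None | t. t \<in> ntips x}\<rparr>"

text \<open>For a singleton \<open>\<nu>\<close>-node \<open>x\<close> of a pristine graph \<open>G\<close>, \<open>remove_node G x\<close> is \<open>G\<close> itself.\<close>

definition unseparated :: "rank \<Rightarrow> 'b tgraph \<Rightarrow> 'b set \<Rightarrow> bool" where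
  "unseparated \<nu> G H \<longleftrightarrow> H \<subseteq> branches G \<and> connected_within G \<nu> H H \<and>
     (\<forall>x\<in>nodes G. nrank x = \<nu> \<longrightarrow>
        (\<exists>C. component (remove_node G x) \<nu> (branches G) C \<and> H \<subseteq> C))"

definition nu_block :: "rank \<Rightarrow> 'b tgraph \<Rightarrow> 'b set \<Rightarrow> bool" where
  "nu_block \<nu> G H \<longleftrightarrow> unseparated \<nu> G H \<and> (\<forall>K. H \<subseteq> K \<and> unseparated \<nu> G K \<longrightarrow> K = H)"

text \<open>
  A node belongs to the subgraph induced by \<open>H\<close> if it embraces a tip of that subgraph; in
  particular this holds if it embraces an elementary tip of a branch in \<open>H\<close>.
\<close>

definition subgraph_nodes :: "'b tgraph \<Rightarrow> 'b set \<Rightarrow> 'b node set" where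
  "subgraph_nodes G H = {x. maxnode G x \<and> (\<exists>t\<in>etips x. tip_of_subgraph t H)}"

end

theory Submission imports Defs
begin

text \<open>
  Coinciding one-ended paths of equal rank coincide cofinally, and a path meets no node at two of its
  points; hence paths can be reversed, cut at their nodes, and joined.  By Condition (C) for the graph
  with appended end branches, tips at distinct nodes of \<open>M\<close> are not nondisconnectable, so that
  a path which meets another one has a first node in common with it.  Therefore joining paths of rank
  below \<open>\<nu>\<close> is transitive, and the \<open>(\<nu> - 1)\<close>-sections partition the branches.  The
  \<open>\<nu>\<close>-paths become walks alternating between sections and \<open>\<nu>\<close>-nodes, and the components of
  \<open>G - v\<close> are described by the walks avoiding \<open>v\<close>.

  Suppose that a \<open>\<nu>\<close>-node \<open>v\<close> separates two center nodes.  The distances from \<open>v\<close> are bounded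
  multiples of \<open>\<omega>\<close> to the power \<open>\<nu>\<close>, so some \<open>y\<close> in \<open>M\<close> is farthest from \<open>v\<close>.  It is separated
  by \<open>v\<close> from one of the two center nodes, say \<open>c\<close>.  A shortest path from \<open>c\<close> to \<open>y\<close> passes through
  \<open>v\<close>, so \<open>d(c, y)\<close> exceeds \<open>d(v, y) = e(v)\<close>, contrary to the minimality of \<open>e(c)\<close>.  So no \<open>\<nu>\<close>-node
  separates center nodes, and the sections that no \<open>\<nu>\<close>-node separates from a suitable one form the
  block.
\<close>

section \<open>Tips and nodes\<close>

text \<open>The main obstacle is a circularity. A tip is the set of all paths that
  \<open>coincide\<close> with one path, and \<open>coincide\<close> is not visibly transitive: two
  such sets might overlap, a path end might lie at several nodes, and even the reverse of a path is
  not obviously a path. Reversal and uniqueness of nodes are therefore obtained together, by a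
  well-founded induction on the rank that ends in \<open>rigid\<close>. Its core is that a path
  whose branches all belong to another path is a section of it. As one trace can be nested into
  constituents in several ways, points of a path are sets of branches, not positions. The second
  obstacle is the arrow rank, which has no two-ended paths and whose junction ranks increase:
  joining and cutting must merge constituents there. For the distances, pristineness makes each
  \<nu>-node reachable through (\<nu>-1)-tips only, so a two-ended path from it consists of
  constituents of length \<omega>^\<nu> or twice that. The finite boundary bounds the number of
  constituents of suitable paths. So the distances from a \<nu>-node in \<open_M> take finitely many
  values.\<close>

lemma rank_less_simps [simp]:
 "Elem < Rk n" "Elem < Arr" "Elem < Om" "Rk n < Arr" "Rk n < Om" "Arr < Om"
 "(Rk m < Rk n) = (m < n)" "\<not> Rk n < Elem" "\<not> Arr < Elem" "\<not> Om < Elem" "\<not> Arr < Rk n" "\<not> Om < Rk n"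
 "\<not> Om < Arr"
 by (simp_all add: less_rank_def)

lemma rank_le_simps [simp]:
 "(Rk m <= Rk n) = (m <= n)" "\<not> Om <= Rk n" "\<not> Arr <= Rk n" "\<not> Om <= Arr" "\<not> Rk n <= Elem"
 "\<not> Arr <= Elem" "\<not> Om <= Elem" "Rk n <= Arr"
 by (simp_all add: less_eq_rank_def)

lemma rank_extremes [simp]: "Elem <= r" "r <= Om"
 by (cases r; simp add: less_eq_rank_def)+

lemma rank_not_less_extremes [simp]: "\<not> r < Elem" "\<not> Om < r"
 by (simp_all add: not_less)

lemma rpred_less: "\<mu> ~= Elem ==> \<mu> ~= Arr ==> rpred \<mu> < \<mu>"
 by (cases \<mu>) (auto split: nat.splits)

lemma rpred_inject:
 "\<mu> ~= Elem ==> \<mu> ~= Arr ==> \<rho> ~= Elem ==> \<rho> ~= Arr ==> rpred \<mu> = rpred \<rho> \<longleftrightarrow> \<mu> = \<rho>"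
 by (cases \<mu>; cases \<rho>) (auto split: nat.splits)

lemma rpred_eq_Elem: "\<mu> ~= Elem ==> rpred \<mu> = Elem \<longleftrightarrow> \<mu> = Rk 0"
 by (cases \<mu>) (auto split: nat.splits)

lemma less_imp_le_rpred: "\<alpha> < \<mu> ==> \<mu> ~= Arr ==> \<alpha> <= rpred \<mu>"
 by (cases \<mu>; cases \<alpha>) (auto split: nat.splits)

lemma rank_wf: "wf {(a, b :: rank). a < b}"
proof -
 have "{(a, b :: rank). a < b} = inv_image {(x, y). x < y} expo"
  by (auto simp: inv_image_def less_rank_def)
 thus ?thesis using wf_inv_image[OF wf, of expo] by metis
qed

section \<open>Tips and their representatives\<close>

lemma tipsE:
 assumes "t \<in> tips G \<rho>"
 obtains (Elem) b s where "\<rho> = Elem" "t = {Br b s}" "b \<in> branches G"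
  | (Seq) P where "\<rho> ~= Elem" "gpath G P" "one_ended P" "prank P = \<rho>"
    "t = {Q. gpath G Q & one_ended Q & prank Q = \<rho> & coincide P Q}"
 using assms by (auto simp: tips_def split: if_splits)

lemma tips_Br: "Br b s \<in> t ==> t \<in> tips G \<rho> ==> \<rho> = Elem & t = {Br b s} & b \<in> branches G"
 by (erule tipsE) (auto simp: one_ended_def)

lemma one_endedE:
 assumes "one_ended P" obtains \<mu> s f where "P = Seq \<mu> s f" "s = Out \<or> s = In"
 using assms by (auto simp: one_ended_def)

lemma tail_branches_In: "tail_branches (Seq \<mu> In f) m = (\<Union>i\<in>{..<- int m}. pbranches (f i))"
proof -
 have "(%k. - 1 - int k) ` {m..} = {..<- int m}"
 proof (intro equalityI subsetI)
  fix i assume "i \<in> {..<- int m}" thus "i \<in> (%k. - 1 - int k) ` {m..}"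
   by (intro image_eqI[of _ _ "nat (-1-i)"]) auto
 qed auto
 from this[symmetric] show ?thesis by simp
qed

lemma tail_branches_Out: "tail_branches (Seq \<mu> Out f) m = (\<Union>i\<in>{int m..}. pbranches (f i))"
proof -
 have "int ` {m..} = {int m..}"
 proof (intro equalityI subsetI)
  fix i assume "i \<in> {int m..}" thus "i \<in> int ` {m..}"
   by (intro image_eqI[of _ _ "nat i"]) auto
 qed auto
 from this[symmetric] show ?thesis by simp
qed

lemma tail_branches_0: "one_ended P ==> tail_branches P 0 = pbranches P"
 by (auto elim!: one_endedE simp: tail_branches_In tail_branches_Out simp del: tail_branches.simps)

lemma tail_branches_antimono: "m <= n ==> tail_branches P n \<subseteq> tail_branches P m"
 by (cases "(P, m)" rule: tail_branches.cases) (auto, force+)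

lemma coincide_refl: "one_ended P ==> coincide P P"
 unfolding coincide_def using tail_branches_0 by blast

lemma tips_nonempty: "t \<in> tips G \<rho> ==> t ~= {}"
 by (erule tipsE) (auto intro: coincide_refl)

lemma tips_prank: "t \<in> tips G \<rho> ==> p \<in> t ==> prank p = \<rho>"
 by (erule tipsE) auto

lemma tips_gpath: "t \<in> tips G \<rho> ==> p \<in> t ==> gpath G p"
 by (erule tipsE) (auto intro: gpath.intros)

lemma tips_one_ended: "t \<in> tips G \<rho> ==> p \<in> t ==> \<rho> ~= Elem ==> one_ended p"
 by (erule tipsE) auto

lemma gpath_Elem: "gpath G P ==> prank P = Elem \<longleftrightarrow> (EX b s. P = Br b s)"
 by (erule gpath.cases) auto

lemma gpath_Br [simp]: "gpath G (Br b s) \<longleftrightarrow> b \<in> branches G"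
 by (auto elim: gpath.cases intro: gpath.intros)

section \<open>Embracing of nodes, and the maximal node of a tip\<close>

locale tfg =
 fixes G :: "'b tgraph" and \<nu> :: rank
 assumes tfg: "transfinite_graph \<nu> G"
begin

lemma nu_valid: "\<nu> ~= Elem" "\<nu> ~= Arr"
 using tfg by (auto simp: transfinite_graph_def)

lemma node_valid:
 assumes "x \<in> nodes G"
 shows "nrank x ~= Elem" "nrank x ~= Arr" "nrank x <= \<nu>" "ntips x ~= {}" "ntips x \<subseteq> tips G (rpred (nrank x))"
 using tfg assms by (auto simp: transfinite_graph_def)

lemma nexc_node: "x \<in> nodes G ==> nexc x = Some y ==> y \<in> nodes G & nrank y < nrank x"
 using tfg unfolding transfinite_graph_def by blast

lemma nexc_unique:
 assumes "x \<in> nodes G" "y \<in> nodes G" "nexc x = Some z" "nexc y = Some z" shows "x = y"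
proof -
 have "\<forall>x\<in>nodes G. \<forall>y\<in>nodes G. nexc x = nexc y & nexc x ~= None --> x = y"
  using tfg unfolding transfinite_graph_def by argo
 thus ?thesis using assms by simp
qed

lemma tip_unique_node: "\<rho> < \<nu> ==> t \<in> tips G \<rho> ==> EX! x. x \<in> nodes G & t \<in> ntips x"
 using tfg unfolding transfinite_graph_def by blast

lemma maxnode_above: "x \<in> nodes G ==> EX y. maxnode G y & (x, y) \<in> (embraced_in G)\<^sup>*"
 using tfg unfolding transfinite_graph_def by blast

lemma no_loop: "x \<in> nodes G ==> {Br b True} \<in> ntips x ==> {Br b False} ~: ntips x"
 using tfg unfolding transfinite_graph_def by blast

lemma ntips_etips: "ntips x \<subseteq> etips x"
 by (cases x rule: etips.cases) auto

lemma etips_embraced: "(x, y) \<in> (embraced_in G)\<^sup>* ==> etips x \<subseteq> etips y"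
proof (induction rule: rtrancl_induct)
 case (step y z)
 hence "etips y \<subseteq> etips z" by (cases z rule: etips.cases) (auto simp: embraced_in_def)
 with step show ?case by auto
qed simp

lemma etips_node:
 assumes "x \<in> nodes G" "t \<in> etips x"
 shows "EX y. y \<in> nodes G & t \<in> ntips y & (y, x) \<in> (embraced_in G)\<^sup>*"
 using assms
proof (induction x rule: etips.induct)
 case (2 \<mu> T y)
 show ?case
 proof (cases "t \<in> T")
  case True thus ?thesis using 2 by (intro exI[of _ "Node \<mu> T (Some y)"]) auto
 next
  case False
  have y: "y \<in> nodes G" using nexc_node[of "Node \<mu> T (Some y)" y] 2 by auto
  then obtain z where "z \<in> nodes G" "t \<in> ntips z" "(z, y) \<in> (embraced_in G)\<^sup>*"
   using 2 False by auto
  moreover have "(y, Node \<mu> T (Some y)) \<in> embraced_in G" using y 2 by (auto simp: embraced_in_def)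
  ultimately show ?thesis by (meson rtrancl.rtrancl_into_rtrancl)
 qed
qed auto

lemma embraced_rank: "(x, y) \<in> (embraced_in G)\<^sup>* ==> x = y \<or> nrank x < nrank y"
 by (induction rule: rtrancl_induct) (auto simp: embraced_in_def dest: nexc_node)

lemma maxnode_no_succ: "maxnode G x ==> (x, y) \<in> (embraced_in G)\<^sup>* ==> y = x"
 by (erule converse_rtranclE) (auto simp: maxnode_def embraced_in_def)

text \<open>No node is embraced twice, so \<open>embraced_in\<close> is single-valued and the nodes
  above \<open>y\<close> form a chain, which has at most one maximal member.\<close>

lemma maxnode_above_unique:
 assumes "(y, x) \<in> (embraced_in G)\<^sup>*" "(y, x') \<in> (embraced_in G)\<^sup>*" "maxnode G x" "maxnode G x'"
 shows "x = x'"
proof -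
 have "single_valued (embraced_in G)"
  by (auto simp: single_valued_def embraced_in_def intro: nexc_unique)
 from single_valued_confluent[OF this assms(1,2)] show ?thesis
  using assms maxnode_no_succ by blast
qed

lemma maxnode_node: "maxnode G x ==> x \<in> nodes G" by (simp add: maxnode_def)

lemma etips_tips:
 assumes "x \<in> nodes G" "t \<in> etips x" shows "\<exists>\<rho><\<nu>. t \<in> tips G \<rho> & \<rho> < nrank x"
proof -
 obtain y where y: "y \<in> nodes G" "t \<in> ntips y" "(y, x) \<in> (embraced_in G)\<^sup>*"
  using etips_node[OF assms] by auto
 hence "rpred (nrank y) < nrank y" using node_valid rpred_less by blast
 hence "rpred (nrank y) < \<nu>" "rpred (nrank y) < nrank x"
  using y node_valid(3)[OF y(1)] embraced_rank[OF y(3)] by auto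
 thus ?thesis using y node_valid(5)[OF y(1)] by blast
qed

lemma tip_unique_maxnode:
 assumes "\<rho> < \<nu>" "t \<in> tips G \<rho>" shows "EX! x. maxnode G x & t \<in> etips x"
proof -
 obtain y where y: "y \<in> nodes G" "t \<in> ntips y" and u: "!!z. z \<in> nodes G ==> t \<in> ntips z ==> z = y"
  using tip_unique_node[OF assms] by auto
 obtain x where x: "maxnode G x" "(y, x) \<in> (embraced_in G)\<^sup>*" using maxnode_above y by blast
 show ?thesis
 proof (intro ex1I[of _ x] conjI)
  show "t \<in> etips x" using etips_embraced[OF x(2)] ntips_etips y by blast
  fix z assume z: "maxnode G z & t \<in> etips z"
  then obtain w where "w \<in> nodes G" "t \<in> ntips w" "(w, z) \<in> (embraced_in G)\<^sup>*"
   using etips_node maxnode_node by blast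
  thus "z = x" using u x maxnode_above_unique z by blast
 qed (use x in auto)
qed

lemma at_nodeE:
 assumes "at_node G p x"
 obtains t \<rho> where "t \<in> etips x" "p \<in> t" "t \<in> tips G \<rho>" "\<rho> < \<nu>" "prank p = \<rho>" "maxnode G x" "gpath G p"
  "\<rho> < nrank x"
proof -
 obtain t where t: "t \<in> etips x" "p \<in> t" "maxnode G x" using assms by (auto simp: at_node_def)
 obtain \<rho> where "\<rho> < \<nu>" "t \<in> tips G \<rho>" "\<rho> < nrank x" using etips_tips t maxnode_node by blast
 thus ?thesis using that t tips_prank tips_gpath by metis
qed

lemma at_node_Br_unique:
 assumes "at_node G (Br b s) x" "at_node G (Br b s) y" shows "x = y"
proof -
 have "!!z. at_node G (Br b s) z ==> {Br b s} \<in> etips z & maxnode G z & b \<in> branches G"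
  by (metis at_nodeE tips_Br)
 moreover have "EX! z. maxnode G z & {Br b s} \<in> etips z" if "b \<in> branches G"
  using tip_unique_maxnode[of Elem] that nu_valid(1)
  by (cases \<nu>) (auto simp: tips_def)
 ultimately show ?thesis using assms by blast
qed

lemma Br_node: "b \<in> branches G ==> EX x. at_node G (Br b s) x"
proof -
 assume "b \<in> branches G"
 hence "{Br b s} \<in> tips G Elem" by (auto simp: tips_def)
 moreover have "Elem < \<nu>" using nu_valid(1) by (cases \<nu>) auto
 ultimately obtain x where "maxnode G x" "{Br b s} \<in> etips x" using tip_unique_maxnode by blast
 thus ?thesis by (auto simp: at_node_def)
qed

text \<open>\<open>no_loop\<close> speaks of a single 0-node, whereas the two elementary tips might
  lie in different 0-nodes below \<open>x\<close>. Each node embraces at most one node, so the nodes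
  below \<open>x\<close> form a chain of strictly increasing ranks, with at most one 0-node.\<close>

lemma Br_nodes_distinct:
 assumes "at_node G (Br b s) x" shows "\<not> at_node G (Br b (\<not> s)) x"
proof
 assume a: "at_node G (Br b (\<not> s)) x"
 have *: "EX y. y \<in> nodes G & {Br b r} \<in> ntips y & (y, x) \<in> (embraced_in G)\<^sup>* & nrank y = Rk 0"
  if r: "at_node G (Br b r) x" for r
 proof -
  have "{Br b r} \<in> etips x" "maxnode G x" using r by (metis at_nodeE tips_Br)+
  then obtain y where y: "y \<in> nodes G" "{Br b r} \<in> ntips y" "(y, x) \<in> (embraced_in G)\<^sup>*"
   using etips_node maxnode_node by blast
  hence "{Br b r} \<in> tips G (rpred (nrank y))" using node_valid(5)[OF y(1)] by blast
  hence "rpred (nrank y) = Elem" by (metis tips_Br insertI1)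
  thus ?thesis using y node_valid(1,2)[OF y(1)] rpred_eq_Elem by blast
 qed
 obtain y z where y: "y \<in> nodes G" "{Br b s} \<in> ntips y" "(y, x) \<in> (embraced_in G)\<^sup>*" "nrank y = Rk 0"
  and z: "z \<in> nodes G" "{Br b (\<not>s)} \<in> ntips z" "(z, x) \<in> (embraced_in G)\<^sup>*" "nrank z = Rk 0"
  using *[OF assms] *[OF a] by blast
 have "single_valued ((embraced_in G)\<inverse>)" by (auto simp: single_valued_def embraced_in_def)
 from single_valued_confluent[OF this, of x y z] have "(z, y) \<in> (embraced_in G)\<^sup>* \<or> (y, z) \<in> (embraced_in G)\<^sup>*"
  using y z by (auto simp: rtrancl_converse)
 hence "y = z" using embraced_rank y z by fastforce
 thus False using no_loop[of y b] y z by (cases s) auto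
qed

end

section \<open>Branches and ends of a path\<close>

lemma idx_nonempty: "s ~= Two 0 ==> idx s ~= {}"
 by (cases s rule: idx.cases) auto

lemma idx_convex: "i \<in> idx s ==> k \<in> idx s ==> i <= j ==> j <= k ==> j \<in> idx s"
 by (cases s rule: idx.cases) auto

lemma gpath_SeqD:
 assumes "gpath G (Seq \<mu> s f)"
 shows "\<mu> ~= Elem" "s ~= Two 0" "!!i. i \<in> idx s ==> gpath G (f i)" "!!i. i \<in> idx s ==> prank (f i) < \<mu>"
  "!!i. i \<in> idx s ==> prank (f i) = Elem ==> \<mu> = Rk 0" "tracing G s f" "junction_ranks \<mu> s f"
 using assms by (auto elim: gpath.cases)

lemma pbranches_nonempty: "gpath G P ==> pbranches P ~= {}"
proof (induction rule: gpath.induct)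
 case (sequence \<mu> s f)
 thus ?case using idx_nonempty[of s] by auto
qed auto

lemma pbranches_branches: "gpath G P ==> pbranches P \<subseteq> branches G"
 by (induction rule: gpath.induct) auto

lemma lend_Seq: "i \<in> idx s ==> i - 1 ~: idx s ==> lend (Seq \<mu> s f) = lend (f i)"
proof (cases s)
 case (Two n) assume "i \<in> idx s" "i - 1 ~: idx s" with Two have "i = 0" by auto
 thus ?thesis using Two by simp
next
 case Out assume "i \<in> idx s" "i - 1 ~: idx s" with Out have "i = 0" by auto
 thus ?thesis using Out by simp
qed auto

lemma rend_Seq: "i \<in> idx s ==> i + 1 ~: idx s ==> rend (Seq \<mu> s f) = rend (f i)"
proof (cases s)
 case (Two n) assume "i \<in> idx s" "i + 1 ~: idx s" with Two have "i = int n - 1" by auto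
 thus ?thesis using Two by simp
next
 case In assume "i \<in> idx s" "i + 1 ~: idx s" with In have "i = -1" by auto
 thus ?thesis using In by simp
qed auto

lemma first_idx: "s ~= Two 0 ==> s ~= In ==> s ~= Endless ==> 0 \<in> idx s & -1 ~: idx s"
 by (cases s) auto

lemma last_idx: "s ~= Two 0 ==> s ~= Out ==> s ~= Endless ==> EX i. i \<in> idx s & i + 1 ~: idx s"
 by (cases s) (auto intro: exI[of _ "-1"] exI[of _ "int n - 1" for n])

lemma lend_open: "s = In \<or> s = Endless ==> lend (Seq \<mu> s f) = Seq \<mu> In f" by auto
lemma rend_open: "s = Out \<or> s = Endless ==> rend (Seq \<mu> s f) = Seq \<mu> Out f" by auto

lemma lend_cases:
 assumes "s ~= Two 0"
 obtains (first) i where "i \<in> idx s" "i - 1 ~: idx s" "lend (Seq \<mu> s f) = lend (f i)"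
 | (opn) "s = In \<or> s = Endless" "lend (Seq \<mu> s f) = Seq \<mu> In f"
 using first_idx[of s] lend_Seq[of 0 s] lend_open assms by fastforce

lemma rend_cases:
 assumes "s ~= Two 0"
 obtains (last) i where "i \<in> idx s" "i + 1 ~: idx s" "rend (Seq \<mu> s f) = rend (f i)"
 | (opn) "s = Out \<or> s = Endless" "rend (Seq \<mu> s f) = Seq \<mu> Out f"
 using last_idx[of s] rend_Seq rend_open assms by metis

lemma lend_rend_prank: "gpath G P ==> prank (lend P) <= prank P & prank (rend P) <= prank P"
proof (induction rule: gpath.induct)
 case (sequence \<mu> s f)
 have "prank (lend (Seq \<mu> s f)) <= \<mu>"
  by (rule lend_cases[OF sequence(2), of \<mu> f]) (use sequence in \<open>force+\<close>)
 moreover have "prank (rend (Seq \<mu> s f)) <= \<mu>"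
  by (rule rend_cases[OF sequence(2), of \<mu> f]) (use sequence in \<open>force+\<close>)
 ultimately show ?case by simp
qed auto

lemmas lend_prank = lend_rend_prank[THEN conjunct1]
lemmas rend_prank = lend_rend_prank[THEN conjunct2]

context tfg
begin

text \<open>Going outward through the nesting, an end of a branch either remains an end of the path
  or becomes a junction. Uniqueness of nodes is used for elementary tips only, the one case
  available so far.\<close>

lemma branch_nodes:
 assumes "gpath G P" "b \<in> pbranches P" "at_node G (Br b r) x"
 shows "x \<in> inner G P \<or> lend P = Br b r \<or> rend P = Br b r"
 using assms
proof (induction rule: gpath.induct)
 case (sequence \<mu> s f)
 then obtain i where i: "i \<in> idx s" "b \<in> pbranches (f i)" by auto
 then consider "x \<in> inner G (f i)" | "lend (f i) = Br b r" | "rend (f i) = Br b r"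
  using sequence by blast
 thus ?case
 proof cases
  case 1 thus ?thesis using i by auto
 next
  case 2
  show ?thesis
  proof (cases "i - 1 \<in> idx s")
   case True thus ?thesis using 2 i sequence by auto
  next
   case False
   thus ?thesis using 2 lend_Seq[OF i(1) False] by metis
  qed
 next
  case 3
  obtain y where y: "\<forall>i\<in>idx s. at_node G (lend (f i)) (y i) & at_node G (rend (f i)) (y (i + 1))"
   using sequence by (auto simp: tracing_def)
  show ?thesis
  proof (cases "i + 1 \<in> idx s")
   case True
   hence "x = y (i+1)" using y 3 i sequence at_node_Br_unique by metis
   hence "at_node G (lend (f (i+1))) x" using y True by auto
   thus ?thesis using True i by (auto intro!: exI[of _ "i+1"])
  next
   case False
   thus ?thesis using 3 rend_Seq[OF i(1) False] by metis
  qed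
 qed
qed auto

text \<open>A common branch has two distinct end nodes. By \<open>tracing\<close>, a node met inside
  one constituent is not met by another, so both nodes are terminal nodes of both constituents, and
  injectivity of the node sequence forces \<open>i = j\<close>.\<close>

lemma pbranches_disjoint:
 assumes "gpath G (Seq \<mu> s f)" "i \<in> idx s" "j \<in> idx s" "i ~= j"
 shows "pbranches (f i) Int pbranches (f j) = {}"
proof (rule ccontr)
 assume "pbranches (f i) Int pbranches (f j) ~= {}"
 then obtain b where b: "b \<in> pbranches (f i)" "b \<in> pbranches (f j)" by auto
 note g = gpath_SeqD[OF assms(1)]
 obtain x where x: "\<forall>i\<in>idx s. at_node G (lend (f i)) (x i) & at_node G (rend (f i)) (x (i + 1))"
   "inj_on x (idx s Un (%i. i + 1) ` idx s)"
   "\<forall>i\<in>idx s Un (%i. i + 1) ` idx s. \<forall>j\<in>idx s. x i ~: inner G (f j)"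
   "\<forall>i\<in>idx s. \<forall>j\<in>idx s. i ~= j --> inner G (f i) Int inner G (f j) = {}"
  using g(6) by (auto simp: tracing_def)
 obtain u v where u: "at_node G (Br b True) u" and v: "at_node G (Br b False) v"
  using Br_node pbranches_branches[OF g(3)[OF assms(2)]] b by blast
 have *: "\<forall>w\<in>{u,v}. w \<in> inner G (f k) \<or> w = x k \<or> w = x (k+1)" if "k \<in> idx s" "b \<in> pbranches (f k)" for k
  using branch_nodes[OF g(3)[OF that(1)] that(2)] x(1) that u v at_node_Br_unique by (metis insertE empty_iff)
 have uv: "u ~= v" using u v Br_nodes_distinct by fastforce
 have "\<forall>w\<in>{u,v}. w \<in> {x i, x (i+1)} & w \<in> {x j, x(j+1)}"
 proof
  fix w assume w: "w \<in> {u, v}"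
  have d: "inner G (f i) Int inner G (f j) = {}" using x(4) assms(2,3,4) by metis
  have n: "{x i, x (i+1), x j, x (j+1)} Int (inner G (f i) Un inner G (f j)) = {}"
   using x(3) assms(2,3) by auto
  have "w \<in> inner G (f i) \<or> w \<in> {x i, x (i+1)}" using *[OF assms(2) b(1)] w by (metis insertCI)
  moreover have "w \<in> inner G (f j) \<or> w \<in> {x j, x (j+1)}" using *[OF assms(3) b(2)] w by (metis insertCI)
  ultimately show "w \<in> {x i, x (i+1)} & w \<in> {x j, x(j+1)}" using d n by auto
 qed
 hence "{x i, x (i+1)} = {x j, x (j+1)}" using uv by auto
 hence "x ` {i, i+1} = x ` {j, j+1}" by auto
 hence "{i,i+1} = {j,j+1}"
  using inj_on_image_eq_iff[OF x(2), of "{i,i+1}" "{j,j+1}"] assms(2,3) by blast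
 thus False using assms(4) by (auto simp: doubleton_eq_iff)
qed

end

section \<open>Reversal\<close>

fun rshape :: "shape => shape" where
 "rshape (Two n) = Two n" | "rshape Out = In" | "rshape In = Out" | "rshape Endless = Endless"

text \<open>An involution for each shape; \<open>-1 - i\<close> is the reflection that exchanges the
  index sets \<open>{0..}\<close> of \<open>Out\<close> and \<open>{..<0}\<close> of
  \<open>In\<close>.\<close>

fun ridx :: "shape => int => int" where
 "ridx (Two n) i = int n - 1 - i" | "ridx _ i = - 1 - i"

primrec prev :: "'b tpath => 'b tpath" where
 "prev (Br b s) = Br b (\<not> s)"
| "prev (Seq \<mu> s f) = Seq \<mu> (rshape s) (%i. prev (f (ridx s i)))"

text \<open>Reversal of representatives of tips. \<open>Br b s\<close> names the end
  \<open>s\<close> of \<open>b\<close> whatever the direction of traversal, so it is fixed here,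
  unlike under \<open>prev\<close>.\<close>

fun trev :: "'b tpath => 'b tpath" where
 "trev (Br b s) = Br b s" | "trev (Seq \<mu> s f) = prev (Seq \<mu> s f)"

lemma rshape_rshape [simp]: "rshape (rshape s) = s" by (cases s) auto
lemma rshape_Two0 [simp]: "rshape s = Two n \<longleftrightarrow> s = Two n" by (cases s) auto
lemma ridx_rshape [simp]: "ridx (rshape s) i = ridx s i" by (cases s) auto
lemma ridx_ridx [simp]: "ridx s (ridx s i) = i" by (cases s) auto
lemma ridx_pred: "ridx s (i - 1) = ridx s i + 1" by (cases s) auto
lemma ridx_succ: "ridx s (i + 1) = ridx s i - 1" by (cases s) auto
lemma idx_rshape: "i \<in> idx (rshape s) \<longleftrightarrow> ridx s i \<in> idx s" by (cases s) auto
lemma idx_rshape': "ridx s i \<in> idx (rshape s) \<longleftrightarrow> i \<in> idx s" by (simp add: idx_rshape)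
lemma ridx_less [simp]: "ridx s i < ridx s j \<longleftrightarrow> j < i" by (cases s) auto
lemma ridx_eq [simp]: "ridx s i = ridx s j \<longleftrightarrow> i = j" by (cases s) auto

lemma prev_prev [simp]: "prev (prev P) = P"
 by (induction P) auto

lemma prank_prev [simp]: "prank (prev P) = prank P" by (cases P) auto
lemma prank_trev [simp]: "prank (trev P) = prank P" by (cases P) auto

lemma trev_trev [simp]: "trev (trev P) = P"
proof (cases P)
 case (Seq \<mu> s f) thus ?thesis using prev_prev[of P] by simp
qed simp

lemma UN_ridx: "(\<Union>i\<in>idx (rshape s). A (ridx s i)) = (\<Union>i\<in>idx s. A i)"
 by (auto simp: idx_rshape) (metis idx_rshape' ridx_ridx)

lemma pbranches_prev [simp]: "pbranches (prev P) = pbranches P"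
proof (induction P)
 case (Seq \<mu> s f)
 thus ?case using UN_ridx[where s=s and A="%i. pbranches (f i)"] by simp
qed auto

lemma pbranches_trev [simp]: "pbranches (trev P) = pbranches P"
 by (cases P) (simp_all del: prev.simps)

lemma lend_prev: "lend (prev P) = trev (rend P)"
 by (induction P) (auto split: shape.splits)

lemma rend_prev: "rend (prev P) = trev (lend P)"
 by (metis lend_prev prev_prev trev_trev)

lemma one_ended_prev [simp]: "one_ended (prev P) = one_ended P"
proof -
 have "one_ended P ==> one_ended (prev P)" for P :: "'b tpath"
  by (auto elim!: one_endedE simp: one_ended_def)
 thus ?thesis by (metis prev_prev)
qed

lemma one_ended_trev [simp]: "one_ended (trev P) = one_ended P"
 by (cases P) (simp_all del: prev.simps)

lemma tail_branches_prev [simp]: "tail_branches (prev P) m = tail_branches P m"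
proof (cases P)
 case (Seq \<mu> s f) thus ?thesis by (cases s) auto
qed auto

lemma tail_branches_trev [simp]: "tail_branches (trev P) m = tail_branches P m"
 by (cases P) (simp_all del: prev.simps)

lemma jrank_prev: "jrank (%i. prev (f (ridx s i))) i = jrank f (ridx s i + 1)"
 by (simp add: jrank_def lend_prev rend_prev ridx_pred max.commute)

lemma junction_ranks_prev:
 assumes "junction_ranks \<mu> s f"
 shows "junction_ranks \<mu> (rshape s) (%i. prev (f (ridx s i)))"
proof -
 have j: "i \<in> junctions (rshape s) \<longleftrightarrow> ridx s i + 1 \<in> junctions s" for i
  by (auto simp: junctions_def idx_rshape ridx_pred)
 show ?thesis
 proof (cases "\<mu> = Arr")
  case True
  hence *: "ALL n. s ~= Two n" "!!i j. i\<in>junctions s ==> j\<in>junctions s ==>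
      0 < i & i < j \<or> j < i & i < 0 ==> jrank f i < jrank f j"
   using assms by (auto simp: junction_ranks_def)
  \<comment> \<open>With shape \<open>Two\<close> excluded, reversal sends junction \<open>i\<close>
    to junction \<open>-i\<close>, and so exchanges the monotonicity conditions on the two sides of
    junction \<open>0\<close>.\<close>
  hence r: "ridx s i + 1 = - i" for i by (cases s) auto
  show ?thesis using True * unfolding junction_ranks_def by (auto simp: jrank_prev j r)
 qed (use assms in \<open>auto simp: junction_ranks_def jrank_prev j\<close>)
qed

section \<open>Eventual coincidence and the node at a tip\<close>

definition tclass :: "'b tgraph => rank => 'b tpath => 'b tip" where
 "tclass G \<alpha> P = {Q. gpath G Q & one_ended Q & prank Q = \<alpha> & coincide P Q}"

text \<open>\<open>coincide\<close> compares a tail of one path with the whole of the other, which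
  leaves transitivity unclear. Comparing tails with arbitrary tails gives an equivalence relation by
  its form.\<close>

definition scoin :: "'b tpath => 'b tpath => bool" where
 "scoin P Q \<longleftrightarrow> (ALL k. EX m. tail_branches P m \<subseteq> tail_branches Q k) & (ALL k. EX m. tail_branches Q m \<subseteq> tail_branches P k)"

lemma scoin_refl [simp]: "scoin P P" by (auto simp: scoin_def)
lemma scoin_sym: "scoin P Q ==> scoin Q P" by (auto simp: scoin_def)
lemma scoin_trans: "scoin P Q ==> scoin Q R ==> scoin P R" unfolding scoin_def by (meson subset_trans)
lemma scoin_coincide: "one_ended P ==> one_ended Q ==> scoin P Q ==> coincide P Q"
 unfolding scoin_def coincide_def by (metis tail_branches_0)
lemma scoin_trev [simp]: "scoin (trev P) Q = scoin P Q" "scoin P (trev Q) = scoin P Q"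
 by (simp_all add: scoin_def)

definition same_tip :: "'b tgraph => 'b tpath => 'b tpath => bool" where
 "same_tip G p q \<longleftrightarrow> prank p = prank q &
   (p = q \<or> gpath G p & gpath G q & one_ended p & one_ended q & scoin p q)"

lemma same_tip_refl [simp]: "same_tip G p p" by (simp add: same_tip_def)
lemma same_tip_sym: "same_tip G p q ==> same_tip G q p" by (auto simp: same_tip_def scoin_sym)
lemma same_tip_trans: "same_tip G p q ==> same_tip G q r ==> same_tip G p r"
 by (auto simp: same_tip_def intro: scoin_trans)

text \<open>The claim of the induction on the rank. It makes any two tip classes of rank
  \<open>\<alpha>\<close> equal or disjoint.\<close>

definition tips_rigid :: "'b tgraph => rank => bool" where
 "tips_rigid G \<alpha> \<longleftrightarrow> (ALL P Q. gpath G P & gpath G Q & one_ended P & one_ended Q & prank P = \<alpha> & prank Q = \<alpha> &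
   coincide P Q --> scoin P Q)"

context tfg
begin

lemma at_node_one_ended:
 assumes "at_node G p x" "one_ended p"
 shows "EX P. gpath G P & one_ended P & prank P = prank p & coincide P p & tclass G (prank p) P \<in> etips x &
  tclass G (prank p) P \<in> tips G (prank p) & prank p < \<nu> & maxnode G x & gpath G p"
 using assms(1)
proof (rule at_nodeE)
 fix t \<rho> assume *: "t \<in> etips x" "p \<in> t" "t \<in> tips G \<rho>" "\<rho> < \<nu>" "prank p = \<rho>" "maxnode G x" "gpath G p"
 from *(3) show ?thesis
 proof (cases rule: tipsE)
  case Elem thus ?thesis using * assms(2) by (auto simp: one_ended_def)
 next
  case (Seq P)
  hence "t = tclass G \<rho> P" by (simp add: tclass_def)
  moreover have "coincide P p" using Seq * by auto
  ultimately show ?thesis using * Seq(2-4) by auto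
 qed
qed

text \<open>Needs no rigidity: \<open>coincide\<close> only compares branches and does not see the
  direction in which a path is listed.\<close>

lemma at_node_trev:
 assumes "at_node G p x" "gpath G (trev p)" shows "at_node G (trev p) x"
proof (cases "one_ended p")
 case True
 from at_node_one_ended[OF assms(1) True] obtain P where
  P: "coincide P p" "tclass G (prank p) P \<in> etips x" "maxnode G x"
  by blast
 have "coincide P (trev p)" using P(1) by (simp add: coincide_def)
 thus ?thesis using P assms(2) True unfolding at_node_def
  by (intro conjI UnionI[OF P(2)]) (auto simp: tclass_def)
next
 case False
 from assms(1) obtain t \<rho> where t: "p \<in> t" "t \<in> tips G \<rho>" "prank p = \<rho>" "gpath G p" by (rule at_nodeE)
 hence "\<rho> = Elem" using tips_one_ended False by blast
 then obtain b s where "p = Br b s" using gpath_Elem[OF t(4)] t by auto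
 thus ?thesis using assms by simp
qed

lemma at_node_same_tip:
 assumes "tips_rigid G (prank p)" "same_tip G p q" "at_node G p x" shows "at_node G q x"
proof (cases "p = q")
 case False
 hence q: "gpath G p" "gpath G q" "one_ended p" "one_ended q" "scoin p q" "prank p = prank q"
  using assms by (auto simp: same_tip_def)
 from at_node_one_ended[OF assms(3) q(3)] obtain P where
  P: "gpath G P" "one_ended P" "prank P = prank p" "coincide P p"
  "tclass G (prank p) P \<in> etips x" "maxnode G x"
  by blast
 have "scoin P p" using assms(1) P q unfolding tips_rigid_def by blast
 hence "coincide P q" using q P scoin_trans scoin_coincide by blast
 thus ?thesis using P q unfolding at_node_def
  by (intro conjI UnionI[OF P(5)]) (auto simp: tclass_def)
qed (use assms in simp)

text \<open>By rigidity the two tip classes that contain \<open>p\<close> are equal, and a tip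
  belongs to just one maximal node.\<close>

lemma at_node_unique:
 assumes "tips_rigid G (prank p)" "at_node G p x" "at_node G p y" shows "x = y"
proof (cases "one_ended p")
 case True
 from at_node_one_ended[OF assms(2) True] obtain P where
  P: "gpath G P" "one_ended P" "prank P = prank p" "coincide P p"
  "tclass G (prank p) P \<in> etips x" "maxnode G x"
   "tclass G (prank p) P \<in> tips G (prank p)"
  "prank p < \<nu>" "gpath G p"
  by blast
 from at_node_one_ended[OF assms(3) True] obtain R where
  R: "gpath G R" "one_ended R" "prank R = prank p" "coincide R p"
  "tclass G (prank p) R \<in> etips y" "maxnode G y"
  by blast
 have s: "scoin U V" if "gpath G U" "one_ended U" "prank U = prank p" "coincide U V" "gpath G V" "one_ended V" "prank V = prank p" for U V
  using that assms(1) unfolding tips_rigid_def by blast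
 have "scoin P R" using s[OF P(1-4)] s[OF R(1-4)] P True scoin_trans scoin_sym by blast
 hence "coincide P Q = coincide R Q" if "gpath G Q" "one_ended Q" "prank Q = prank p" for Q
  using s[OF P(1-3) _ that] s[OF R(1-3) _ that] scoin_coincide[OF P(2) that(2)] scoin_coincide[OF R(2) that(2)]
   scoin_trans scoin_sym by metis
 hence "tclass G (prank p) P = tclass G (prank p) R" by (auto simp: tclass_def)
 thus ?thesis using tip_unique_maxnode[OF P(8,7)] P R by metis
next
 case False
 from assms(2) obtain t \<rho> where t: "p \<in> t" "t \<in> tips G \<rho>" "prank p = \<rho>" "gpath G p" by (rule at_nodeE)
 hence "\<rho> = Elem" using tips_one_ended False by blast
 then obtain b s where "p = Br b s" using gpath_Elem[OF t(4)] t by auto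
 thus ?thesis using assms at_node_Br_unique by simp
qed

end

lemma tracing_subset:
 assumes "tracing G s f" "idx s' \<subseteq> idx s" shows "tracing G s' f"
proof -
 have sub: "idx s' Un (%i. i + 1) ` idx s' \<subseteq> idx s Un (%i. i + 1) ` idx s" using assms(2) by blast
 obtain x where x: "\<forall>i\<in>idx s. at_node G (lend (f i)) (x i) & at_node G (rend (f i)) (x (i + 1))"
   "inj_on x (idx s Un (%i. i + 1) ` idx s)"
   "\<forall>i\<in>idx s Un (%i. i + 1) ` idx s. \<forall>j\<in>idx s. x i ~: inner G (f j)"
   "\<forall>i\<in>idx s. \<forall>j\<in>idx s. i ~= j --> inner G (f i) Int inner G (f j) = {}"
  using assms(1) by (auto simp: tracing_def)
 show ?thesis unfolding tracing_def
 proof (rule exI[of _ x], intro conjI)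
  show "inj_on x (idx s' Un (%i. i + 1) ` idx s')" using x(2) sub by (rule inj_on_subset)
  show "\<forall>i\<in>idx s' Un (%i. i + 1) ` idx s'. \<forall>j\<in>idx s'. x i ~: inner G (f j)"
   using x(3) sub assms(2) by (meson subsetD)
 qed (use x(1,4) assms(2) in \<open>(meson subsetD)+\<close>)
qed

lemma gpath_lend_In:
 assumes "gpath G (Seq \<mu> s f)" "s = In \<or> s = Endless" shows "gpath G (Seq \<mu> In f)"
proof -
 note g = gpath_SeqD[OF assms(1)]
 have sub: "idx In \<subseteq> idx s" using assms(2) by auto
 have "tracing G In f" using g(6) sub by (rule tracing_subset)
 moreover have "junction_ranks \<mu> In f"
  using g(7) assms(2) unfolding junction_ranks_def junctions_def by (auto split: if_splits)
 ultimately show ?thesis using g sub by (intro gpath.sequence) auto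
qed

lemma gpath_rend_Out:
 assumes "gpath G (Seq \<mu> s f)" "s = Out \<or> s = Endless" shows "gpath G (Seq \<mu> Out f)"
proof -
 note g = gpath_SeqD[OF assms(1)]
 have sub: "idx Out \<subseteq> idx s" using assms(2) by auto
 have "tracing G Out f" using g(6) sub by (rule tracing_subset)
 moreover have "junction_ranks \<mu> Out f"
  using g(7) assms(2) unfolding junction_ranks_def junctions_def by (auto split: if_splits)
 ultimately show ?thesis using g sub by (intro gpath.sequence) auto
qed

lemma gpath_ends: "gpath G P ==> gpath G (lend P) & gpath G (rend P)"
proof (induction rule: gpath.induct)
 case (sequence \<mu> s f)
 hence g: "gpath G (Seq \<mu> s f)" by (intro gpath.sequence) auto
 have "gpath G (lend (Seq \<mu> s f))"
  by (rule lend_cases[OF sequence(2), of \<mu> f]) (use sequence g gpath_lend_In in \<open>force+\<close>)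
 moreover have "gpath G (rend (Seq \<mu> s f))"
  by (rule rend_cases[OF sequence(2), of \<mu> f]) (use sequence g gpath_rend_Out in \<open>force+\<close>)
 ultimately show ?case by simp
qed auto

context tfg
begin

text \<open>\<open>inner\<close> reads the node of a junction off the left end of the constituent to
  its right; after reversal it is read off the other tip at that junction. That both tips determine
  the same node is the uniqueness of nodes for tips of smaller rank, whence the assumption.\<close>

lemma gpath_prev_rigid:
 assumes "\<forall>\<alpha><\<rho>. tips_rigid G \<alpha>" "gpath G P" "prank P <= \<rho>"
 shows "gpath G (prev P) & inner G (prev P) = inner G P"
 using assms(2,3)
proof (induction rule: gpath.induct)
 case (sequence \<mu> s f)
 let ?f = "%i. prev (f (ridx s i))"
 obtain x where x: "\<forall>i\<in>idx s. at_node G (lend (f i)) (x i) & at_node G (rend (f i)) (x (i + 1))"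
   "inj_on x (idx s Un (%i. i + 1) ` idx s)"
   "\<forall>i\<in>idx s Un (%i. i + 1) ` idx s. \<forall>j\<in>idx s. x i ~: inner G (f j)"
   "\<forall>i\<in>idx s. \<forall>j\<in>idx s. i ~= j --> inner G (f i) Int inner G (f j) = {}"
  using sequence by (auto simp: tracing_def)
 have IH: "gpath G (prev (f i))" "inner G (prev (f i)) = inner G (f i)" "gpath G (f i)" "prank (f i) < \<rho>" if "i \<in> idx s" for i
  using sequence that by fastforce+
 have tr: "at_node G (lend (prev (f i))) (x (i+1))" "at_node G (rend (prev (f i))) (x i)" if "i \<in> idx s" for i
  using that x(1) IH[OF that] gpath_ends[OF IH(1)[OF that]] at_node_trev
  by (auto simp: lend_prev rend_prev)
 let ?x = "%i. x (ridx s i + 1)"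
 have r1: "i \<in> idx (rshape s) Un (%i. i + 1) ` idx (rshape s) ==> ridx s i + 1 \<in> idx s Un (%i. i + 1) ` idx s" for i
  by (auto simp: idx_rshape ridx_succ)
 have tc: "tracing G (rshape s) ?f"
  unfolding tracing_def
 proof (rule exI[of _ ?x], intro conjI)
  show "\<forall>i\<in>idx (rshape s). at_node G (lend (prev (f (ridx s i)))) (x (ridx s i + 1)) &
    at_node G (rend (prev (f (ridx s i)))) (x (ridx s (i + 1) + 1))"
   using tr by (auto simp: idx_rshape ridx_succ)
  show "inj_on ?x (idx (rshape s) Un (%i. i + 1) ` idx (rshape s))"
   using x(2) r1 unfolding inj_on_def by (metis add_right_cancel ridx_eq)
  show "\<forall>i\<in>idx (rshape s) Un (%i. i + 1) ` idx (rshape s). \<forall>j\<in>idx (rshape s). x (ridx s i + 1) ~: inner G (prev (f (ridx s j)))"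
   using x(3) r1 IH(2) by (metis idx_rshape)
  show "\<forall>i\<in>idx (rshape s). \<forall>j\<in>idx (rshape s). i ~= j --> inner G (prev (f (ridx s i))) Int inner G (prev (f (ridx s j))) = {}"
   using x(4) IH(2) by (metis idx_rshape ridx_eq)
 qed
 have "gpath G (Seq \<mu> (rshape s) ?f)"
  using sequence IH tc junction_ranks_prev[of \<mu> s f] by (intro gpath.sequence) (auto simp: idx_rshape)
 moreover have "inner G (Seq \<mu> (rshape s) ?f) = inner G (Seq \<mu> s f)"
 proof -
  have "(\<Union>i\<in>idx (rshape s). inner G (prev (f (ridx s i)))) = (\<Union>i\<in>idx s. inner G (f i))"
   using UN_ridx[where s=s and A="%i. inner G (prev (f i))"] IH(2) by auto
  moreover have "at_node G (lend (prev (f (i - 1)))) y \<longleftrightarrow> at_node G (lend (f i)) y"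
   if "i - 1 \<in> idx s" "i \<in> idx s" for i y
  proof -
   have "prank (lend (prev (f (i-1)))) < \<rho>" "prank (lend (f i)) < \<rho>"
    using IH[OF that(1)] IH[OF that(2)] lend_prank[OF IH(1)[OF that(1)]] lend_prank[OF IH(3)[OF that(2)]]
    by (auto simp: le_less_trans)
   thus ?thesis
    using at_node_unique assms(1) tr(1)[OF that(1)] x(1) that by (metis diff_add_cancel)
  qed
  hence "(EX i. i - 1 \<in> idx (rshape s) & i \<in> idx (rshape s) & at_node G (lend (prev (f (ridx s i)))) y) \<longleftrightarrow>
   (EX i. i - 1 \<in> idx s & i \<in> idx s & at_node G (lend (f i)) y)" for y
   unfolding idx_rshape ridx_pred by (metis diff_add_cancel ridx_ridx add_diff_cancel)
  ultimately show ?thesis by simp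
 qed
 ultimately show ?case by simp
qed simp_all

end

section \<open>The points of a path\<close>

definition pre :: "shape => (int => 'b tpath) => int => 'b set" where
 "pre s f i = (\<Union>j\<in>{j \<in> idx s. j < i}. pbranches (f j))"

definition post :: "shape => (int => 'b tpath) => int => 'b set" where
 "post s f i = (\<Union>j\<in>{j \<in> idx s. i < j}. pbranches (f j))"

text \<open>
  A point of a path is recorded by the set \<open>D\<close> of the branches before it; \<open>(D, q) \<in> rt P\<close> means that the
 path leaves this point to the right through the tip represented by \<open>q\<close>.  The tips to the left
 of the points are obtained from the reversed path.  In this way the points of a path form a maximal
 chain of subsets of its branches, which makes the order completeness of paths available.
\<close>

primrec rt :: "'b tpath => ('b set \<times> 'b tpath) set" where
 "rt (Br b s) = {({}, Br b (\<not> s))}"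
| "rt (Seq \<mu> s f) = (\<Union>i\<in>idx s. (%(D, q). (pre s f i Un D, q)) ` rt (f i)) Un
   (if s = In \<or> s = Endless then {({}, Seq \<mu> In f)} else {})"

text \<open>The right end of the path is left through no tip, so it is missing in \<open>rt\<close>
  and is added here.\<close>

definition pt :: "'b tpath => 'b set set" where
 "pt P = insert (pbranches P) (fst ` rt P)"

lemma rt_Seq_iff:
 "(D, q) \<in> rt (Seq \<mu> s f) \<longleftrightarrow> (\<exists>i\<in>idx s. EX E. (E, q) \<in> rt (f i) & D = pre s f i Un E) \<or>
   (s = In \<or> s = Endless) & D = {} & q = Seq \<mu> In f"
proof -
 have "(D, q) \<in> (%(D, q). (A Un D, q)) ` S \<longleftrightarrow> (EX E. (E, q) \<in> S & D = A Un E)" for A and S :: "('a set \<times> 'a tpath) set"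
  by force
 thus ?thesis by simp
qed

declare rt.simps(2) [simp del]

lemma rt_SeqI: "i \<in> idx s ==> (E, q) \<in> rt (f i) ==> (pre s f i Un E, q) \<in> rt (Seq \<mu> s f)"
 by (auto simp: rt_Seq_iff)

lemma pre_rshape: "pre (rshape s) (%i. prev (f (ridx s i))) i = post s f (ridx s i)"
proof -
 have "b \<in> pbranches (f j) ==> j \<in> idx s ==> ridx s i < j ==> EX k. ridx s k \<in> idx s & k < i & b \<in> pbranches (f (ridx s k))" for b j
  by (intro exI[of _ "ridx s j"]) (metis ridx_less ridx_ridx)
 thus ?thesis unfolding pre_def post_def by (auto simp: idx_rshape)
qed

lemma rt_prev_iff:
 "(D, q) \<in> rt (prev (Seq \<mu> s f)) \<longleftrightarrow> (\<exists>i\<in>idx s. EX E. (E, q) \<in> rt (prev (f i)) & D = post s f i Un E) \<or>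
   (s = Out \<or> s = Endless) & D = {} & q = Seq \<mu> In (%i. prev (f (ridx s i)))"
proof -
 have "(\<exists>i\<in>idx (rshape s). EX E. (E, q) \<in> rt (prev (f (ridx s i))) & D = post s f (ridx s i) Un E) \<longleftrightarrow>
   (\<exists>i\<in>idx s. EX E. (E, q) \<in> rt (prev (f i)) & D = post s f i Un E)"
  by (metis idx_rshape idx_rshape' ridx_ridx)
 moreover have "(rshape s = In \<or> rshape s = Endless) \<longleftrightarrow> (s = Out \<or> s = Endless)" by (cases s) auto
 ultimately show ?thesis by (simp add: rt_Seq_iff pre_rshape)
qed

lemma pre_mono: "i <= j ==> pre s f i \<subseteq> pre s f j"
 unfolding pre_def by (auto intro: less_le_trans)

lemma pre_sub: "pre s f i \<subseteq> pbranches (Seq \<mu> s f)" unfolding pre_def by auto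
lemma post_sub: "post s f i \<subseteq> pbranches (Seq \<mu> s f)" unfolding post_def by auto

lemma rt_subset: "(D, q) \<in> rt P ==> D \<subseteq> pbranches P"
proof (induction P arbitrary: D)
 case (Seq \<mu> s f)
 from Seq.prems[unfolded rt_Seq_iff] show ?case
 proof (elim disjE bexE exE conjE)
  fix i E assume i: "i \<in> idx s" "(E, q) \<in> rt (f i)" "D = pre s f i Un E"
  hence "E \<subseteq> pbranches (f i)" using Seq.IH by blast
  thus ?thesis using i pre_sub[of s f i \<mu>] by auto
 qed auto
qed auto

lemma branch_pre: "i \<in> idx s ==> i < j ==> pbranches (f i) \<subseteq> pre s f j"
 unfolding pre_def by auto

lemma pre_Suc: "i \<in> idx s ==> pre s f (i + 1) = pre s f i Un pbranches (f i)"
proof -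
 assume i: "i \<in> idx s"
 have "j < i + 1 \<longleftrightarrow> j < i \<or> j = i" for j by auto
 thus ?thesis using i unfolding pre_def by auto
qed

lemma pre_decomp:
 assumes "i \<in> idx s" shows "pbranches (Seq \<mu> s f) = pre s f i Un pbranches (f i) Un post s f i"
proof -
 have "j < i \<or> j = i \<or> i < j" for j by auto
 thus ?thesis using assms unfolding pre_def post_def by auto
qed

lemma pre_first: "i - 1 ~: idx s ==> i \<in> idx s ==> pre s f i = {}"
proof -
 assume "i - 1 ~: idx s" "i \<in> idx s"
 hence "\<not> (j < i & j \<in> idx s)" for j using idx_convex[of j s i "i - 1"] by auto
 thus ?thesis unfolding pre_def by auto
qed

lemma post_last: "i + 1 ~: idx s ==> i \<in> idx s ==> post s f i = {}"
proof -
 assume "i + 1 ~: idx s" "i \<in> idx s"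
 hence "\<not> (i < j & j \<in> idx s)" for j using idx_convex[of i s j "i + 1"] by auto
 thus ?thesis unfolding post_def by auto
qed

lemma rt_lend: "gpath G P ==> ({}, lend P) \<in> rt P"
proof (induction rule: gpath.induct)
 case (sequence \<mu> s f)
 show ?case
 proof (rule lend_cases[OF sequence(2), of \<mu> f])
  fix i assume i: "i \<in> idx s" "i - 1 ~: idx s" "lend (Seq \<mu> s f) = lend (f i)"
  have "({}, lend (f i)) \<in> rt (f i)" using sequence i by blast
  hence "(pre s f i Un {}, lend (f i)) \<in> rt (Seq \<mu> s f)" using rt_SeqI i by blast
  thus ?thesis unfolding i(3) pre_first[OF i(2,1)] by simp
 qed (auto simp: rt_Seq_iff)
qed auto

lemma empty_pt: "gpath G P ==> {} \<in> pt P"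
 using rt_lend unfolding pt_def by force

lemma full_pt [simp]: "pbranches P \<in> pt P" by (simp add: pt_def)

lemma rt_pt: "(D, q) \<in> rt P ==> D \<in> pt P" unfolding pt_def by force

lemma pt_rt: "D \<in> pt P ==> D ~= pbranches P ==> EX q. (D, q) \<in> rt P" unfolding pt_def by force

lemma pt_SeqI:
 assumes "gpath G (Seq \<mu> s f)" "i \<in> idx s" "E \<in> pt (f i)" shows "pre s f i Un E \<in> pt (Seq \<mu> s f)"
proof (cases "E = pbranches (f i)")
 case True
 show ?thesis
 proof (cases "i + 1 \<in> idx s")
  case T: True
  hence "(pre s f (i+1) Un {}, lend (f (i+1))) \<in> rt (Seq \<mu> s f)"
   using gpath_SeqD(3)[OF assms(1)] rt_lend by (intro rt_SeqI) auto
  thus ?thesis using True assms(2) by (auto simp: pre_Suc dest: rt_pt)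
 next
  case False
  hence "pre s f i Un E = pbranches (Seq \<mu> s f)"
   using pre_decomp[OF assms(2), of \<mu> f] post_last[of i s f] True assms(2) by simp
  thus ?thesis by (metis full_pt)
 qed
next
 case False
 thus ?thesis using pt_rt[OF assms(3)] rt_SeqI assms(2) rt_pt by metis
qed

lemma pt_SeqE:
 assumes "D \<in> pt (Seq \<mu> s f)"
 obtains (inside) i E where "i \<in> idx s" "E \<in> pt (f i)" "D = pre s f i Un E"
 | (left) "D = {}" "s = In \<or> s = Endless"
 | (right) "D = pbranches (Seq \<mu> s f)"
proof (cases "D = pbranches (Seq \<mu> s f)")
 case False
 then obtain q where "(D, q) \<in> rt (Seq \<mu> s f)" using pt_rt assms by metis
 thus ?thesis unfolding rt_Seq_iff using rt_pt that by metis
qed (use that in simp)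

section \<open>The points of a path as a maximal chain\<close>

context tfg
begin

lemma pre_disjoint: "gpath G (Seq \<mu> s f) ==> i \<in> idx s ==> pre s f i Int pbranches (f i) = {}"
 unfolding pre_def using pbranches_disjoint[of \<mu> s f _ i] by auto

lemma post_disjoint: "gpath G (Seq \<mu> s f) ==> i \<in> idx s ==> post s f i Int pbranches (f i) = {}"
 unfolding post_def using pbranches_disjoint[of \<mu> s f _ i] by auto

lemma pre_post_disjoint:
 assumes "gpath G (Seq \<mu> s f)" shows "pre s f i Int post s f i = {}"
proof -
 have "pbranches (f j) Int pbranches (f k) = {}" if "j \<in> idx s" "k \<in> idx s" "j < i" "i < k" for j k
  using pbranches_disjoint[OF assms that(1,2)] that by auto
 thus ?thesis unfolding pre_def post_def by blast
qed

lemma rt_psubset: "gpath G P ==> (D, q) \<in> rt P ==> D \<subset> pbranches P"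
proof (induction arbitrary: D rule: gpath.induct)
 case (sequence \<mu> s f)
 hence g: "gpath G (Seq \<mu> s f)" by (intro gpath.sequence) auto
 from sequence(6)[unfolded rt_Seq_iff] show ?case
 proof (elim disjE bexE exE conjE)
  fix i E assume i: "i \<in> idx s" "(E, q) \<in> rt (f i)" "D = pre s f i Un E"
  hence "E \<subset> pbranches (f i)" using sequence by blast
  thus ?thesis using i pre_decomp[OF i(1), of \<mu> f] pre_disjoint[OF g i(1)] by blast
 qed (use pbranches_nonempty[OF g] in auto)
qed auto

lemma pt_subset: "gpath G P ==> D \<in> pt P ==> D \<subseteq> pbranches P"
 using rt_psubset unfolding pt_def by fastforce

lemma pre_nonempty: "gpath G (Seq \<mu> s f) ==> i - 1 \<in> idx s ==> pre s f i ~= {}"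
 using branch_pre[of "i - 1" s i f] gpath_SeqD(3)[of G \<mu> s f "i - 1"] pbranches_nonempty[of G "f (i - 1)"] by force

lemma pre_nonempty': "gpath G (Seq \<mu> s f) ==> i \<in> idx s ==> s = In \<or> s = Endless ==> pre s f i ~= {}"
 using pre_nonempty[of \<mu> s f i] by auto

text \<open>Constituents have disjoint nonempty sets of branches, so points of different
  constituents differ. A junction is counted once, as the left end of the constituent after it,
  because \<open>rt\<close> omits the right end of a path.\<close>

lemma rt_unique: "gpath G P ==> (D, q) \<in> rt P ==> (D, q') \<in> rt P ==> q = q'"
proof (induction arbitrary: D rule: gpath.induct)
 case (sequence \<mu> s f)
 hence g: "gpath G (Seq \<mu> s f)" by (intro gpath.sequence) auto
 have lt: "pre s f i Un E ~= pre s f j Un E'" if "i \<in> idx s" "j \<in> idx s" "(E, p) \<in> rt (f i)" "i < j" for i j E E' p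
 proof -
  have "E \<subset> pbranches (f i)" using rt_psubset that gpath_SeqD(3)[OF g] by blast
  moreover have "pre s f i Un pbranches (f i) \<subseteq> pre s f j"
   using pre_mono[of "i+1" j s f] pre_Suc[OF that(1), of f] that(4) by simp
  ultimately show ?thesis using pre_disjoint[OF g that(1)] by blast
 qed
 have ne: "pre s f i Un E ~= {}" if "i \<in> idx s" "s = In \<or> s = Endless" for i E
  using pre_nonempty'[OF g that] by auto
 from sequence(6)[unfolded rt_Seq_iff] show ?case
 proof (elim disjE bexE exE conjE)
  fix i E assume i: "i \<in> idx s" "(E, q) \<in> rt (f i)" "D = pre s f i Un E"
  from sequence(7)[unfolded rt_Seq_iff] show ?thesis
  proof (elim disjE bexE exE conjE)
   fix j E' assume j: "j \<in> idx s" "(E', q') \<in> rt (f j)" "D = pre s f j Un E'"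
   have "i = j" using lt[OF i(1) j(1) i(2)] lt[OF j(1) i(1) j(2)] i(3) j(3) by (metis linorder_neqE)
   moreover from this have "E = E'"
    using i(3) j(3) pre_disjoint[OF g i(1)] rt_psubset i(2) j(2) gpath_SeqD(3)[OF g i(1)] by blast
   ultimately show ?thesis using sequence i j by blast
  qed (use ne i in auto)
 qed (use ne sequence(7) in \<open>auto simp: rt_Seq_iff\<close>)
qed auto

lemma rt_empty: "gpath G P ==> ({}, q) \<in> rt P \<longleftrightarrow> q = lend P"
 using rt_lend rt_unique by metis

lemma pt_chain: "gpath G P ==> D \<in> pt P ==> E \<in> pt P ==> D \<subseteq> E \<or> E \<subseteq> D"
proof (induction arbitrary: D E rule: gpath.induct)
 case (branch b s) thus ?case by (auto simp: pt_def)
next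
 case (sequence \<mu> s f)
 hence g: "gpath G (Seq \<mu> s f)" by (intro gpath.sequence) auto
 have lt: "pre s f i Un D' \<subseteq> pre s f j Un E'" if "i \<in> idx s" "j \<in> idx s" "D' \<in> pt (f i)" "i < j" for i j D' E'
 proof -
  have "D' \<subseteq> pbranches (f i)" using pt_subset that gpath_SeqD(3)[OF g] by blast
  moreover have "pre s f i Un pbranches (f i) \<subseteq> pre s f j"
   using pre_mono[of "i+1" j s f] pre_Suc[OF that(1), of f] that(4) by simp
  ultimately show ?thesis by blast
 qed
 have sub: "D \<subseteq> pbranches (Seq \<mu> s f)" "E \<subseteq> pbranches (Seq \<mu> s f)" using pt_subset[OF g] sequence by auto
 from sequence(6) show ?case
 proof (cases rule: pt_SeqE)
  case (inside i D')
  from sequence(7) show ?thesis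
  proof (cases rule: pt_SeqE)
   case i2: (inside j E')
   show ?thesis
   proof (cases "i = j")
    case True thus ?thesis using sequence i2 inside by blast
   next
    case False thus ?thesis using lt inside i2 by (metis linorder_neqE)
   qed
  qed (use sub in auto)
 qed (use sub in auto)
qed

text \<open>The order completeness of paths: limits of points are unions or intersections of points,
  which are comparable with all points. If \<open>D\<close> falls into the range of one constituent,
  induction applies. Otherwise each constituent lies entirely in or out of \<open>D\<close>, and
  since indices are consecutive integers, membership propagates from one constituent to the next, so
  that \<open>D\<close> is an end of the path.\<close>

lemma pt_maximal:
 "gpath G P ==> D \<subseteq> pbranches P ==> (!!E. E \<in> pt P ==> D \<subseteq> E \<or> E \<subseteq> D) ==> D \<in> pt P"
proof (induction arbitrary: D rule: gpath.induct)
 case (branch b s) thus ?case by (auto simp: pt_def)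
next
 case (sequence \<mu> s f)
 hence g: "gpath G (Seq \<mu> s f)" by (intro gpath.sequence) auto
 let ?B = "%i. pbranches (f i)"
 note cmp = sequence(7)
 have gi: "gpath G (f i)" if "i \<in> idx s" for i using gpath_SeqD(3)[OF g that] .
 have pp: "pre s f i Un {} \<in> pt (Seq \<mu> s f)" "pre s f i Un ?B i \<in> pt (Seq \<mu> s f)" if "i \<in> idx s" for i
  using pt_SeqI[OF g that empty_pt[OF gi[OF that]]] pt_SeqI[OF g that full_pt] by auto
 show ?case
 proof (cases "\<exists>i\<in>idx s. pre s f i \<subseteq> D & D \<subseteq> pre s f i Un ?B i")
  case True
  then obtain i where i: "i \<in> idx s" "pre s f i \<subseteq> D" "D \<subseteq> pre s f i Un ?B i" by auto
  have "D - pre s f i \<in> pt (f i)"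
  proof (rule sequence.IH[rule_format, OF i(1), THEN conjunct1, THEN conjunct2, rule_format])
   fix E assume E: "E \<in> pt (f i)"
   hence "D \<subseteq> pre s f i Un E \<or> pre s f i Un E \<subseteq> D" using cmp pt_SeqI[OF g i(1)] by blast
   moreover have "E Int pre s f i = {}" using pt_subset[OF gi[OF i(1)] E] pre_disjoint[OF g i(1)] by auto
   ultimately show "D - pre s f i \<subseteq> E \<or> E \<subseteq> D - pre s f i" by blast
  qed (use i in auto)
  hence "pre s f i Un (D - pre s f i) \<in> pt (Seq \<mu> s f)" using pt_SeqI[OF g i(1)] by blast
  thus ?thesis using i(2) by (simp add: Un_absorb1)
 next
  case False
  hence *: "D \<subset> pre s f i \<or> pre s f i Un ?B i \<subset> D" if "i \<in> idx s" for i
   using cmp[OF pp(1)[OF that]] cmp[OF pp(2)[OF that]] that by auto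
  show ?thesis
  proof (cases "D = {} \<or> D = pbranches (Seq \<mu> s f)")
   case True thus ?thesis using empty_pt[OF g] full_pt by metis
  next
   case ne: False
   then obtain d where "d \<in> D" by auto
   then obtain j where j: "j \<in> idx s" "d \<in> ?B j" using sequence(6) by auto
   obtain e where "e \<in> pbranches (Seq \<mu> s f)" "e ~: D" using ne sequence(6) by blast
   then obtain k where k: "k \<in> idx s" "e \<in> ?B k" by auto
   have dj: "pre s f j Un ?B j \<subseteq> D" using *[OF j(1)] pre_disjoint[OF g j(1)] j(2) \<open>d \<in> D\<close> by blast
   have dk: "\<not> pre s f k Un ?B k \<subseteq> D" using k \<open>e ~: D\<close> by auto
   have "j <= n ==> n <= k ==> pre s f n Un ?B n \<subseteq> D" for n
   proof (induction n rule: int_ge_induct)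
    case base show ?case using dj .
   next
    case (step i)
    hence "i \<in> idx s" "i + 1 \<in> idx s" using idx_convex[OF j(1) k(1)] by auto
    thus ?case using *[of "i+1"] pre_Suc[of i s f] step by auto
   qed
   moreover have "j <= k"
   proof (rule ccontr)
    assume "\<not> j <= k"
    hence "pre s f k Un ?B k \<subseteq> pre s f j" using pre_mono[of "k+1" j s f] pre_Suc[OF k(1), of f] by simp
    thus False using dj dk by blast
   qed
   ultimately show ?thesis using dk by blast
  qed
 qed
qed

lemma pt_prev: "gpath G P ==> E \<in> pt (prev P) ==> pbranches P - E \<in> pt P"
proof (induction arbitrary: E rule: gpath.induct)
 case (branch b s) thus ?case by (auto simp: pt_def)
next
 case (sequence \<mu> s f)
 hence g: "gpath G (Seq \<mu> s f)" by (intro gpath.sequence) auto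
 let ?P = "Seq \<mu> s f"
 show ?case
 proof (cases "E = pbranches ?P")
  case True thus ?thesis using empty_pt[OF g] by simp
 next
  case False
  then obtain q where "(E, q) \<in> rt (prev ?P)" using pt_rt[of E "prev ?P"] sequence(6)
   by (metis pbranches_prev)
  thus ?thesis unfolding rt_prev_iff
  proof (elim disjE bexE exE conjE)
   fix i F assume i: "i \<in> idx s" "(F, q) \<in> rt (prev (f i))" "E = post s f i Un F"
   hence "pbranches (f i) - F \<in> pt (f i)" using sequence rt_pt by blast
   hence "pre s f i Un (pbranches (f i) - F) \<in> pt ?P" using pt_SeqI[OF g i(1)] by blast
   moreover have "F \<subseteq> pbranches (f i)" using rt_subset[OF i(2)] by simp
   hence "pbranches ?P - E = pre s f i Un (pbranches (f i) - F)"
    using i(3) pre_decomp[OF i(1), of \<mu> f] pre_disjoint[OF g i(1)] post_disjoint[OF g i(1)]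
     pre_post_disjoint[OF g, of i] by blast
   ultimately show ?thesis by simp
  qed (metis Diff_empty full_pt)+
 qed
qed

lemma branch_pt:
 "gpath G P ==> b \<in> pbranches P ==>
  EX D s. (D, Br b s) \<in> rt P & (pbranches P - D - {b}, Br b (\<not> s)) \<in> rt (prev P) & b ~: D"
proof (induction rule: gpath.induct)
 case (branch c s) thus ?case by auto
next
 case (sequence \<mu> s f)
 hence g: "gpath G (Seq \<mu> s f)" by (intro gpath.sequence) auto
 obtain i where i: "i \<in> idx s" "b \<in> pbranches (f i)" using sequence by auto
 then obtain D r where D: "(D, Br b r) \<in> rt (f i)" "(pbranches (f i) - D - {b}, Br b (\<not> r)) \<in> rt (prev (f i))" "b ~: D"
  using sequence by blast
 have "(pre s f i Un D, Br b r) \<in> rt (Seq \<mu> s f)" using rt_SeqI i D by blast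
 moreover have "(post s f i Un (pbranches (f i) - D - {b}), Br b (\<not> r)) \<in> rt (prev (Seq \<mu> s f))"
  unfolding rt_prev_iff using i D by blast
 moreover have "pbranches (Seq \<mu> s f) - (pre s f i Un D) - {b} = post s f i Un (pbranches (f i) - D - {b})"
  using pre_decomp[OF i(1), of \<mu> f] pre_disjoint[OF g i(1)] post_disjoint[OF g i(1)]
     pre_post_disjoint[OF g, of i] rt_subset[OF D(1)] i(2) by blast
 moreover have "b ~: pre s f i Un D" using i(2) D(3) pre_disjoint[OF g i(1)] by blast
 ultimately show ?case by metis
qed

lemma rt_Br:
 "gpath G P ==> (D, Br b s) \<in> rt P ==>
   b \<in> pbranches P & b ~: D & (pbranches P - D - {b}, Br b (\<not> s)) \<in> rt (prev P)"
proof (induction arbitrary: D rule: gpath.induct)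
 case (branch c s) thus ?case by auto
next
 case (sequence \<mu> s' f)
 hence g: "gpath G (Seq \<mu> s' f)" by (intro gpath.sequence) auto
 from sequence(6)[unfolded rt_Seq_iff] obtain i E where
  i: "i \<in> idx s'" "(E, Br b s) \<in> rt (f i)" "D = pre s' f i Un E" by auto
 hence D: "b \<in> pbranches (f i)" "b ~: E" "(pbranches (f i) - E - {b}, Br b (\<not> s)) \<in> rt (prev (f i))"
  using sequence by blast+
 have "(post s' f i Un (pbranches (f i) - E - {b}), Br b (\<not> s)) \<in> rt (prev (Seq \<mu> s' f))"
  unfolding rt_prev_iff using i D by blast
 moreover have "pbranches (Seq \<mu> s' f) - D - {b} = post s' f i Un (pbranches (f i) - E - {b})"
  using pre_decomp[OF i(1), of \<mu> f] pre_disjoint[OF g i(1)] post_disjoint[OF g i(1)]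
     pre_post_disjoint[OF g, of i] rt_subset[OF i(2)] D i(3) by blast
 ultimately show ?case using i D pre_disjoint[OF g i(1)] by auto
qed

text \<open>A one-ended tip occurring at a point of a path is a section of that path.\<close>

lemma rt_Seq_local:
 "gpath G P ==> (D, q) \<in> rt P ==> q = Seq \<beta> s' h ==>
  s' = In & gpath G q & D Int pbranches q = {} & pbranches q \<subseteq> pbranches P &
  (\<forall>(E, e)\<in>rt q. (D Un E, e) \<in> rt P) &
  (\<forall>(E, e)\<in>rt (prev q). (pbranches P - D - pbranches q Un E, e) \<in> rt (prev P))"
proof (induction arbitrary: D rule: gpath.induct)
 case (branch c s) thus ?case by auto
next
 case (sequence \<mu> s f)
 hence g: "gpath G (Seq \<mu> s f)" by (intro gpath.sequence) auto
 from sequence(6)[unfolded rt_Seq_iff]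
 consider (inside) i E where "i \<in> idx s" "(E, q) \<in> rt (f i)" "D = pre s f i Un E"
  | (opn) "s = In \<or> s = Endless" "D = {}" "q = Seq \<mu> In f" by blast
 thus ?case
 proof cases
  case i: (inside i E)
  have IH: "s' = In" "gpath G q" "E Int pbranches q = {}" "pbranches q \<subseteq> pbranches (f i)"
    "!!F e. (F, e) \<in> rt q ==> (E Un F, e) \<in> rt (f i)"
    "!!F e. (F, e) \<in> rt (prev q) ==> (pbranches (f i) - E - pbranches q Un F, e) \<in> rt (prev (f i))"
   using sequence.IH i(1,2) sequence.prems(2) by blast+
  have eq: "pbranches (Seq \<mu> s f) - D - pbranches q Un F = post s f i Un (pbranches (f i) - E - pbranches q Un F)"
   if "F \<subseteq> pbranches q" for F
   using pre_decomp[OF i(1), of \<mu> f] pre_disjoint[OF g i(1)] post_disjoint[OF g i(1)]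
     pre_post_disjoint[OF g, of i] rt_subset[OF i(2)] IH(4) i(3) that by blast
  have "(D Un F, e) \<in> rt (Seq \<mu> s f)" if "(F, e) \<in> rt q" for F e
   using rt_SeqI[of i s "E Un F" e f \<mu>] i(1) IH(5)[OF that] i(3) by (simp add: Un_assoc)
  moreover have "(pbranches (Seq \<mu> s f) - D - pbranches q Un F, e) \<in> rt (prev (Seq \<mu> s f))"
   if F: "(F, e) \<in> rt (prev q)" for F e
  proof -
   have "F \<subseteq> pbranches q" using rt_subset[OF F] by simp
   from eq[OF this] show ?thesis unfolding rt_prev_iff using i(1) IH(6)[OF F] by blast
  qed
  moreover have "D Int pbranches q = {}" using i(3) IH(3,4) pre_disjoint[OF g i(1)] by blast
  ultimately show ?thesis using IH(1,2,4) i(1) by fastforce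
 next
  case opn
  note s = opn(1) and D = opn(2) and q = opn(3)
  have pi: "pre In f i = pre s f i" if "i < 0" for i
  proof -
   have "{j \<in> idx In. j < i} = {j \<in> idx s. j < i}" using s that by auto
   thus ?thesis unfolding pre_def by simp
  qed
  \<comment> \<open>What lies to the right of the open left half: empty for shape \<open>In\<close>,
    the constituents of nonnegative index for \<open>Endless\<close>.\<close>
  let ?R = "\<Union>j\<in>idx s - idx In. pbranches (f j)"
  have dj: "pbranches (f j) Int pbranches (f k) = {}" if "j \<in> idx s - idx In" "k \<in> idx In" for j k
   using pbranches_disjoint[OF g, of j k] s that by auto
  have Iss: "idx s = idx In Un (idx s - idx In)" using s by auto
  have "pbranches (Seq \<mu> s f) = pbranches q Un ?R" unfolding q pbranches.simps
   by (subst Iss) (rule UN_Un)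
  moreover have "pbranches q Int ?R = {}" unfolding q using dj by auto
  ultimately have R: "pbranches (Seq \<mu> s f) - pbranches q = ?R" by blast
  have po: "pbranches (Seq \<mu> s f) - pbranches q Un (post In f i Un F) = post s f i Un F" if i: "i < 0" for i F
  proof -
   have "{j \<in> idx s. i < j} = {j \<in> idx In. i < j} Un (idx s - idx In)" using s i by auto
   hence "post s f i = post In f i Un ?R" unfolding post_def by auto
   thus ?thesis using R by blast
  qed
  have "(D Un F, e) \<in> rt (Seq \<mu> s f)" if "(F, e) \<in> rt q" for F e
  proof -
   from that[unfolded q rt_Seq_iff] consider (a) i E where "i \<in> idx In" "(E, e) \<in> rt (f i)" "F = pre In f i Un E"
    | (b) "F = {}" "e = Seq \<mu> In f" by blast
   thus ?thesis
   proof cases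
    case a
    hence "i \<in> idx s" "i < 0" using s by auto
    thus ?thesis using rt_SeqI[of i s E e f \<mu>] a pi D by simp
   next
    case b thus ?thesis using D s by (simp add: rt_Seq_iff)
   qed
  qed
  moreover have "(pbranches (Seq \<mu> s f) - D - pbranches q Un F, e) \<in> rt (prev (Seq \<mu> s f))"
   if F: "(F, e) \<in> rt (prev q)" for F e
  proof -
   from F[unfolded q rt_prev_iff] obtain i F' where i: "i < 0" "(F', e) \<in> rt (prev (f i))" "F = post In f i Un F'"
    by auto
   hence "(post s f i Un F', e) \<in> rt (prev (Seq \<mu> s f))" using s unfolding rt_prev_iff by fastforce
   thus ?thesis using po[OF i(1), of F'] D i(3) by simp
  qed
  ultimately show ?thesis using q D s gpath_lend_In[OF g] sequence(7) by auto
 qed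
qed

end

declare prev.simps(2) [simp del]

section \<open>A path meets no node at two points\<close>

text \<open>The ranks possible for tips at inner points of a path of rank \<open>\<mu>\<close>. For
  the arrow rank there is no largest one, so the whole set is kept; it still determines
  \<open>\<mu>\<close>.\<close>

definition tip_ranks :: "rank => rank set" where
 "tip_ranks \<mu> = (if \<mu> = Arr then {..<Arr} else {..rpred \<mu>})"

lemma tip_ranks_inject:
 assumes "tip_ranks \<mu> = tip_ranks \<beta>" "\<mu> ~= Elem" "\<beta> ~= Elem" shows "\<mu> = \<beta>"
proof -
 have *: "{..a} ~= {..<Arr}" for a
 proof (cases a)
  case Elem hence "Rk 0 \<in> {..<Arr}" "Rk 0 ~: {..a}" by auto thus ?thesis by blast
 next
  case (Rk n) hence "Rk (Suc n) \<in> {..<Arr}" "Rk (Suc n) ~: {..a}" by auto thus ?thesis by blast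
 next
  case Arr hence "Arr ~: {..<Arr}" "Arr \<in> {..a}" by auto thus ?thesis by blast
 next
  case Om hence "Arr ~: {..<Arr}" "Arr \<in> {..a}" by auto thus ?thesis by blast
 qed
 show ?thesis
  using assms rpred_inject[of \<mu> \<beta>] *[of "rpred \<mu>"] *[of "rpred \<beta>"] unfolding tip_ranks_def
  by (auto split: if_splits)
qed

lemma tip_ranks_down: "r \<in> tip_ranks \<mu> ==> r' <= r ==> r' \<in> tip_ranks \<mu>"
 by (auto simp: tip_ranks_def split: if_splits)

lemma rpred_mono: "\<alpha> <= \<beta> ==> rpred \<alpha> <= rpred \<beta>"
 by (cases \<alpha>; cases \<beta>) (auto split: nat.splits)

lemma rpred_le: "rpred \<alpha> <= \<alpha>"
 by (cases \<alpha>) (auto split: nat.splits)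

lemma tip_ranks_mono: "\<alpha> < \<beta> ==> tip_ranks \<alpha> \<subseteq> tip_ranks \<beta>"
proof -
 assume a: "\<alpha> < \<beta>"
 show ?thesis
 proof (cases "\<beta> = Arr")
  case True
  hence "rpred \<alpha> < Arr" "\<alpha> ~= Arr" using a rpred_le[of \<alpha>] by auto
  thus ?thesis using True by (auto simp: tip_ranks_def)
 next
  case False
  thus ?thesis using a rpred_mono[of \<alpha> \<beta>] less_imp_le_rpred[OF a False] by (auto simp: tip_ranks_def)
 qed
qed

lemma tip_ranks_less: "r \<in> tip_ranks \<mu> ==> \<mu> ~= Elem ==> r < \<mu>"
 using rpred_less[of \<mu>] by (auto simp: tip_ranks_def split: if_splits)

text \<open>Applied to the junction ranks of a one-ended arrow path: increasing strictly, they
  exceed every finite rank.\<close>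

lemma strict_inc_rank:
 fixes a :: "nat => rank"
 assumes "!!n. a n < a (Suc n)" shows "Rk n <= a (Suc n)"
proof (induction n)
 case 0
 have "Elem < a 1" using assms[of 0] le_less_trans[of Elem "a 0"] by simp
 thus ?case by (cases "a 1") auto
next
 case (Suc n)
 hence "Rk n < a (Suc (Suc n))" using assms[of "Suc n"] by auto
 thus ?case by (cases "a (Suc (Suc n))") auto
qed

definition inner_point :: "'b tpath => 'b set => bool" where
 "inner_point P D \<longleftrightarrow> D \<in> pt P & D ~= {} & D ~= pbranches P"

definition (in tfg) rigid_below :: "rank => bool" where
 "rigid_below \<rho> \<longleftrightarrow> (\<forall>\<alpha><\<rho>. tips_rigid G \<alpha>)"

section \<open>Tips and nodes at the points of a path\<close>

context tfg
begin

lemma rt_tip_rank: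
 "gpath G P ==> (D, q) \<in> rt P ==> D ~= {} ==> prank q \<in> tip_ranks (prank P)"
proof (induction arbitrary: D rule: gpath.induct)
 case (sequence \<mu> s f)
 hence g: "gpath G (Seq \<mu> s f)" by (intro gpath.sequence) auto
 from sequence.prems[unfolded rt_Seq_iff] obtain i E where
  i: "i \<in> idx s" "(E, q) \<in> rt (f i)" "D = pre s f i Un E" by auto
 have lt: "prank (f i) < \<mu>" using gpath_SeqD(4)[OF g i(1)] .
 show ?case
 proof (cases "E = {}")
  case False
  thus ?thesis using sequence i tip_ranks_mono[OF lt] by fastforce
 next
  case True
  hence q: "q = lend (f i)" using i rt_empty gpath_SeqD(3)[OF g] by blast
  show ?thesis
  proof (cases "\<mu> = Arr")
   case T: True
   thus ?thesis using lt lend_prank[of G "f i"] gpath_SeqD(3)[OF g i(1)] q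
    by (auto simp: tip_ranks_def)
  next
   case False
   have "i - 1 \<in> idx s" using True i sequence.prems(2) pre_first[of i s f] by auto
   hence "jrank f i = rpred \<mu>" using gpath_SeqD(7)[OF g] False i
    by (auto simp: junction_ranks_def junctions_def)
   hence "prank q <= rpred \<mu>" using q unfolding jrank_def by (metis max.cobounded2)
   thus ?thesis using False by (simp add: tip_ranks_def)
  qed
 qed
qed auto

text \<open>Only an open left end carries a tip of the full rank of the path. Full-rank tips are
  thereby recognized as open ends later on.\<close>

lemma rt_tip_rank_Seq:
 assumes "gpath G (Seq \<mu> s f)" "(D, q) \<in> rt (Seq \<mu> s f)"
 shows "prank q < \<mu> \<or> D = {} & q = Seq \<mu> In f"
proof (cases "D = {}")
 case False
 thus ?thesis using rt_tip_rank[OF assms] tip_ranks_less gpath_SeqD(1)[OF assms(1)] by auto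
next
 case True
 note s2 = gpath_SeqD(2)[OF assms(1)]
 have q: "q = lend (Seq \<mu> s f)" using True assms rt_empty by blast
 show ?thesis
 proof (rule lend_cases[OF s2, of \<mu> f])
  fix i assume i: "i \<in> idx s" "lend (Seq \<mu> s f) = lend (f i)"
  thus ?thesis using q lend_prank[of G "f i"] gpath_SeqD(3,4)[OF assms(1) i(1)] by auto
 qed (use True q in auto)
qed

lemma rt_prank_le: "gpath G P ==> (D, q) \<in> rt P ==> prank q <= prank P"
proof (cases P)
 case (Br b s) assume "(D, q) \<in> rt P" thus ?thesis using Br by auto
next
 case (Seq \<mu> s f) assume "gpath G P" "(D, q) \<in> rt P" thus ?thesis
  using Seq rt_tip_rank_Seq[of \<mu> s f D q] by auto
qed

lemma rt_inner: "gpath G P ==> (D, q) \<in> rt P ==> D ~= {} ==> at_node G q x ==> x \<in> inner G P"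
proof (induction arbitrary: D rule: gpath.induct)
 case (sequence \<mu> s f)
 hence g: "gpath G (Seq \<mu> s f)" by (intro gpath.sequence) auto
 from sequence.prems[unfolded rt_Seq_iff] obtain i E where
  i: "i \<in> idx s" "(E, q) \<in> rt (f i)" "D = pre s f i Un E" by auto
 show ?case
 proof (cases "E = {}")
  case False hence "x \<in> inner G (f i)" using sequence i by blast
  thus ?thesis using i by auto
 next
  case True
  hence "q = lend (f i)" using i rt_empty gpath_SeqD(3)[OF g] by blast
  moreover have "i - 1 \<in> idx s" using True i sequence.prems(2) pre_first[of i s f] by auto
  ultimately show ?thesis using i sequence.prems by auto
 qed
qed auto

text \<open>With \<open>rt_inner\<close> this translates between inner nodes and points other than
  the two ends; from here on \<open>inner\<close> is handled through points.\<close>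

lemma inner_rt: "gpath G P ==> x \<in> inner G P ==> EX D q. (D, q) \<in> rt P & D ~= {} & at_node G q x"
proof (induction rule: gpath.induct)
 case (sequence \<mu> s f)
 hence g: "gpath G (Seq \<mu> s f)" by (intro gpath.sequence) auto
 from sequence.prems consider (a) i where "i \<in> idx s" "x \<in> inner G (f i)"
  | (b) i where "i - 1 \<in> idx s" "i \<in> idx s" "at_node G (lend (f i)) x" by auto
 thus ?case
 proof cases
  case a
  then obtain D q where "(D, q) \<in> rt (f i)" "D ~= {}" "at_node G q x" using sequence by blast
  thus ?thesis using rt_SeqI[OF a(1)] by blast
 next
  case b
  hence "(pre s f i Un {}, lend (f i)) \<in> rt (Seq \<mu> s f)"
   using rt_lend gpath_SeqD(3)[OF g b(2)] by (intro rt_SeqI) auto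
  thus ?thesis using b pre_nonempty[OF g b(1)] by auto
 qed
qed auto

lemma gpath_prev_below:
 assumes "rigid_below \<rho>" "gpath G P" "prank P <= \<rho>"
 shows "gpath G (prev P)" "inner G (prev P) = inner G P"
 using gpath_prev_rigid assms unfolding rigid_below_def by blast+

lemma unique_below: "rigid_below \<rho> ==> prank p < \<rho> ==> at_node G p x ==> at_node G p y ==> x = y"
 using at_node_unique unfolding rigid_below_def by blast

lemma pt_prev':
 assumes "gpath G (prev P)" "D \<in> pt P" shows "pbranches P - D \<in> pt (prev P)"
 using pt_prev[OF assms(1), of D] assms(2) by simp

lemma left_tip:
 assumes "gpath G (prev P)" "D \<in> pt P" "D ~= {}" "D \<subseteq> pbranches P"
 shows "EX p. (pbranches P - D, p) \<in> rt (prev P)"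
proof -
 have "pbranches P - D ~= pbranches P" using assms by auto
 thus ?thesis using pt_rt[OF pt_prev'[OF assms(1,2)]] by simp
qed

lemma tracing_junction:
 assumes "gpath G (Seq \<mu> s f)" "i - 1 \<in> idx s" "i \<in> idx s"
 shows "EX x. at_node G (rend (f (i - 1))) x & at_node G (lend (f i)) x"
 using gpath_SeqD(6)[OF assms(1)] assms(2,3) unfolding tracing_def by (metis diff_add_cancel)

lemma post_pre_compl:
 assumes "gpath G (Seq \<mu> s f)" "i - 1 \<in> idx s"
 shows "post s f (i - 1) = pbranches (Seq \<mu> s f) - pre s f i"
 using pre_decomp[OF assms(2), of \<mu> f] pre_Suc[OF assms(2), of f] post_disjoint[OF assms]
  pre_post_disjoint[OF assms(1), of "i - 1"] by auto

lemma compl_inside: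
 assumes "gpath G (Seq \<mu> s f)" "i \<in> idx s" "E \<subseteq> pbranches (f i)"
 shows "pbranches (Seq \<mu> s f) - (pre s f i Un E) = post s f i Un (pbranches (f i) - E)"
 using pre_decomp[OF assms(2), of \<mu> f] pre_disjoint[OF assms(1,2)] post_disjoint[OF assms(1,2)]
  pre_post_disjoint[OF assms(1), of i] assms(3) by blast

text \<open>At a junction of the path itself \<open>tracing\<close> gives a common node of the two
  tips, which have rank below \<open>\<rho>\<close> and so determine their node; at a point inside a
  constituent the claim is inherited.\<close>

lemma left_right_node:
 assumes rb: "rigid_below \<rho>"
 shows "gpath G P ==> prank P <= \<rho> ==> (D, q) \<in> rt P ==> (pbranches P - D, p) \<in> rt (prev P) ==> D ~= {} ==>
  at_node G p x ==> at_node G q x"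
proof (induction arbitrary: D rule: gpath.induct)
 case (branch b s) thus ?case by auto
next
 case (sequence \<mu> s f)
 hence g: "gpath G (Seq \<mu> s f)" by (intro gpath.sequence) auto
 have gp: "gpath G (prev (Seq \<mu> s f))" using gpath_prev_below[OF rb g] sequence.prems by simp
 have lt: "prank (f i) < \<mu>" "prank (f i) <= \<rho>" "prank (f i) < \<rho>" "gpath G (f i)" if "i \<in> idx s" for i
  using gpath_SeqD(3,4)[OF g that] sequence.prems(1) by auto
 have gpi: "gpath G (prev (f i))" if "i \<in> idx s" for i using gpath_prev_below[OF rb] lt that by blast
 from sequence.prems(2)[unfolded rt_Seq_iff] obtain i E where
  i: "i \<in> idx s" "(E, q) \<in> rt (f i)" "D = pre s f i Un E" using sequence.prems(4) by auto
 have Es: "E \<subset> pbranches (f i)" using rt_psubset[OF lt(4)[OF i(1)] i(2)] .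
 show ?case
 proof (cases "E = {}")
  case False
  have "E \<in> pt (f i)" using i rt_pt by blast
  then obtain p' where p': "(pbranches (f i) - E, p') \<in> rt (prev (f i))"
   using left_tip[OF gpi[OF i(1)]] False Es by blast
  hence "(post s f i Un (pbranches (f i) - E), p') \<in> rt (prev (Seq \<mu> s f))"
   unfolding rt_prev_iff using i by blast
  hence "p' = p" using rt_unique[OF gp] sequence.prems(3) compl_inside[OF g i(1)] Es i(3) by fastforce
  thus ?thesis using sequence i p' False lt by blast
 next
  case True
  hence q: "q = lend (f i)" using i rt_empty lt by blast
  have i1: "i - 1 \<in> idx s" using True i sequence.prems(4) pre_first[of i s f] by auto
  have "(post s f (i - 1) Un {}, lend (prev (f (i - 1)))) \<in> rt (prev (Seq \<mu> s f))"
   unfolding rt_prev_iff using i1 rt_lend[OF gpi[OF i1]] by blast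
  hence p: "p = lend (prev (f (i-1)))"
   using rt_unique[OF gp] sequence.prems(3) post_pre_compl[OF g i1] True i(3) by fastforce
  obtain y where y: "at_node G (rend (f (i - 1))) y" "at_node G (lend (f i)) y"
   using tracing_junction[OF g i1 i(1)] by auto
  have "gpath G (trev (rend (f (i - 1))))" using gpath_ends[OF gpi[OF i1]] by (simp add: lend_prev)
  hence "at_node G p y" using at_node_trev[OF y(1)] p by (simp add: lend_prev)
  moreover have "prank p < \<rho>" using p lend_prank[OF gpi[OF i1]] lt(3)[OF i1] by simp
  ultimately have "x = y" using unique_below[OF rb] sequence.prems(5) by blast
  thus ?thesis using y q by simp
 qed
qed

text \<open>The three separation clauses of \<open>tracing\<close> serve the three cases: two
  junctions, a junction and a point inside a constituent, and points inside different
  constituents.\<close>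

lemma inner_points_distinct:
 assumes rb: "rigid_below \<rho>" and "gpath G P" "prank P <= \<rho>" "(D, q) \<in> rt P" "(D', q') \<in> rt P" "D ~= {}" "D' ~= {}"
  "at_node G q x" "at_node G q' x"
 shows "D = D'"
 using assms(2-)
proof (induction arbitrary: D D' rule: gpath.induct)
 case (branch b s) thus ?case by auto
next
 case (sequence \<mu> s f)
 hence g: "gpath G (Seq \<mu> s f)" by (intro gpath.sequence) auto
 obtain y where y: "\<forall>i\<in>idx s. at_node G (lend (f i)) (y i) & at_node G (rend (f i)) (y (i + 1))"
   "inj_on y (idx s Un (%i. i + 1) ` idx s)"
   "\<forall>i\<in>idx s Un (%i. i + 1) ` idx s. \<forall>j\<in>idx s. y i ~: inner G (f j)"
   "\<forall>i\<in>idx s. \<forall>j\<in>idx s. i ~= j --> inner G (f i) Int inner G (f j) = {}"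
  using sequence by (auto simp: tracing_def)
 have lt: "prank (f i) < \<mu>" "prank (f i) <= \<rho>" "prank (f i) < \<rho>" "gpath G (f i)" if "i \<in> idx s" for i
  using gpath_SeqD(3,4)[OF g that] sequence.prems(1) by auto
 have *: "EX i E. i \<in> idx s & (E, q) \<in> rt (f i) & D = pre s f i Un E &
   (E ~= {} & x \<in> inner G (f i) \<or> E = {} & x = y i)"
  if D: "(D, q) \<in> rt (Seq \<mu> s f)" "D ~= {}" "at_node G q x" for D q
 proof -
  from D[unfolded rt_Seq_iff] obtain i E where
   i: "i \<in> idx s" "(E, q) \<in> rt (f i)" "D = pre s f i Un E" by auto
  have "x \<in> inner G (f i)" if "E ~= {}" using rt_inner lt(4)[OF i(1)] i(2) that D(3) by blast
  moreover have "x = y i" if "E = {}"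
  proof -
   have q: "q = lend (f i)" using i rt_empty lt that by blast
   hence "prank q < \<rho>" using lend_prank[OF lt(4)[OF i(1)]] lt(3)[OF i(1)] by simp
   thus ?thesis using unique_below[OF rb] y(1) q i D(3) by blast
  qed
  ultimately show ?thesis using i by blast
 qed
 obtain i E where i: "i \<in> idx s" "(E, q) \<in> rt (f i)" "D = pre s f i Un E"
   "E ~= {} & x \<in> inner G (f i) \<or> E = {} & x = y i" using * sequence.prems by blast
 obtain j E' where j: "j \<in> idx s" "(E', q') \<in> rt (f j)" "D' = pre s f j Un E'"
   "E' ~= {} & x \<in> inner G (f j) \<or> E' = {} & x = y j" using * sequence.prems by blast
 show ?case
 proof (cases "E = {}")
  case True
  hence "E' = {}" using i j y(3) by blast
  hence "i = j" using True i j y(2) unfolding inj_on_def by blast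
  thus ?thesis using i j True \<open>E' = {}\<close> by simp
 next
  case False
  hence ne: "E' ~= {}" using i j y(3) by blast
  hence "i = j" using False i j y(4) by blast
  thus ?thesis using sequence i j False ne lt by blast
 qed
qed

text \<open>A left end tip of smaller rank than the path means that there is a first constituent, so
  that \<open>x\<close> is the first term of the injective node sequence. For an open end the node
  may well occur again inside.\<close>

lemma first_not_inner:
 assumes rb: "rigid_below \<rho>" and g: "gpath G (Seq \<mu> s f)" and "\<mu> <= \<rho>" "prank (lend (Seq \<mu> s f)) < \<mu>"
  "at_node G (lend (Seq \<mu> s f)) x"
 shows "x ~: inner G (Seq \<mu> s f)"
  "at_node G (rend (Seq \<mu> s f)) x ==> prank (rend (Seq \<mu> s f)) < \<mu> ==> False"
proof -
 obtain y where y: "\<forall>i\<in>idx s. at_node G (lend (f i)) (y i) & at_node G (rend (f i)) (y (i + 1))"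
   "inj_on y (idx s Un (%i. i + 1) ` idx s)"
   "\<forall>i\<in>idx s Un (%i. i + 1) ` idx s. \<forall>j\<in>idx s. y i ~: inner G (f j)"
  using gpath_SeqD(6)[OF g] by (auto simp: tracing_def)
 have u: "at_node G p u ==> at_node G p v ==> prank p < \<mu> ==> u = v" for p u v
  using unique_below[OF rb, of p u v] assms(3) by simp
 have lp: "prank (lend (f i)) < \<mu>" "prank (rend (f i)) < \<mu>" if "i \<in> idx s" for i
  using lend_rend_prank[of G "f i"] gpath_SeqD(3,4)[OF g that] by auto
 obtain i where i: "i \<in> idx s" "i - 1 ~: idx s" "lend (Seq \<mu> s f) = lend (f i)"
  using lend_cases[OF gpath_SeqD(2)[OF g], of \<mu> f] assms(4) by (metis less_irrefl prank.simps(2))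
 have x: "x = y i" using u assms(4,5) i y(1) by metis
 show "x ~: inner G (Seq \<mu> s f)"
 proof
  assume "x \<in> inner G (Seq \<mu> s f)"
  then consider (a) j where "j \<in> idx s" "x \<in> inner G (f j)"
   | (b) j where "j - 1 \<in> idx s" "j \<in> idx s" "at_node G (lend (f j)) x" by auto
  thus False
  proof cases
   case a thus ?thesis using x y(3) i by blast
  next
   case b
   hence "x = y j" using u lp y(1) by blast
   hence "i = j" using x y(2) i b unfolding inj_on_def by blast
   thus ?thesis using i b by simp
  qed
 qed
 assume r: "at_node G (rend (Seq \<mu> s f)) x" "prank (rend (Seq \<mu> s f)) < \<mu>"
 obtain j where j: "j \<in> idx s" "j + 1 ~: idx s" "rend (Seq \<mu> s f) = rend (f j)"
  using rend_cases[OF gpath_SeqD(2)[OF g], of \<mu> f] r(2) by (metis less_irrefl prank.simps(2))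
 hence "x = y (j + 1)" using u r y(1) by metis
 hence "i = j + 1" using x y(2) i j unfolding inj_on_def by blast
 thus False using i j by simp
qed

lemma points_distinct:
 assumes rb: "rigid_below \<rho>" and g: "gpath G (Seq \<rho> s f)"
  and "(D, q) \<in> rt (Seq \<rho> s f)" "(D', q') \<in> rt (Seq \<rho> s f)" "prank q < \<rho>" "prank q' < \<rho>"
  "at_node G q x" "at_node G q' x"
 shows "D = D'"
proof -
 let ?P = "Seq \<rho> s f"
 have *: "False" if "({}, q) \<in> rt ?P" "(D', q') \<in> rt ?P" "prank q < \<rho>"
  "at_node G q x" "at_node G q' x" "D' ~= {}" for q D' q'
 proof -
  have q: "q = lend ?P" using that rt_empty[OF g] by simp
  have "x ~: inner G ?P" by (rule first_not_inner(1)[OF rb g]) (use q that in auto)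
  thus False using rt_inner[OF g that(2,6,5)] by blast
 qed
 show ?thesis
  using inner_points_distinct[OF rb g _ assms(3,4) _ _ assms(7,8)]
   *[OF _ assms(4,5,7,8)] *[OF _ assms(3,6,8,7)] assms(3,4) by auto
qed

text \<open>Unless \<open>E\<close> is empty, the point of \<open>E\<close> also has a tip to its
  right, at the same node, and \<open>points_distinct\<close> applies. If \<open>E\<close> is empty,
  \<open>x\<close> would be the right terminal node and also the left terminal or an inner
  node.\<close>

lemma left_right_points_distinct:
 assumes rb: "rigid_below \<rho>" and g: "gpath G (Seq \<rho> s f)"
  and D: "(D, q) \<in> rt (Seq \<rho> s f)" and E: "(E, p) \<in> rt (prev (Seq \<rho> s f))" and "prank q < \<rho>" "prank p < \<rho>"
  and x: "at_node G q x" "at_node G p x"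
 shows "E = pbranches (Seq \<rho> s f) - D"
proof -
 let ?P = "Seq \<rho> s f"
 have gp: "gpath G (prev ?P)" "inner G (prev ?P) = inner G ?P" using gpath_prev_below[OF rb g] by auto
 have Es: "E \<subset> pbranches ?P" using rt_psubset[OF gp(1) E] by simp
 consider (a) "E = {}" "D = {}" | (b) "E = {}" "D ~= {}" | (c) "E ~= {}" by auto
 thus ?thesis
 proof cases
  case a
  hence p: "p = lend (prev ?P)" and q: "q = lend ?P" using rt_empty[OF gp(1)] rt_empty[OF g] D E by auto
  have tp: "trev p = rend ?P" by (simp only: p lend_prev trev_trev)
  have "at_node G (rend ?P) x" using at_node_trev[OF x(2)] gpath_ends[OF g] unfolding tp by blast
  moreover have "prank (rend ?P) < \<rho>" using assms(6) tp prank_trev by metis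
  ultimately show ?thesis using first_not_inner(2)[OF rb g _ _ x(1)[unfolded q]] q assms(5) by blast
 next
  case b
  hence p: "p = lend (prev ?P)" using rt_empty[OF gp(1)] E by auto
  have "x ~: inner G (prev ?P)"
   using first_not_inner(1)[OF rb gp(1)[unfolded prev.simps], of x] p x(2) assms(6) by (simp add: prev.simps)
  thus ?thesis using rt_inner[OF g D b(2) x(1)] gp(2) by blast
 next
  case c
  have "pbranches ?P - E \<in> pt ?P" using pt_prev[OF g] E rt_pt by blast
  moreover have "pbranches ?P - E ~= pbranches ?P" using c Es by blast
  ultimately obtain r where r: "(pbranches ?P - E, r) \<in> rt ?P" using pt_rt by blast
  have "pbranches ?P - (pbranches ?P - E) = E" using Es by blast
  moreover have "pbranches ?P - E ~= {}" using Es by blast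
  ultimately have rx: "at_node G r x" using left_right_node[OF rb g _ r _ _ x(2)] E by simp
  have "prank r < \<rho>" using rt_tip_rank_Seq[OF g r] Es by auto
  hence "D = pbranches ?P - E" using points_distinct[OF rb g D r] assms(5) x(1) rx by blast
  thus ?thesis using Es by blast
 qed
qed

end

section \<open>Paths inside paths\<close>

text \<open>The one-sided relation: it compares only the tips to the right of points. The tips to
  the left come from the reversed paths.\<close>

definition semb :: "'b tgraph => 'b tpath => 'b tpath => 'b set => bool" where
 "semb G A Q D \<longleftrightarrow> D Int pbranches A = {} & D Un pbranches A \<subseteq> pbranches Q &
   (\<forall>(E, e)\<in>rt A. EX e'. (D Un E, e') \<in> rt Q & same_tip G e e')"

text \<open>The path \<open>A\<close> occurs, in the same direction, as the section of \<open>Q\<close> from the point \<open>D\<close>.\<close>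

definition emb :: "'b tgraph => 'b tpath => 'b tpath => 'b set => bool" where
 "emb G A Q D \<longleftrightarrow> semb G A Q D & semb G (prev A) (prev Q) (pbranches Q - (D Un pbranches A))"

text \<open>A weaker relation, which ignores the identity of tips and the two ends of \<open>A\<close>.\<close>

definition iemb :: "'b tpath => 'b tpath => 'b set => bool" where
 "iemb A Q D \<longleftrightarrow> D Int pbranches A = {} & D Un pbranches A \<subseteq> pbranches Q & D \<in> pt Q & D Un pbranches A \<in> pt Q &
   (\<forall>(E, e)\<in>rt A. E ~= {} --> (EX e'. (D Un E, e') \<in> rt Q & prank e' = prank e)) &
   (\<forall>(E, e)\<in>rt (prev A). E ~= {} -->
    (EX e'. (pbranches Q - (D Un pbranches A) Un E, e') \<in> rt (prev Q) & prank e' = prank e))"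

lemma emb_prev:
 assumes "emb G A Q D" shows "emb G (prev A) (prev Q) (pbranches Q - (D Un pbranches A))"
proof -
 have "pbranches Q - (pbranches Q - (D Un pbranches A) Un pbranches A) = D"
  using assms unfolding emb_def semb_def by blast
 thus ?thesis using assms unfolding emb_def by simp
qed

lemma tail_branches_pre: "tail_branches (Seq \<mu> In f) m = pre In f (- int m)"
 unfolding tail_branches_In pre_def by (rule arg_cong[where f = "%A. \<Union> (_ ` A)"]) auto

context tfg
begin

text \<open>For the arrow rank the junction ranks grow towards the open end; for all others they are
  constantly \<open>rpred \<mu>\<close>. In both cases the open end can be reached past junctions of
  any rank that \<open>tip_ranks \<mu>\<close> allows.\<close>

lemma In_cofinal_ranks:
 assumes g: "gpath G (Seq \<mu> In f)" and r: "r \<in> tip_ranks \<mu>" and k: "k < 0"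
 shows "\<exists>j\<le>k. r <= jrank f j"
proof (cases "\<mu> = Arr")
 case False
 hence "jrank f k = rpred \<mu>" using gpath_SeqD(7)[OF g] k by (auto simp: junction_ranks_def junctions_def)
 thus ?thesis using r False by (auto simp: tip_ranks_def)
next
 case True
 define a where "a n = jrank f (k - int n)" for n :: nat
 have "a n < a (Suc n)" for n
  using gpath_SeqD(7)[OF g] k True by (auto simp: junction_ranks_def junctions_def a_def)
 from strict_inc_rank[of a, OF this] have *: "Rk n <= a (Suc n)" for n .
 have "r < Arr" using r True by (simp add: tip_ranks_def)
 hence "EX n. r <= a n"
 proof (cases r)
  case (Rk n) thus ?thesis using *[of n] by blast
 qed auto
 thus ?thesis unfolding a_def by (metis diff_le_self of_nat_0_le_iff diff_left_mono diff_zero)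
qed

lemma In_junction:
 assumes g: "gpath G (Seq \<mu> In f)" and gp: "gpath G (prev (Seq \<mu> In f))" and j: "j < 0"
 shows "(pre In f j, lend (f j)) \<in> rt (Seq \<mu> In f)"
  "(pbranches (Seq \<mu> In f) - pre In f j, trev (rend (f (j - 1)))) \<in> rt (prev (Seq \<mu> In f))"
  "pre In f j ~= {}" "pbranches (Seq \<mu> In f) - pre In f j ~= {}" "pre In f j \<subseteq> pbranches (Seq \<mu> In f)"
proof -
 have gi: "gpath G (f i)" if "i < 0" for i using gpath_SeqD(3)[OF g] that by simp
 show "(pre In f j, lend (f j)) \<in> rt (Seq \<mu> In f)"
  using rt_SeqI[of j In "{}" "lend (f j)" f \<mu>] rt_lend[OF gi[OF j]] j by simp
 have "({}, lend (prev (f (j - 1)))) \<in> rt (prev (f (j - 1)))"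
 proof -
  have "({}, lend (prev (Seq \<mu> In f))) \<in> rt (prev (Seq \<mu> In f))" using rt_lend[OF gp] .
  have "gpath G (prev (f (j - 1)))"
   using gpath_SeqD(3)[OF gp[unfolded prev.simps], of "ridx In (j - 1)"] j by (simp add: idx_rshape)
  thus ?thesis by (rule rt_lend)
 qed
 hence "(post In f (j - 1) Un {}, lend (prev (f (j - 1)))) \<in> rt (prev (Seq \<mu> In f))"
  unfolding rt_prev_iff using j by (intro disjI1 bexI[of _ "j - 1"]) auto
 moreover have "post In f (j - 1) = pbranches (Seq \<mu> In f) - pre In f j"
  by (rule post_pre_compl[OF g]) (use j in simp)
 ultimately show "(pbranches (Seq \<mu> In f) - pre In f j, trev (rend (f (j - 1)))) \<in> rt (prev (Seq \<mu> In f))"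
  by (simp add: lend_prev)
 show "pre In f j ~= {}" using pre_nonempty[OF g] j by simp
 show "pre In f j \<subseteq> pbranches (Seq \<mu> In f)" by (rule pre_sub)
 have "pbranches (f j) Int pre In f j = {}" using pre_disjoint[OF g] j by auto
 thus "pbranches (Seq \<mu> In f) - pre In f j ~= {}"
  using pbranches_nonempty[OF gi[OF j]] j by auto
qed

lemma iemb_sets: "iemb A Q D ==> D Int pbranches A = {}" "iemb A Q D ==> D Un pbranches A \<subseteq> pbranches Q"
 by (simp_all add: iemb_def)

lemma iemb_pt:
 assumes "iemb A Q D" "F \<in> pt A" shows "D Un F \<in> pt Q"
proof (cases "F = {} \<or> F = pbranches A")
 case True thus ?thesis using assms unfolding iemb_def by auto
next
 case False
 then obtain e where "(F, e) \<in> rt A" using pt_rt assms(2) by blast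
 thus ?thesis using assms(1) False unfolding iemb_def by (fast dest: rt_pt)
qed

text \<open>Both paths shrink to the same point \<open>D\<close> of \<open>Q\<close>. Were no tail
  of the first inside the given tail of the second, comparability of points would put a fixed branch
  into all tails of the first, whose intersection is empty.\<close>

lemma iemb_cofinal:
 assumes g: "gpath G (Seq \<mu> In f)" "gpath G (prev (Seq \<mu> In f))" and h: "gpath G (Seq \<beta> In h)" "gpath G (prev (Seq \<beta> In h))"
  and Q: "gpath G Q" and i: "iemb (Seq \<mu> In f) Q D" "iemb (Seq \<beta> In h) Q D" and k: "k < 0"
 shows "\<exists>j<0. pre In f j \<subseteq> pre In h k"
proof (rule ccontr)
 assume n: "\<not> ?thesis"
 have "pre In h k \<subseteq> pre In f j" if j: "j < 0" for j
 proof -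
  have "pre In f j \<in> pt (Seq \<mu> In f)" "pre In h k \<in> pt (Seq \<beta> In h)"
   using In_junction(1)[OF g j] In_junction(1)[OF h k] rt_pt by blast+
  hence "D Un pre In f j \<subseteq> D Un pre In h k \<or> D Un pre In h k \<subseteq> D Un pre In f j"
   using iemb_pt[OF i(1)] iemb_pt[OF i(2)] pt_chain[OF Q] by blast
  moreover have "D Int pbranches (Seq \<mu> In f) = {}" "D Int pbranches (Seq \<beta> In h) = {}"
   using iemb_sets i by blast+
  hence "D Int pre In f j = {}" "D Int pre In h k = {}"
   using In_junction(5)[OF g j] In_junction(5)[OF h k] by blast+
  ultimately show ?thesis using n j by blast
 qed
 moreover obtain b where b: "b \<in> pre In h k" using In_junction(3)[OF h k] by auto
 ultimately have *: "b \<in> pre In f j" if "j < 0" for j using that by auto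
 hence "b \<in> pre In f (-1)" by simp
 then obtain j where "j < 0" "b \<in> pbranches (f j)" unfolding pre_def by auto
 thus False using *[of j] pre_disjoint[OF g(1), of j] by auto
qed

text \<open>A junction of the first path of rank at least \<open>r\<close>, taken deep enough, is an
  inner point of the second path. The ranks of both its tips can be read off \<open>Q\<close>, so
  they are possible in the second path too.\<close>

lemma iemb_tip_ranks:
 assumes g: "gpath G (Seq \<mu> In f)" "gpath G (prev (Seq \<mu> In f))" and h: "gpath G (Seq \<beta> In h)" "gpath G (prev (Seq \<beta> In h))"
  and Q: "gpath G Q" "gpath G (prev Q)" and i: "iemb (Seq \<mu> In f) Q D" "iemb (Seq \<beta> In h) Q D"
 shows "tip_ranks \<mu> \<subseteq> tip_ranks \<beta>"
proof
 let ?A = "Seq \<mu> In f" and ?B = "Seq \<beta> In h"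
 fix r assume r: "r \<in> tip_ranks \<mu>"
 obtain j0 where j0: "j0 < 0" "pre In f j0 \<subseteq> pre In h (-1)" using iemb_cofinal[OF g h Q(1) i, of "-1"] by auto
 obtain j where j: "j <= j0" "r <= jrank f j" using In_cofinal_ranks[OF g(1) r j0(1)] by auto
 hence jn: "j < 0" using j0 by auto
 let ?F = "pre In f j"
 note J = In_junction[OF g jn]
 have FB: "?F \<subseteq> pre In h (-1)" using pre_mono[OF j(1), of In f] j0 by blast
 hence Fs: "?F \<subset> pbranches ?B" using In_junction(4,5)[OF h, of "-1"] by auto
 have dA: "D Int pbranches ?A = {}" "D Un pbranches ?A \<subseteq> pbranches Q"
  and dB: "D Int pbranches ?B = {}" "D Un pbranches ?B \<subseteq> pbranches Q" using i unfolding iemb_def by auto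
 have Fp: "?F \<in> pt ?B"
 proof (rule pt_maximal[OF h(1)])
  fix E assume E: "E \<in> pt ?B"
  have "D Un ?F \<subseteq> D Un E \<or> D Un E \<subseteq> D Un ?F"
   using iemb_pt[OF i(1) rt_pt[OF J(1)]] iemb_pt[OF i(2) E] pt_chain[OF Q(1)] by blast
  thus "?F \<subseteq> E \<or> E \<subseteq> ?F" using dA dB J(5) pt_subset[OF h(1) E] by blast
 qed (use Fs in blast)
 obtain e where e: "(?F, e) \<in> rt ?B" using pt_rt[OF Fp] Fs by blast
 obtain e1 where e1: "(D Un ?F, e1) \<in> rt Q" "prank e1 = prank e" using i(2) e J(3) unfolding iemb_def by fast
 obtain e2 where e2: "(D Un ?F, e2) \<in> rt Q" "prank e2 = prank (lend (f j))" using i(1) J(1,3) unfolding iemb_def by fast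
 have 1: "prank (lend (f j)) \<in> tip_ranks \<beta>"
  using rt_unique[OF Q(1) e1(1) e2(1)] e1(2) e2(2) rt_tip_rank[OF h(1) e J(3)] by simp
 obtain p where p: "(pbranches ?B - ?F, p) \<in> rt (prev ?B)" using left_tip[OF h(2) Fp J(3)] Fs by blast
 have ne: "pbranches ?B - ?F ~= {}" using Fs by blast
 obtain p1 where p1: "(pbranches Q - (D Un pbranches ?B) Un (pbranches ?B - ?F), p1) \<in> rt (prev Q)" "prank p1 = prank p"
  using i(2) p ne unfolding iemb_def by fast
 obtain p2 where p2: "(pbranches Q - (D Un pbranches ?A) Un (pbranches ?A - ?F), p2) \<in> rt (prev Q)"
   "prank p2 = prank (trev (rend (f (j - 1))))"
  using i(1) J(2,4) unfolding iemb_def by fast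
 have "pbranches Q - (D Un pbranches ?B) Un (pbranches ?B - ?F) = pbranches Q - (D Un ?F)" using dB Fs by blast
 moreover have "pbranches Q - (D Un pbranches ?A) Un (pbranches ?A - ?F) = pbranches Q - (D Un ?F)" using dA J(5) by blast
 ultimately have "prank (rend (f (j - 1))) = prank p"
  using rt_unique[OF Q(2)] p1 p2 by (metis prank_trev)
 hence 2: "prank (rend (f (j - 1))) \<in> tip_ranks \<beta>"
  using rt_tip_rank[OF h(2) p ne] by simp
 have "jrank f j \<in> tip_ranks \<beta>" using 1 2 unfolding jrank_def by (auto simp: max_def)
 thus "r \<in> tip_ranks \<beta>" using tip_ranks_down j(2) by blast
qed

text \<open>Open ends that reach the same point of \<open>Q\<close> from the right represent the
  same tip: equality of \<open>tip_ranks\<close> gives equal ranks, and \<open>iemb_cofinal\<close>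
  in both directions gives \<open>scoin\<close>.\<close>

lemma iemb_same_limit:
 assumes g: "gpath G (Seq \<mu> In f)" "gpath G (prev (Seq \<mu> In f))" and h: "gpath G (Seq \<beta> In h)" "gpath G (prev (Seq \<beta> In h))"
  and Q: "gpath G Q" "gpath G (prev Q)" and i: "iemb (Seq \<mu> In f) Q D" "iemb (Seq \<beta> In h) Q D"
 shows "same_tip G (Seq \<mu> In f) (Seq \<beta> In h)"
proof -
 have "tip_ranks \<mu> = tip_ranks \<beta>"
  using iemb_tip_ranks[OF g h Q i] iemb_tip_ranks[OF h g Q i(2,1)] by auto
 hence "\<mu> = \<beta>" using tip_ranks_inject gpath_SeqD(1)[OF g(1)] gpath_SeqD(1)[OF h(1)] by blast
 moreover have "EX m. tail_branches A m \<subseteq> tail_branches B k"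
  if AB: "A = Seq \<mu>' In f'" "B = Seq \<beta>' In h'" "gpath G A" "gpath G (prev A)" "gpath G B" "gpath G (prev B)" "iemb A Q D" "iemb B Q D"
  for A B k \<mu>' \<beta>' f' h'
 proof -
  obtain j where j: "j < 0" "pre In f' j \<subseteq> pre In h' (- int k - 1)"
   using iemb_cofinal[OF AB(3,4,5,6)[unfolded AB(1,2)] Q(1) AB(7,8)[unfolded AB(1,2)], of "- int k - 1"] by auto
  have "pre In h' (- int k - 1) \<subseteq> pre In h' (- int k)" by (rule pre_mono) simp
  hence "tail_branches A (nat (- j)) \<subseteq> tail_branches B k"
   using AB(1,2) j by (simp add: tail_branches_pre del: tail_branches.simps)
  thus ?thesis by blast
 qed
 hence "scoin (Seq \<mu> In f) (Seq \<beta> In h)" unfolding scoin_def using g h i by blast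
 ultimately show ?thesis using g h unfolding same_tip_def one_ended_def by auto
qed

lemma emb_points:
 assumes "emb G A Q D" "gpath G A" "gpath G (prev A)" "gpath G Q"
 shows "D \<in> pt Q" "D Un pbranches A \<in> pt Q" "D Int pbranches A = {}" "D Un pbranches A \<subseteq> pbranches Q"
  "(E, e) \<in> rt A ==> EX e'. (D Un E, e') \<in> rt Q & same_tip G e e'"
  "(E, e) \<in> rt (prev A) ==> EX e'. (pbranches Q - (D Un pbranches A) Un E, e') \<in> rt (prev Q) & same_tip G e e'"
proof -
 show s: "D Int pbranches A = {}" "D Un pbranches A \<subseteq> pbranches Q"
   and r: "(E, e) \<in> rt A ==> EX e'. (D Un E, e') \<in> rt Q & same_tip G e e'" for E e
  using assms(1) unfolding emb_def semb_def by auto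
 show l: "(E, e) \<in> rt (prev A) ==> EX e'. (pbranches Q - (D Un pbranches A) Un E, e') \<in> rt (prev Q) & same_tip G e e'" for E e
  using assms(1) unfolding emb_def semb_def by fast
 show "D \<in> pt Q" using r[OF rt_lend[OF assms(2)]] rt_pt by auto
 have "pbranches Q - (D Un pbranches A) \<in> pt (prev Q)" using l[OF rt_lend[OF assms(3)]] rt_pt by auto
 hence "pbranches Q - (pbranches Q - (D Un pbranches A)) \<in> pt Q" using pt_prev assms(4) by blast
 moreover have "pbranches Q - (pbranches Q - (D Un pbranches A)) = D Un pbranches A" using s by blast
 ultimately show "D Un pbranches A \<in> pt Q" by simp
qed

section \<open>Embedding a sequence whose constituents are embedded consecutively\<close>

context
 fixes Q :: "'b tpath" and \<mu> :: rank and s :: shape and f :: "int => 'b tpath" and E :: "int => 'b set"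
 assumes Q: "gpath G Q" "gpath G (prev Q)" and R: "gpath G (Seq \<mu> s f)"
  and f: "!!i. i \<in> idx s ==> gpath G (prev (f i))"
  and E: "!!i. i \<in> idx s ==> emb G (f i) Q (E i)"
  and Estep: "!!i. i \<in> idx s ==> i + 1 \<in> idx s ==> E (i + 1) = E i Un pbranches (f i)"
begin

lemma emb_seq_mono: "i <= j ==> i \<in> idx s ==> j \<in> idx s ==> E j = E i Un (\<Union>k\<in>{i..<j}. pbranches (f k))"
proof (induction j rule: int_ge_induct)
 case (step j)
 hence j: "j \<in> idx s" using idx_convex[of i s "j+1" j] by auto
 have "{i..<j + 1} = insert j {i..<j}" using step by auto
 thus ?case using step j Estep[OF j] by auto
qed simp

text \<open>The point of \<open>Q\<close> at which the sequence starts: the smallest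
  \<open>E i\<close> if there is a first constituent, their limit otherwise.\<close>

abbreviation (input) "D1 \<equiv> \<Inter>i\<in>idx s. E i"

lemma emb_seq_pre: "i \<in> idx s ==> E i = D1 Un pre s f i"
proof (intro equalityI subsetI)
 fix b assume i: "i \<in> idx s" and b: "b \<in> E i"
 have "b \<in> E k" if "b ~: pre s f i" "k \<in> idx s" for k
 proof (cases "i <= k")
  case True thus ?thesis using emb_seq_mono[OF True i that(2)] b by auto
 next
  case False
  hence "k <= i" by simp
  moreover have "(\<Union>j\<in>{k..<i}. pbranches (f j)) \<subseteq> pre s f i"
   using idx_convex[OF that(2) i] unfolding pre_def by force
  ultimately show ?thesis using emb_seq_mono[OF _ that(2) i] b that(1) by blast
 qed
 thus "b \<in> D1 Un pre s f i" by blast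
next
 fix b assume i: "i \<in> idx s" and b: "b \<in> D1 Un pre s f i"
 then consider "b \<in> E i" | j where "j \<in> idx s" "j < i" "b \<in> pbranches (f j)" by (auto simp: pre_def)
 thus "b \<in> E i"
 proof cases
  case 2
  hence "E i = E j Un (\<Union>k\<in>{j..<i}. pbranches (f k))" using emb_seq_mono i by simp
  thus ?thesis using 2 by auto
 qed
qed

lemma emb_seq_facts:
 "i \<in> idx s ==> gpath G (f i)" "i \<in> idx s ==> E i \<in> pt Q" "i \<in> idx s ==> E i Un pbranches (f i) \<in> pt Q"
 "i \<in> idx s ==> E i Int pbranches (f i) = {}"
 "i \<in> idx s ==> E i Un pbranches (f i) \<subseteq> pbranches Q" "D1 Int pbranches (Seq \<mu> s f) = {}"
 "D1 Un pbranches (Seq \<mu> s f) \<subseteq> pbranches Q"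
proof -
 show *: "gpath G (f i)" "E i \<in> pt Q" "E i Un pbranches (f i) \<in> pt Q" "E i Int pbranches (f i) = {}"
  "E i Un pbranches (f i) \<subseteq> pbranches Q" if i: "i \<in> idx s" for i
  using emb_points[OF E[OF i] gpath_SeqD(3)[OF R i] f[OF i] Q(1)] gpath_SeqD(3)[OF R i] by auto
 show "D1 Int pbranches (Seq \<mu> s f) = {}" using *(4) by fastforce
 obtain i where "i \<in> idx s" using idx_nonempty gpath_SeqD(2)[OF R] by blast
 thus "D1 Un pbranches (Seq \<mu> s f) \<subseteq> pbranches Q" using *(5) by fastforce
qed

text \<open>Intersections and unions of points are comparable with all points, so the limits exist
  by \<open>pt_maximal\<close>.\<close>

lemma emb_seq_points: "D1 \<in> pt Q" "D1 Un pbranches (Seq \<mu> s f) \<in> pt Q"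
proof -
 show "D1 \<in> pt Q"
 proof (rule pt_maximal[OF Q(1)])
  fix F assume "F \<in> pt Q"
  thus "D1 \<subseteq> F \<or> F \<subseteq> D1" using emb_seq_facts(2) pt_chain[OF Q(1)] by (meson INF_lower2 INF_greatest)
 qed (use emb_seq_facts(7) in blast)
 have u: "D1 Un pbranches (Seq \<mu> s f) = (\<Union>i\<in>idx s. E i Un pbranches (f i))"
 proof (intro equalityI subsetI)
  fix b assume "b \<in> D1 Un pbranches (Seq \<mu> s f)"
  thus "b \<in> (\<Union>i\<in>idx s. E i Un pbranches (f i))" using idx_nonempty[OF gpath_SeqD(2)[OF R]] by auto
 next
  fix b assume "b \<in> (\<Union>i\<in>idx s. E i Un pbranches (f i))"
  then obtain i where i: "i \<in> idx s" "b \<in> E i Un pbranches (f i)" by blast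
  thus "b \<in> D1 Un pbranches (Seq \<mu> s f)" using emb_seq_pre[OF i(1)] pre_sub[of s f i \<mu>] by auto
 qed
 show "D1 Un pbranches (Seq \<mu> s f) \<in> pt Q"
 proof (rule pt_maximal[OF Q(1)])
  fix F assume F: "F \<in> pt Q"
  have "E i Un pbranches (f i) \<subseteq> F \<or> F \<subseteq> E i Un pbranches (f i)" if "i \<in> idx s" for i
   using emb_seq_facts(3)[OF that] pt_chain[OF Q(1)] F by blast
  thus "D1 Un pbranches (Seq \<mu> s f) \<subseteq> F \<or> F \<subseteq> D1 Un pbranches (Seq \<mu> s f)" unfolding u by blast
 qed (use emb_seq_facts(7) in blast)
qed

lemma emb_seq_post:
 assumes "i \<in> idx s" "F \<subseteq> pbranches (f i)"
 shows "pbranches Q - (D1 Un pbranches (Seq \<mu> s f)) Un (post s f i Un F) = pbranches Q - (E i Un pbranches (f i)) Un F"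
proof -
 have "E i Un pbranches (f i) = D1 Un (pre s f i Un pbranches (f i))" using emb_seq_pre[OF assms(1)] by auto
 moreover have "post s f i Int (D1 Un (pre s f i Un pbranches (f i))) = {}"
  using post_disjoint[OF R assms(1)] pre_post_disjoint[OF R, of i] emb_seq_facts(6) post_sub[of s f i \<mu>] by blast
 moreover have "post s f i \<subseteq> pbranches Q" using emb_seq_facts(7) post_sub[of s f i \<mu>] by blast
 ultimately show ?thesis unfolding pre_decomp[OF assms(1), of \<mu> f] by blast
qed

lemma emb_seq_tips:
 assumes i: "i \<in> idx s"
 shows "(F, e) \<in> rt (f i) ==> EX e'. (D1 Un (pre s f i Un F), e') \<in> rt Q & same_tip G e e'"
  "(F, e) \<in> rt (prev (f i)) ==> EX e'. (pbranches Q - (D1 Un pbranches (Seq \<mu> s f)) Un (post s f i Un F), e') \<in> rt (prev Q) & same_tip G e e'"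
proof -
 note P = emb_points[OF E[OF i] emb_seq_facts(1)[OF i] f[OF i] Q(1)]
 show "EX e'. (D1 Un (pre s f i Un F), e') \<in> rt Q & same_tip G e e'" if "(F, e) \<in> rt (f i)"
  using P(5)[OF that] emb_seq_pre[OF i] by (simp add: Un_assoc)
 assume F: "(F, e) \<in> rt (prev (f i))"
 hence "F \<subseteq> pbranches (f i)" using rt_subset by fastforce
 thus "EX e'. (pbranches Q - (D1 Un pbranches (Seq \<mu> s f)) Un (post s f i Un F), e') \<in> rt (prev Q) & same_tip G e e'"
  using P(6)[OF F] emb_seq_post[OF i] by simp
qed

lemma iemb_seq: "iemb (Seq \<mu> s f) Q D1"
proof -
 have "EX e'. (D1 Un F, e') \<in> rt Q & prank e' = prank e" if "(F, e) \<in> rt (Seq \<mu> s f)" "F ~= {}" for F e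
  using that emb_seq_tips(1) unfolding rt_Seq_iff same_tip_def by metis
 moreover have "EX e'. (pbranches Q - (D1 Un pbranches (Seq \<mu> s f)) Un F, e') \<in> rt (prev Q) & prank e' = prank e"
  if "(F, e) \<in> rt (prev (Seq \<mu> s f))" "F ~= {}" for F e
  using that emb_seq_tips(2) unfolding rt_prev_iff same_tip_def by metis
 ultimately show ?thesis unfolding iemb_def using emb_seq_facts(6,7) emb_seq_points by blast
qed

end

end

lemma psubset_UnI: "E = D Un P ==> D Int P = {} ==> P ~= {} ==> D \<subset> E"
 by blast

lemma ridx_image: "ridx s ` idx (rshape s) = idx s"
proof (intro equalityI subsetI)
 fix i assume "i \<in> idx s" thus "i \<in> ridx s ` idx (rshape s)"
  by (intro image_eqI[of _ _ "ridx s i"]) (auto simp: idx_rshape)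
qed (auto simp: idx_rshape)

context tfg
begin

lemma rt_iemb:
 assumes Q: "gpath G Q" and D: "(D, Seq \<beta> s' h) \<in> rt Q" and gp: "gpath G (prev (Seq \<beta> s' h))"
 shows "iemb (Seq \<beta> s' h) Q D"
proof -
 let ?q = "Seq \<beta> s' h"
 note L = rt_Seq_local[OF Q D refl]
 have l: "gpath G ?q" "D Int pbranches ?q = {}" "pbranches ?q \<subseteq> pbranches Q"
  "!!F e. (F, e) \<in> rt ?q ==> (D Un F, e) \<in> rt Q"
  "!!F e. (F, e) \<in> rt (prev ?q) ==> (pbranches Q - D - pbranches ?q Un F, e) \<in> rt (prev Q)"
  using L by blast+
 have sub: "D Un pbranches ?q \<subseteq> pbranches Q" using l(3) rt_subset[OF D] by blast
 have eq: "pbranches Q - D - pbranches ?q = pbranches Q - (D Un pbranches ?q)" by blast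
 have "pbranches Q - (D Un pbranches ?q) \<in> pt (prev Q)"
  using l(5)[OF rt_lend[OF gp]] rt_pt unfolding eq by (metis sup_bot.right_neutral)
 hence "pbranches Q - (pbranches Q - (D Un pbranches ?q)) \<in> pt Q" using pt_prev[OF Q] by blast
 hence "D Un pbranches ?q \<in> pt Q" using sub by (simp add: double_diff)
 moreover have "EX e'. (D Un E, e') \<in> rt Q & prank e' = prank e" if "(E, e) \<in> rt ?q" for E e using l(4) that by blast
 moreover have "EX e'. (pbranches Q - (D Un pbranches ?q) Un E, e') \<in> rt (prev Q) & prank e' = prank e"
  if "(E, e) \<in> rt (prev ?q)" for E e using l(5)[OF that] eq by auto
 ultimately show ?thesis unfolding iemb_def using l(2) sub rt_pt[OF D] by blast
qed

text \<open>Every tip of the sequence is inherited from a constituent, except the one at an open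
  left end. There the embedded constituents have a limit point in \<open>Q\<close>; the tip of
  \<open>Q\<close> at this point must be open as well, and \<open>iemb_same_limit\<close> identifies
  the two.\<close>

lemma semb_Seq:
 assumes rb: "rigid_below \<rho>" and Q: "gpath G Q" "prank Q <= \<rho>" and R: "gpath G (Seq \<mu> s f)" "\<mu> <= \<rho>"
  and E: "!!i. i \<in> idx s ==> emb G (f i) Q (E i)"
  and Estep: "!!i. i \<in> idx s ==> i + 1 \<in> idx s ==> E (i + 1) = E i Un pbranches (f i)"
 shows "semb G (Seq \<mu> s f) Q (\<Inter>i\<in>idx s. E i)"
proof -
 let ?D = "\<Inter>i\<in>idx s. E i"
 have Qp: "gpath G (prev Q)" using gpath_prev_below[OF rb Q] by simp
 have fp: "gpath G (prev (f i))" if "i \<in> idx s" for i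
  using gpath_prev_below[OF rb] gpath_SeqD(3,4)[OF R(1) that] R(2) by (meson less_imp_le order_trans)
 note C = Q(1) Qp R(1) fp E Estep
 have opn: "EX q'. (?D, q') \<in> rt Q & same_tip G (Seq \<mu> In f) q'" if s: "s = In \<or> s = Endless"
 proof -
  let ?q = "Seq \<mu> In f"
  have gq: "gpath G ?q" using gpath_lend_In[OF R(1) s] .
  have gqp: "gpath G (prev ?q)" using gpath_prev_below[OF rb gq] R(2) by simp
  have sub: "i \<in> idx s" if "i \<in> idx In" for i using s that by auto
  have "iemb ?q Q (\<Inter>i\<in>idx In. E i)"
   by (rule iemb_seq[OF Q(1) Qp gq]) (use fp E Estep sub in auto)
  moreover have "(\<Inter>i\<in>idx In. E i) = ?D"
  proof -
   have "E (-1) \<subseteq> E i" if "i \<in> idx s" "i ~: idx In" for i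
    using emb_seq_mono[OF C, of "-1" i] s that by auto
   moreover have "-1 \<in> idx In" by simp
   ultimately have "b \<in> E i" if "i \<in> idx s" "b \<in> (\<Inter>i\<in>idx In. E i)" for b i
    using that by (cases "i \<in> idx In") blast+
   thus ?thesis using sub by blast
  qed
  ultimately have iq: "iemb ?q Q ?D" by simp
  have Dp: "?D \<in> pt Q" by (rule emb_seq_points(1)[OF C])
  have "?D Int pbranches (Seq \<mu> s f) = {}" "?D Un pbranches (Seq \<mu> s f) \<subseteq> pbranches Q"
   using emb_seq_facts(6,7)[OF C] by auto
  hence Dne: "?D ~= pbranches Q" using pbranches_nonempty[OF R(1)] by blast
  obtain q' where q': "(?D, q') \<in> rt Q" using pt_rt[OF Dp Dne] by blast
  have lim: "?D \<subset> E i" "E i \<in> pt Q" if "i \<in> idx In" for i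
  proof -
   have i: "i \<in> idx s" using sub that .
   have "E i = ?D Un pre s f i" by (rule emb_seq_pre[OF C i])
   moreover have "?D Int pre s f i = {}" using emb_seq_facts(6)[OF C] pre_sub[of s f i \<mu>] by blast
   moreover have "pre s f i ~= {}" using pre_nonempty'[OF R(1) i s] .
   ultimately show "?D \<subset> E i" by (rule psubset_UnI)
   show "E i \<in> pt Q" by (rule emb_seq_facts(2)[OF C i])
  qed
  \<comment> \<open>If \<open>Q\<close> left the limit point through a branch \<open>b\<close>,
    there would be a next point, contained in all these \<open>E i\<close>, so \<open>b\<close>
    would lie in their intersection \<open>?D\<close>.\<close>
  obtain \<beta> s' h where qs: "q' = Seq \<beta> s' h"
  proof (cases q')
   case (Br b r)
   have b: "b ~: ?D" "b \<in> pbranches Q" "(pbranches Q - ?D - {b}, Br b (\<not> r)) \<in> rt (prev Q)"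
    using rt_Br[OF Q(1) q'[unfolded Br]] by auto
   have "pbranches Q - (pbranches Q - ?D - {b}) \<in> pt Q" using pt_prev[OF Q(1) rt_pt[OF b(3)]] .
   moreover have "pbranches Q - (pbranches Q - ?D - {b}) = ?D Un {b}" using b(2) rt_subset[OF q'] by blast
   ultimately have "?D Un {b} \<in> pt Q" by simp
   hence "?D Un {b} \<subseteq> E i" if "i \<in> idx In" for i
    using pt_chain[OF Q(1)] lim[OF that] by blast
   hence "b \<in> (\<Inter>i\<in>idx In. E i)" by blast
   thus ?thesis using b(1) \<open>(\<Inter>i\<in>idx In. E i) = ?D\<close> by blast
  qed
  have "s' = In" "gpath G q'" using rt_Seq_local[OF Q(1) q' qs] by auto
  moreover have "prank q' <= \<rho>" using rt_prank_le[OF Q(1) q'] Q(2) by simp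
  ultimately have q'p: "gpath G (Seq \<beta> In h)" "gpath G (prev (Seq \<beta> In h))"
   using gpath_prev_below[OF rb, of q'] qs by auto
  have "iemb (Seq \<beta> In h) Q ?D" using rt_iemb[OF Q(1), of ?D \<beta> In h] q' qs \<open>s' = In\<close> q'p by simp
  from iemb_same_limit[OF gq gqp q'p Q(1) Qp iq this] show ?thesis using q' qs \<open>s' = In\<close> by blast
 qed
 have "EX e'. (?D Un F, e') \<in> rt Q & same_tip G e e'" if F: "(F, e) \<in> rt (Seq \<mu> s f)" for F e
 proof -
  from F[unfolded rt_Seq_iff] consider
   (a) i F' where "i \<in> idx s" "(F', e) \<in> rt (f i)" "F = pre s f i Un F'"
   | (b) "s = In \<or> s = Endless" "F = {}" "e = Seq \<mu> In f" by blast
  thus ?thesis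
  proof cases
   case a thus ?thesis using emb_seq_tips(1)[OF C a(1,2)] by simp
  next
   case b thus ?thesis using opn by simp
  qed
 qed
 thus ?thesis unfolding semb_def using emb_seq_facts(6,7)[OF C] by blast
qed

lemma emb_Seq:
 assumes rb: "rigid_below \<rho>" and Q: "gpath G Q" "prank Q <= \<rho>" and R: "gpath G (Seq \<mu> s f)" "\<mu> <= \<rho>"
  and E: "!!i. i \<in> idx s ==> emb G (f i) Q (E i)"
  and Estep: "!!i. i \<in> idx s ==> i + 1 \<in> idx s ==> E (i + 1) = E i Un pbranches (f i)"
 shows "emb G (Seq \<mu> s f) Q (\<Inter>i\<in>idx s. E i)"
proof -
 let ?D = "\<Inter>i\<in>idx s. E i"
 have Qp: "gpath G (prev Q)" using gpath_prev_below[OF rb Q] by simp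
 have Rp: "gpath G (prev (Seq \<mu> s f))" using gpath_prev_below[OF rb R(1)] R(2) by simp
 have fp: "gpath G (prev (f i))" if "i \<in> idx s" for i
  using gpath_prev_below[OF rb] gpath_SeqD(3,4)[OF R(1) that] R(2) by (meson less_imp_le order_trans)
 note C = Q(1) Qp R(1) fp E Estep
 let ?E = "%i. pbranches Q - (E (ridx s i) Un pbranches (f (ridx s i)))"
 have "semb G (Seq \<mu> (rshape s) (%i. prev (f (ridx s i)))) (prev Q) (\<Inter>i\<in>idx (rshape s). ?E i)"
 proof (rule semb_Seq[OF rb Qp])
  show "gpath G (Seq \<mu> (rshape s) (%i. prev (f (ridx s i))))" using Rp by (simp add: prev.simps)
  show "emb G (prev (f (ridx s i))) (prev Q) (?E i)" if "i \<in> idx (rshape s)" for i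
   using emb_prev[OF E] that by (simp add: idx_rshape)
  fix i assume i: "i \<in> idx (rshape s)" "i + 1 \<in> idx (rshape s)"
  let ?k = "ridx s i - 1"
  have k: "?k \<in> idx s" "?k + 1 \<in> idx s" using i by (auto simp: idx_rshape ridx_succ)
  have e: "E (?k + 1) = E ?k Un pbranches (f ?k)" using Estep[OF k] .
  have "E (?k + 1) Int pbranches (f (?k + 1)) = {}" "E (?k + 1) Un pbranches (f (?k + 1)) \<subseteq> pbranches Q"
   using emb_seq_facts(4,5)[OF C k(2)] by auto
  hence "pbranches Q - E (?k + 1) = pbranches Q - (E (?k + 1) Un pbranches (f (?k + 1))) Un pbranches (f (?k + 1))"
   by blast
  thus "?E (i + 1) = ?E i Un pbranches (prev (f (ridx s i)))"
   using e by (simp add: ridx_succ)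
 qed (use Q R in auto)
 moreover have "(\<Inter>i\<in>idx (rshape s). ?E i) = pbranches Q - (?D Un pbranches (Seq \<mu> s f))"
 proof -
  have "(\<Inter>i\<in>idx (rshape s). ?E i) = (\<Inter>i\<in>idx s. pbranches Q - (E i Un pbranches (f i)))"
   unfolding ridx_image[of s, symmetric] by simp
  also have "\<dots> = pbranches Q - (\<Union>i\<in>idx s. E i Un pbranches (f i))"
   using idx_nonempty[OF gpath_SeqD(2)[OF R(1)]] by auto
  also have "(\<Union>i\<in>idx s. E i Un pbranches (f i)) = ?D Un pbranches (Seq \<mu> s f)"
  proof (intro equalityI subsetI)
   fix b assume "b \<in> ?D Un pbranches (Seq \<mu> s f)"
   thus "b \<in> (\<Union>i\<in>idx s. E i Un pbranches (f i))" using idx_nonempty[OF gpath_SeqD(2)[OF R(1)]] by auto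
  next
   fix b assume "b \<in> (\<Union>i\<in>idx s. E i Un pbranches (f i))"
   then obtain i where i: "i \<in> idx s" "b \<in> E i Un pbranches (f i)" by blast
   have "E i = ?D Un pre s f i" by (rule emb_seq_pre[OF C i(1)])
   thus "b \<in> ?D Un pbranches (Seq \<mu> s f)" using i pre_sub[of s f i \<mu>] by auto
  qed
  finally show ?thesis .
 qed
 ultimately have "semb G (prev (Seq \<mu> s f)) (prev Q) (pbranches Q - (?D Un pbranches (Seq \<mu> s f)))"
  by (simp add: prev.simps)
 moreover have "semb G (Seq \<mu> s f) Q ?D" by (rule semb_Seq[OF rb Q R E Estep])
 ultimately show ?thesis unfolding emb_def by blast
qed

lemma same_tip_overlap:
 assumes "same_tip G p q" "gpath G p" shows "pbranches p Int pbranches q ~= {}"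
proof (cases "p = q")
 case True thus ?thesis using pbranches_nonempty assms by blast
next
 case False
 hence *: "one_ended p" "one_ended q" "scoin p q" "gpath G p" using assms by (auto simp: same_tip_def)
 obtain m where m: "tail_branches p m \<subseteq> pbranches q" using *(3) tail_branches_0[OF *(2)] unfolding scoin_def by metis
 have "tail_branches p m ~= {} & tail_branches p m \<subseteq> pbranches p"
 proof -
  obtain \<mu> s f where p: "p = Seq \<mu> s f" "s = Out \<or> s = In" using *(1) by (rule one_endedE)
  let ?i = "if s = Out then int m else - 1 - int m"
  have "?i \<in> idx s" using p by auto
  hence "pbranches (f ?i) ~= {}" using gpath_SeqD(3)[of G \<mu> s f ?i] *(4) p pbranches_nonempty by blast
  thus ?thesis using p tail_branches_antimono[of 0 m p] tail_branches_0[OF *(1)] by auto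
 qed
 thus ?thesis using m by blast
qed

text \<open>\<open>Q\<close> meets the common node \<open>x\<close> at one point only, so
  \<open>A\<close> must end where \<open>C\<close> starts. With opposite directions both would leave
  this point through the same tip of the reversed path, and hence share branches.\<close>

lemma emb_adjacent:
 assumes rb: "rigid_below \<rho>" and Q: "gpath G (Seq \<rho> t g)"
  and A: "gpath G A" "prank A < \<rho>" "emb G A (Seq \<rho> t g) D" and C: "gpath G C" "prank C < \<rho>"
  and x: "at_node G (rend A) x" "at_node G (lend C) x"
 shows "emb G C (Seq \<rho> t g) E ==> E = D Un pbranches A"
  "emb G C (prev (Seq \<rho> t g)) E ==> pbranches A Int pbranches C = {} ==> False"
proof -
 let ?Q = "Seq \<rho> t g"
 have p: "gpath G (prev A)" "gpath G (prev C)" "gpath G (prev ?Q)"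
  using gpath_prev_below[OF rb] A C Q by auto
 have rk: "prank (lend (prev A)) < \<rho>" "prank (lend C) < \<rho>"
  using lend_prank[OF p(1)] lend_prank[OF C(1)] A C by auto
 have xA: "at_node G (lend (prev A)) x"
  using at_node_trev[OF x(1)] gpath_ends[OF p(1)] by (simp add: lend_prev)
 note sA = emb_points(3,4)[OF A(3,1) p(1) Q]
 obtain e where e: "(pbranches ?Q - (D Un pbranches A), e) \<in> rt (prev ?Q)" "same_tip G (lend (prev A)) e"
  using emb_points(6)[OF A(3,1) p(1) Q rt_lend[OF p(1)]] by auto
 have ex: "at_node G e x" "prank e < \<rho>"
  using at_node_same_tip[OF _ e(2) xA] rb rk e(2) unfolding rigid_below_def same_tip_def by auto
 show "E = D Un pbranches A" if EE: "emb G C ?Q E"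
 proof -
  obtain e' where e': "(E, e') \<in> rt ?Q" "same_tip G (lend C) e'"
   using emb_points(5)[OF EE C(1) p(2) Q rt_lend[OF C(1)]] by auto
  have "at_node G e' x" "prank e' < \<rho>"
   using at_node_same_tip[OF _ e'(2) x(2)] rb rk e'(2) unfolding rigid_below_def same_tip_def by auto
  hence "pbranches ?Q - (D Un pbranches A) = pbranches ?Q - E"
   using left_right_points_distinct[OF rb Q e'(1) e(1)] ex by blast
  moreover have "E \<subseteq> pbranches ?Q" by (rule rt_subset[OF e'(1)])
  ultimately show ?thesis using sA by blast
 qed
 show False if EE: "emb G C (prev ?Q) E" and dj: "pbranches A Int pbranches C = {}"
 proof -
  obtain e' where e': "(E, e') \<in> rt (prev ?Q)" "same_tip G (lend C) e'"
   using emb_points(5)[OF EE C(1) p(2) p(3) rt_lend[OF C(1)]] by auto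
  have e'x: "at_node G e' x" "prank e' < \<rho>"
   using at_node_same_tip[OF _ e'(2) x(2)] rb rk e'(2) unfolding rigid_below_def same_tip_def by auto
  have "pbranches ?Q - (D Un pbranches A) = E"
   using points_distinct[OF rb, of "rshape t"] p(3) e e' ex e'x unfolding prev.simps by blast
  hence "e = e'" using rt_unique[OF p(3)] e(1) e'(1) by blast
  hence "same_tip G (lend (prev A)) (lend C)" using e(2) e'(2) same_tip_sym same_tip_trans by blast
  hence "pbranches (lend (prev A)) Int pbranches (lend C) ~= {}"
   using same_tip_overlap gpath_ends[OF p(1)] by blast
  moreover have "pbranches (lend P) \<subseteq> pbranches P" if "gpath G P" for P :: "'b tpath"
  proof (cases "lend P")
   case (Br b s) thus ?thesis using rt_Br[OF that] rt_lend[OF that] by auto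
  next
   case (Seq \<beta> s' h) thus ?thesis using rt_Seq_local[OF that rt_lend[OF that]] by blast
  qed
  from this[OF p(1)] this[OF C(1)] have "pbranches (lend (prev A)) \<subseteq> pbranches A" "pbranches (lend C) \<subseteq> pbranches C"
   by simp_all
  ultimately show False using dj by blast
 qed
qed

text \<open>The core of rigidity, by induction on \<open>R\<close>. Each constituent is a section of
  \<open>Q\<close> or of its reverse; by \<open>emb_adjacent\<close> neighbours run in the same
  direction and fit together, and \<open>emb_Seq\<close> assembles them. The choice of direction is
  therefore made once, at an arbitrary constituent.\<close>

lemma gpath_subset_emb:
 assumes rb: "rigid_below \<rho>" and Q: "gpath G (Seq \<rho> t g)"
 shows "gpath G R ==> prank R <= \<rho> ==> pbranches R \<subseteq> pbranches (Seq \<rho> t g) ==>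
  EX D. emb G R (Seq \<rho> t g) D \<or> emb G R (prev (Seq \<rho> t g)) D"
proof (induction rule: gpath.induct)
 case (branch b s)
 have Qp: "gpath G (prev (Seq \<rho> t g))" using gpath_prev_below[OF rb Q] by simp
 have *: "emb G (Br b s) Q D" if "(D, Br b (\<not> s)) \<in> rt Q" "(pbranches Q - D - {b}, Br b s) \<in> rt (prev Q)" "b ~: D" "b \<in> pbranches Q" for Q D s
 proof -
  have "pbranches Q - (D Un {b}) = pbranches Q - D - {b}" by blast
  thus ?thesis using that rt_subset[OF that(1)] unfolding emb_def semb_def by auto
 qed
 obtain D r where D: "(D, Br b r) \<in> rt (Seq \<rho> t g)" "b ~: D"
   "(pbranches (Seq \<rho> t g) - D - {b}, Br b (\<not> r)) \<in> rt (prev (Seq \<rho> t g))" "b \<in> pbranches (Seq \<rho> t g)"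
  using branch_pt[OF Q, of b] branch.prems by auto
 show ?case
 proof (cases "r = s")
  case False
  hence "emb G (Br b s) (Seq \<rho> t g) D" using *[of D s "Seq \<rho> t g"] D by auto
  thus ?thesis by blast
 next
  case True
  have "pbranches (Seq \<rho> t g) - (pbranches (Seq \<rho> t g) - D - {b}) - {b} = D"
   using rt_subset[OF D(1)] D(2,4) by blast
  hence "emb G (Br b s) (prev (Seq \<rho> t g)) (pbranches (Seq \<rho> t g) - D - {b})"
   using *[of "pbranches (Seq \<rho> t g) - D - {b}" s "prev (Seq \<rho> t g)"] D True by simp
  thus ?thesis by blast
 qed
next
 case (sequence \<mu> s f)
 hence R: "gpath G (Seq \<mu> s f)" by (intro gpath.sequence) auto
 let ?B = "%i. pbranches (f i)"
 have lt: "prank (f i) < \<rho>" "gpath G (f i)" if "i \<in> idx s" for i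
  using gpath_SeqD(3,4)[OF R that] sequence.prems(1) by auto
 have nd: "EX x. at_node G (rend (f i)) x & at_node G (lend (f (i + 1))) x" if "i \<in> idx s" "i + 1 \<in> idx s" for i
  using tracing_junction[OF R, of "i + 1"] that by simp
 have dj: "?B i Int ?B j = {}" if "i \<in> idx s" "j \<in> idx s" "i ~= j" for i j
  using pbranches_disjoint[OF R that] .
 \<comment> \<open>Stated for an arbitrary \<open>Seq \<rho> t' g'\<close>, to be used for
   \<open>Seq \<rho> t g\<close> and for its reverse.\<close>
 have main: "emb G (Seq \<mu> s f) (Seq \<rho> t' g') (\<Inter>i\<in>idx s. SOME D. emb G (f i) (Seq \<rho> t' g') D)"
  if Q': "gpath G (Seq \<rho> t' g')" and i0: "i0 \<in> idx s" "emb G (f i0) (Seq \<rho> t' g') D0"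
  and any: "\<forall>i\<in>idx s. EX D. emb G (f i) (Seq \<rho> t' g') D \<or> emb G (f i) (prev (Seq \<rho> t' g')) D" for t' g' i0 D0
 proof -
  let ?Q = "Seq \<rho> t' g'"
  have Q'p: "gpath G (prev ?Q)" using gpath_prev_below[OF rb Q'] by simp
  have up: "EX D. emb G (f (i+1)) ?Q D" if i: "i \<in> idx s" "i + 1 \<in> idx s" "emb G (f i) ?Q D" for i D
  proof -
   obtain x where "at_node G (rend (f i)) x" "at_node G (lend (f (i + 1))) x" using nd i by blast
   thus ?thesis
    using emb_adjacent(2)[OF rb Q' lt(2)[OF i(1)] lt(1)[OF i(1)] i(3) lt(2)[OF i(2)] lt(1)[OF i(2)]] any i dj[OF i(1,2)]
    by (metis add_cancel_left_right zero_neq_one)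
  qed
  have down: "EX D. emb G (f i) ?Q D" if i: "i \<in> idx s" "i + 1 \<in> idx s" "emb G (f (i+1)) ?Q D" for i D
  proof (rule ccontr)
   assume "\<not> ?thesis"
   then obtain E where E: "emb G (f i) (prev ?Q) E" using any i by blast
   obtain x where x: "at_node G (rend (f i)) x" "at_node G (lend (f (i + 1))) x" using nd i by blast
   have "emb G (f (i+1)) (prev (prev ?Q)) D" using i(3) by simp
   thus False
    using emb_adjacent(2)[OF rb Q'p[unfolded prev.simps] lt(2)[OF i(1)] lt(1)[OF i(1)] E[unfolded prev.simps] lt(2)[OF i(2)] lt(1)[OF i(2)] x]
     dj[OF i(1,2)] by (simp add: prev.simps)
  qed
  have "i0 <= i ==> i \<in> idx s ==> EX D. emb G (f i) ?Q D" for i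
  proof (induction i rule: int_ge_induct)
   case (step i)
   hence "i \<in> idx s" using idx_convex[OF i0(1) step.prems] by simp
   thus ?case using step up by blast
  qed (use i0 in blast)
  moreover have "i <= i0 ==> i \<in> idx s ==> EX D. emb G (f i) ?Q D" for i
  proof (induction i rule: int_le_induct)
   case (step i)
   hence "i \<in> idx s" using idx_convex[OF step.prems i0(1)] by simp
   thus ?case using step down[of "i - 1"] by auto
  qed (use i0 in blast)
  ultimately have ex: "EX D. emb G (f i) ?Q D" if "i \<in> idx s" for i using that by (cases "i0 <= i") auto
  let ?E = "%i. SOME D. emb G (f i) ?Q D"
  have E: "emb G (f i) ?Q (?E i)" if "i \<in> idx s" for i using someI_ex[OF ex[OF that]] .
  show ?thesis
  proof (rule emb_Seq[OF rb Q' _ R _ E])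
   fix i assume i: "i \<in> idx s" "i + 1 \<in> idx s"
   obtain x where "at_node G (rend (f i)) x" "at_node G (lend (f (i + 1))) x" using nd i by blast
   thus "?E (i + 1) = ?E i Un ?B i"
    using emb_adjacent(1)[OF rb Q' lt(2)[OF i(1)] lt(1)[OF i(1)] E[OF i(1)] lt(2)[OF i(2)] lt(1)[OF i(2)] _ _ E[OF i(2)]] by blast
  qed (use sequence.prems in auto)
 qed
 have IH: "EX D. emb G (f i) (Seq \<rho> t g) D \<or> emb G (f i) (prev (Seq \<rho> t g)) D" if "i \<in> idx s" for i
  using sequence.IH that lt[OF that] sequence.prems(2) by fastforce
 have Qp: "gpath G (prev (Seq \<rho> t g))" using gpath_prev_below[OF rb Q] by simp
 obtain i0 where i0: "i0 \<in> idx s" using idx_nonempty gpath_SeqD(2)[OF R] by blast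
 from IH[OF i0] obtain D0 where "emb G (f i0) (Seq \<rho> t g) D0 \<or> emb G (f i0) (prev (Seq \<rho> t g)) D0" by blast
 thus ?case
 proof
  assume "emb G (f i0) (Seq \<rho> t g) D0"
  thus ?thesis using main[OF Q i0] IH by blast
 next
  assume a: "emb G (f i0) (prev (Seq \<rho> t g)) D0"
  have "\<forall>i\<in>idx s. EX D. emb G (f i) (prev (Seq \<rho> t g)) D \<or> emb G (f i) (prev (prev (Seq \<rho> t g))) D"
   using IH by auto
  hence "EX D. emb G (Seq \<mu> s f) (prev (Seq \<rho> t g)) D"
   using main[OF Qp[unfolded prev.simps] i0 a[unfolded prev.simps]] unfolding prev.simps by blast
  thus ?thesis by blast
 qed
qed

section \<open>Rigidity of the tips of every rank\<close>

lemma gpath_In_shift: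
 assumes "gpath G (Seq \<mu> In f)" shows "gpath G (Seq \<mu> In (%i. f (i - int m)))"
proof -
 note g = gpath_SeqD[OF assms]
 let ?f = "%i. f (i - int m)"
 obtain x where x: "\<forall>i\<in>idx In. at_node G (lend (f i)) (x i) & at_node G (rend (f i)) (x (i + 1))"
   "inj_on x (idx In Un (%i. i + 1) ` idx In)"
   "\<forall>i\<in>idx In Un (%i. i + 1) ` idx In. \<forall>j\<in>idx In. x i ~: inner G (f j)"
   "\<forall>i\<in>idx In. \<forall>j\<in>idx In. i ~= j --> inner G (f i) Int inner G (f j) = {}"
  using g(6) by (auto simp: tracing_def)
 have u: "idx In Un (%i. i + 1) ` idx In = {..0}"
 proof (intro equalityI subsetI)
  fix i :: int assume "i \<in> {..0}" thus "i \<in> idx In Un (%i. i + 1) ` idx In"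
   by (intro UnI2 image_eqI[of _ _ "i - 1"]) auto
 qed auto
 have "tracing G In ?f"
  unfolding tracing_def
 proof (rule exI[of _ "%i. x (i - int m)"], intro conjI)
  show "inj_on (%i. x (i - int m)) (idx In Un (%i. i + 1) ` idx In)"
  proof (rule inj_onI)
   fix i j assume "i \<in> idx In Un (%i. i + 1) ` idx In" "j \<in> idx In Un (%i. i + 1) ` idx In" "x (i - int m) = x (j - int m)"
   hence "i - int m = j - int m" using inj_onD[OF x(2), of "i - int m" "j - int m"] unfolding u by simp
   thus "i = j" by simp
  qed
  show "\<forall>i\<in>idx In Un (%i. i + 1) ` idx In. \<forall>j\<in>idx In. x (i - int m) ~: inner G (f (j - int m))"
   using x(3) unfolding u by auto
  show "\<forall>i\<in>idx In. at_node G (lend (f (i - int m))) (x (i - int m)) & at_node G (rend (f (i - int m))) (x (i + 1 - int m))"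
  proof
   fix i assume "i \<in> idx In"
   hence "at_node G (lend (f (i - int m))) (x (i - int m)) & at_node G (rend (f (i - int m))) (x (i - int m + 1))"
    using x(1) by simp
   moreover have "i - int m + 1 = i + 1 - int m" by simp
   ultimately show "at_node G (lend (f (i - int m))) (x (i - int m)) & at_node G (rend (f (i - int m))) (x (i + 1 - int m))"
    by metis
  qed
 qed (use x(4) in auto)
 moreover have "junction_ranks \<mu> In ?f"
 proof -
  have j: "jrank ?f i = jrank f (i - int m)" for i
   by (simp add: jrank_def diff_diff_eq add.commute)
  have jn: "junctions In = {..<0}" by (auto simp: junctions_def)
  have "jrank f (i - int m) < jrank f (j - int m)" if "\<mu> = Arr" "i < 0" "j < i" for i j
  proof -
   have "\<forall>i\<in>junctions In. \<forall>j\<in>junctions In. 0 < i & i < j \<or> j < i & i < 0 --> jrank f i < jrank f j"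
    using g(7) that(1) by (auto simp: junction_ranks_def)
   thus ?thesis using that unfolding jn by simp
  qed
  thus ?thesis using g(7) unfolding junction_ranks_def jn by (auto simp: j)
 qed
 moreover have "gpath G (f (i - int m)) & prank (f (i - int m)) < \<mu> & (prank (f (i - int m)) = Elem --> \<mu> = Rk 0)"
  if "i \<in> idx In" for i using g(3,4,5)[of "i - int m"] that by simp
 ultimately show ?thesis using g(1) by (intro gpath.sequence) auto
qed

text \<open>A tail of \<open>P\<close> that runs in \<open>Q\<close> is a section of
  \<open>Q\<close> by \<open>gpath_subset_emb\<close>. Its open end is a tip of rank
  \<open>\<rho>\<close>, and \<open>Q\<close> has only one of these, its own open end.\<close>

lemma rigid_step:
 assumes rb: "rigid_below \<rho>" shows "tips_rigid G \<rho>"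
proof -
 have *: "scoin P Q" if P: "gpath G P" "P = Seq \<rho> In f" and Q: "gpath G Q" "Q = Seq \<rho> In g" and c: "coincide P Q" for P Q f g
 proof -
  obtain m where m: "tail_branches P m \<subseteq> pbranches Q" using c by (auto simp: coincide_def)
  let ?P = "Seq \<rho> In (%i. f (i - int m))"
  have gP: "gpath G ?P" using gpath_In_shift P by blast
  have tl: "tail_branches ?P k = tail_branches P (k + m)" for k
  proof -
   have "(%i. i - int m) ` {..< - int k} = {..< - int (k + m)}"
   proof (intro equalityI subsetI)
    fix i assume "i \<in> {..< - int (k + m)}" thus "i \<in> (%i. i - int m) ` {..< - int k}"
     by (intro image_eqI[of _ _ "i + int m"]) auto
   qed auto
   from this[symmetric] show ?thesis unfolding P(2) tail_branches_In by simp
  qed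
  have "pbranches ?P = tail_branches P m"
   using tail_branches_0[of ?P] tl[of 0] by (simp add: one_ended_def)
  hence sub: "pbranches ?P \<subseteq> pbranches (Seq \<rho> In g)" using m unfolding Q(2) by blast
  obtain D where D: "emb G ?P (Seq \<rho> In g) D \<or> emb G ?P (prev (Seq \<rho> In g)) D"
   using gpath_subset_emb[OF rb Q(1)[unfolded Q(2)] gP _ sub] by (metis prank.simps(2) order_refl)
  have Qp: "gpath G (prev (Seq \<rho> In g))" using gpath_prev_below[OF rb] Q by simp
  have "({}, ?P) \<in> rt ?P" by (simp add: rt_Seq_iff)
  from D this obtain Q' e where e: "(D, e) \<in> rt Q'" "same_tip G ?P e" "Q' = Seq \<rho> In g \<or> Q' = prev (Seq \<rho> In g)"
   unfolding emb_def semb_def by fastforce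
  have "prank e = \<rho>" using e(2) by (simp add: same_tip_def)
  \<comment> \<open>All other tips at points of \<open>Q\<close> or of its reverse belong to
    constituents and have rank below \<open>\<rho>\<close>.\<close>
  have "e = Q"
  proof (rule disjE[OF e(3)])
   assume "Q' = Seq \<rho> In g"
   thus ?thesis using rt_tip_rank_Seq[of \<rho> In g D e] Q e(1) \<open>prank e = \<rho>\<close> by simp
  next
   assume "Q' = prev (Seq \<rho> In g)"
   hence "(D, e) \<in> rt (prev (Seq \<rho> In g))" using e(1) by simp
   from this[unfolded rt_prev_iff] obtain i E where i: "i \<in> idx In" "(E, e) \<in> rt (prev (g i))" by auto
   have gi: "gpath G (g i)" "prank (g i) < \<rho>" using gpath_SeqD(3,4)[OF Q(1)[unfolded Q(2)] i(1)] by auto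
   have "gpath G (prev (g i))" using gpath_prev_below[OF rb gi(1)] gi(2) by simp
   hence "prank e < \<rho>" using rt_prank_le[OF _ i(2)] gi by simp
   thus ?thesis using \<open>prank e = \<rho>\<close> by simp
  qed
  hence "scoin ?P Q" using e(2) by (auto simp: same_tip_def)
  moreover have "scoin P ?P"
  proof -
   have "EX n. tail_branches P n \<subseteq> tail_branches ?P k" for k using tl[of k] by blast
   moreover have "tail_branches ?P k \<subseteq> tail_branches P k" for k
    using tl[of k] tail_branches_antimono[of k "k + m" P] by simp
   ultimately show ?thesis unfolding scoin_def by blast
  qed
  ultimately show ?thesis using scoin_trans by blast
 qed
 have **: "EX P' f. gpath G P' & P' = Seq \<rho> In f & (ALL m. tail_branches P' m = tail_branches P m) & pbranches P' = pbranches P"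
  if P: "gpath G P" "one_ended P" "prank P = \<rho>" for P
 proof -
  obtain s f where s: "P = Seq \<rho> s f" "s = Out \<or> s = In" using one_endedE[OF P(2)] P(3) by (metis prank.simps(2))
  show ?thesis
  proof (cases "s = In")
   case True thus ?thesis using P s by blast
  next
   case False
   have "gpath G (prev P)" using gpath_prev_below[OF rb] P by simp
   moreover have "prev P = Seq \<rho> In (%i. prev (f (ridx Out i)))" using False s by (simp add: prev.simps)
   ultimately show ?thesis using tail_branches_prev pbranches_prev by metis
  qed
 qed
 show ?thesis unfolding tips_rigid_def
 proof (intro allI impI, elim conjE)
  fix P Q assume P: "gpath G P" "one_ended P" "prank P = \<rho>" and Q: "gpath G Q" "one_ended Q" "prank Q = \<rho>"
   and c: "coincide P Q"
  obtain P' f where P': "gpath G P'" "P' = Seq \<rho> In f" "ALL m. tail_branches P' m = tail_branches P m" "pbranches P' = pbranches P"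
   using **[OF P] by blast
  obtain Q' g where Q': "gpath G Q'" "Q' = Seq \<rho> In g" "ALL m. tail_branches Q' m = tail_branches Q m" "pbranches Q' = pbranches Q"
   using **[OF Q] by blast
  have "coincide P' Q'" using c P'(3,4) Q'(3,4) by (simp add: coincide_def)
  from *[OF P'(1,2) Q'(1,2) this] show "scoin P Q" using P'(3) Q'(3) by (simp add: scoin_def)
 qed
qed

theorem rigid: "tips_rigid G \<rho>"
proof (induction \<rho> rule: wf_induct[OF rank_wf])
 case (1 \<rho>) thus ?case using rigid_step[of \<rho>] unfolding rigid_below_def by blast
qed

lemma rigid_all [simp]: "rigid_below \<rho>" using rigid by (simp add: rigid_below_def)

lemma gpath_prev [simp]: "gpath G (prev P) = gpath G P"
proof -
 have "gpath G P ==> gpath G (prev P)" for P using gpath_prev_below(1)[of "prank P" P] by simp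
 thus ?thesis by (metis prev_prev)
qed

lemma inner_prev: "gpath G P ==> inner G (prev P) = inner G P"
 using gpath_prev_below(2)[of "prank P" P] by simp

lemma at_node_inject: "at_node G p x ==> at_node G p y ==> x = y"
 using at_node_unique rigid by blast

end

declare inner.simps(2) [simp del] pbranches.simps(2) [simp]

section \<open>Joining paths\<close>

text \<open>Gluing and cutting produce sequences over arbitrary intervals of integers; a shift by
  \<open>k\<close> brings them to one of the standard index sets.\<close>

lemma int_interval_shape:
 assumes "I ~= {}" and conv: "!!i j k. i \<in> I ==> k \<in> I ==> i <= j ==> j <= k ==> j \<in> I"
 shows "EX s k. idx s = {i. i + k \<in> I} & s ~= Two 0"
proof -
 obtain c where c: "c \<in> I" using assms by auto
 have up: "d \<in> I" if "d \<ge> c" "\<forall>b\<in>I. b + 1 \<in> I" for d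
  using that by (induction d rule: int_ge_induct) (use c in auto)
 have down: "d \<in> I" if "d <= c" "\<forall>b\<in>I. b - 1 \<in> I" for d
  using that by (induction d rule: int_le_induct) (use c in auto)
 have low: "a <= i" if "a \<in> I" "a - 1 ~: I" "i \<in> I" for a i using conv[of i a "a - 1"] that by force
 have high: "i <= b" if "b \<in> I" "b + 1 ~: I" "i \<in> I" for b i using conv[of b i "b + 1"] that by force
 consider (two) a b where "a \<in> I" "a - 1 ~: I" "b \<in> I" "b + 1 ~: I" | (out) a where "a \<in> I" "a - 1 ~: I" "\<forall>b\<in>I. b + 1 \<in> I"
  | (inw) b where "b \<in> I" "b + 1 ~: I" "\<forall>a\<in>I. a - 1 \<in> I" | (endl) "\<forall>b\<in>I. b + 1 \<in> I" "\<forall>a\<in>I. a - 1 \<in> I" by blast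
 thus ?thesis
 proof cases
  case two
  hence "i \<in> I \<longleftrightarrow> a <= i & i <= b" for i using low high conv by blast
  hence I: "I = {a..b}" by (simp add: set_eq_iff)
  have "a <= b" using low[OF two(1,2,3)] .
  thus ?thesis unfolding I by (intro exI[of _ "Two (nat (b - a + 1))"] exI[of _ a]) auto
 next
  case out
  have "i \<in> I \<longleftrightarrow> a <= i" for i using low[OF out(1,2)] up[OF _ out(3)] conv[OF out(1), of c i] c
   by (metis linear)
  hence I: "I = {a..}" by (simp add: set_eq_iff)
  show ?thesis unfolding I by (intro exI[of _ Out] exI[of _ a]) auto
 next
  case inw
  have "i \<in> I \<longleftrightarrow> i <= b" for i using high[OF inw(1,2)] down[OF _ inw(3)] conv[OF _ inw(1), of c i] c
   by (metis linear)
  hence I: "I = {..b}" by (simp add: set_eq_iff)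
  show ?thesis unfolding I by (intro exI[of _ In] exI[of _ "b + 1"]) auto
 next
  case endl
  have "i \<in> I" for i using up[OF _ endl(1)] down[OF _ endl(2)] by (metis linear)
  hence I: "I = UNIV" by (simp add: set_eq_iff)
  show ?thesis unfolding I by (intro exI[of _ Endless] exI[of _ 0]) auto
 qed
qed

section \<open>Sequences over an arbitrary index interval\<close>

definition traced :: "'b tgraph => int set => (int => 'b tpath) => (int => 'b node) => bool" where
 "traced G I f x \<longleftrightarrow> (\<forall>i\<in>I. at_node G (lend (f i)) (x i) & at_node G (rend (f i)) (x (i + 1))) &
   inj_on x (I Un (%i. i + 1) ` I) &
   (\<forall>i\<in>I Un (%i. i + 1) ` I. \<forall>j\<in>I. x i ~: inner G (f j)) &
   (\<forall>i\<in>I. \<forall>j\<in>I. i ~= j --> inner G (f i) Int inner G (f j) = {})"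

lemma tracing_traced: "tracing G s f \<longleftrightarrow> (EX x. traced G (idx s) f x)"
 by (simp add: tracing_def traced_def)

lemma traced_shift:
 assumes "traced G I f x" shows "traced G {i. i + k \<in> I} (%i. f (i + k)) (%i. x (i + k))"
proof -
 have 1: "at_node G (rend (f i)) (x (i + 1))" if "i \<in> I" for i using assms that by (auto simp: traced_def)
 have "at_node G (rend (f (i + k))) (x (i + 1 + k))" if "i + k \<in> I" for i
  using 1[OF that] by (simp add: algebra_simps)
 moreover have dom: "i + k \<in> I Un (%i. i + 1) ` I"
  if i: "i \<in> {i. i + k \<in> I} Un (%i. i + 1) ` {i. i + k \<in> I}" for i
 proof (cases "i + k \<in> I")
  case False
  then obtain j where "i = j + 1" "j + k \<in> I" using i by auto
  thus ?thesis by (intro UnI2 image_eqI[of _ _ "j + k"]) auto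
 qed simp
 have "inj_on (%i. x (i + k)) ({i. i + k \<in> I} Un (%i. i + 1) ` {i. i + k \<in> I})"
 proof (rule inj_onI)
  fix i j assume ij: "i \<in> {i. i + k \<in> I} Un (%i. i + 1) ` {i. i + k \<in> I}" "j \<in> {i. i + k \<in> I} Un (%i. i + 1) ` {i. i + k \<in> I}"
   "x (i + k) = x (j + k)"
  have "inj_on x (I Un (%i. i + 1) ` I)" using assms by (simp add: traced_def)
  from inj_onD[OF this ij(3) dom[OF ij(1)] dom[OF ij(2)]] show "i = j" by simp
 qed
 ultimately show ?thesis using assms dom unfolding traced_def by auto
qed

lemma traced_mono:
 assumes "traced G I f x" "J \<subseteq> I" shows "traced G J f x"
proof -
 have sub: "J Un (%i. i + 1) ` J \<subseteq> I Un (%i. i + 1) ` I" using assms(2) by blast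
 have "inj_on x (J Un (%i. i + 1) ` J)" using assms(1) sub inj_on_subset unfolding traced_def by blast
 moreover have "\<forall>i\<in>J Un (%i. i + 1) ` J. \<forall>j\<in>J. x i ~: inner G (f j)"
  using assms sub unfolding traced_def by (meson subsetD)
 ultimately show ?thesis using assms unfolding traced_def by (simp add: subset_iff)
qed

text \<open>A path in the making. The arrow-rank condition on junctions depends on where index
  \<open>0\<close> lies, which a shift changes; it is left out and imposed when the path is
  assembled.\<close>

definition seqpre :: "'b tgraph => rank => int set => (int => 'b tpath) => (int => 'b node) => bool" where
 "seqpre G \<mu> I f x \<longleftrightarrow> (\<forall>i\<in>I. gpath G (f i) & prank (f i) < \<mu> & (prank (f i) = Elem --> \<mu> = Rk 0)) &
   traced G I f x & (\<mu> ~= Arr --> (ALL i. i - 1 \<in> I & i \<in> I --> jrank f i = rpred \<mu>))"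

definition seqsets :: "'b tgraph => int set => (int => 'b tpath) => (int => 'b node) => 'b tpath => bool" where
 "seqsets G I f x P \<longleftrightarrow> pbranches P = (\<Union>i\<in>I. pbranches (f i)) &
   inner G P = (\<Union>i\<in>I. inner G (f i)) Un {x i | i. i - 1 \<in> I & i \<in> I}"

lemma jrank_shift: "jrank (%i. f (i + k)) i = jrank f (i + k)"
proof -
 have "i - 1 + k = i + k - 1" by simp
 thus ?thesis unfolding jrank_def by metis
qed

lemma seqpre_shift:
 assumes "seqpre G \<mu> I f x" shows "seqpre G \<mu> {i. i + k \<in> I} (%i. f (i + k)) (%i. x (i + k))"
proof -
 have "jrank f (i + k) = rpred \<mu>" if "\<mu> ~= Arr" "i - 1 + k \<in> I" "i + k \<in> I" for i
 proof -
  have "i - 1 + k = i + k - 1" by simp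
  hence "i + k - 1 \<in> I" using that(2) by metis
  thus ?thesis using assms that(1,3) unfolding seqpre_def by blast
 qed
 thus ?thesis using assms traced_shift[of G I f x k] unfolding seqpre_def by (auto simp: jrank_shift)
qed

lemma seqsets_shift: "seqsets G {i. i + k \<in> I} (%i. f (i + k)) (%i. x (i + k)) P = seqsets G I f x P"
proof -
 have "(%i. i + k) ` {i. i + k \<in> I} = I"
 proof (intro equalityI subsetI)
  fix i assume "i \<in> I" thus "i \<in> (%i. i + k) ` {i. i + k \<in> I}" by (intro image_eqI[of _ _ "i - k"]) auto
 qed auto
 note e = this[symmetric]
 have 1: "(\<Union>i\<in>{i. i + k \<in> I}. A (i + k)) = (\<Union>i\<in>I. A i)" for A :: "int => 'c set" by (subst (2) e) simp
 have 2: "{x (i + k) |i. i - 1 + k \<in> I & i + k \<in> I} = {x i |i. i - 1 \<in> I & i \<in> I}"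
 proof (intro equalityI subsetI)
  fix v assume "v \<in> {x (i + k) |i. i - 1 + k \<in> I & i + k \<in> I}"
  then obtain i where "v = x (i + k)" "i - 1 + k \<in> I" "i + k \<in> I" by auto
  thus "v \<in> {x i |i. i - 1 \<in> I & i \<in> I}" by (auto intro!: exI[of _ "i + k"] simp: algebra_simps)
 next
  fix v assume "v \<in> {x i |i. i - 1 \<in> I & i \<in> I}"
  then obtain i where "v = x i" "i - 1 \<in> I" "i \<in> I" by auto
  thus "v \<in> {x (i + k) |i. i - 1 + k \<in> I & i + k \<in> I}" by (auto intro!: exI[of _ "i - k"])
 qed
 show ?thesis unfolding seqsets_def using 1[of "%i. pbranches (f i)"] 1[of "%i. inner G (f i)"] 2 by simp
qed

context tfg
begin

lemma seqsets_Seq: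
 assumes "traced G (idx s) f x" shows "seqsets G (idx s) f x (Seq \<mu> s f)"
proof -
 have "at_node G (lend (f i)) v \<longleftrightarrow> v = x i" if "i \<in> idx s" for i v
  using assms that at_node_inject unfolding traced_def by blast
 hence "{v. EX i. i - 1 \<in> idx s & i \<in> idx s & at_node G (lend (f i)) v} = {x i |i. i - 1 \<in> idx s & i \<in> idx s}"
  by auto
 thus ?thesis by (simp add: seqsets_def inner.simps(2))
qed

lemma gpath_seqpre:
 assumes "gpath G (Seq \<mu> s f)"
 obtains x where "seqpre G \<mu> (idx s) f x" "seqsets G (idx s) f x (Seq \<mu> s f)"
proof -
 note g = gpath_SeqD[OF assms]
 obtain x where x: "traced G (idx s) f x" using g(6) tracing_traced by blast
 have "seqpre G \<mu> (idx s) f x" using x g unfolding seqpre_def junction_ranks_def junctions_def by auto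
 thus ?thesis using that seqsets_Seq[OF x] by blast
qed

lemma seqpre_gpath:
 assumes "seqpre G \<mu> I f x" "\<mu> ~= Elem" "I ~= {}" and conv: "!!i j k. i \<in> I ==> k \<in> I ==> i <= j ==> j <= k ==> j \<in> I"
  and Arr: "\<mu> = Arr ==> EX a. I = {a..} & (ALL i j. a < i & i < j --> jrank f i < jrank f j)"
 obtains s k where "gpath G (Seq \<mu> s (%i. f (i + k)))" "idx s = {i. i + k \<in> I}" "seqsets G I f x (Seq \<mu> s (%i. f (i + k)))"
proof -
 obtain s k where s: "idx s = {i. i + k \<in> I}" "s ~= Two 0" using int_interval_shape[OF assms(3)] conv by metis
 have p: "seqpre G \<mu> (idx s) (%i. f (i + k)) (%i. x (i + k))" using seqpre_shift[OF assms(1)] s(1) by simp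
 have t: "traced G (idx s) (%i. f (i + k)) (%i. x (i + k))" using p by (simp add: seqpre_def)
 have "junction_ranks \<mu> s (%i. f (i + k))"
 proof (cases "\<mu> = Arr")
  case True
  then obtain a where a: "I = {a..}" "ALL i j. a < i & i < j --> jrank f i < jrank f j" using Arr by auto
  hence ids: "idx s = {a - k..}" using s by auto
  hence so: "s = Out"
  proof (cases s)
   case (Two n)
   hence "max (a - k) (int n) \<in> {0..<int n}" using ids by auto
   thus ?thesis by simp
  next
   case In hence "max (a - k) 0 \<in> {..<(0::int)}" using ids by auto
   thus ?thesis by simp
  next
   case Endless hence "a - k - 1 \<in> {a - k..}" using ids by auto
   thus ?thesis by simp
  qed simp
  have "0 \<in> {a - k..}" "-1 ~: {a - k..}" using ids so by auto
  hence "a = k" by simp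
  thus ?thesis using True so a(2) unfolding junction_ranks_def junctions_def by (auto simp: jrank_shift)
 next
  case False
  thus ?thesis using p unfolding seqpre_def junction_ranks_def junctions_def by simp
 qed
 hence "gpath G (Seq \<mu> s (%i. f (i + k)))"
  using p s(2) assms(2) t unfolding seqpre_def by (intro gpath.sequence) (auto simp: tracing_traced)
 moreover have "seqsets G I f x (Seq \<mu> s (%i. f (i + k)))"
  using seqsets_Seq[OF t] seqsets_shift[of G k I f x] s(1) by simp
 ultimately show ?thesis using that s(1) by blast
qed

text \<open>The ends of \<open>P\<close> may be open: \<open>x\<close> and \<open>y\<close> need
  only embrace its end tips. As \<open>tracing\<close> does not keep the node of an open end out of
  the inside, this has to be required.\<close>

definition arc :: "'b node => 'b tpath => 'b node => bool" where
 "arc x P y \<longleftrightarrow> gpath G P & at_node G (lend P) x & at_node G (rend P) y & x ~= y & x ~: inner G P & y ~: inner G P"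

lemma at_node_trev_iff: "gpath G P ==> at_node G (trev (lend P)) x \<longleftrightarrow> at_node G (lend P) x"
 "gpath G P ==> at_node G (trev (rend P)) x \<longleftrightarrow> at_node G (rend P) x"
proof -
 assume g: "gpath G P"
 have *: "at_node G (trev p) x \<longleftrightarrow> at_node G p x" if "gpath G p" "gpath G (trev p)" for p
  using at_node_trev[of p x] at_node_trev[of "trev p" x] that by auto
 show "at_node G (trev (lend P)) x \<longleftrightarrow> at_node G (lend P) x" "at_node G (trev (rend P)) x \<longleftrightarrow> at_node G (rend P) x"
  using *[of "lend P"] *[of "rend P"] gpath_ends[OF g] gpath_ends[of G "prev P"] g by (simp_all add: lend_prev rend_prev)
qed

lemma arc_prev: "arc x P y \<longleftrightarrow> arc y (prev P) x"
proof -
 have "arc x P y ==> arc y (prev P) x" for x P y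
  unfolding arc_def using at_node_trev_iff inner_prev by (auto simp: lend_prev rend_prev)
 thus ?thesis by (metis prev_prev)
qed

lemma traced_arc:
 assumes "traced G I f x" "i \<in> I" "gpath G (f i)" shows "arc (x i) (f i) (x (i + 1))"
 using assms unfolding arc_def traced_def inj_on_def by (auto, metis add_cancel_right_right zero_neq_one Un_iff image_eqI)

definition joinable :: "'b node => 'b node => 'b node => 'b tpath => 'b tpath => bool" where
 "joinable x z y P Q \<longleftrightarrow> arc x P z & arc z Q y & x ~= y & x ~: inner G Q & y ~: inner G P & inner G P Int inner G Q = {}"

text \<open>The ranks of the end tips are recorded because junction ranks of a surrounding sequence
  depend on them.\<close>

definition joined :: "'b node => 'b node => 'b node => 'b tpath => 'b tpath => 'b tpath => bool" where
 "joined x z y P Q R \<longleftrightarrow> gpath G R & pbranches R = pbranches P Un pbranches Q &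
   inner G R = insert z (inner G P Un inner G Q) & at_node G (lend R) x & at_node G (rend R) y &
   prank (lend R) = prank (lend P) & prank (rend R) = prank (rend Q)"

lemma joined_prev: "joined x z y P Q R ==> gpath G P ==> gpath G Q ==> joined y z x (prev Q) (prev P) (prev R)"
 unfolding joined_def by (auto simp: lend_prev rend_prev inner_prev at_node_trev_iff)

lemma joinable_prev: "joinable x z y P Q ==> joinable y z x (prev Q) (prev P)"
 unfolding joinable_def using arc_prev by (auto simp: arc_def inner_prev)

lemma joined_arc: "joinable x z y P Q ==> joined x z y P Q R ==> arc x R y"
 unfolding joinable_def joined_def arc_def by auto

text \<open>\<open>A\<close> and \<open>B\<close> hold the nodes met on the left and on the right,
  apart from the common node \<open>z\<close> at index \<open>0\<close>; their disjointness gives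
  all separation conditions across \<open>z\<close>.\<close>

lemma traced_glue:
 assumes I: "I \<subseteq> {..<0}" "J \<subseteq> {0..}" "!!i. i \<in> I ==> i + 1 < 0 ==> i + 1 \<in> I" "!!j. j \<in> J ==> 0 < j ==> j - 1 \<in> J"
  and f: "traced G I f x" and g: "traced G J g y" and z: "x 0 = z" "y 0 = z"
  and A: "!!i. i \<in> I ==> x i \<in> A & inner G (f i) \<subseteq> A" and B: "!!j. j \<in> J ==> y (j + 1) \<in> B & inner G (g j) \<subseteq> B"
  and AB: "A Int B = {}" "z ~: A" "z ~: B"
 shows "traced G (I Un J) (%i. if i < 0 then f i else g i) (%i. if i <= 0 then x i else y i)"
proof -
 let ?f = "%i. if i < 0 then f i else g i" and ?x = "%i. if i <= 0 then x i else y i"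
 let ?K = "(I Un J) Un (%i. i + 1) ` (I Un J)"
 have neg: "i \<in> I" if "i \<in> ?K" "i < 0" for i using that I(2) I(3) by force
 have pos: "i - 1 \<in> J" if "i \<in> ?K" "0 < i" for i using that I(1) I(4) by force
 have xA: "?x i \<in> A" if "i \<in> ?K" "i < 0" for i using A[OF neg[OF that]] that by simp
 have xB: "?x i \<in> B" if "i \<in> ?K" "0 < i" for i using B[OF pos[OF that]] that by simp
 have x0: "?x 0 = z" using z by simp
 have injx: "inj_on x (I Un (%i. i + 1) ` I)" and injy: "inj_on y (J Un (%i. i + 1) ` J)"
  using f g by (auto simp: traced_def)
 have pd: "i \<in> (%i. i + 1) ` J" if "i \<in> ?K" "0 < i" for i using pos[OF that] by (intro image_eqI[of _ _ "i - 1"]) auto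
 have "inj_on ?x ?K"
 proof (rule inj_onI)
  fix i j assume ij: "i \<in> ?K" "j \<in> ?K" "?x i = ?x j"
  have *: "i = j" if "i \<in> ?K" "j \<in> ?K" "?x i = ?x j" and le: "i <= j" for i j
  proof -
   consider "i < 0" "j < 0" | "i < 0" "j \<ge> 0" | "i = 0" | "i > 0" "j > 0"
    using le by linarith
   thus ?thesis
   proof cases
    case 1
    hence "i \<in> I" "j \<in> I" using neg[OF that(1)] neg[OF that(2)] by auto
    moreover have "x i = x j" using that(3) 1 by simp
    ultimately show ?thesis using inj_onD[OF injx, of i j] by blast
   next
    case 2
    hence "?x i \<in> A" using xA that by blast
    moreover have "?x j \<in> insert z B" using xB[OF that(2)] x0 2 by (cases "j = 0") auto
    ultimately show ?thesis using that(3) AB by auto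
   next
    case 3
    hence "?x j = z" using that(3) x0 by simp
    thus ?thesis using 3 le xB[OF that(2)] AB by (cases "j = 0") auto
   next
    case 4
    hence "i \<in> (%i. i + 1) ` J" "j \<in> (%i. i + 1) ` J" using pd[OF that(1)] pd[OF that(2)] by auto
    moreover have "y i = y j" using that(3) 4 by simp
    ultimately show ?thesis using inj_onD[OF injy, of i j] by blast
   qed
  qed
  show "i = j" using *[OF ij(1,2,3)] *[OF ij(2,1) ij(3)[symmetric]] by (metis linear)
 qed
 moreover have "?x i ~: inner G (?f j)" if i: "i \<in> ?K" and j: "j \<in> I Un J" for i j
 proof (cases "j < 0")
  case True
  hence jI: "j \<in> I" using j I(2) by auto
  hence jA: "inner G (f j) \<subseteq> A" using A by blast
  consider "i < 0" | "i = 0" | "i > 0" by linarith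
  thus ?thesis
  proof cases
   case 1 thus ?thesis using f neg[OF i] jI True unfolding traced_def by simp
  qed (use xB[OF i] x0 jA AB True in auto)
 next
  case False
  hence jJ: "j \<in> J" using j I(1) by auto
  hence jB: "inner G (g j) \<subseteq> B" using B by blast
  consider "i < 0" | "i = 0" | "i > 0" by linarith
  thus ?thesis
  proof cases
   case 3 thus ?thesis using g pd[OF i] jJ False unfolding traced_def by auto
  qed (use xA[OF i] x0 jB AB False in auto)
 qed
 moreover have "inner G (?f i) Int inner G (?f j) = {}" if ij: "i \<in> I Un J" "j \<in> I Un J" "i ~= j" for i j
 proof -
  have *: "inner G (f i) Int inner G (g j) = {}" if "i \<in> I" "j \<in> J" for i j using A[OF that(1)] B[OF that(2)] AB by blast
  have "i \<in> I \<longleftrightarrow> i < 0" "j \<in> I \<longleftrightarrow> j < 0" "i \<in> J \<longleftrightarrow> \<not> i < 0" "j \<in> J \<longleftrightarrow> \<not> j < 0" using ij(1,2) I by auto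
  thus ?thesis using *[of i j] *[of j i] f g ij(3) unfolding traced_def by (auto split: if_splits)
 qed
 moreover have "at_node G (lend (?f i)) (?x i) & at_node G (rend (?f i)) (?x (i + 1))" if "i \<in> I Un J" for i
 proof (cases "i < 0")
  case True
  hence "i \<in> I" using that I(2) by auto
  thus ?thesis using f True unfolding traced_def by auto
 next
  case False
  hence "i \<in> J" using that I(1) by auto
  thus ?thesis using g False z unfolding traced_def by auto
 qed
 ultimately show ?thesis unfolding traced_def by blast
qed

end

lemma scoin_shift:
 assumes "!!i. i < - int n ==> f' i = f (i - d)" shows "scoin (Seq \<mu> In f) (Seq \<mu> In f')"
proof -
 have *: "tail_branches (Seq \<mu> In f') m = tail_branches (Seq \<mu> In f) (nat (int m + d))"
  if m: "n <= m" "0 <= int m + d" for m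
 proof -
  have "(%i. i - d) ` {..< - int m} = {..< - int (nat (int m + d))}"
  proof (intro equalityI subsetI)
   fix i assume "i \<in> {..< - int (nat (int m + d))}"
   thus "i \<in> (%i. i - d) ` {..< - int m}" using m by (intro image_eqI[of _ _ "i + d"]) auto
  qed (use m in auto)
  from this[symmetric] have "tail_branches (Seq \<mu> In f) (nat (int m + d)) = (\<Union>i\<in>{..< - int m}. pbranches (f (i - d)))"
   unfolding tail_branches_In by simp
  thus ?thesis using assms m(1) unfolding tail_branches_In by auto
 qed
 have "EX m. tail_branches (Seq \<mu> In f') m \<subseteq> tail_branches (Seq \<mu> In f) k" for k
 proof -
  let ?m = "n + nat \<bar>d\<bar> + k"
  have "tail_branches (Seq \<mu> In f') ?m = tail_branches (Seq \<mu> In f) (nat (int ?m + d))" by (rule *) auto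
  also have "\<dots> \<subseteq> tail_branches (Seq \<mu> In f) k" by (rule tail_branches_antimono) auto
  finally show ?thesis by blast
 qed
 moreover have "EX m. tail_branches (Seq \<mu> In f) m \<subseteq> tail_branches (Seq \<mu> In f') k" for k
 proof -
  let ?m = "n + nat \<bar>d\<bar> + k"
  have "tail_branches (Seq \<mu> In f) (nat (int ?m + d)) = tail_branches (Seq \<mu> In f') ?m" by (rule *[symmetric]) auto
  also have "\<dots> \<subseteq> tail_branches (Seq \<mu> In f') k" by (rule tail_branches_antimono) auto
  finally show ?thesis by blast
 qed
 ultimately show ?thesis by (simp add: scoin_def)
qed

context tfg
begin

lemma at_node_scoin:
 assumes "gpath G (Seq \<mu> In f)" "gpath G (Seq \<mu> In f')" "scoin (Seq \<mu> In f) (Seq \<mu> In f')" "at_node G (Seq \<mu> In f) x"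
 shows "at_node G (Seq \<mu> In f') x"
 using at_node_same_tip[OF rigid, of "Seq \<mu> In f" "Seq \<mu> In f'" x] assms by (auto simp: same_tip_def one_ended_def)

lemma seq_first:
 assumes "idx s = {i. i + k \<in> I}" "a \<in> I" "a - 1 ~: I"
 shows "lend (Seq \<mu> s (%i. f (i + k))) = lend (f a)"
 using lend_Seq[of "a - k" s \<mu> "%i. f (i + k)"] assms by (simp add: algebra_simps)

lemma seq_last:
 assumes "idx s = {i. i + k \<in> I}" "b \<in> I" "b + 1 ~: I"
 shows "rend (Seq \<mu> s (%i. f (i + k))) = rend (f b)"
 using rend_Seq[of "b - k" s \<mu> "%i. f (i + k)"] assms by (simp add: algebra_simps)

lemma seq_unbounded_below:
 assumes s: "idx s = {i. i + k \<in> I}" and I: "!!i. i < n ==> i \<in> I"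
 shows "s = In \<or> s = Endless" "lend (Seq \<mu> s (%i. f (i + k))) = Seq \<mu> In (%i. f (i + k))"
proof -
 have "i \<in> idx s" if "i < n - k" for i using s I[of "i + k"] that by simp
 thus "s = In \<or> s = Endless"
 proof (cases s)
  case (Two m) assume *: "!!i. i < n - k ==> i \<in> idx s"
  have "min (n - k) 0 - 1 \<in> idx s" by (rule *) linarith
  hence "0 <= min (n - k) 0 - 1" using Two by simp
  thus ?thesis by linarith
 next
  case Out assume *: "!!i. i < n - k ==> i \<in> idx s"
  have "min (n - k) 0 - 1 \<in> idx s" by (rule *) linarith
  hence "0 <= min (n - k) 0 - 1" using Out by simp
  thus ?thesis by linarith
 qed auto
 thus "lend (Seq \<mu> s (%i. f (i + k))) = Seq \<mu> In (%i. f (i + k))" by auto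
qed

lemma seq_unbounded_above:
 assumes s: "idx s = {i. i + k \<in> I}" and I: "!!i. n < i ==> i \<in> I"
 shows "s = Out \<or> s = Endless" "rend (Seq \<mu> s (%i. f (i + k))) = Seq \<mu> Out (%i. f (i + k))"
proof -
 have "i \<in> idx s" if "n - k < i" for i using s I[of "i + k"] that by simp
 thus "s = Out \<or> s = Endless"
 proof (cases s)
  case (Two m) assume *: "!!i. n - k < i ==> i \<in> idx s"
  have "max (n - k) (int m) + 1 \<in> idx s" by (rule *) linarith
  hence "max (n - k) (int m) + 1 < int m" using Two by simp
  thus ?thesis by linarith
 next
  case In assume *: "!!i. n - k < i ==> i \<in> idx s"
  have "max (n - k) 0 + 1 \<in> idx s" by (rule *) linarith
  hence "max (n - k) 0 + 1 < 0" using In by simp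
  thus ?thesis by linarith
 qed auto
 thus "rend (Seq \<mu> s (%i. f (i + k))) = Seq \<mu> Out (%i. f (i + k))" by auto
qed

lemma prev_Out: "prev (Seq \<mu> Out f) = Seq \<mu> In (%i. prev (f (- 1 - i)))"
 by (simp add: prev.simps)

lemma at_node_Out_shift:
 assumes g: "gpath G (Seq \<mu> Out f)" "gpath G (Seq \<mu> Out f')" and e: "!!i. int n <= i ==> f' i = f (i + d)"
  and x: "at_node G (Seq \<mu> Out f) x"
 shows "at_node G (Seq \<mu> Out f') x"
proof -
 have g': "gpath G (prev (Seq \<mu> Out f))" "gpath G (prev (Seq \<mu> Out f'))" using g by simp_all
 have "scoin (prev (Seq \<mu> Out f)) (prev (Seq \<mu> Out f'))"
  unfolding prev_Out
 proof (rule scoin_shift[of n])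
  fix i assume "i < - int n"
  thus "prev (f' (- 1 - i)) = prev (f (- 1 - (i - d)))" using e[of "- 1 - i"] by (simp add: algebra_simps)
 qed
 moreover have "at_node G (prev (Seq \<mu> Out f)) x" using at_node_trev[OF x] g' by simp
 ultimately have "at_node G (prev (Seq \<mu> Out f')) x" using at_node_scoin g' unfolding prev_Out by blast
 moreover have "trev (prev (Seq \<mu> Out f')) = Seq \<mu> Out f'" using trev_trev[of "Seq \<mu> Out f'"] by simp
 ultimately show ?thesis using at_node_trev[of "prev (Seq \<mu> Out f')" x] g by simp
qed

lemma seqsets_inner: "seqsets G I f x P ==> i \<in> I ==> inner G (f i) \<subseteq> inner G P"
 "seqsets G I f x P ==> i - 1 \<in> I ==> i \<in> I ==> x i \<in> inner G P"
 by (auto simp: seqsets_def)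

lemma seqpre_arc: "seqpre G \<mu> I f x ==> i \<in> I ==> arc (x i) (f i) (x (i + 1))"
 using traced_arc unfolding seqpre_def by blast

lemma raise_one:
 assumes "arc x P y" "prank P < \<mu>" "prank P = Elem ==> \<mu> = Rk 0" "\<mu> ~= Arr"
 shows "gpath G (Seq \<mu> (Two 1) (%_. P))" "pbranches (Seq \<mu> (Two 1) (%_. P)) = pbranches P"
  "inner G (Seq \<mu> (Two 1) (%_. P)) = inner G P" "lend (Seq \<mu> (Two 1) (%_. P)) = lend P"
  "rend (Seq \<mu> (Two 1) (%_. P)) = rend P"
proof -
 have i: "{0..<int 1} = {0}" by auto
 have "traced G (idx (Two 1)) (%_. P) (%i. if i <= 0 then x else y)"
  using assms(1) unfolding arc_def traced_def by (auto simp: i inj_on_def)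
 hence "tracing G (Two 1) (%_. P)" using tracing_traced by blast
 moreover have "junction_ranks \<mu> (Two 1) (%_. P)" using assms(4) by (auto simp: junction_ranks_def junctions_def)
 ultimately show "gpath G (Seq \<mu> (Two 1) (%_. P))"
  using assms by (intro gpath.sequence) (auto simp: arc_def)
qed (auto simp: inner.simps(2))

text \<open>One constituent makes a path of higher rank out of a path. A single branch is a
  constituent of 0-paths only, so it is wrapped twice.\<close>

lemma raise:
 assumes "arc x P y" "prank P <= Rk n"
 shows "EX s f. gpath G (Seq (Rk n) s f) & pbranches (Seq (Rk n) s f) = pbranches P &
  inner G (Seq (Rk n) s f) = inner G P & lend (Seq (Rk n) s f) = lend P & rend (Seq (Rk n) s f) = rend P"
proof -
 consider (eq) "prank P = Rk n" | (lt) "prank P < Rk n" "prank P ~= Elem \<or> n = 0" | (br) "prank P = Elem" "n ~= 0"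
  using assms(2) by (metis order_le_less)
 thus ?thesis
 proof cases
  case eq
  then obtain s f where "P = Seq (Rk n) s f" by (cases P) auto
  thus ?thesis using assms by (auto simp: arc_def)
 next
  case lt thus ?thesis using raise_one[OF assms(1), of "Rk n"] by blast
 next
  case br
  let ?P = "Seq (Rk 0) (Two 1) (%_. P)"
  note r = raise_one[OF assms(1), of "Rk 0"]
  have "arc x ?P y" using r br assms(1) unfolding arc_def by (simp del: lend.simps rend.simps)
  note q = raise_one[OF this, of "Rk n"]
  show ?thesis
   by (intro exI[of _ "Two 1"] exI[of _ "%_. ?P"])
    (use r q br in \<open>simp del: lend.simps rend.simps pbranches.simps One_nat_def\<close>)
 qed
qed

text \<open>Two sequences are joined either at their common node, or by merging the two constituents there.\<close>

lemma glue_seq: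
 assumes I: "I \<subseteq> {..<0}" "!!i. i \<in> I ==> i + 1 < 0 ==> i + 1 \<in> I"
  and J: "J \<subseteq> {0..}" "!!j. j \<in> J ==> 0 < j ==> j - 1 \<in> J" "0 \<in> J"
  and f: "seqpre G \<mu> I f x" and g: "seqpre G \<mu> J g y" and z: "x 0 = y 0"
  and A: "!!i. i \<in> I ==> x i \<in> A & inner G (f i) \<subseteq> A" and B: "!!j. j \<in> J ==> y (j + 1) \<in> B & inner G (g j) \<subseteq> B"
  and AB: "A Int B = {}" "y 0 ~: A" "y 0 ~: B"
  and jr: "\<mu> ~= Arr ==> -1 \<in> I ==> max (prank (rend (f (-1)))) (prank (lend (g 0))) = rpred \<mu>"
 shows "seqpre G \<mu> (I Un J) (%i. if i < 0 then f i else g i) (%i. if i <= 0 then x i else y i)"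
 unfolding seqpre_def
proof (intro conjI)
 show "traced G (I Un J) (%i. if i < 0 then f i else g i) (%i. if i <= 0 then x i else y i)"
 proof -
  have t: "traced G I f x" "traced G J g y" using f g by (simp_all add: seqpre_def)
  show ?thesis
   by (rule traced_glue[where A = A and B = B and z = "y 0"]) (use I J t z A B AB in auto)
 qed
 show "\<mu> ~= Arr --> (ALL i. i - 1 \<in> I Un J & i \<in> I Un J --> jrank (%i. if i < 0 then f i else g i) i = rpred \<mu>)"
 proof (intro impI allI, elim conjE)
  fix i assume m: "\<mu> ~= Arr" and i: "i - 1 \<in> I Un J" "i \<in> I Un J"
  consider "i < 0" | "i = 0" | "i > 0" by linarith
  thus "jrank (%i. if i < 0 then f i else g i) i = rpred \<mu>"
  proof cases
   case 1
   hence "i - 1 \<in> I" "i \<in> I" using i J(1) by auto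
   hence "jrank f i = rpred \<mu>" using f m unfolding seqpre_def by blast
   thus ?thesis using 1 by (simp add: jrank_def)
  next
   case 2
   hence "-1 \<in> I" using i J(1) by auto
   thus ?thesis using jr[OF m] 2 by (simp add: jrank_def)
  next
   case 3
   hence "i - 1 \<in> J" "i \<in> J" using i I(1) by auto
   hence "jrank g i = rpred \<mu>" using g m unfolding seqpre_def by blast
   thus ?thesis using 3 by (simp add: jrank_def)
  qed
 qed
 show "\<forall>i\<in>I Un J. gpath G (if i < 0 then f i else g i) & prank (if i < 0 then f i else g i) < \<mu> &
    (prank (if i < 0 then f i else g i) = Elem --> \<mu> = Rk 0)"
  using f g I(1) J(1) unfolding seqpre_def by auto
qed

lemma glue_convex:
 assumes I: "I \<subseteq> {..<(0::int)}" "!!i. i \<in> I ==> i + 1 < 0 ==> i + 1 \<in> I"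
  and J: "J \<subseteq> {0..}" "!!j. j \<in> J ==> 0 < j ==> j - 1 \<in> J" "0 \<in> J"
 shows "i \<in> I Un J ==> k \<in> I Un J ==> i <= j ==> j <= k ==> j \<in> I Un J"
proof -
 assume i: "i \<in> I Un J" and k: "k \<in> I Un J" and ij: "i <= j" "j <= k"
 have up: "j < 0 ==> j \<in> I" if "i \<in> I" using ij(1)
  by (induction j rule: int_ge_induct) (use that I(2) in auto)
 have down: "0 <= j ==> j \<in> J" if "k \<in> J" using ij(2)
  by (induction j rule: int_le_induct) (use that J(2) in auto)
 show ?thesis
 proof (cases "j < 0")
  case True
  hence "i \<in> I" using i ij J(1) by auto
  thus ?thesis using up True by blast
 next
  case False
  hence "k \<in> J" using k ij I(1) by auto
  thus ?thesis using down False by auto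
 qed
qed

end

lemma seqpre_mono: "seqpre G \<mu> I f x ==> J \<subseteq> I ==> seqpre G \<mu> J f x"
 using traced_mono[of G I f x J] unfolding seqpre_def by blast

lemma glue_sets:
 assumes I: "I \<subseteq> {..<0}" and J: "J \<subseteq> {0..}" "0 \<in> J"
 shows "(\<Union>i\<in>I Un J. h (if i < 0 then f i else g i)) = (\<Union>i\<in>I. h (f i)) Un (\<Union>i\<in>J. h (g i))"
  "{(if i <= 0 then x i else y i) | i :: int. i - 1 \<in> I Un J & i \<in> I Un J} =
   {x i | i. i - 1 \<in> I & i \<in> I} Un {y i | i. i - 1 \<in> J & i \<in> J} Un (if -1 \<in> I then {x 0} else {})"
proof -
 show "(\<Union>i\<in>I Un J. h (if i < 0 then f i else g i)) = (\<Union>i\<in>I. h (f i)) Un (\<Union>i\<in>J. h (g i))"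
  using I J by force
 have 1: "i - 1 \<in> I Un J & i \<in> I Un J \<longleftrightarrow> (i < 0 & i - 1 \<in> I & i \<in> I) \<or> (i = 0 & -1 \<in> I) \<or> (0 < i & i - 1 \<in> J & i \<in> J)" for i
 proof -
  have "k \<in> I ==> k < 0" "k \<in> J ==> 0 <= k" for k using I J by auto
  from this[of i] this[of "i - 1"] J(2) show ?thesis by (cases "i < 0"; cases "i = 0") auto
 qed
 have 2: "i - 1 \<in> I & i \<in> I \<longleftrightarrow> i < 0 & i - 1 \<in> I & i \<in> I" for i using I by auto
 have 3: "i - 1 \<in> J & i \<in> J \<longleftrightarrow> 0 < i & i - 1 \<in> J & i \<in> J" for i using J by auto
 show "{(if i <= 0 then x i else y i) | i :: int. i - 1 \<in> I Un J & i \<in> I Un J} =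
   {x i | i. i - 1 \<in> I & i \<in> I} Un {y i | i. i - 1 \<in> J & i \<in> J} Un (if -1 \<in> I then {x 0} else {})"
 proof -
  have "{x i | i. i - 1 \<in> I & i \<in> I} = {x i | i. i < 0 & i - 1 \<in> I & i \<in> I}" using 2 by blast
  moreover have "{y i | i. i - 1 \<in> J & i \<in> J} = {y i | i. 0 < i & i - 1 \<in> J & i \<in> J}" using 3 by blast
  moreover have "{(if i <= 0 then x i else y i) | i :: int. i - 1 \<in> I Un J & i \<in> I Un J} =
   {x i | i. i < 0 & i - 1 \<in> I & i \<in> I} Un {y i | i. 0 < i & i - 1 \<in> J & i \<in> J} Un (if -1 \<in> I then {x 0} else {})"
  proof (intro equalityI subsetI)
   fix v assume "v \<in> {(if i <= 0 then x i else y i) | i :: int. i - 1 \<in> I Un J & i \<in> I Un J}"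
   then obtain i where i: "v = (if i <= 0 then x i else y i)" "i - 1 \<in> I Un J & i \<in> I Un J" by blast
   from i(2)[unfolded 1] show "v \<in> {x i | i. i < 0 & i - 1 \<in> I & i \<in> I} Un {y i | i. 0 < i & i - 1 \<in> J & i \<in> J} Un (if -1 \<in> I then {x 0} else {})"
    using i(1) by auto
  next
   fix v assume "v \<in> {x i | i. i < 0 & i - 1 \<in> I & i \<in> I} Un {y i | i. 0 < i & i - 1 \<in> J & i \<in> J} Un (if -1 \<in> I then {x 0} else {})"
   then consider (a) i where "v = x i" "i < 0" "i - 1 \<in> I" "i \<in> I" | (b) i where "v = y i" "0 < i" "i - 1 \<in> J" "i \<in> J"
    | (c) "v = x 0" "-1 \<in> I" by (auto split: if_splits)
   thus "v \<in> {(if i <= 0 then x i else y i) | i :: int. i - 1 \<in> I Un J & i \<in> I Un J}"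
   proof cases
    case a thus ?thesis using 1[of i] by (intro CollectI exI[of _ i]) auto
   next
    case b thus ?thesis using 1[of i] by (intro CollectI exI[of _ i]) auto
   next
    case c thus ?thesis using 1[of 0] by (intro CollectI exI[of _ 0]) auto
   qed
  qed
  ultimately show ?thesis by simp
 qed
qed

section \<open>Normal forms around a common node, and merging of constituents\<close>

context tfg
begin

text \<open>Predicts the left end of the assembled path: the first constituent decides, or, if there
  is none, a one-ended path \<open>g\<close> with the same entries up to a shift \<open>d\<close>,
  whose tip is not changed by altering entries near index \<open>0\<close>.\<close>

definition left_end :: "rank => int set => (int => 'b tpath) => (int => 'b node) => rank => 'b node => bool" where
 "left_end \<mu> I f x r v \<longleftrightarrow> (\<exists>a\<in>I. a - 1 ~: I & prank (lend (f a)) = r & x a = v) \<or>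
   {..<0} \<subseteq> I & r = \<mu> & (EX g d. gpath G (Seq \<mu> In g) & at_node G (Seq \<mu> In g) v & (\<forall>i<0. f i = g (i - d)))"

definition right_end :: "rank => int set => (int => 'b tpath) => (int => 'b node) => rank => 'b node => bool" where
 "right_end \<mu> I f x r v \<longleftrightarrow> (\<exists>b\<in>I. b + 1 ~: I & prank (rend (f b)) = r & x (b + 1) = v) \<or>
   {0<..} \<subseteq> I & r = \<mu> & (EX g d. gpath G (Seq \<mu> Out g) & at_node G (Seq \<mu> Out g) v & (\<forall>i>0. f i = g (i + d)))"

lemma seq_ends:
 assumes g: "gpath G (Seq \<mu> s (%i. f (i + k)))" and s: "idx s = {i. i + k \<in> I}" and p: "seqpre G \<mu> I f x"
 shows "left_end \<mu> I f x r v ==> at_node G (lend (Seq \<mu> s (%i. f (i + k)))) v & prank (lend (Seq \<mu> s (%i. f (i + k)))) = r"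
  "right_end \<mu> I f x r v ==> at_node G (rend (Seq \<mu> s (%i. f (i + k)))) v & prank (rend (Seq \<mu> s (%i. f (i + k)))) = r"
proof -
 let ?P = "Seq \<mu> s (%i. f (i + k))"
 have t: "at_node G (lend (f i)) (x i)" "at_node G (rend (f i)) (x (i + 1))" if "i \<in> I" for i
  using p that unfolding seqpre_def traced_def by auto
 have ge: "gpath G (lend ?P)" "gpath G (rend ?P)" using gpath_ends[OF g] by auto
 {
  assume "left_end \<mu> I f x r v"
  then consider (a) a where "a \<in> I" "a - 1 ~: I" "prank (lend (f a)) = r" "x a = v"
   | (b) h d where "{..<0} \<subseteq> I" "r = \<mu>" "gpath G (Seq \<mu> In h)" "at_node G (Seq \<mu> In h) v" "\<forall>i<0. f i = h (i - d)"
   unfolding left_end_def by blast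
  thus "at_node G (lend ?P) v & prank (lend ?P) = r"
  proof cases
   case a thus ?thesis using seq_first[OF s a(1,2), of \<mu> f] t(1)[OF a(1)] by (simp del: lend.simps)
  next
   case b
   have "i \<in> I" if "i < 0" for i using b(1) that by auto
   from seq_unbounded_below(2)[OF s this] have l: "lend ?P = Seq \<mu> In (%i. f (i + k))" by blast
   have "scoin (Seq \<mu> In h) (Seq \<mu> In (%i. f (i + k)))"
   proof (rule scoin_shift[of "nat \<bar>k\<bar>"])
    fix i assume "i < - int (nat \<bar>k\<bar>)"
    hence "i + k < 0" by linarith
    thus "f (i + k) = h (i - (d - k))" using b(5) by (simp add: algebra_simps)
   qed
   thus ?thesis using at_node_scoin[OF b(3) ge(1)[unfolded l]] b(2,4) l by simp
  qed
 next
  assume "right_end \<mu> I f x r v"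
  then consider (a) a where "a \<in> I" "a + 1 ~: I" "prank (rend (f a)) = r" "x (a + 1) = v"
   | (b) h d where "{0<..} \<subseteq> I" "r = \<mu>" "gpath G (Seq \<mu> Out h)" "at_node G (Seq \<mu> Out h) v" "\<forall>i>0. f i = h (i + d)"
   unfolding right_end_def by blast
  thus "at_node G (rend ?P) v & prank (rend ?P) = r"
  proof cases
   case a thus ?thesis using seq_last[OF s a(1,2), of \<mu> f] t(2)[OF a(1)] by (simp del: rend.simps)
  next
   case b
   have "i \<in> I" if "0 < i" for i using b(1) that by auto
   from seq_unbounded_above(2)[OF s this] have l: "rend ?P = Seq \<mu> Out (%i. f (i + k))" by blast
   have "at_node G (Seq \<mu> Out (%i. f (i + k))) v"
   proof (rule at_node_Out_shift[OF b(3) ge(2)[unfolded l] _ b(4)])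
    fix i assume "int (nat \<bar>k\<bar> + 1) <= i"
    hence "i + k > 0" by linarith
    thus "f (i + k) = h (i + (k + d))" using b(5) by (simp add: algebra_simps)
   qed
   thus ?thesis using b(2) l by simp
  qed
 }
qed

text \<open>Renumbers the left path so that its last constituent has index \<open>-1\<close> and the
  common node \<open>z\<close> index \<open>0\<close>. For shape \<open>In\<close> nothing moves,
  which the arrow rank relies on.\<close>

lemma left_form:
 assumes g: "gpath G (Seq \<mu> s f)" and s: "s ~= Out" "s ~= Endless" and x: "at_node G (lend (Seq \<mu> s f)) x"
  and z: "at_node G (rend (Seq \<mu> s f)) z"
 obtains I h u where "I \<subseteq> {..<0}" "-1 \<in> I" "!!i. i \<in> I ==> i + 1 < 0 ==> i + 1 \<in> I" "seqpre G \<mu> I h u"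
  "seqsets G I h u (Seq \<mu> s f)" "u 0 = z" "prank (rend (h (-1))) = prank (rend (Seq \<mu> s f))"
  "!!i. i \<in> I ==> u i \<in> insert x (inner G (Seq \<mu> s f))"
  "left_end \<mu> I h u (prank (lend (Seq \<mu> s f))) x"
  "s = In ==> I = {..<0} & h = f"
proof -
 let ?P = "Seq \<mu> s f"
 obtain v where v: "seqpre G \<mu> (idx s) f v" "seqsets G (idx s) f v ?P" using gpath_seqpre[OF g] by blast
 have t: "at_node G (lend (f i)) (v i)" "at_node G (rend (f i)) (v (i + 1))" if "i \<in> idx s" for i
  using v(1) that unfolding seqpre_def traced_def by auto
 obtain b where b: "b \<in> idx s" "b + 1 ~: idx s" "rend ?P = rend (f b)"
  using rend_cases[OF gpath_SeqD(2)[OF g], of \<mu> f] s by metis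
 let ?k = "b + 1"
 let ?I = "{i. i + ?k \<in> idx s}" and ?h = "%i. f (i + ?k)" and ?u = "%i. v (i + ?k)"
 have bmax: "i <= b" if "i \<in> idx s" for i using idx_convex[OF b(1) that, of "b + 1"] b(2) by force
 have bIn: "b = -1" if "s = In" using b that by auto
 show ?thesis
 proof (rule that[of ?I ?h ?u])
  show "?I \<subseteq> {..<0}" using bmax by force
  show "-1 \<in> ?I" using b by simp
  show "i + 1 \<in> ?I" if "i \<in> ?I" "i + 1 < 0" for i
   using idx_convex[of "i + ?k" s b "i + 1 + ?k"] that b(1) by simp
  show "seqpre G \<mu> ?I ?h ?u" by (rule seqpre_shift[OF v(1)])
  show "seqsets G ?I ?h ?u ?P" using v(2) by (simp only: seqsets_shift)
  show "?u 0 = z" using t(2)[OF b(1)] z b(3) at_node_inject by (simp del: rend.simps)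
  show "prank (rend (?h (-1))) = prank (rend ?P)" using b(3) by (simp del: rend.simps)
  show "?u i \<in> insert x (inner G ?P)" if i: "i \<in> ?I" for i
  proof (cases "i + ?k - 1 \<in> idx s")
   case True thus ?thesis using seqsets_inner(2)[OF v(2) True] i by simp
  next
   case False
   hence "lend ?P = lend (f (i + ?k))" using lend_Seq[of "i + ?k" s \<mu> f] i by (simp del: lend.simps)
   hence "?u i = x" using t(1)[of "i + ?k"] i x at_node_inject by (simp del: lend.simps)
   thus ?thesis by simp
  qed
  show "left_end \<mu> ?I ?h ?u (prank (lend ?P)) x"
  proof (rule lend_cases[OF gpath_SeqD(2)[OF g], of \<mu> f])
   fix a assume a: "a \<in> idx s" "a - 1 ~: idx s" "lend ?P = lend (f a)"
   have "v a = x" using t(1)[OF a(1)] a(3) x at_node_inject by metis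
   thus ?thesis using a unfolding left_end_def
    by (intro disjI1 bexI[of _ "a - ?k"]) (auto simp: algebra_simps simp del: lend.simps)
  next
   assume o: "s = In \<or> s = Endless" "lend ?P = Seq \<mu> In f"
   hence "s = In" using s by auto
   thus ?thesis using o(2) x g bIn unfolding left_end_def
    by (intro disjI2 conjI exI[of _ f] exI[of _ 0]) auto
  qed
  show "s = In ==> ?I = {..<0} & ?h = f" using bIn by auto
 qed
qed

lemma right_form:
 assumes g: "gpath G (Seq \<mu> s f)" and s: "s ~= In" "s ~= Endless" and y: "at_node G (rend (Seq \<mu> s f)) y"
  and z: "at_node G (lend (Seq \<mu> s f)) z"
 obtains u where "idx s \<subseteq> {0..}" "0 \<in> idx s" "!!i. i \<in> idx s ==> 0 < i ==> i - 1 \<in> idx s" "seqpre G \<mu> (idx s) f u"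
  "seqsets G (idx s) f u (Seq \<mu> s f)" "u 0 = z" "lend (f 0) = lend (Seq \<mu> s f)"
  "!!i. i \<in> idx s ==> u (i + 1) \<in> insert y (inner G (Seq \<mu> s f))"
  "right_end \<mu> (idx s) f u (prank (rend (Seq \<mu> s f))) y"
proof -
 let ?P = "Seq \<mu> s f"
 obtain v where v: "seqpre G \<mu> (idx s) f v" "seqsets G (idx s) f v ?P" using gpath_seqpre[OF g] by blast
 have t: "at_node G (lend (f i)) (v i)" "at_node G (rend (f i)) (v (i + 1))" if "i \<in> idx s" for i
  using v(1) that unfolding seqpre_def traced_def by auto
 have 0: "0 \<in> idx s" "-1 ~: idx s" using first_idx[of s] s gpath_SeqD(2)[OF g] by auto
 have l: "lend ?P = lend (f 0)" using lend_Seq[of 0 s \<mu> f] 0 by simp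
 show ?thesis
 proof (rule that[of v])
  show "idx s \<subseteq> {0..}" using s by (cases s) auto
  show "i - 1 \<in> idx s" if "i \<in> idx s" "0 < i" for i
   using idx_convex[OF 0(1) that(1), of "i - 1"] that by simp
  show "v 0 = z" using t(1)[OF 0(1)] z l at_node_inject by (simp del: lend.simps)
  show "v (i + 1) \<in> insert y (inner G ?P)" if i: "i \<in> idx s" for i
  proof (cases "i + 1 \<in> idx s")
   case True thus ?thesis using seqsets_inner(2)[OF v(2), of "i + 1"] i by simp
  next
   case False
   hence "rend ?P = rend (f i)" using rend_Seq[of i s \<mu> f] i by (simp del: rend.simps)
   hence "v (i + 1) = y" using t(2)[of i] i y at_node_inject by (simp del: rend.simps)
   thus ?thesis by simp
  qed
  show "right_end \<mu> (idx s) f v (prank (rend ?P)) y"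
  proof (rule rend_cases[OF gpath_SeqD(2)[OF g], of \<mu> f])
   fix a assume a: "a \<in> idx s" "a + 1 ~: idx s" "rend ?P = rend (f a)"
   have "v (a + 1) = y" using t(2)[OF a(1)] a(3) y at_node_inject by metis
   thus ?thesis using a unfolding right_end_def
    by (intro disjI1 bexI[of _ "a"]) (auto simp del: rend.simps)
  next
   assume o: "s = Out \<or> s = Endless" "rend ?P = Seq \<mu> Out f"
   hence "s = Out" using s by auto
   thus ?thesis using o(2) y g unfolding right_end_def
    by (intro disjI2 conjI exI[of _ f] exI[of _ 0]) auto
  qed
 qed (use 0 v l in auto)
qed

text \<open>The new first constituent ends with a tip of the same rank as the old one, so the rank
  of junction \<open>1\<close> is preserved.\<close>

lemma seqpre_replace:
 assumes J: "J \<subseteq> {0..}" "!!j. j \<in> J ==> 0 < j ==> j - 1 \<in> J" "0 \<in> J" and g: "seqpre G \<mu> J g y"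
  and C: "gpath G C" "prank C < \<mu>" "prank C = Elem ==> \<mu> = Rk 0" "at_node G (lend C) w" "at_node G (rend C) (y 1)"
   "prank (rend C) = prank (rend (g 0))"
  and w: "w ~: inner G C" "!!j. j \<in> J ==> w ~= y (j + 1)" "!!j. j \<in> J ==> 0 < j ==> w ~: inner G (g j)"
  and d: "!!j. j \<in> J ==> y (j + 1) ~: inner G C" "!!j. j \<in> J ==> 0 < j ==> inner G C Int inner G (g j) = {}"
 shows "seqpre G \<mu> J (g(0 := C)) (y(0 := w))"
proof -
 let ?g = "g(0 := C)" and ?y = "y(0 := w)"
 have t: "traced G J g y" using g by (simp add: seqpre_def)
 have nn: "0 <= j" if "j \<in> J" for j using J(1) that by auto
 have dom: "i = 0 \<or> (0 < i & i - 1 \<in> J)" if "i \<in> J Un (%i. i + 1) ` J" for i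
  using that nn J(2) by force
 have "traced G J ?g ?y"
  unfolding traced_def
 proof (intro conjI ballI impI)
  fix i assume i: "i \<in> J"
  show "at_node G (lend (?g i)) (?y i)" using t C(4) i by (auto simp: traced_def)
  show "at_node G (rend (?g i)) (?y (i + 1))" using t C(5) i nn[OF i] by (auto simp: traced_def)
 next
  show "inj_on ?y (J Un (%i. i + 1) ` J)"
  proof (rule inj_onI)
   fix i j assume ij: "i \<in> J Un (%i. i + 1) ` J" "j \<in> J Un (%i. i + 1) ` J" "?y i = ?y j"
   have "inj_on y (J Un (%i. i + 1) ` J)" using t by (simp add: traced_def)
   moreover have "?y 0 ~= ?y k" if "k \<in> J Un (%i. i + 1) ` J" "0 < k" for k
    using dom[OF that(1)] w(2)[of "k - 1"] that by auto
   ultimately show "i = j" using dom[OF ij(1)] dom[OF ij(2)] ij inj_onD[of y _ i j]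
    by (metis fun_upd_other less_irrefl)
  qed
 next
  fix i j assume i: "i \<in> J Un (%i. i + 1) ` J" and j: "j \<in> J"
  have "y i ~: inner G (g j)" using t i j unfolding traced_def by blast
  thus "?y i ~: inner G (?g j)"
   using dom[OF i] w(1) w(3)[OF j] d(1)[of "i - 1"] nn[OF j] by auto
 next
  fix i j assume "i \<in> J" "j \<in> J" "i ~= j"
  thus "inner G (?g i) Int inner G (?g j) = {}"
   using t d(2)[of i] d(2)[of j] nn[of i] nn[of j] unfolding traced_def by (auto split: if_splits)
 qed
 moreover have "jrank ?g i = rpred \<mu>" if "\<mu> ~= Arr" "i - 1 \<in> J" "i \<in> J" for i
 proof -
  have "jrank g i = rpred \<mu>" using g that by (simp add: seqpre_def)
  moreover have "0 < i" using nn[OF that(2)] by simp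
  ultimately show ?thesis using C(6) by (auto simp: jrank_def)
 qed
 ultimately show ?thesis using g C(1,2,3) unfolding seqpre_def by auto
qed

lemma seqsets_replace:
 assumes "0 \<in> J" "J \<subseteq> {0..}"
 shows "(\<Union>i\<in>J. h ((g(0 := C)) i)) = h C Un (\<Union>i\<in>J - {0}. h (g i))"
  "{(y(0 := w)) i | i :: int. i - 1 \<in> J & i \<in> J} = {y i | i. i - 1 \<in> J & i \<in> J}"
proof -
 show "(\<Union>i\<in>J. h ((g(0 := C)) i)) = h C Un (\<Union>i\<in>J - {0}. h (g i))" using assms(1) by (auto split: if_splits)
 have n: "i ~= 0" if "i - 1 \<in> J" for i using that assms(2) by auto
 hence "(EX i. v = (y(0 := w)) i & i - 1 \<in> J & i \<in> J) \<longleftrightarrow> (EX i. v = y i & i - 1 \<in> J & i \<in> J)" for v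
  by (metis fun_upd_other)
 thus "{(y(0 := w)) i | i :: int. i - 1 \<in> J & i \<in> J} = {y i | i. i - 1 \<in> J & i \<in> J}" by simp
qed

end

lemma insert_shuffle: "X Un N Un insert z (H Un W) = insert z ((X Un H Un N) Un W)"
 by blast

context tfg
begin

lemma seq_assemble:
 assumes p: "seqpre G \<mu> I f x" "\<mu> ~= Elem" "I ~= {}" and conv: "!!i j k. i \<in> I ==> k \<in> I ==> i <= j ==> j <= k ==> j \<in> I"
  and Arr: "\<mu> = Arr ==> EX a. I = {a..} & (ALL i j. a < i & i < j --> jrank f i < jrank f j)"
  and l: "left_end \<mu> I f x r v" and r: "right_end \<mu> I f x r' v'"
 shows "EX R. gpath G R & prank R = \<mu> & seqsets G I f x R & at_node G (lend R) v & prank (lend R) = r &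
  at_node G (rend R) v' & prank (rend R) = r'"
proof -
 obtain s k where R: "gpath G (Seq \<mu> s (%i. f (i + k)))" "idx s = {i. i + k \<in> I}" "seqsets G I f x (Seq \<mu> s (%i. f (i + k)))"
 proof (rule seqpre_gpath[OF p])
  show "j \<in> I" if "i \<in> I" "k \<in> I" "i <= j" "j <= k" for i j k using that by (rule conv)
  show "EX a. I = {a..} & (ALL i j. a < i & i < j --> jrank f i < jrank f j)" if "\<mu> = Arr" using that by (rule Arr)
 qed (rule that)
 show ?thesis
  using R seq_ends(1)[OF R(1,2) p(1) l] seq_ends(2)[OF R(1,2) p(1) r]
  by (intro exI[of _ "Seq \<mu> s (%i. f (i + k))"]) (simp del: lend.simps rend.simps)
qed

text \<open>The case in which the path \<open>A\<close> arriving at \<open>y 0\<close> cannot become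
  a constituent of its own, because the junction would have too small a rank: \<open>A\<close> and
  \<open>g 0\<close> are merged into \<open>C\<close>.\<close>

lemma merge_first:
 assumes J: "J \<subseteq> {0..}" "!!j. j \<in> J ==> 0 < j ==> j - 1 \<in> J" "0 \<in> J" and g: "seqpre G \<mu> J g y" "seqsets G J g y Q"
  and e: "!!i. i \<in> J ==> y (i + 1) \<in> insert e (inner G Q)"
  and A: "arc w A (y 0)" "w ~: insert e (inner G Q)" "inner G A Int insert e (inner G Q) = {}"
  and C: "joined w (y 0) (y 1) A (g 0) C" "prank C < \<mu>"
 shows "seqpre G \<mu> J (g(0 := C)) (y(0 := w))"
  "right_end \<mu> J g y r v ==> right_end \<mu> J (g(0 := C)) (y(0 := w)) r v"
  "pbranches A Un pbranches Q = (\<Union>i\<in>J. pbranches ((g(0 := C)) i))"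
  "insert (y 0) (inner G A Un inner G Q) = (\<Union>i\<in>J. inner G ((g(0 := C)) i)) Un {(y(0 := w)) i | i. i - 1 \<in> J & i \<in> J}"
  "!!i. i \<in> J ==> (y(0 := w)) (i + 1) \<in> insert e (inner G Q)"
proof -
 have C': "gpath G C" "inner G C = insert (y 0) (inner G A Un inner G (g 0))" "at_node G (lend C) w" "at_node G (rend C) (y 1)"
  "prank (rend C) = prank (rend (g 0))" "pbranches C = pbranches A Un pbranches (g 0)" using C by (auto simp: joined_def)
 have t: "inj_on y (J Un (%i. i + 1) ` J)" "!!i j. i \<in> J Un (%i. i + 1) ` J ==> j \<in> J ==> y i ~: inner G (g j)"
   "!!i j. i \<in> J ==> j \<in> J ==> i ~= j ==> inner G (g i) Int inner G (g j) = {}"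
  using g(1) unfolding seqpre_def traced_def by auto
 have gQ: "inner G (g j) \<subseteq> inner G Q" if "j \<in> J" for j using seqsets_inner(1)[OF g(2) that] .
 have nn: "0 <= j" if "j \<in> J" for j using J(1) that by auto
 show "seqpre G \<mu> J (g(0 := C)) (y(0 := w))"
 proof (rule seqpre_replace[OF J g(1) C'(1) C(2) _ C'(3,4,5)])
  assume "prank C = Elem"
  then obtain b s where "C = Br b s" using gpath_Elem[OF C'(1)] by auto
  thus "\<mu> = Rk 0" using C'(2) by auto
 next
  show "w ~: inner G C" using A gQ[OF J(3)] unfolding C'(2) by (auto simp: arc_def)
  show "w ~= y (j + 1)" if "j \<in> J" for j using e[OF that] A(2) by auto
  show "w ~: inner G (g j)" if "j \<in> J" "0 < j" for j using gQ[OF that(1)] A(2) by auto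
  show "y (j + 1) ~: inner G C" if "j \<in> J" for j
  proof -
   have "y (j + 1) ~= y 0" using inj_onD[OF t(1), of "j + 1" 0] that J(3) nn[OF that] by auto
   moreover have "y (j + 1) ~: inner G (g 0)" using t(2)[of "j + 1" 0] that J(3) by auto
   ultimately show ?thesis using e[OF that] A(3) unfolding C'(2) by blast
  qed
  show "inner G C Int inner G (g j) = {}" if "j \<in> J" "0 < j" for j
  proof -
   have "y 0 ~: inner G (g j)" using t(2)[of 0 j] that J(3) by auto
   moreover have "inner G (g 0) Int inner G (g j) = {}" using t(3)[of 0 j] that J(3) by auto
   ultimately show ?thesis using A(3) gQ[OF that(1)] unfolding C'(2) by blast
  qed
 qed
 show "right_end \<mu> J (g(0 := C)) (y(0 := w)) r v" if "right_end \<mu> J g y r v"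
 proof -
  from that consider (a) b where "b \<in> J" "b + 1 ~: J" "prank (rend (g b)) = r" "y (b + 1) = v"
   | (b) h d where "{0<..} \<subseteq> J" "r = \<mu>" "gpath G (Seq \<mu> Out h)" "at_node G (Seq \<mu> Out h) v" "\<forall>i>0. g i = h (i + d)"
   unfolding right_end_def by blast
  thus ?thesis
  proof cases
   case a thus ?thesis unfolding right_end_def using nn[OF a(1)] C'(5)
    by (intro disjI1 bexI[of _ b]) auto
  next
   case b thus ?thesis unfolding right_end_def by (intro disjI2 conjI exI[of _ h] exI[of _ d]) auto
  qed
 qed
 have un: "(\<Union>i\<in>J. h (g i)) = h (g 0) Un (\<Union>i\<in>J - {0}. h (g i))" for h :: "'b tpath => 'c set" using J(3) by blast
 show "pbranches A Un pbranches Q = (\<Union>i\<in>J. pbranches ((g(0 := C)) i))"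
 proof -
  have "pbranches Q = pbranches (g 0) Un (\<Union>i\<in>J - {0}. pbranches (g i))"
   using g(2) un[of pbranches] by (simp add: seqsets_def)
  thus ?thesis unfolding seqsets_replace(1)[OF J(3,1), of pbranches] C'(6) by blast
 qed
 show "insert (y 0) (inner G A Un inner G Q) = (\<Union>i\<in>J. inner G ((g(0 := C)) i)) Un {(y(0 := w)) i | i. i - 1 \<in> J & i \<in> J}"
 proof -
  have "inner G Q = inner G (g 0) Un (\<Union>i\<in>J - {0}. inner G (g i)) Un {y i | i. i - 1 \<in> J & i \<in> J}"
   using g(2) un[of "inner G"] by (simp add: seqsets_def)
  thus ?thesis unfolding seqsets_replace(1)[OF J(3,1), of "inner G"] seqsets_replace(2)[OF J(3,1)] C'(2) by blast
 qed
 show "(y(0 := w)) (i + 1) \<in> insert e (inner G Q)" if "i \<in> J" for i using e[OF that] nn[OF that] by auto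
qed

lemma right_end_glue:
 assumes "right_end \<mu> J g y r v" "I \<subseteq> {..<0}" "J \<subseteq> {0..}"
 shows "right_end \<mu> (I Un J) (%i. if i < 0 then f i else g i) (%i. if i <= 0 then x i else y i) r v"
proof -
 from assms(1) consider (a) b where "b \<in> J" "b + 1 ~: J" "prank (rend (g b)) = r" "y (b + 1) = v"
  | (b) h d where "{0<..} \<subseteq> J" "r = \<mu>" "gpath G (Seq \<mu> Out h)" "at_node G (Seq \<mu> Out h) v" "\<forall>i>0. g i = h (i + d)"
  unfolding right_end_def by blast
 thus ?thesis
 proof cases
  case a
  have "0 <= b" using a assms(3) by auto
  moreover from this have "b + 1 ~: I" using assms(2) by auto
  ultimately show ?thesis unfolding right_end_def using a by (intro disjI1 bexI[of _ b]) auto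
 next
  case b thus ?thesis unfolding right_end_def by (intro disjI2 conjI exI[of _ h] exI[of _ d]) auto
 qed
qed

lemma left_end_glue:
 assumes "left_end \<mu> I f x r v" "I \<subseteq> {..<0}" "J \<subseteq> {0..}"
 shows "left_end \<mu> (I Un J) (%i. if i < 0 then f i else g i) (%i. if i <= 0 then x i else y i) r v"
proof -
 from assms(1) consider (a) a where "a \<in> I" "a - 1 ~: I" "prank (lend (f a)) = r" "x a = v"
  | (b) h d where "{..<0} \<subseteq> I" "r = \<mu>" "gpath G (Seq \<mu> In h)" "at_node G (Seq \<mu> In h) v" "\<forall>i<0. f i = h (i - d)"
  unfolding left_end_def by blast
 thus ?thesis
 proof cases
  case a
  have "a < 0" using a assms(2) by auto
  moreover from this have "a - 1 ~: J" using assms(3) by auto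
  ultimately show ?thesis unfolding left_end_def using a by (intro disjI1 bexI[of _ a]) auto
 next
  case b thus ?thesis unfolding left_end_def by (intro disjI2 conjI exI[of _ h] exI[of _ d]) auto
 qed
qed

text \<open>If the merged constituent was the only one on the left, the left end is that of the
  merged constituent, now at index \<open>0\<close>; otherwise it is the old one moved by one
  place.\<close>

lemma left_end_merge:
 assumes "left_end \<mu> I f x r v" "I \<subseteq> {..<0}" "J \<subseteq> {0..}" "0 \<in> J" "y 0 = x (-1)" "prank (lend (g 0)) = prank (lend (f (-1)))"
 shows "left_end \<mu> ({i. i < 0 & i - 1 \<in> I} Un J) (%i. if i < 0 then f (i - 1) else g i) (%i. if i <= 0 then x (i - 1) else y i) r v"
proof -
 from assms(1) consider (a) "-2 ~: I" "prank (lend (f (-1))) = r" "x (-1) = v"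
  | (a2) a where "a < -1" "a \<in> I" "a - 1 ~: I" "prank (lend (f a)) = r" "x a = v"
  | (b) h d where "{..<0} \<subseteq> I" "r = \<mu>" "gpath G (Seq \<mu> In h)" "at_node G (Seq \<mu> In h) v" "\<forall>i<0. f i = h (i - d)"
 proof (unfold left_end_def, elim disjE bexE conjE exE, goal_cases)
  case (1 a)
  hence "a = -1 \<or> a < -1" using assms(2) by auto
  thus ?case using 1 by auto
 qed blast
 thus ?thesis
 proof cases
  case a
  have "-1 ~: J" using assms(3) by auto
  thus ?thesis unfolding left_end_def using a assms(4,6) by (intro disjI1 bexI[of _ 0]) auto
 next
  case a2
  have "a ~: J" using assms(3) a2 by auto
  thus ?thesis unfolding left_end_def using a2 by (intro disjI1 bexI[of _ "a + 1"]) auto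
 next
  case b
  have "\<forall>i<0. (if i < 0 then f (i - 1) else g i) = h (i - (d + 1))"
   using b(5) by (simp add: algebra_simps)
  thus ?thesis unfolding left_end_def using b(1,2,3,4)
   by (intro disjI2 conjI exI[of _ h] exI[of _ "d + 1"]) auto
 qed
qed

text \<open>Both paths are raised to rank \<open>n\<close>. If one of the tips at \<open>z\<close>
  has rank \<open>n - 1\<close>, then \<open>z\<close> is an admissible junction and the sequences
  are concatenated. Otherwise both tips are lower, and the last constituent of \<open>P\<close> and
  the first one of \<open>Q\<close>, of rank at most \<open>n - 1\<close>, are joined by induction
  and become one constituent.\<close>

lemma finite_join:
 "joinable x z y P Q ==> prank P <= Rk n ==> prank Q <= Rk n ==> prank (rend P) < Rk n ==> prank (lend Q) < Rk n ==>
  EX R. joined x z y P Q R & prank R <= Rk n"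
proof (induction n arbitrary: x z y P Q rule: less_induct)
 case (less n x z y P0 Q0)
 have jn0: "arc x P0 z" "arc z Q0 y" "x ~= y" "x ~: inner G Q0" "y ~: inner G P0" "inner G P0 Int inner G Q0 = {}"
  using less.prems(1) by (auto simp: joinable_def)
 obtain s f where P0: "gpath G (Seq (Rk n) s f)" "pbranches (Seq (Rk n) s f) = pbranches P0"
  "inner G (Seq (Rk n) s f) = inner G P0" "lend (Seq (Rk n) s f) = lend P0" "rend (Seq (Rk n) s f) = rend P0"
  using raise[OF jn0(1) less.prems(2)] by metis
 obtain t g where Q0: "gpath G (Seq (Rk n) t g)" "pbranches (Seq (Rk n) t g) = pbranches Q0"
  "inner G (Seq (Rk n) t g) = inner G Q0" "lend (Seq (Rk n) t g) = lend Q0" "rend (Seq (Rk n) t g) = rend Q0"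
  using raise[OF jn0(2) less.prems(3)] by metis
 define P Q where "P = Seq (Rk n) s f" and "Q = Seq (Rk n) t g"
 note PQ = P0[folded P_def] Q0[folded Q_def]
 have jn: "arc x P z" "arc z Q y" "x ~= y" "x ~: inner G Q" "y ~: inner G P" "inner G P Int inner G Q = {}"
  using jn0 PQ unfolding arc_def by simp_all
 have s: "s ~= Out" "s ~= Endless"
  using rend_open[of s "Rk n" f] less.prems(4) P0(5) by (metis prank.simps(2) less_irrefl)+
 have t: "t ~= In" "t ~= Endless"
  using lend_open[of t "Rk n" g] less.prems(5) Q0(4) by (metis prank.simps(2) less_irrefl)+
 have PE: "at_node G (lend P) x" "at_node G (rend P) z" and QE: "at_node G (lend Q) z" "at_node G (rend Q) y"
  using jn by (auto simp: arc_def)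
 obtain I h u where L: "I \<subseteq> {..<0}" "-1 \<in> I" "!!i. i \<in> I ==> i + 1 < 0 ==> i + 1 \<in> I" "seqpre G (Rk n) I h u"
  "seqsets G I h u P" "u 0 = z" "prank (rend (h (-1))) = prank (rend P)"
  "!!i. i \<in> I ==> u i \<in> insert x (inner G P)" "left_end (Rk n) I h u (prank (lend P)) x"
  using left_form[OF P0(1) s PE[unfolded P_def], folded P_def] by metis
 obtain v where R: "idx t \<subseteq> {0..}" "0 \<in> idx t" "!!i. i \<in> idx t ==> 0 < i ==> i - 1 \<in> idx t" "seqpre G (Rk n) (idx t) g v"
  "seqsets G (idx t) g v Q" "v 0 = z" "lend (g 0) = lend Q"
  "!!i. i \<in> idx t ==> v (i + 1) \<in> insert y (inner G Q)" "right_end (Rk n) (idx t) g v (prank (rend Q)) y"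
  using right_form[OF Q0(1) t QE(2,1)[unfolded Q_def], folded Q_def] by metis
 have hP: "inner G (h i) \<subseteq> inner G P" if "i \<in> I" for i using seqsets_inner(1)[OF L(5) that] .
 have gQ: "inner G (g i) \<subseteq> inner G Q" if "i \<in> idx t" for i using seqsets_inner(1)[OF R(5) that] .
 have tip: "prank (rend (h (-1))) < Rk n" "prank (lend (g 0)) < Rk n"
  using L(7) R(7) less.prems(4,5) PQ(5,9) by simp_all
 have "EX R. joined x z y P Q R & prank R <= Rk n"
 proof (cases "max (prank (rend (h (-1)))) (prank (lend (g 0))) = rpred (Rk n)")
  case True
  let ?F = "%i. if i < 0 then h i else g i" and ?X = "%i. if i <= 0 then u i else v i"
  have sp: "seqpre G (Rk n) (I Un idx t) ?F ?X"
  proof (rule glue_seq[OF L(1,3) R(1,3,2) L(4) R(4)])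
   show "u 0 = v 0" using L R by simp
   show "u i \<in> insert x (inner G P) & inner G (h i) \<subseteq> insert x (inner G P)" if "i \<in> I" for i
    using L(8)[OF that] hP[OF that] by blast
   show "v (i + 1) \<in> insert y (inner G Q) & inner G (g i) \<subseteq> insert y (inner G Q)" if "i \<in> idx t" for i
    using R(8)[OF that] gQ[OF that] by blast
   show "insert x (inner G P) Int insert y (inner G Q) = {}" using jn by blast
   show "v 0 ~: insert x (inner G P)" "v 0 ~: insert y (inner G Q)" using R(6) jn by (auto simp: arc_def)
  qed (use True in auto)
  have cv: "!!i j k. i \<in> I Un idx t ==> k \<in> I Un idx t ==> i <= j ==> j <= k ==> j \<in> I Un idx t"
   by (rule glue_convex[OF L(1,3) R(1,3,2)])
  have "EX W. gpath G W & prank W = Rk n & seqsets G (I Un idx t) ?F ?X W & at_node G (lend W) x &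
    prank (lend W) = prank (lend P) & at_node G (rend W) y & prank (rend W) = prank (rend Q)"
  proof (rule seq_assemble[OF sp _ _ _ _ left_end_glue[OF L(9,1) R(1)] right_end_glue[OF R(9) L(1) R(1)]])
   show "j \<in> I Un idx t" if "i \<in> I Un idx t" "k \<in> I Un idx t" "i <= j" "j <= k" for i j k using that by (rule cv)
  qed (use L(2) in auto)
  then obtain W where W: "gpath G W" "prank W = Rk n" "seqsets G (I Un idx t) ?F ?X W" "at_node G (lend W) x"
    "prank (lend W) = prank (lend P)" "at_node G (rend W) y" "prank (rend W) = prank (rend Q)" by blast
  have "pbranches W = pbranches P Un pbranches Q"
   using W(3) L(5) R(5) glue_sets(1)[OF L(1) R(1,2), of pbranches h g] by (simp add: seqsets_def)
  moreover have "inner G W = insert z (inner G P Un inner G Q)"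
   using W(3) L(5,2,6) R(5) glue_sets(1)[OF L(1) R(1,2), of "inner G" h g] glue_sets(2)[OF L(1) R(1,2), of u v]
   by (auto simp: seqsets_def)
  ultimately show ?thesis using W unfolding joined_def by auto
 next
  case False
  have "max (prank (rend (h (-1)))) (prank (lend (g 0))) <= rpred (Rk n)"
   using less_imp_le_rpred[OF tip(1)] less_imp_le_rpred[OF tip(2)] by simp
  hence lt: "max (prank (rend (h (-1)))) (prank (lend (g 0))) < rpred (Rk n)"
   using False by (metis order_le_less)
  then obtain m where m: "n = Suc m" by (cases n) auto
  have t1: "prank (rend (h (-1))) < Rk m" "prank (lend (g 0)) < Rk m" using lt unfolding m by simp_all
  have hg: "gpath G (h (-1))" "prank (h (-1)) < Rk n" "gpath G (g 0)" "prank (g 0) < Rk n"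
   using L(2,4) R(2,4) by (auto simp: seqpre_def)
  have t2: "prank (h (-1)) <= Rk m" "prank (g 0) <= Rk m"
   using less_imp_le_rpred[OF hg(2)] less_imp_le_rpred[OF hg(4)] m by simp_all
  have a1: "arc (u (-1)) (h (-1)) z" using seqpre_arc[OF L(4,2)] L(6) by simp
  have a2: "arc z (g 0) (v 1)" using seqpre_arc[OF R(4,2)] R(6) by simp
  have dj: "insert x (inner G P) Int insert y (inner G Q) = {}" using jn by blast
  have u1: "u (-1) \<in> insert x (inner G P)" "v 1 \<in> insert y (inner G Q)" using L(8)[OF L(2)] R(8)[OF R(2)] by auto
  have "joinable (u (-1)) z (v 1) (h (-1)) (g 0)"
  proof -
   have "u (-1) ~= v 1" using dj u1 by auto
   moreover have "u (-1) ~: inner G (g 0)" using dj u1(1) gQ[OF R(2)] by auto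
   moreover have "v 1 ~: inner G (h (-1))" using dj u1(2) hP[OF L(2)] by auto
   moreover have "inner G (h (-1)) Int inner G (g 0) = {}" using dj hP[OF L(2)] gQ[OF R(2)] by auto
   ultimately show ?thesis using a1 a2 by (simp add: joinable_def)
  qed
  then obtain C where C: "joined (u (-1)) z (v 1) (h (-1)) (g 0) C" "prank C <= Rk m"
   using less.IH[of m] m t1 t2 by blast
  have Cn: "prank C < Rk n" using C(2) m by (metis lessI order_le_less_trans rank_less_simps(7))
  have m1: "arc (u (-1)) (h (-1)) (v 0)" "u (-1) ~: insert y (inner G Q)" "inner G (h (-1)) Int insert y (inner G Q) = {}"
    "joined (u (-1)) (v 0) (v 1) (h (-1)) (g 0) C"
   using a1 R(6) u1(1) dj hP[OF L(2)] C by auto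
  note mf = merge_first[OF R(1) _ R(2) R(4,5) _ m1 Cn]
  have M: "seqpre G (Rk n) (idx t) (g(0 := C)) (v(0 := u (-1)))"
   "right_end (Rk n) (idx t) (g(0 := C)) (v(0 := u (-1))) (prank (rend Q)) y"
   "pbranches (h (-1)) Un pbranches Q = (\<Union>i\<in>idx t. pbranches ((g(0 := C)) i))"
   "insert (v 0) (inner G (h (-1)) Un inner G Q) = (\<Union>i\<in>idx t. inner G ((g(0 := C)) i)) Un
     {(v(0 := u (-1))) i | i. i - 1 \<in> idx t & i \<in> idx t}"
   "!!i. i \<in> idx t ==> (v(0 := u (-1))) (i + 1) \<in> insert y (inner G Q)"
  proof -
   show "seqpre G (Rk n) (idx t) (g(0 := C)) (v(0 := u (-1)))" by (rule mf(1)) (fact R(3), fact R(8))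
   show "right_end (Rk n) (idx t) (g(0 := C)) (v(0 := u (-1))) (prank (rend Q)) y"
    by (rule mf(2)) (fact R(3), fact R(8), fact R(9))
   show "pbranches (h (-1)) Un pbranches Q = (\<Union>i\<in>idx t. pbranches ((g(0 := C)) i))"
    by (rule mf(3)) (fact R(3), fact R(8))
   show "insert (v 0) (inner G (h (-1)) Un inner G Q) = (\<Union>i\<in>idx t. inner G ((g(0 := C)) i)) Un
     {(v(0 := u (-1))) i | i. i - 1 \<in> idx t & i \<in> idx t}" by (rule mf(4)) (fact R(3), fact R(8))
   show "(v(0 := u (-1))) (i + 1) \<in> insert y (inner G Q)" if "i \<in> idx t" for i
    by (rule mf(5)) (fact R(3), fact R(8), fact that)
  qed
  \<comment> \<open>The last constituent of the left sequence has gone into \<open>C\<close>, which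
    takes index \<open>0\<close>; the others move up by one place.\<close>
  let ?I = "{i. i < 0 & i - 1 \<in> I}"
  let ?h = "%i. h (i - 1)" and ?u = "%i. u (i - 1)" and ?g = "g(0 := C)" and ?v = "v(0 := u (-1))"
  let ?F = "%i. if i < 0 then ?h i else ?g i" and ?X = "%i. if i <= 0 then ?u i else ?v i"
  have I1: "?I \<subseteq> {..<0}" "!!i. i \<in> ?I ==> i + 1 < 0 ==> i + 1 \<in> ?I" using L(3) by force+
  have spI: "seqpre G (Rk n) ?I ?h ?u"
   using seqpre_mono[OF seqpre_shift[OF L(4), of "-1"], of ?I] by auto
  have tr: "inj_on u (I Un (%i. i + 1) ` I)" "!!i j. i \<in> I Un (%i. i + 1) ` I ==> j \<in> I ==> u i ~: inner G (h j)"
   "!!i j. i \<in> I ==> j \<in> I ==> i ~= j ==> inner G (h i) Int inner G (h j) = {}"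
   using L(4) unfolding seqpre_def traced_def by auto
  have zI: "0 \<in> I Un (%i. i + 1) ` I" using L(2) by (auto intro!: image_eqI[of _ _ "-1"])
  let ?A = "\<Union>i\<in>?I. insert (?u i) (inner G (?h i))"
  let ?B = "insert y (inner G Q) Un inner G C"
  have Ci: "inner G C = insert z (inner G (h (-1)) Un inner G (g 0))" using C(1) by (auto simp: joined_def)
  have zA: "z ~: ?A"
  proof -
   have "z ~= u (i - 1)" "z ~: inner G (h (i - 1))" if "i \<in> ?I" for i
    using inj_onD[OF tr(1) _ zI, of "i - 1"] tr(2)[OF zI, of "i - 1"] that L(6) by auto
   thus ?thesis by blast
  qed
  have hA: "inner G (h (-1)) Int ?A = {}"
  proof -
   have "u (i - 1) ~: inner G (h (-1))" "inner G (h (i - 1)) Int inner G (h (-1)) = {}" if "i \<in> ?I" for i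
    using tr(2)[of "i - 1" "-1"] tr(3)[of "i - 1" "-1"] that L(2) by auto
   thus ?thesis by blast
  qed
  have AP: "?A \<subseteq> insert x (inner G P)" using L(8) hP by fastforce
  have uA: "u (-1) ~: ?A"
  proof -
   have "u (-1) ~= u (i - 1)" "u (-1) ~: inner G (h (i - 1))" if "i \<in> ?I" for i
    using inj_onD[OF tr(1), of "-1" "i - 1"] tr(2)[of "-1" "i - 1"] that L(2) by auto
   thus ?thesis by blast
  qed
  have sp: "seqpre G (Rk n) (?I Un idx t) ?F ?X"
  proof (rule glue_seq[OF I1 R(1,3,2) spI M(1), where A = ?A and B = ?B])
   show "?u 0 = ?v 0" by simp
   show "?u i \<in> ?A & inner G (?h i) \<subseteq> ?A" if "i \<in> ?I" for i using that by blast
   show "?v (i + 1) \<in> ?B & inner G (?g i) \<subseteq> ?B" if "i \<in> idx t" for i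
    using M(5)[OF that] gQ[OF that] by auto
   show "?A Int ?B = {}" using AP dj zA hA gQ[OF R(2)] unfolding Ci by blast
   show "?v 0 ~: ?A" using uA by simp
   have "u (-1) ~= z" using a1 by (simp add: arc_def)
   thus "?v 0 ~: ?B" using u1(1) dj m1(1) gQ[OF R(2)] unfolding Ci by (auto simp: arc_def)
   assume "-1 \<in> ?I"
   hence "-2 \<in> I" by simp
   hence "jrank h (-1) = rpred (Rk n)" using L(2,4) unfolding seqpre_def by simp
   thus "max (prank (rend (?h (-1)))) (prank (lend (?g 0))) = rpred (Rk n)"
    using C(1) by (simp add: jrank_def joined_def)
  qed auto
  have cv: "!!i j k. i \<in> ?I Un idx t ==> k \<in> ?I Un idx t ==> i <= j ==> j <= k ==> j \<in> ?I Un idx t"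
   by (rule glue_convex[OF I1 R(1,3,2)])
  have le: "left_end (Rk n) (?I Un idx t) ?F ?X (prank (lend P)) x"
   by (rule left_end_merge[OF L(9,1) R(1,2)]) (use C(1) in \<open>auto simp: joined_def\<close>)
  have "EX W. gpath G W & prank W = Rk n & seqsets G (?I Un idx t) ?F ?X W & at_node G (lend W) x &
    prank (lend W) = prank (lend P) & at_node G (rend W) y & prank (rend W) = prank (rend Q)"
  proof (rule seq_assemble[OF sp _ _ _ _ le right_end_glue[OF M(2) I1(1) R(1)]])
   show "j \<in> ?I Un idx t" if "i \<in> ?I Un idx t" "k \<in> ?I Un idx t" "i <= j" "j <= k" for i j k using that by (rule cv)
  qed (use R(2) in auto)
  then obtain W where W: "gpath G W" "prank W = Rk n" "seqsets G (?I Un idx t) ?F ?X W" "at_node G (lend W) x"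
    "prank (lend W) = prank (lend P)" "at_node G (rend W) y" "prank (rend W) = prank (rend Q)" by blast
  have Ish: "(%i. i - 1) ` ?I = I - {-1}"
  proof (intro equalityI subsetI)
   fix i assume "i \<in> I - {-1}" thus "i \<in> (%i. i - 1) ` ?I" using L(1) by (intro image_eqI[of _ _ "i + 1"]) auto
  qed auto
  have un: "(\<Union>i\<in>?I. k (h (i - 1))) Un k (h (-1)) = (\<Union>i\<in>I. k (h i))" for k :: "'b tpath => 'c set"
  proof -
   have "(\<Union>i\<in>?I. k (h (i - 1))) = (\<Union>i\<in>(%i. i - 1) ` ?I. k (h i))" by simp
   thus ?thesis unfolding Ish using L(2) by blast
  qed
  have nodesI: "{?u i | i. i - 1 \<in> ?I & i \<in> ?I} Un (if -1 \<in> ?I then {?u 0} else {}) = {u i | i. i - 1 \<in> I & i \<in> I}"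
  proof (intro equalityI subsetI)
   fix w assume "w \<in> {u i | i. i - 1 \<in> I & i \<in> I}"
   then obtain i where i: "w = u i" "i - 1 \<in> I" "i \<in> I" by blast
   show "w \<in> {?u i | i. i - 1 \<in> ?I & i \<in> ?I} Un (if -1 \<in> ?I then {?u 0} else {})"
   proof (cases "i = -1")
    case False
    hence "i + 1 < 0" using i(3) L(1) by force
    hence "w = ?u (i + 1)" "i + 1 - 1 \<in> ?I" "i + 1 \<in> ?I" using i L(1) by auto
    thus ?thesis by blast
   qed (use i in auto)
  qed (use L(2) in \<open>auto split: if_splits\<close>)
  have "pbranches W = pbranches P Un pbranches Q"
  proof -
   have "pbranches W = (\<Union>i\<in>?I. pbranches (?h i)) Un (pbranches (h (-1)) Un pbranches Q)"
    using W(3) glue_sets(1)[OF I1(1) R(1,2), of pbranches ?h ?g] M(3) by (simp only: seqsets_def)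
   thus ?thesis using un[of pbranches] L(5) by (auto simp: seqsets_def)
  qed
  moreover have "inner G W = insert z (inner G P Un inner G Q)"
  proof -
   have "inner G W = (\<Union>i\<in>?I. inner G (?h i)) Un (\<Union>i\<in>idx t. inner G (?g i)) Un
    ({?u i | i. i - 1 \<in> ?I & i \<in> ?I} Un {?v i | i. i - 1 \<in> idx t & i \<in> idx t} Un (if -1 \<in> ?I then {?u 0} else {}))"
    using W(3) glue_sets(1)[OF I1(1) R(1,2), of "inner G" ?h ?g] glue_sets(2)[OF I1(1) R(1,2), of ?u ?v]
    by (simp only: seqsets_def)
   also have "\<dots> = (\<Union>i\<in>?I. inner G (?h i)) Un {u i | i. i - 1 \<in> I & i \<in> I} Un insert z (inner G (h (-1)) Un inner G Q)"
    using M(4) nodesI R(6) by blast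
   also have "\<dots> = insert z (((\<Union>i\<in>?I. inner G (?h i)) Un inner G (h (-1)) Un {u i | i. i - 1 \<in> I & i \<in> I}) Un inner G Q)"
    by (rule insert_shuffle)
   also have "(\<Union>i\<in>?I. inner G (?h i)) Un inner G (h (-1)) Un {u i | i. i - 1 \<in> I & i \<in> I} = inner G P"
    using un[of "inner G"] L(5) by (simp add: seqsets_def)
   finally show ?thesis .
  qed
  ultimately show ?thesis using W unfolding joined_def by auto
 qed
 thus ?case using PQ unfolding joined_def by metis
qed

end

section \<open>Joining at arrow rank\<close>

lemma finite_rank: "r < Arr ==> EX n. r < Rk n"
 by (cases r) auto

lemma insert_shuffle2: "(A Un B) Un (N Un M Un {z}) = insert z ((A Un N) Un (B Un M))"
 by blast

lemma max_jrank_replace: "prank (rend C) = prank (rend (g 0)) ==> 0 < i ==> jrank (g(0 := C)) i = jrank g i"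
 by (auto simp: jrank_def)

context tfg
begin

lemma Arr_Out_jrank:
 assumes "gpath G (Seq Arr s g)" "s = Out \<or> s = Endless" "0 < i" "i < j" shows "jrank g i < jrank g j"
 using gpath_SeqD(7)[OF assms(1)] assms(2-) by (auto simp: junction_ranks_def junctions_def)

lemma finite_join_less:
 assumes jn: "joinable x z y P Q" and "prank P < Rk n" "prank Q < Rk n"
 shows "EX R. joined x z y P Q R & prank R <= Rk n"
proof (rule finite_join[OF jn])
 have g: "gpath G P" "gpath G Q" using jn by (auto simp: joinable_def arc_def)
 show "prank (rend P) < Rk n" using rend_prank[OF g(1)] assms(2) by (rule le_less_trans)
 show "prank (lend Q) < Rk n" using lend_prank[OF g(2)] assms(3) by (rule le_less_trans)
qed (use assms in auto)

text \<open>\<open>P\<close> is merged into the first constituent. The right tip of that constituent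
  keeps its rank, so the junction ranks still increase.\<close>

lemma prepend_Arr:
 assumes jn: "joinable x z y P Q" and P: "prank P < Arr" and Q: "Q = Seq Arr Out g"
 shows "EX R. joined x z y P Q R & prank R = Arr"
proof -
 have a: "arc x P z" "arc z Q y" "x ~= y" "x ~: inner G Q" "y ~: inner G P" "inner G P Int inner G Q = {}"
  using jn by (auto simp: joinable_def)
 have gQ: "gpath G (Seq Arr Out g)" using a Q by (simp add: arc_def)
 have QE: "at_node G (lend Q) z" "at_node G (rend Q) y" using a by (auto simp: arc_def)
 obtain v where R: "idx Out \<subseteq> {0..}" "0 \<in> idx Out" "!!i. i \<in> idx Out ==> 0 < i ==> i - 1 \<in> idx Out" "seqpre G Arr (idx Out) g v"
  "seqsets G (idx Out) g v Q" "v 0 = z" "lend (g 0) = lend Q"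
  "!!i. i \<in> idx Out ==> v (i + 1) \<in> insert y (inner G Q)" "right_end Arr (idx Out) g v (prank (rend Q)) y"
  using right_form[OF gQ _ _ QE(2,1)[unfolded Q], folded Q] by (metis shape.distinct(7,9))
 have gQi: "inner G (g 0) \<subseteq> inner G Q" using seqsets_inner(1)[OF R(5,2)] .
 have g0: "prank (g 0) < Arr" "gpath G (g 0)" using R(2,4) by (auto simp: seqpre_def)
 have ag: "arc z (g 0) (v 1)" using seqpre_arc[OF R(4,2)] R(6) by simp
 have gP: "gpath G P" using a by (simp add: arc_def)
 obtain n where n: "max (prank P) (prank (g 0)) < Rk n" using finite_rank P g0 by (metis max_less_iff_conj max_def)
 have v1: "v 1 \<in> insert y (inner G Q)" using R(8)[OF R(2)] by simp
 have "joinable x z (v 1) P (g 0)"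
  unfolding joinable_def
 proof (intro conjI)
  show "x ~= v 1" using v1 a by auto
  show "x ~: inner G (g 0)" using a gQi by auto
  show "v 1 ~: inner G P" using v1 a by auto
  show "inner G P Int inner G (g 0) = {}" using a gQi by auto
 qed (use a ag in auto)
 then obtain C where C: "joined x z (v 1) P (g 0) C" "prank C <= Rk n"
  using finite_join_less[of x z "v 1" P "g 0" n] n by auto
 have Cn: "prank C < Arr" using C(2) by (metis rank_less_simps(4) order_le_less_trans)
 have m1: "arc x P (v 0)" "x ~: insert y (inner G Q)" "inner G P Int insert y (inner G Q) = {}"
    "joined x (v 0) (v 1) P (g 0) C"
  using a R(6) C by auto
 note mf = merge_first[OF R(1) _ R(2) R(4,5) _ m1 Cn]
 let ?J = "idx Out" and ?g = "g(0 := C)" and ?v = "v(0 := x)"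
 have M: "seqpre G Arr ?J ?g ?v" "right_end Arr ?J ?g ?v (prank (rend Q)) y"
  "pbranches P Un pbranches Q = (\<Union>i\<in>?J. pbranches (?g i))"
  "insert (v 0) (inner G P Un inner G Q) = (\<Union>i\<in>?J. inner G (?g i)) Un {?v i | i. i - 1 \<in> ?J & i \<in> ?J}"
 proof -
  show "seqpre G Arr ?J ?g ?v" by (rule mf(1)) (fact R(3), fact R(8))
  show "right_end Arr ?J ?g ?v (prank (rend Q)) y" by (rule mf(2)) (fact R(3), fact R(8), fact R(9))
  show "pbranches P Un pbranches Q = (\<Union>i\<in>?J. pbranches (?g i))" by (rule mf(3)) (fact R(3), fact R(8))
  show "insert (v 0) (inner G P Un inner G Q) = (\<Union>i\<in>?J. inner G (?g i)) Un {?v i | i. i - 1 \<in> ?J & i \<in> ?J}"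
   by (rule mf(4)) (fact R(3), fact R(8))
 qed
 have le: "left_end Arr ?J ?g ?v (prank (lend P)) x"
  unfolding left_end_def by (intro disjI1 bexI[of _ 0]) (use C(1) in \<open>auto simp: joined_def\<close>)
 have rC: "prank (rend C) = prank (rend (g 0))" using C(1) by (simp add: joined_def)
 have "EX W. gpath G W & prank W = Arr & seqsets G ?J ?g ?v W & at_node G (lend W) x &
    prank (lend W) = prank (lend P) & at_node G (rend W) y & prank (rend W) = prank (rend Q)"
 proof (rule seq_assemble[OF M(1) _ _ _ _ le M(2)])
  have "ALL i j. 0 < i & i < j --> jrank ?g i < jrank ?g j"
   using Arr_Out_jrank[OF gQ] max_jrank_replace[of C g, OF rC] by simp
  thus "EX a. ?J = {a..} & (ALL i j. a < i & i < j --> jrank ?g i < jrank ?g j)"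
   by (intro exI[of _ 0]) (auto simp del: fun_upd_apply)
 qed (use R(2) in auto)
 then obtain W where W: "gpath G W" "prank W = Arr" "seqsets G ?J ?g ?v W" "at_node G (lend W) x"
   "prank (lend W) = prank (lend P)" "at_node G (rend W) y" "prank (rend W) = prank (rend Q)" by blast
 have "pbranches W = pbranches P Un pbranches Q" "inner G W = insert z (inner G P Un inner G Q)"
  using W(3) M(3,4) R(6) by (auto simp only: seqsets_def)
 thus ?thesis using W unfolding joined_def by auto
qed

lemma append_Arr:
 assumes jn: "joinable x z y P Q" and Q: "prank Q < Arr" and P: "P = Seq Arr In f"
 shows "EX R. joined x z y P Q R & prank R = Arr"
proof -
 have g: "gpath G P" "gpath G Q" using jn by (auto simp: joinable_def arc_def)
 have "prev P = Seq Arr Out (%i. prev (f (ridx In i)))" using P by (simp add: prev.simps)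
 then obtain R where "joined y z x (prev Q) (prev P) R" "prank R = Arr"
  using prepend_Arr[OF joinable_prev[OF jn]] Q by auto
 hence "joined x z y (prev (prev P)) (prev (prev Q)) (prev R)" "prank (prev R) = Arr"
  using joined_prev[of y z x "prev Q" "prev P" R] g by simp_all
 thus ?thesis by auto
qed

text \<open>The common terminal node gets index \<open>0\<close>, where no condition on junction
  ranks is imposed; on either side they increase as before.\<close>

lemma join_Arr:
 assumes jn: "joinable x z y P Q" and P: "P = Seq Arr In f" and Q: "Q = Seq Arr Out g"
 shows "EX R. joined x z y P Q R & prank R = Arr"
proof -
 have a: "arc x P z" "arc z Q y" "x ~= y" "x ~: inner G Q" "y ~: inner G P" "inner G P Int inner G Q = {}"
  using jn by (auto simp: joinable_def)
 have gQ: "gpath G (Seq Arr Out g)" and gP: "gpath G (Seq Arr In f)" using a P Q by (auto simp: arc_def)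
 have PE: "at_node G (lend P) x" "at_node G (rend P) z" and QE: "at_node G (lend Q) z" "at_node G (rend Q) y"
  using a by (auto simp: arc_def)
 obtain v where R: "idx Out \<subseteq> {0..}" "0 \<in> idx Out" "!!i. i \<in> idx Out ==> 0 < i ==> i - 1 \<in> idx Out" "seqpre G Arr (idx Out) g v"
  "seqsets G (idx Out) g v Q" "v 0 = z" "lend (g 0) = lend Q"
  "!!i. i \<in> idx Out ==> v (i + 1) \<in> insert y (inner G Q)" "right_end Arr (idx Out) g v (prank (rend Q)) y"
  using right_form[OF gQ _ _ QE(2,1)[unfolded Q], folded Q] by (metis shape.distinct(7,9))
 obtain I h u where L0: "I \<subseteq> {..<0}" "-1 \<in> I" "!!i. i \<in> I ==> i + 1 < 0 ==> i + 1 \<in> I" "seqpre G Arr I h u"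
  "seqsets G I h u P" "u 0 = z"
  "!!i. i \<in> I ==> u i \<in> insert x (inner G P)" "left_end Arr I h u (prank (lend P)) x" "I = {..<0} & h = f"
  using left_form[OF gP _ _ PE[unfolded P], folded P] by (metis shape.distinct)
 hence Ih: "I = idx In" "h = f" by auto
 note L = L0[unfolded Ih]
 let ?F = "%i. if i < 0 then f i else g i" and ?X = "%i. if i <= 0 then u i else v i"
 have sp: "seqpre G Arr (idx In Un idx Out) ?F ?X"
 proof (rule glue_seq[OF L(1,3) R(1,3,2) L(4) R(4)])
  show "u 0 = v 0" using L R by simp
  show "u i \<in> insert x (inner G P) & inner G (f i) \<subseteq> insert x (inner G P)" if "i \<in> idx In" for i
   using L(7)[OF that] seqsets_inner(1)[OF L(5) that] by blast
  show "v (i + 1) \<in> insert y (inner G Q) & inner G (g i) \<subseteq> insert y (inner G Q)" if "i \<in> idx Out" for i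
   using R(8)[OF that] seqsets_inner(1)[OF R(5) that] by blast
  show "insert x (inner G P) Int insert y (inner G Q) = {}" using a by blast
  show "v 0 ~: insert x (inner G P)" "v 0 ~: insert y (inner G Q)" using R(6) a by (auto simp: arc_def)
 qed auto
 have U: "idx In Un idx Out = idx Endless" by auto
 have jr: "jrank ?F i = jrank f i" if "i < 0" for i using that by (simp add: jrank_def)
 have jr': "jrank ?F i = jrank g i" if "0 < i" for i using that by (simp add: jrank_def)
 have incr: "jrank f i < jrank f j" if "j < i" "i < 0" for i j
  using gpath_SeqD(7)[OF gP] that by (auto simp: junction_ranks_def junctions_def)
 have "junction_ranks Arr Endless ?F"
  unfolding junction_ranks_def using incr Arr_Out_jrank[OF gQ] by (auto simp: jr jr')
 hence gR: "gpath G (Seq Arr Endless ?F)"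
  using sp[unfolded U] unfolding seqpre_def by (intro gpath.sequence) (auto simp: tracing_traced)
 let ?W = "Seq Arr Endless ?F"
 have ss: "seqsets G (idx In Un idx Out) ?F ?X ?W"
  using seqsets_Seq[of Endless ?F ?X Arr] sp unfolding U seqpre_def by blast
 have e: "idx Endless = {i. i + 0 \<in> idx In Un idx Out}" by auto
 have gR0: "gpath G (Seq Arr Endless (%i. ?F (i + 0)))" using gR by (simp only: add_0_right)
 have "at_node G (lend ?W) x & prank (lend ?W) = prank (lend P)"
  using seq_ends(1)[OF gR0 e sp left_end_glue[OF L(8,1) R(1)]] by (simp only: add_0_right)
 moreover have "at_node G (rend ?W) y & prank (rend ?W) = prank (rend Q)"
  using seq_ends(2)[OF gR0 e sp right_end_glue[OF R(9) L(1) R(1)]] by (simp only: add_0_right)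
 moreover have "pbranches ?W = pbranches P Un pbranches Q"
  using ss L(5) R(5) glue_sets(1)[OF L(1) R(1,2), of pbranches f g] by (simp only: seqsets_def)
 moreover have "inner G ?W = insert z (inner G P Un inner G Q)"
 proof -
  have 1: "inner G ?W = ((\<Union>i\<in>idx In. inner G (f i)) Un (\<Union>i\<in>idx Out. inner G (g i))) Un
    ({u i | i. i - 1 \<in> idx In & i \<in> idx In} Un {v i | i. i - 1 \<in> idx Out & i \<in> idx Out} Un {u 0})"
   using ss glue_sets(1)[OF L(1) R(1,2), of "inner G" f g] glue_sets(2)[OF L(1) R(1,2), of u v] L(2)
   by (simp only: seqsets_def if_True)
  have 2: "inner G P = (\<Union>i\<in>idx In. inner G (f i)) Un {u i | i. i - 1 \<in> idx In & i \<in> idx In}"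
   using L(5) by (simp only: seqsets_def)
  have 3: "inner G Q = (\<Union>i\<in>idx Out. inner G (g i)) Un {v i | i. i - 1 \<in> idx Out & i \<in> idx Out}"
   using R(5) by (simp only: seqsets_def)
  show ?thesis unfolding 1 2 3 L(6) by (rule insert_shuffle2)
 qed
 ultimately have "joined x z y P Q ?W" using gR unfolding joined_def by (simp del: lend.simps rend.simps pbranches.simps)
 thus ?thesis by auto
qed

text \<open>The bounds on the two end tips say that \<open>z\<close> is passed below rank
  \<open>\<nu> - 1\<close>, so the joint path can stay below rank \<open>\<nu>\<close>. For
  \<open>\<nu> = \<omega>\<close>, a given path of arrow rank must then have a terminal constituent
  at \<open>z\<close> and its one open end on the far side.\<close>

theorem join:
 assumes jn: "joinable x z y P Q" and r: "prank P < \<nu>" "prank Q < \<nu>" "prank (rend P) < rpred \<nu>" "prank (lend Q) < rpred \<nu>"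
 shows "EX R. joined x z y P Q R & prank R < \<nu>"
proof -
 have g: "gpath G P" "gpath G Q" using jn by (auto simp: joinable_def arc_def)
 show ?thesis
 proof (cases \<nu>)
  case Elem thus ?thesis using nu_valid by simp
 next
  case Arr thus ?thesis using nu_valid by simp
 next
  case (Rk n)
  then obtain m where m: "n = Suc m" using r(3) by (cases n) auto
  have "prank P <= Rk m" "prank Q <= Rk m" using less_imp_le_rpred[OF r(1)] less_imp_le_rpred[OF r(2)] Rk m by auto
  then obtain R where "joined x z y P Q R" "prank R <= Rk m" using finite_join[OF jn, of m] r Rk m by auto
  moreover from this(2) have "prank R < \<nu>" using Rk m by (metis lessI order_le_less_trans rank_less_simps(7))
  ultimately show ?thesis by blast
 next
  case Om
  have le: "prank P <= Arr" "prank Q <= Arr" using less_imp_le_rpred[OF r(1)] less_imp_le_rpred[OF r(2)] Om by auto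
  have PA: "EX f. P = Seq Arr In f" if PArr: "prank P = Arr"
  proof -
   obtain s f where P: "P = Seq Arr s f" using PArr by (cases P) auto
   have "s ~= Two k" for k using gpath_SeqD(7)[OF g(1)[unfolded P]] by (auto simp: junction_ranks_def)
   moreover have "s ~= Out" "s ~= Endless" using r(3) P Om by auto
   ultimately show ?thesis using P by (cases s) auto
  qed
  have QA: "EX f. Q = Seq Arr Out f" if QArr: "prank Q = Arr"
  proof -
   obtain s f where Q: "Q = Seq Arr s f" using QArr by (cases Q) auto
   have "s ~= Two k" for k using gpath_SeqD(7)[OF g(2)[unfolded Q]] by (auto simp: junction_ranks_def)
   moreover have "s ~= In" "s ~= Endless" using r(4) Q Om by auto
   ultimately show ?thesis using Q by (cases s) auto
  qed
  have lt: "R = Arr ==> R < \<nu>" for R using Om by simp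
  consider (ff) "prank P < Arr" "prank Q < Arr" | (fa) "prank P < Arr" "prank Q = Arr"
   | (af) "prank P = Arr" "prank Q < Arr" | (aa) "prank P = Arr" "prank Q = Arr" using le by (meson order_le_less)
  thus ?thesis
  proof cases
   case ff
   then obtain n where n: "max (prank P) (prank Q) < Rk n" using finite_rank by (metis max_def)
   then obtain R where "joined x z y P Q R" "prank R <= Rk n"
    using finite_join_less[OF jn, of n] by auto
   moreover from this(2) have "prank R < \<nu>" using Om by (metis order_le_less_trans rank_less_simps(5))
   ultimately show ?thesis by blast
  next
   case fa thus ?thesis using prepend_Arr[OF jn] QA lt by metis
  next
   case af thus ?thesis using append_Arr[OF jn] PA lt by metis
  next
   case aa thus ?thesis using join_Arr[OF jn] PA QA lt by metis
  qed
 qed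
qed

text \<open>A two-ended piece of an arrow path is not an arrow path; its finitely many constituents
  have bounded finite ranks and are joined one after the other.\<close>

lemma join_block:
 assumes "a <= b" "seqpre G Arr {a..b} g y"
 shows "EX C. gpath G C & prank C < Arr & (prank C = Elem --> prank (g a) = Elem) & seqsets G {a..b} g y C &
   at_node G (lend C) (y a) & at_node G (rend C) (y (b + 1)) &
   prank (lend C) = prank (lend (g a)) & prank (rend C) = prank (rend (g b))"
 using assms
proof (induction b rule: int_ge_induct)
 case base
 have e: "{y i | i. i - 1 \<in> {a..a} & i \<in> {a..a}} = {}" by auto
 have "seqsets G {a..a} g y (g a)" unfolding seqsets_def e by simp
 thus ?case using base by (intro exI[of _ "g a"]) (auto simp: seqpre_def traced_def)
next
 case (step b)
 have "seqpre G Arr {a..b} g y" using seqpre_mono[OF step.prems] by simp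
 then obtain C where C: "gpath G C" "prank C < Arr" "seqsets G {a..b} g y C" "at_node G (lend C) (y a)"
  "at_node G (rend C) (y (b + 1))" "prank (lend C) = prank (lend (g a))" "prank (rend C) = prank (rend (g b))"
  using step.IH by blast
 let ?D = "g (b + 1)"
 have D: "gpath G ?D" "prank ?D < Arr" "arc (y (b + 1)) ?D (y (b + 1 + 1))"
  using step seqpre_arc[OF step.prems, of "b + 1"] by (auto simp: seqpre_def)
 have t: "inj_on y ({a..b + 1} Un (%i. i + 1) ` {a..b + 1})"
  "!!i j. i \<in> {a..b + 1} Un (%i. i + 1) ` {a..b + 1} ==> j \<in> {a..b + 1} ==> y i ~: inner G (g j)"
  "!!i j. i \<in> {a..b + 1} ==> j \<in> {a..b + 1} ==> i ~= j ==> inner G (g i) Int inner G (g j) = {}"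
  using step.prems unfolding seqpre_def traced_def by auto
 have dom: "i \<in> {a..b + 1} Un (%i. i + 1) ` {a..b + 1}" if "a <= i" "i <= b + 2" for i
 proof (cases "i <= b + 1")
  case False hence "i = (b + 1) + 1" using that by simp
  thus ?thesis using step(1) by auto
 qed (use that in auto)
 have neq: "y i ~= y j" if "a <= i" "i < j" "j <= b + 2" for i j
  using inj_onD[OF t(1) _ dom dom, of i j] that by auto
 have inC: "inner G C = (\<Union>i\<in>{a..b}. inner G (g i)) Un {y i | i. i - 1 \<in> {a..b} & i \<in> {a..b}}"
  using C(3) by (simp add: seqsets_def)
 have yC: "y i ~: inner G C" if "i = a \<or> (b + 1 <= i & i <= b + 2)" for i
 proof -
  have "y i ~: inner G (g j)" if "j \<in> {a..b}" for j
   using t(2)[OF dom, of i j] that \<open>i = a \<or> (b + 1 <= i & i <= b + 2)\<close> step(1) by auto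
  moreover have "y i ~= y j" if "j - 1 \<in> {a..b}" "j \<in> {a..b}" for j
   using neq[of a j] neq[of j i] that \<open>i = a \<or> (b + 1 <= i & i <= b + 2)\<close> by auto
  ultimately show ?thesis unfolding inC by blast
 qed
 have jn: "joinable (y a) (y (b + 1)) (y (b + 2)) C ?D"
  unfolding joinable_def
 proof (intro conjI)
  show "arc (y a) C (y (b + 1))" unfolding arc_def using C yC neq[of a "b + 1"] step(1) by auto
  show "arc (y (b + 1)) ?D (y (b + 2))" using D(3) by (simp add: add.assoc)
  show "y a ~= y (b + 2)" using neq[of a "b + 2"] step(1) by auto
  show "y a ~: inner G ?D" using t(2)[OF dom, of a "b + 1"] step(1) by auto
  show "y (b + 2) ~: inner G C" using yC by auto
  have "inner G (g i) Int inner G ?D = {}" if "i \<in> {a..b}" for i using t(3)[of i "b + 1"] that by auto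
  moreover have "y i ~: inner G ?D" if "i \<in> {a..b}" for i using t(2)[OF dom, of i "b + 1"] that by auto
  ultimately show "inner G C Int inner G ?D = {}" unfolding inC by blast
 qed
 obtain n where n: "max (prank C) (prank ?D) < Rk n" using finite_rank C D by (metis max_def)
 then obtain R where R: "joined (y a) (y (b + 1)) (y (b + 2)) C ?D R" "prank R <= Rk n"
  using finite_join_less[OF jn, of n] by auto
 have Ri: "prank R < Arr" "prank R ~= Elem"
 proof -
  show "prank R < Arr" using R(2) by (metis order_le_less_trans rank_less_simps(4))
  have "inner G R ~= {}" "gpath G R" using R(1) by (auto simp: joined_def)
  thus "prank R ~= Elem" using gpath_Elem by fastforce
 qed
 have s: "{a..b + 1} = insert (b + 1) {a..b}" using step(1) by auto
 have nodes: "{y i | i. i - 1 \<in> {a..b + 1} & i \<in> {a..b + 1}} = insert (y (b + 1)) {y i | i. i - 1 \<in> {a..b} & i \<in> {a..b}}"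
 proof -
  have "i - 1 \<in> {a..b + 1} & i \<in> {a..b + 1} \<longleftrightarrow> i = b + 1 \<or> (i - 1 \<in> {a..b} & i \<in> {a..b})" for i
   using step(1) by auto
  hence "{y i | i. i - 1 \<in> {a..b + 1} & i \<in> {a..b + 1}} = {y i | i. i = b + 1 \<or> (i - 1 \<in> {a..b} & i \<in> {a..b})}"
   by simp
  thus ?thesis by blast
 qed
 have "seqsets G {a..b + 1} g y R"
  unfolding seqsets_def nodes using R(1) C(3) unfolding joined_def seqsets_def by (auto simp: s)
 thus ?case using R Ri C by (intro exI[of _ R]) (auto simp: joined_def add.assoc)
qed

end

section \<open>Cutting paths\<close>

context tfg
begin

lemma inner_tip_node: "gpath G P ==> (D, q) \<in> rt P ==> D ~= {} ==> EX w. at_node G q w"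
proof (induction arbitrary: D rule: gpath.induct)
 case (sequence \<mu> s f)
 hence g: "gpath G (Seq \<mu> s f)" by (intro gpath.sequence) auto
 from sequence.prems[unfolded rt_Seq_iff] obtain i E where
  i: "i \<in> idx s" "(E, q) \<in> rt (f i)" "D = pre s f i Un E" by auto
 show ?case
 proof (cases "E = {}")
  case False thus ?thesis using sequence.IH i by blast
 next
  case True
  hence "q = lend (f i)" using i rt_empty gpath_SeqD(3)[OF g] by blast
  moreover have "i - 1 \<in> idx s" using True i sequence.prems(2) pre_first[of i s f] by auto
  ultimately show ?thesis using tracing_junction[OF g] i by blast
 qed
qed auto

text \<open>The inner nodes that remain when the path is cut at the point \<open>D\<close>; the node
  at \<open>D\<close> itself is not among them.\<close>

definition beyond :: "'b tpath => 'b set => 'b node set" where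
 "beyond P D = {v. EX E e. (E, e) \<in> rt P & D \<subset> E & at_node G e v}"

lemma beyond_empty: "gpath G P ==> beyond P {} = inner G P"
 using rt_inner inner_rt unfolding beyond_def by blast

lemma beyond_inner: "gpath G P ==> beyond P D \<subseteq> inner G P"
 using rt_inner unfolding beyond_def by blast

lemma beyond_not: "gpath G P ==> (D, q) \<in> rt P ==> D ~= {} ==> at_node G q w ==> w ~: beyond P D"
 using inner_points_distinct[OF rigid_all, of P "prank P" _ _ D q w] unfolding beyond_def by blast

lemma beyond_Seq:
 assumes g: "gpath G (Seq \<mu> s f)" and i: "i \<in> idx s" and E: "E \<subset> pbranches (f i)"
  and x: "!!j. j \<in> idx s ==> at_node G (lend (f j)) (x j)"
 shows "beyond (Seq \<mu> s f) (pre s f i Un E) = beyond (f i) E Un (\<Union>j\<in>{j \<in> idx s. i < j}. inner G (f j)) Un {x j | j. j \<in> idx s & i < j}"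
  (is "?L = ?R")
proof (intro equalityI subsetI)
 let ?D = "pre s f i Un E"
 have le: "pre s f i Un pbranches (f i) \<subseteq> pre s f j" if "i < j" for j
  using pre_mono[of "i + 1" j s f] pre_Suc[OF i, of f] that by simp
 {
  fix v assume "v \<in> ?L"
  then obtain F e where F: "(F, e) \<in> rt (Seq \<mu> s f)" "?D \<subset> F" "at_node G e v" by (auto simp: beyond_def)
  then obtain j F' where j: "j \<in> idx s" "(F', e) \<in> rt (f j)" "F = pre s f j Un F'" unfolding rt_Seq_iff by auto
  have gj: "gpath G (f j)" using gpath_SeqD(3)[OF g j(1)] .
  have "\<not> j < i"
  proof
   assume "j < i"
   hence "pre s f j Un pbranches (f j) \<subseteq> pre s f i" using pre_mono[of "j + 1" i s f] pre_Suc[OF j(1), of f] by simp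
   thus False using F(2) j(3) rt_subset[OF j(2)] by blast
  qed
  then consider "j = i" | "i < j" by linarith
  thus "v \<in> ?R"
  proof cases
   case 1
   hence "E \<subset> F'" using F(2) j(3) E pre_disjoint[OF g i] by blast
   thus ?thesis using 1 j(2) F(3) by (auto simp: beyond_def)
  next
   case 2
   show ?thesis
   proof (cases "F' = {}")
    case True
    hence "e = lend (f j)" using rt_empty[OF gj] j(2) by blast
    hence "v = x j" using x[OF j(1)] F(3) at_node_inject by blast
    thus ?thesis using 2 j(1) by blast
   next
    case False
    hence "v \<in> inner G (f j)" using rt_inner[OF gj j(2) _ F(3)] by blast
    thus ?thesis using 2 j(1) by blast
   qed
  qed
 next
  fix v assume "v \<in> ?R"
  then consider (a) "v \<in> beyond (f i) E" | (b) j where "j \<in> idx s" "i < j" "v \<in> inner G (f j)" | (c) j where "j \<in> idx s" "i < j" "v = x j"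
   by blast
  thus "v \<in> ?L"
  proof cases
   case a
   then obtain F e where F: "(F, e) \<in> rt (f i)" "E \<subset> F" "at_node G e v" by (auto simp: beyond_def)
   have "?D \<subset> pre s f i Un F" using F(2) rt_subset[OF F(1)] pre_disjoint[OF g i] by blast
   thus ?thesis using rt_SeqI[of i s F e f \<mu>, OF i F(1)] F(3) unfolding beyond_def by blast
  next
   case b
   then obtain F e where F: "(F, e) \<in> rt (f j)" "at_node G e v" using inner_rt[OF gpath_SeqD(3)[OF g b(1)]] by blast
   have "?D \<subset> pre s f j Un F" using le[OF b(2)] E pre_disjoint[OF g i] by blast
   thus ?thesis using rt_SeqI[of j s F e f \<mu>, OF b(1) F(1)] F(2) unfolding beyond_def by blast
  next
   case c
   have "?D \<subset> pre s f j Un {}" using le[OF c(2)] E pre_disjoint[OF g i] by blast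
   thus ?thesis using rt_SeqI[of j s "{}" "lend (f j)" f \<mu>, OF c(1) rt_lend[OF gpath_SeqD(3)[OF g c(1)]]] x[OF c(1)] c(3) unfolding beyond_def by blast
  qed
 }
qed

lemma right_end_of:
 assumes g: "gpath G (Seq \<mu> s f)" and x: "traced G (idx s) f x" and v: "at_node G (rend (Seq \<mu> s f)) v"
  and i: "i \<in> idx s" and C: "prank (rend C) = prank (rend (f i))"
 shows "right_end \<mu> {j. 0 <= j & j + i \<in> idx s} ((%j. f (j + i))(0 := C)) ((%j. x (j + i))(0 := w)) (prank (rend (Seq \<mu> s f))) v"
proof (rule rend_cases[OF gpath_SeqD(2)[OF g], of \<mu> f])
 fix b assume b: "b \<in> idx s" "b + 1 ~: idx s" "rend (Seq \<mu> s f) = rend (f b)"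
 have "i <= b" using idx_convex[OF b(1) i, of "b + 1"] b(2) by linarith
 moreover have "x (b + 1) = v" using x b v at_node_inject unfolding traced_def by metis
 ultimately show ?thesis unfolding right_end_def b(3) using b(1,2) C
  by (intro disjI1 bexI[of _ "b - i"]) (auto simp: algebra_simps)
next
 assume o: "s = Out \<or> s = Endless" "rend (Seq \<mu> s f) = Seq \<mu> Out f"
 have "j + i \<in> idx s" if "0 < j" for j using o(1) i that by auto
 thus ?thesis unfolding right_end_def o(2) using v[unfolded o(2)] gpath_ends[OF g, unfolded o(2)]
  by (intro disjI2 conjI exI[of _ f] exI[of _ i]) auto
qed

text \<open>The constituent containing \<open>D\<close> is cut by induction and the later ones are
  kept. At arrow rank the result must have shape \<open>Out\<close> with increasing junction ranks,
  or finite rank. So if the cut lies where the junction ranks decrease, finitely many constituents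
  are merged by \<open>join_block\<close>.\<close>

theorem suffix:
 "gpath G P ==> (D, q) \<in> rt P ==> at_node G q w ==> at_node G (rend P) v ==>
  EX R. gpath G R & prank R <= prank P & (prank R = Elem --> prank P = Elem) & pbranches R = pbranches P - D & inner G R = beyond P D &
   at_node G (lend R) w & prank (lend R) = prank q & at_node G (rend R) v & prank (rend R) = prank (rend P)"
proof (induction arbitrary: D w v rule: gpath.induct)
 case (branch b s) thus ?case by (intro exI[of _ "Br b s"]) (auto simp: beyond_def)
next
 case (sequence \<mu> s f)
 hence g: "gpath G (Seq \<mu> s f)" by (intro gpath.sequence) auto
 let ?P = "Seq \<mu> s f"
 show ?case
 proof (cases "D = {}")
  case True
  hence "q = lend ?P" using sequence.prems(1) rt_empty[OF g] by blast
  thus ?thesis using True g sequence.prems beyond_empty[OF g] by (intro exI[of _ ?P]) (simp del: lend.simps rend.simps)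
 next
  case Dne: False
  obtain i E where i: "i \<in> idx s" "(E, q) \<in> rt (f i)" "D = pre s f i Un E"
   using sequence.prems(1) Dne unfolding rt_Seq_iff by auto
  obtain x where x: "seqpre G \<mu> (idx s) f x" "seqsets G (idx s) f x ?P" using gpath_seqpre[OF g] by blast
  have tx: "traced G (idx s) f x" using x by (simp add: seqpre_def)
  have t: "inj_on x (idx s Un (%i. i + 1) ` idx s)"
   "!!i j. i \<in> idx s Un (%i. i + 1) ` idx s ==> j \<in> idx s ==> x i ~: inner G (f j)"
   "!!i j. i \<in> idx s ==> j \<in> idx s ==> i ~= j ==> inner G (f i) Int inner G (f j) = {}"
   "!!j. j \<in> idx s ==> at_node G (lend (f j)) (x j)" "!!j. j \<in> idx s ==> at_node G (rend (f j)) (x (j + 1))"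
   using tx unfolding traced_def by auto
  have gi: "gpath G (f i)" "prank (f i) < \<mu>" "prank (f i) = Elem ==> \<mu> = Rk 0" using gpath_SeqD(3,4,5)[OF g i(1)] by auto
  have "EX R. gpath G R & prank R <= prank (f i) & (prank R = Elem --> prank (f i) = Elem) &
   pbranches R = pbranches (f i) - E & inner G R = beyond (f i) E &
   at_node G (lend R) w & prank (lend R) = prank q & at_node G (rend R) (x (i + 1)) & prank (rend R) = prank (rend (f i))"
   using sequence.IH[rule_format, OF i(1), THEN conjunct1, THEN conjunct2, rule_format, OF i(2) sequence.prems(2) t(5)[OF i(1)]] .
  then obtain R0 where R0: "gpath G R0" "prank R0 <= prank (f i)" "prank R0 = Elem --> prank (f i) = Elem"
   "pbranches R0 = pbranches (f i) - E" "inner G R0 = beyond (f i) E"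
   "at_node G (lend R0) w" "prank (lend R0) = prank q" "at_node G (rend R0) (x (i + 1))" "prank (rend R0) = prank (rend (f i))"
   by (elim exE conjE)
  have Es: "E \<subset> pbranches (f i)" using rt_psubset[OF gi(1) i(2)] .
  have R0s: "inner G R0 \<subseteq> inner G (f i)" using R0(5) beyond_inner[OF gi(1)] by simp
  have wi: "w = x i & E = {} \<or> w \<in> inner G (f i)"
  proof (cases "E = {}")
   case True
   hence "q = lend (f i)" using i(2) rt_empty[OF gi(1)] by blast
   thus ?thesis using True t(4)[OF i(1)] sequence.prems(2) at_node_inject by blast
  next
   case False thus ?thesis using rt_inner[OF gi(1) i(2) _ sequence.prems(2)] by blast
  qed
  have wR0: "w ~: inner G R0"
  proof (cases "E = {}")
   case True
   hence "q = lend (f i)" using i(2) rt_empty[OF gi(1)] by blast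
   hence "w = x i" using t(4)[OF i(1)] sequence.prems(2) at_node_inject by blast
   thus ?thesis using t(2)[of i i] i(1) R0s by auto
  next
   case False
   thus ?thesis using beyond_not[OF gi(1) i(2) _ sequence.prems(2)] R0(5) by simp
  qed
  let ?J = "{j. 0 <= j & j + i \<in> idx s}" and ?f = "%j. f (j + i)" and ?x = "%j. x (j + i)"
  let ?g = "?f(0 := R0)" and ?y = "?x(0 := w)"
  have J: "?J \<subseteq> {0..}" "!!j. j \<in> ?J ==> 0 < j ==> j - 1 \<in> ?J" "0 \<in> ?J"
   using i(1) idx_convex[OF i(1)] by auto
  have dom: "i + 1 + j \<in> idx s Un (%i. i + 1) ` idx s" if "j + i \<in> idx s" for j
   using that by (intro UnI2 image_eqI[of _ _ "j + i"]) auto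
  have sp: "seqpre G \<mu> ?J ?g ?y"
  proof (rule seqpre_replace[OF J(1) J(2) J(3)])
   show "seqpre G \<mu> ?J ?f ?x" by (rule seqpre_mono[OF seqpre_shift[OF x(1), of i]]) auto
   show "gpath G R0" "at_node G (lend R0) w" "w ~: inner G R0" by fact+
   show "prank R0 < \<mu>" using R0(2) gi(2) by simp
   show "\<mu> = Rk 0" if "prank R0 = Elem" using R0(3) that gi(3) by blast
   show "at_node G (rend R0) (?x 1)" using R0(8) by (simp add: add.commute)
   show "prank (rend R0) = prank (rend (?f 0))" using R0(9) by simp
   show "w ~= ?x (j + 1)" if j: "j \<in> ?J" for j
    using wi
   proof (elim disjE conjE)
    assume "w = x i"
    thus ?thesis using inj_onD[OF t(1), of i "i + 1 + j"] dom[of j] j i(1) by (auto simp: algebra_simps)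
   next
    assume "w \<in> inner G (f i)"
    thus ?thesis using t(2)[OF dom[of j] i(1)] j by (auto simp: algebra_simps)
   qed
   show "w ~: inner G (?f j)" if j: "j \<in> ?J" "0 < j" for j
    using wi t(2)[of i "j + i"] t(3)[of i "j + i"] i(1) j by auto
   show "?x (j + 1) ~: inner G R0" if j: "j \<in> ?J" for j
    using t(2)[OF dom[of j] i(1)] j R0s by (auto simp: algebra_simps)
   show "inner G R0 Int inner G (?f j) = {}" if j: "j \<in> ?J" "0 < j" for j
    using t(3)[of i "j + i"] i(1) j R0s by auto
  qed auto
  have Jsh: "(%j. j + i) ` (?J - {0}) = {j \<in> idx s. i < j}"
  proof (intro equalityI subsetI)
   fix j assume "j \<in> {j \<in> idx s. i < j}" thus "j \<in> (%j. j + i) ` (?J - {0})" by (intro image_eqI[of _ _ "j - i"]) auto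
  qed auto
  have un: "(\<Union>j\<in>?J - {0}. k (?f j)) = (\<Union>j\<in>{j \<in> idx s. i < j}. k (f j))" for k :: "'b tpath => 'c set"
   unfolding Jsh[symmetric] by simp
  have set1: "(\<Union>j\<in>?J. pbranches (?g j)) = pbranches ?P - D"
  proof -
   have "(\<Union>j\<in>?J. pbranches (?g j)) = pbranches R0 Un post s f i"
    unfolding seqsets_replace(1)[OF J(3,1), of pbranches] un[of pbranches] post_def by simp
   also have "\<dots> = pbranches ?P - D"
    using compl_inside[OF g i(1), of E] Es R0(4) i(3) by auto
   finally show ?thesis .
  qed
  have nodesJ: "{?y j | j. j - 1 \<in> ?J & j \<in> ?J} = {x j | j. j \<in> idx s & i < j}"
   unfolding seqsets_replace(2)[OF J(3,1)]
  proof (intro equalityI subsetI)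
   fix u assume "u \<in> {x j | j. j \<in> idx s & i < j}"
   then obtain j where j: "u = x j" "j \<in> idx s" "i < j" by blast
   hence "j - 1 \<in> idx s" using idx_convex[OF i(1) j(2), of "j - 1"] by simp
   thus "u \<in> {x (j + i) |j. j - 1 \<in> ?J & j \<in> ?J}" using j by (intro CollectI exI[of _ "j - i"]) (auto simp: algebra_simps)
  qed auto
  have set2: "(\<Union>j\<in>?J. inner G (?g j)) Un {?y j | j. j - 1 \<in> ?J & j \<in> ?J} = beyond ?P D"
   unfolding nodesJ seqsets_replace(1)[OF J(3,1), of "inner G"] un[of "inner G"] R0(5)
   using beyond_Seq[OF g i(1) Es, of x] t(4) i(3) by simp
  have ssJ: "seqsets G ?J ?g ?y R ==> pbranches R = pbranches ?P - D & inner G R = beyond ?P D" for R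
   using set1 set2 unfolding seqsets_def by (simp only:)
  have le: "left_end \<mu> ?J ?g ?y (prank q) w"
   unfolding left_end_def using J(3) R0(7) by (intro disjI1 bexI[of _ 0]) auto
  have re: "right_end \<mu> ?J ?g ?y (prank (rend ?P)) v"
   by (rule right_end_of[OF g tx sequence.prems(3) i(1) R0(9)])
  have conv: "j \<in> ?J" if "a \<in> ?J" "k \<in> ?J" "a <= j" "j <= k" for a j k
   using idx_convex[of "a + i" s "k + i" "j + i"] that by simp
  have \<mu>E: "\<mu> ~= Elem" using gpath_SeqD(1)[OF g] .
  have fin: ?thesis if "EX R. gpath G R & prank R = \<mu> & seqsets G ?J ?g ?y R & at_node G (lend R) w & prank (lend R) = prank q &
    at_node G (rend R) v & prank (rend R) = prank (rend ?P)"
  proof -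
   from that obtain R where R: "gpath G R" "prank R = \<mu>" "seqsets G ?J ?g ?y R" "at_node G (lend R) w" "prank (lend R) = prank q"
     "at_node G (rend R) v" "prank (rend R) = prank (rend ?P)" by (elim exE conjE)
   show ?thesis using R(1,2,4-) ssJ[OF R(3)] \<mu>E
    by (intro exI[of _ R]) (simp del: lend.simps rend.simps pbranches.simps)
  qed
  show ?thesis
  proof (cases "\<mu> = Arr")
   case False
   show ?thesis
   proof (rule fin, rule seq_assemble[OF sp \<mu>E _ _ _ le re])
    show "?J ~= {}" using J(3) by blast
    show "j \<in> ?J" if "a \<in> ?J" "k \<in> ?J" "a <= j" "j <= k" for a j k using that by (rule conv)
   qed (use False in simp)
  next
   case Arr: True
   have rR0: "prank (rend R0) = prank (rend (?f 0))" using R0(9) by simp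
   have nTwo: "s ~= Two n" for n using gpath_SeqD(7)[OF g] Arr by (auto simp: junction_ranks_def)
   show ?thesis
   proof (cases "(s = Out \<or> s = Endless) & 0 <= i")
    case True
    show ?thesis
    proof (rule fin, rule seq_assemble[OF sp \<mu>E _ _ _ le re])
     show "?J ~= {}" using J(3) by blast
     show "j \<in> ?J" if "a \<in> ?J" "k \<in> ?J" "a <= j" "j <= k" for a j k using that by (rule conv)
     have "jrank ?g a < jrank ?g b" if "0 < a" "a < b" for a b
      using max_jrank_replace[of R0 ?f, OF rR0] that Arr_Out_jrank[of s f "a + i" "b + i"] g Arr True
      by (simp add: jrank_shift del: fun_upd_apply)
     moreover have "?J = {0..}" using True by auto
     ultimately show "EX a. ?J = {a..} & (ALL i j. a < i & i < j --> jrank ?g i < jrank ?g j)" by blast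
    qed
   next
    case False
    hence si: "(s = In \<or> s = Endless)" "i < 0" using nTwo i(1) by (cases s; auto)+
    \<comment> \<open>In the shifted numbering \<open>c\<close> stands for the old index
      \<open>-1\<close> or \<open>0\<close>: all that is left of an \<open>In\<close>-path is
      merged, and of an endless one everything up to the constituent of index \<open>0\<close>, so
      that exactly the increasing junctions \<open>1, 2, ...\<close> remain.\<close>
    define c where "c = (if s = In then -1 - i else - i)"
    have c: "0 <= c" "{0..c} \<subseteq> ?J" using si unfolding c_def by auto
    obtain C where C: "gpath G C" "prank C < Arr" "prank C = Elem --> prank (?g 0) = Elem" "seqsets G {0..c} ?g ?y C"
     "at_node G (lend C) (?y 0)" "at_node G (rend C) (?y (c + 1))" "prank (lend C) = prank (lend (?g 0))"
     "prank (rend C) = prank (rend (?g c))"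
     using join_block[OF c(1) seqpre_mono[OF sp c(2), unfolded Arr]] by metis
    have CE: "prank C ~= Elem" using C(3) R0(3) gi(3) Arr by auto
    show ?thesis
    proof (cases "s = In")
     case True
     hence Jc: "?J = {0..c}" using si unfolding c_def by auto
     have rP: "rend ?P = rend (f (-1))" using True by simp
     have "?g c = (if c = 0 then R0 else f (-1))" "?y (c + 1) = x 0" using True c(1) unfolding c_def by auto
     moreover have "x 0 = v" using t(5)[of "-1"] sequence.prems(3) rP True at_node_inject by auto
     moreover have "c = 0 ==> i = -1" using True unfolding c_def by simp
     ultimately have "prank (rend C) = prank (rend ?P)" "at_node G (rend C) v"
      using C(6,8) R0(9) rP by (auto simp del: rend.simps split: if_splits)
     thus ?thesis using ssJ[of C] C CE Arr R0(7) unfolding Jc by (intro exI[of _ C]) auto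
    next
     case False
     hence se: "s = Endless" using si by simp
     hence ci: "c = - i" "0 < c" "?J = {0..}" using False si unfolding c_def by auto
     let ?K = "idx Out"
     have spK: "seqpre G Arr ?K (f(0 := C)) (x(0 := w))"
     proof (rule seqpre_replace)
      show "seqpre G Arr ?K f x" using seqpre_mono[OF x(1)] Arr se by auto
      show "gpath G C" "prank C < Arr" by fact+
      show "at_node G (lend C) w" using C(5) by simp
      show "at_node G (rend C) (x 1)" using C(6) ci by simp
      show "prank (rend C) = prank (rend (f 0))" using C(8) ci by simp
      have tJ: "inj_on ?y (?J Un (%i. i + 1) ` ?J)"
       "!!i j. i \<in> ?J Un (%i. i + 1) ` ?J ==> j \<in> ?J ==> ?y i ~: inner G (?g j)"
       "!!i j. i \<in> ?J ==> j \<in> ?J ==> i ~= j ==> inner G (?g i) Int inner G (?g j) = {}"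
       using sp unfolding seqpre_def traced_def by blast+
      have up: "?g (j + c) = f j" "?y (j + 1 + c) = x (j + 1)" if "0 <= j" for j using that ci by auto
      have gf: "?g (j + c) = f j" if "0 < j" for j using that ci by auto
      have inC: "inner G C = (\<Union>j\<in>{0..c}. inner G (?g j)) Un {?y j | j. j - 1 \<in> {0..c} & j \<in> {0..c}}"
       using C(4) by (simp only: seqsets_def)
      have yC: "?y k ~: inner G C" if k: "k = 0 \<or> c < k" for k
      proof -
       have kJ: "k \<in> ?J" unfolding ci(3) using k c(1) by auto
       have "?y k ~: inner G (?g j)" if "j \<in> {0..c}" for j using tJ(2)[of k j] kJ that c(2) by blast
       moreover have "?y k ~= ?y j" if "j - 1 \<in> {0..c}" "j \<in> {0..c}" for j
       proof
        assume "?y k = ?y j"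
        hence "k = j" using inj_onD[OF tJ(1), of k j] kJ that(2) c(2) by blast
        thus False using k that by auto
       qed
       ultimately show ?thesis unfolding inC by blast
      qed
      show "w ~: inner G C" using yC[of 0] by simp
      fix j assume j: "j \<in> ?K"
      show "x (j + 1) ~: inner G C" using yC[of "j + 1 + c"] up(2)[of j] j by simp
      show "w ~= x (j + 1)"
      proof
       assume "w = x (j + 1)"
       hence "?y 0 = ?y (j + 1 + c)" using up(2)[of j] j by simp
       hence "0 = j + 1 + c" using inj_onD[OF tJ(1), of 0 "j + 1 + c"] j ci by auto
       thus False using j c(1) by simp
      qed
      assume j0: "0 < j"
      have jJ: "j + c \<in> ?J" unfolding ci(3) using j0 c(1) by simp
      have "?y 0 ~: inner G (?g (j + c))" by (intro tJ(2)[OF _ jJ] UnI1 J(3))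
      hence "?y 0 ~: inner G (f j)" by (simp only: gf[OF j0] not_False_eq_True)
      thus "w ~: inner G (f j)" by simp
      have "inner G (?g k) Int inner G (f j) = {}" if "k \<in> {0..c}" for k
      proof -
       have kJ: "k \<in> ?J" using that c(2) by blast
       have "inner G (?g k) Int inner G (?g (j + c)) = {}" by (rule tJ(3)[OF kJ jJ]) (use that j0 in auto)
       thus ?thesis by (simp only: gf[OF j0] not_False_eq_True)
      qed
      moreover have "?y k ~: inner G (f j)" if "k \<in> {0..c}" for k
      proof -
       have "k \<in> ?J" using that c(2) by blast
       hence "?y k ~: inner G (?g (j + c))" by (intro tJ(2)[OF _ jJ] UnI1)
       thus ?thesis by (simp only: gf[OF j0] not_False_eq_True)
      qed
      ultimately show "inner G C Int inner G (f j) = {}" unfolding inC by blast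
     qed (use CE in auto)
     have "EX R. gpath G R & prank R = Arr & seqsets G ?K (f(0 := C)) (x(0 := w)) R & at_node G (lend R) w & prank (lend R) = prank q &
       at_node G (rend R) v & prank (rend R) = prank (rend ?P)"
     proof (rule seq_assemble[OF spK])
      show "left_end Arr ?K (f(0 := C)) (x(0 := w)) (prank q) w"
       unfolding left_end_def using C(7) R0(7) by (intro disjI1 bexI[of _ 0]) auto
      have rP: "rend ?P = Seq Arr Out f" using se Arr by simp
      show "right_end Arr ?K (f(0 := C)) (x(0 := w)) (prank (rend ?P)) v"
       unfolding right_end_def rP using sequence.prems(3)[unfolded rP] gpath_ends[OF g, unfolded rP]
       by (intro disjI2 conjI exI[of _ f] exI[of _ 0]) auto
      have rC: "prank (rend C) = prank (rend (f 0))" using C(8) ci by simp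
      have "ALL i j. 0 < i & i < j --> jrank (f(0 := C)) i < jrank (f(0 := C)) j"
       using Arr_Out_jrank[of s f] g Arr se max_jrank_replace[of C f, OF rC] by (simp del: fun_upd_apply)
      thus "EX a. ?K = {a..} & (ALL i j. a < i & i < j --> jrank (f(0 := C)) i < jrank (f(0 := C)) j)"
       by (intro exI[of _ 0]) (auto simp del: fun_upd_apply)
     qed auto
     then obtain R where R: "gpath G R" "prank R = Arr" "seqsets G ?K (f(0 := C)) (x(0 := w)) R" "at_node G (lend R) w"
      "prank (lend R) = prank q" "at_node G (rend R) v" "prank (rend R) = prank (rend ?P)" by blast
     have Jd: "?J = {0..c} Un (%j. j + c) ` {0<..}"
     proof -
      have "j \<in> (%j. j + c) ` {0<..}" if "c < j" for j using that by (intro image_eqI[of _ _ "j - c"]) auto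
      thus ?thesis unfolding ci(3) using c(1) by force
     qed
     have K0: "?K - {0} = {0<..}" by auto
     have unK: "(\<Union>j\<in>?J. k (?g j)) = (\<Union>j\<in>{0..c}. k (?g j)) Un (\<Union>j\<in>{0<..}. k (f j))" for k :: "'b tpath => 'c set"
     proof -
      have "(\<Union>j\<in>(%j. j + c) ` {0<..}. k (?g j)) = (\<Union>j\<in>{0<..}. k (f j))" using ci by auto
      thus ?thesis unfolding Jd UN_Un by simp
     qed
     have nK: "{?y j | j. j - 1 \<in> ?J & j \<in> ?J} = {?y j | j. j - 1 \<in> {0..c} & j \<in> {0..c}} Un {x j | j. j - 1 \<in> ?K & j \<in> ?K}"
     proof (intro equalityI subsetI)
      fix u assume "u \<in> {?y j | j. j - 1 \<in> ?J & j \<in> ?J}"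
      then obtain j where j: "u = ?y j" "1 <= j" unfolding ci(3) by auto
      show "u \<in> {?y j | j. j - 1 \<in> {0..c} & j \<in> {0..c}} Un {x j | j. j - 1 \<in> ?K & j \<in> ?K}"
      proof (cases "j <= c")
       case True thus ?thesis using j by (intro UnI1 CollectI exI[of _ j]) auto
      next
       case False thus ?thesis using j ci by (intro UnI2 CollectI exI[of _ "j - c"]) auto
      qed
     next
      fix u assume "u \<in> {?y j | j. j - 1 \<in> {0..c} & j \<in> {0..c}} Un {x j | j. j - 1 \<in> ?K & j \<in> ?K}"
      then consider (a) j where "u = ?y j" "1 <= j" | (b) j where "u = x j" "1 <= j" by auto
      thus "u \<in> {?y j | j. j - 1 \<in> ?J & j \<in> ?J}"
      proof cases
       case a thus ?thesis unfolding ci(3) by (intro CollectI exI[of _ j]) auto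
      next
       case b thus ?thesis unfolding ci(3) using ci(1,2) by (intro CollectI exI[of _ "j + c"]) auto
      qed
     qed
     have 0: "0 \<in> ?K" "?K \<subseteq> {0..}" by auto
     have "seqsets G ?J ?g ?y R"
      unfolding seqsets_def
     proof
      have "pbranches R = pbranches C Un (\<Union>j\<in>{0<..}. pbranches (f j))"
       using R(3) seqsets_replace(1)[OF 0, of pbranches f C] K0 by (simp only: seqsets_def)
      also have "pbranches C = (\<Union>j\<in>{0..c}. pbranches (?g j))" using C(4) by (simp only: seqsets_def)
      finally show "pbranches R = (\<Union>j\<in>?J. pbranches (?g j))" by (simp only: unK[of pbranches])
      have "inner G R = (inner G C Un (\<Union>j\<in>{0<..}. inner G (f j))) Un {x j | j. j - 1 \<in> ?K & j \<in> ?K}"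
       using R(3) seqsets_replace(1)[OF 0, of "inner G" f C] seqsets_replace(2)[OF 0, of x w] K0 by (simp only: seqsets_def)
      also have "inner G C = (\<Union>j\<in>{0..c}. inner G (?g j)) Un {?y j | j. j - 1 \<in> {0..c} & j \<in> {0..c}}"
       using C(4) by (simp only: seqsets_def)
      finally show "inner G R = (\<Union>j\<in>?J. inner G (?g j)) Un {?y j | j. j - 1 \<in> ?J & j \<in> ?J}"
       unfolding unK[of "inner G"] nK by (simp only: Un_ac)
     qed
     thus ?thesis using fin R Arr by blast
    qed
   qed
  qed
 qed
qed

text \<open>The suffix of the reversed path, reversed again. Its end node is found by
  \<open>left_right_node\<close>.\<close>

lemma prefix:
 assumes g: "gpath G P" and D: "(D, q) \<in> rt P" "D ~= {}" and w: "at_node G q w" and u: "at_node G (lend P) u"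
 shows "EX R. gpath G R & prank R <= prank P & pbranches R = D &
   inner G R \<subseteq> {v. EX E e. (E, e) \<in> rt P & E ~= {} & E \<subset> D & at_node G e v} &
   at_node G (lend R) u & prank (lend R) = prank (lend P) & at_node G (rend R) w"
proof -
 let ?B = "pbranches P"
 have gp: "gpath G (prev P)" using g by simp
 have Ds: "D \<subset> ?B" using rt_psubset[OF g D(1)] .
 obtain p where p: "(?B - D, p) \<in> rt (prev P)" using left_tip[OF gp rt_pt[OF D(1)] D(2)] Ds by blast
 obtain w' where w': "at_node G p w'" using inner_tip_node[OF gp p] Ds by blast
 have lr: "at_node G e v" if "(E, e) \<in> rt P" "(?B - E, e') \<in> rt (prev P)" "E ~= {}" "at_node G e' v" for E e e' v
  using left_right_node[OF rigid_all[of "prank P"] g _ that] by simp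
 have ww: "w' = w" using lr[OF D(1) p D(2) w'] w at_node_inject by blast
 have ru: "at_node G (rend (prev P)) u" using u at_node_trev_iff[OF g] by (simp add: rend_prev)
 obtain R where R: "gpath G R" "prank R <= prank (prev P)" "pbranches R = pbranches (prev P) - (?B - D)"
  "inner G R = beyond (prev P) (?B - D)" "at_node G (lend R) w" "at_node G (rend R) u" "prank (rend R) = prank (rend (prev P))"
  using suffix[OF gp p w'[unfolded ww] ru] by blast
 have in1: "inner G R \<subseteq> {v. EX E e. (E, e) \<in> rt P & E ~= {} & E \<subset> D & at_node G e v}"
 proof
  fix v assume "v \<in> inner G R"
  then obtain F e' where F: "(F, e') \<in> rt (prev P)" "?B - D \<subset> F" "at_node G e' v" unfolding R(4) beyond_def by blast
  have Fs: "F \<subset> ?B" using rt_psubset[OF gp F(1)] by simp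
  have "?B - F \<in> pt P" using pt_prev[OF g rt_pt[OF F(1)]] .
  moreover have "?B - F ~= ?B" using F(2) Fs Ds by blast
  ultimately obtain e where e: "(?B - F, e) \<in> rt P" using pt_rt by blast
  have "?B - (?B - F) = F" using Fs by blast
  hence "at_node G e v" using lr[OF e _ _ F(3)] F(1) Fs by auto
  moreover have "?B - F ~= {}" "?B - F \<subset> D" using Fs F(2) by blast+
  ultimately show "v \<in> {v. EX E e. (E, e) \<in> rt P & E ~= {} & E \<subset> D & at_node G e v}" using e by blast
 qed
 have "pbranches R = D" using R(3) Ds by auto
 thus ?thesis
  using R in1 by (intro exI[of _ "prev R"]) (auto simp: lend_prev rend_prev inner_prev at_node_trev_iff)
qed

end

section \<open>Infinitely many meetings of two paths\<close>

text \<open>Meant for shape \<open>In\<close>, where the open end is on the left: nodes at points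
  that come properly before the terminal node of the tail without the last \<open>m\<close>
  constituents.\<close>

fun tail_nodes :: "'b tgraph => 'b tpath => nat => 'b node set" where
 "tail_nodes G (Seq \<mu> s f) m = {v. EX E e. (E, e) \<in> rt (Seq \<mu> s f) & E ~= {} & E \<subset> pre In f (- int m) & at_node G e v}"
| "tail_nodes G (Br b s) m = {}"

definition ptsof :: "'b tgraph => 'b tpath => 'b node set => 'b set set" where
 "ptsof G Q Y = {F. EX e v. (F, e) \<in> rt Q & F ~= {} & at_node G e v & v \<in> Y}"

text \<open>The tips represented by \<open>p\<close> and \<open>q\<close> are nondisconnectable.\<close>

definition entangled :: "'b tgraph => 'b tpath => 'b tpath => bool" where
 "entangled G p q \<longleftrightarrow> one_ended p & one_ended q & (ALL P Q. gpath G P & one_ended P & prank P = prank p & scoin p P &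
   gpath G Q & one_ended Q & prank Q = prank q & scoin q Q --> infinite (inner G P Int inner G Q))"

lemma psubset_Un_section:
 "C = A Un B ==> A Int B = {} ==> B ~= {} ==> E Int S = {} ==> B \<subseteq> S ==> E Un A \<subset> E Un C"
 by blast

context tfg
begin

text \<open>A tail of the given representative runs in \<open>P\<close> and is a section of it by
  \<open>gpath_subset_emb\<close>; so \<open>P\<close> meets its nodes.\<close>

lemma tail_nodes_inner:
 assumes q: "gpath G (Seq \<mu> In h)" and P: "gpath G P" "one_ended P" "prank P = \<mu>" "scoin (Seq \<mu> In h) P"
 shows "EX m. tail_nodes G (Seq \<mu> In h) m \<subseteq> inner G P"
proof -
 let ?q = "Seq \<mu> In h"
 obtain m where m: "tail_branches ?q m \<subseteq> tail_branches P 0" using P(4) unfolding scoin_def by blast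
 hence mP: "tail_branches ?q m \<subseteq> pbranches P" using tail_branches_0[OF P(2)] by simp
 let ?d = "Seq \<mu> In (%i. h (i - int m))"
 have gd: "gpath G ?d" using gpath_In_shift[OF q] .
 have pre: "pre In (%i. h (i - int m)) i = pre In h (i - int m)" if "i <= 0" for i
 proof -
  have "(%j. j - int m) ` {j \<in> idx In. j < i} = {j \<in> idx In. j < i - int m}"
  proof (intro equalityI subsetI)
   fix j assume "j \<in> {j \<in> idx In. j < i - int m}"
   thus "j \<in> (%j. j - int m) ` {j \<in> idx In. j < i}" using that by (intro image_eqI[of _ _ "j + int m"]) auto
  qed auto
  from this[symmetric] show ?thesis unfolding pre_def by simp
 qed
 have "pbranches ?d = pre In (%i. h (i - int m)) 0" unfolding pre_def by auto
 hence sub: "pbranches ?d \<subseteq> pbranches P" using mP pre[of 0] by (simp add: tail_branches_pre del: tail_branches.simps)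
 obtain s f where Pf: "P = Seq \<mu> s f" using P(2,3) one_endedE by (metis prank.simps(2))
 obtain D Q where Q: "emb G ?d Q D" "Q = P \<or> Q = prev P"
  using gpath_subset_emb[OF rigid_all P(1)[unfolded Pf] gd _ sub[unfolded Pf]] Pf by auto
 have Qg: "gpath G Q" "inner G Q = inner G P" using Q(2) P(1) inner_prev by auto
 have "tail_nodes G ?q m \<subseteq> inner G P"
 proof
  fix v assume "v \<in> tail_nodes G ?q m"
  then obtain E e where E: "(E, e) \<in> rt ?q" "E ~= {}" "E \<subset> pre In h (- int m)" "at_node G e v" by auto
  from E(1)[unfolded rt_Seq_iff] E(2) obtain i E' where i: "i < 0" "(E', e) \<in> rt (h i)" "E = pre In h i Un E'" by auto
  have "i < - int m"
  proof (rule ccontr)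
   assume "\<not> i < - int m"
   hence "pre In h (- int m) \<subseteq> pre In h i" by (intro pre_mono) simp
   thus False using E(3) i(3) by blast
  qed
  hence "(pre In (%i. h (i - int m)) (i + int m) Un E', e) \<in> rt ?d" using i by (intro rt_SeqI) auto
  hence "(E, e) \<in> rt ?d" using pre[of "i + int m"] i(3) \<open>i < - int m\<close> by simp
  then obtain e' where e': "(D Un E, e') \<in> rt Q" "same_tip G e e'"
   using Q(1) unfolding emb_def semb_def by blast
  have "at_node G e' v" using at_node_same_tip[OF rigid e'(2) E(4)] .
  hence "v \<in> inner G Q" using rt_inner[OF Qg(1) e'(1)] E(2) by blast
  thus "v \<in> inner G P" using Qg by simp
 qed
 thus ?thesis by blast
qed

lemma tail_point:
 assumes Q: "gpath G Q" and q: "(D, Seq \<mu> In h) \<in> rt Q" and F: "(F, e) \<in> rt Q" "D \<subset> F" "F \<subset> D Un pre In h (- int m)"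
  and v: "at_node G e v"
 shows "v \<in> tail_nodes G (Seq \<mu> In h) m"
proof -
 let ?q = "Seq \<mu> In h"
 note L = rt_Seq_local[OF Q q refl]
 have gq: "gpath G ?q" using L by blast
 have iq: "iemb ?q Q D" using rt_iemb[OF Q q] gq by simp
 have ps: "pre In h (- int m) \<subseteq> pbranches ?q" by (rule pre_sub)
 have "F - D \<in> pt ?q"
 proof (rule pt_maximal[OF gq])
  show "F - D \<subseteq> pbranches ?q" using F(3) ps by blast
  fix E assume E: "E \<in> pt ?q"
  have "F \<subseteq> D Un E \<or> D Un E \<subseteq> F" using pt_chain[OF Q rt_pt[OF F(1)] iemb_pt[OF iq E]] by blast
  moreover have "D Int E = {}" using iemb_sets(1)[OF iq] pt_subset[OF gq E] by blast
  ultimately show "F - D \<subseteq> E \<or> E \<subseteq> F - D" by blast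
 qed
 moreover have "F - D ~= pbranches ?q" using F(3) ps F(2) by blast
 ultimately obtain e' where e': "(F - D, e') \<in> rt ?q" using pt_rt by blast
 hence "(D Un (F - D), e') \<in> rt Q" using L by blast
 moreover have "D Un (F - D) = F" using F(2) by blast
 ultimately have "e' = e" using rt_unique[OF Q] F(1) by metis
 moreover have "F - D ~= {}" "F - D \<subset> pre In h (- int m)" using F(2,3) iemb_sets(1)[OF iq] ps by blast+
 ultimately show ?thesis using e' v by auto
qed

text \<open>After a branch comes its other end, so such a point has an immediate successor and is no
  limit of later points.\<close>

lemma not_Br_limit:
 assumes Q: "gpath G Q" and U: "(D, Br b s) \<in> rt Q" shows "\<exists>E\<in>pt Q. D \<subset> E & (\<forall>F\<in>pt Q. D \<subset> F --> E \<subseteq> F)"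
proof -
 have b: "b \<in> pbranches Q" "b ~: D" "(pbranches Q - D - {b}, Br b (\<not> s)) \<in> rt (prev Q)" using rt_Br[OF Q U] by auto
 have "pbranches Q - (pbranches Q - D - {b}) \<in> pt Q" using pt_prev[OF Q rt_pt[OF b(3)]] .
 moreover have "pbranches Q - (pbranches Q - D - {b}) = insert b D" using b(1) rt_subset[OF U] by blast
 ultimately have "insert b D \<in> pt Q" by simp
 moreover have "insert b D \<subseteq> F" if "F \<in> pt Q" "D \<subset> F" for F
  using pt_chain[OF Q that(1) \<open>insert b D \<in> pt Q\<close>] that(2) by blast
 ultimately show ?thesis using b(2) by blast
qed

lemma tail_pt:
 assumes Q: "gpath G Q" and q: "(D, Seq \<mu> s h) \<in> rt Q" and k: "k < 0"
 shows "D Un pre In h k \<in> pt Q" "D \<subset> D Un pre In h k" "s = In" "gpath G (Seq \<mu> In h)" "(\<Inter>k\<in>{..<0}. pre In h k) = {}"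
proof -
 note L = rt_Seq_local[OF Q q refl]
 show s: "s = In" and gq: "gpath G (Seq \<mu> In h)" using L by auto
 have gq': "gpath G (prev (Seq \<mu> In h))" using gq by simp
 note J = In_junction[OF gq gq' k]
 have iq: "iemb (Seq \<mu> In h) Q D" using rt_iemb[OF Q] q s gq by simp
 show "D Un pre In h k \<in> pt Q" using iemb_pt[OF iq rt_pt[OF J(1)]] .
 show "D \<subset> D Un pre In h k" using J(3,5) iemb_sets(1)[OF iq] by blast
 show "(\<Inter>k\<in>{..<0}. pre In h k) = {}"
 proof (rule ccontr)
  assume "(\<Inter>k\<in>{..<0}. pre In h k) ~= {}"
  then obtain b where b: "!!k. k < 0 ==> b \<in> pre In h k" by blast
  hence "b \<in> pre In h (-1)" by simp
  then obtain j where "j < 0" "b \<in> pbranches (h j)" unfolding pre_def by auto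
  thus False using b[of j] pre_disjoint[OF gq, of j] by auto
 qed
qed

lemma ptsof_prev:
 assumes Q: "gpath G Q" shows "ptsof G (prev Q) Y = (%F. pbranches Q - F) ` ptsof G Q Y"
proof -
 have *: "pbranches P - F \<in> ptsof G (prev P) Y" if P: "gpath G P" and F: "F \<in> ptsof G P Y" for P F
 proof -
  obtain e v where e: "(F, e) \<in> rt P" "F ~= {}" "at_node G e v" "v \<in> Y" using F by (auto simp: ptsof_def)
  have gp: "gpath G (prev P)" using P by simp
  have Fs: "F \<subset> pbranches P" using rt_psubset[OF P e(1)] .
  then obtain e' where e': "(pbranches P - F, e') \<in> rt (prev P)" using left_tip[OF gp rt_pt[OF e(1)] e(2)] by blast
  have ne: "pbranches P - F ~= {}" using Fs by blast
  obtain v' where v': "at_node G e' v'" using inner_tip_node[OF gp e' ne] by blast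
  have "at_node G e v'" using left_right_node[OF rigid_all[of "prank P"] P _ e(1) e' e(2) v'] by simp
  hence "v' = v" using e(3) at_node_inject by blast
  thus ?thesis using e' ne v' e(4) unfolding ptsof_def by blast
 qed
 show ?thesis
 proof (intro equalityI subsetI)
  fix F assume F: "F \<in> ptsof G (prev Q) Y"
  have "pbranches Q - F \<in> ptsof G Q Y" using *[of "prev Q" F] F Q by simp
  moreover have "F \<subseteq> pbranches Q" using F rt_subset[of F _ "prev Q"] by (auto simp: ptsof_def)
  ultimately show "F \<in> (%F. pbranches Q - F) ` ptsof G Q Y" by (intro image_eqI[of _ _ "pbranches Q - F"]) auto
 qed (use *[OF Q] in blast)
qed

text \<open>Bolzano-Weierstrass for paths. Let \<open>E\<close> be the supremum of the points with
  only finitely many points of the given set before or at them. If \<open>E\<close> itself has this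
  property, the set accumulates at \<open>E\<close> from the right, otherwise from the left, which
  is accumulation from the right in the reversed path.\<close>

lemma accumulation_point:
 assumes Q: "gpath G Q" and inf: "infinite (ptsof G Q Y)"
 shows "EX Q' E U. (Q' = Q \<or> Q' = prev Q) & (E, U) \<in> rt Q' & (\<forall>E'\<in>pt Q'. E \<subset> E' --> infinite {F \<in> ptsof G Q' Y. E \<subset> F & F \<subseteq> E'})"
proof -
 let ?Y = "ptsof G Q Y" and ?B = "pbranches Q"
 define A where "A = {E \<in> pt Q. finite {F \<in> ?Y. F \<subseteq> E}}"
 define E where "E = \<Union>A"
 have Ypt: "?Y \<subseteq> pt Q" using rt_pt by (auto simp: ptsof_def)
 have Ys: "F \<subseteq> ?B" if "F \<in> ?Y" for F using that pt_subset[OF Q] Ypt by blast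
 have Ept: "E \<in> pt Q"
 proof (rule pt_maximal[OF Q])
  show "E \<subseteq> ?B" using pt_subset[OF Q] unfolding E_def A_def by blast
  fix F assume F: "F \<in> pt Q"
  have "E' \<subseteq> F \<or> F \<subseteq> E'" if "E' \<in> A" for E' using pt_chain[OF Q] F that unfolding A_def by blast
  thus "E \<subseteq> F \<or> F \<subseteq> E" unfolding E_def by blast
 qed
 have below: "finite {F \<in> ?Y. F \<subseteq> E'}" if E': "E' \<in> pt Q" "E' \<subset> E" for E'
 proof -
  obtain E'' where "E'' \<in> A" "\<not> E'' \<subseteq> E'" using E'(2) unfolding E_def by blast
  hence "E' \<subseteq> E''" "finite {F \<in> ?Y. F \<subseteq> E''}" using pt_chain[OF Q E'(1)] unfolding A_def by blast+
  thus ?thesis by (auto elim!: rev_finite_subset)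
 qed
 have above: "infinite {F \<in> ?Y. F \<subseteq> E'}" if "E' \<in> pt Q" "E \<subset> E'" for E'
  using that unfolding E_def A_def by blast
 show ?thesis
 proof (cases "finite {F \<in> ?Y. F \<subseteq> E}")
  case True
  have "E ~= ?B"
  proof
   assume "E = ?B"
   hence "{F \<in> ?Y. F \<subseteq> E} = ?Y" using Ys by blast
   thus False using True inf by simp
  qed
  then obtain U where U: "(E, U) \<in> rt Q" using pt_rt Ept by blast
  have "infinite {F \<in> ?Y. E \<subset> F & F \<subseteq> E'}" if E': "E' \<in> pt Q" "E \<subset> E'" for E'
  proof -
   have "{F \<in> ?Y. F \<subseteq> E'} \<subseteq> {F \<in> ?Y. F \<subseteq> E} Un {F \<in> ?Y. E \<subset> F & F \<subseteq> E'}"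
    using pt_chain[OF Q Ept] Ypt by blast
   thus ?thesis using above[OF E'] True by (meson finite_UnI finite_subset)
  qed
  thus ?thesis using U by blast
 next
  case False
  have Ene: "E ~= {}"
  proof
   assume "E = {}"
   moreover have "F ~= {}" if "F \<in> ?Y" for F using that by (auto simp: ptsof_def)
   ultimately have e: "{F \<in> ?Y. F \<subseteq> E} = {}" by blast
   show False using False unfolding e by simp
  qed
  have Es: "E \<subseteq> ?B" using pt_subset[OF Q Ept] .
  obtain U where U: "(?B - E, U) \<in> rt (prev Q)" using left_tip[OF _ Ept Ene Es] Q by auto
  have "infinite {F \<in> ptsof G (prev Q) Y. ?B - E \<subset> F & F \<subseteq> E'}" if E': "E' \<in> pt (prev Q)" "?B - E \<subset> E'" for E'
  proof
   assume fin: "finite {F \<in> ptsof G (prev Q) Y. ?B - E \<subset> F & F \<subseteq> E'}"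
   have E's: "E' \<subseteq> ?B" using pt_subset[of "prev Q" E'] E'(1) Q by simp
   let ?E = "?B - E'"
   have 1: "?E \<in> pt Q" "?E \<subset> E" using pt_prev[OF Q E'(1)] E'(2) E's by blast+
   have "{F \<in> ?Y. F \<subseteq> E} \<subseteq> {F \<in> ?Y. F \<subseteq> ?E} Un {E} Un (%F. ?B - F) ` {F \<in> ptsof G (prev Q) Y. ?B - E \<subset> F & F \<subseteq> E'}"
   proof
    fix F assume F: "F \<in> {F \<in> ?Y. F \<subseteq> E}"
    show "F \<in> {F \<in> ?Y. F \<subseteq> ?E} Un {E} Un (%F. ?B - F) ` {F \<in> ptsof G (prev Q) Y. ?B - E \<subset> F & F \<subseteq> E'}"
    proof (cases "F \<subseteq> ?E \<or> F = E")
     case False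
     hence FE: "?E \<subseteq> F" "F \<subset> E" using F pt_chain[OF Q 1(1)] Ypt by blast+
     have "?B - F \<in> ptsof G (prev Q) Y" using ptsof_prev[OF Q] F by blast
     moreover have "?B - E \<subset> ?B - F" "?B - F \<subseteq> E'" using FE Es by blast+
     moreover have "F = ?B - (?B - F)" using FE Es by blast
     ultimately show ?thesis by blast
    qed (use F in blast)
   qed
   moreover have "finite ({F \<in> ?Y. F \<subseteq> ?E} Un {E} Un (%F. ?B - F) ` {F \<in> ptsof G (prev Q) Y. ?B - E \<subset> F & F \<subseteq> E'})"
    using below[OF 1] fin by simp
   ultimately show False using False finite_subset by blast
  qed
  thus ?thesis using U by blast
 qed
qed

lemma accumulation_tip:
 assumes Q: "gpath G Q" and U: "(E, U) \<in> rt Q"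
  and acc: "\<forall>E'\<in>pt Q. E \<subset> E' --> infinite {F \<in> ptsof G Q Y. E \<subset> F & F \<subseteq> E'}"
 shows "EX \<mu> h. U = Seq \<mu> In h & gpath G U & (ALL m. infinite (Y Int tail_nodes G U m))"
proof (cases U)
 case (Br b s)
 from not_Br_limit[OF Q U[unfolded Br]] obtain E' where E': "E' \<in> pt Q" "E \<subset> E'" "\<forall>F\<in>pt Q. E \<subset> F --> E' \<subseteq> F"
  by (elim bexE conjE)
 have "{F \<in> ptsof G Q Y. E \<subset> F & F \<subseteq> E'} \<subseteq> {E'}" using E'(3) rt_pt unfolding ptsof_def by blast
 hence "finite {F \<in> ptsof G Q Y. E \<subset> F & F \<subseteq> E'}" by (rule finite_subset) simp
 thus ?thesis using acc E'(1,2) by simp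
next
 case (Seq \<mu> s h)
 note t = tail_pt[OF Q U[unfolded Seq]]
 have s: "s = In" and gU: "gpath G (Seq \<mu> In h)" using t[of "-1"] by auto
 have "infinite (Y Int tail_nodes G (Seq \<mu> In h) m)" for m
 proof
  assume fin: "finite (Y Int tail_nodes G (Seq \<mu> In h) m)"
  \<comment> \<open>One constituent closer to the open end than \<open>m\<close>, because
    \<open>tail_nodes\<close> asks for proper subsets.\<close>
  let ?k = "- int m - 1"
  let ?S = "{F \<in> ptsof G Q Y. E \<subset> F & F \<subseteq> E Un pre In h ?k}"
  have inf: "infinite ?S" using acc t(1,2)[of ?k] by simp
  have lt: "E Un pre In h ?k \<subset> E Un pre In h (- int m)"
  proof -
   have gp: "gpath G (prev (Seq \<mu> In h))" using gU by simp
   have k: "?k \<in> idx In" by simp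
   have "pre In h (?k + 1) = pre In h ?k Un pbranches (h ?k)" by (rule pre_Suc[OF k])
   moreover have "pre In h ?k Int pbranches (h ?k) = {}" by (rule pre_disjoint[OF gU k])
   moreover have "pbranches (h ?k) ~= {}" using pbranches_nonempty gpath_SeqD(3)[OF gU k] by blast
   moreover have "E Int pbranches (Seq \<mu> In h) = {}" using rt_Seq_local[OF Q U[unfolded Seq] refl] s by simp
   moreover have "pbranches (h ?k) \<subseteq> pbranches (Seq \<mu> In h)" unfolding pbranches.simps using k by blast
   ultimately have "E Un pre In h ?k \<subset> E Un pre In h (?k + 1)" by (rule psubset_Un_section)
   thus ?thesis by simp
  qed
  define \<phi> where "\<phi> F = (SOME v. EX e. (F, e) \<in> rt Q & at_node G e v & v \<in> Y)" for F
  have \<phi>: "EX e. (F, e) \<in> rt Q & at_node G e (\<phi> F) & \<phi> F \<in> Y" if "F \<in> ptsof G Q Y" for F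
   unfolding \<phi>_def by (rule someI_ex) (use that in \<open>auto simp: ptsof_def\<close>)
  have "inj_on \<phi> ?S"
  proof (rule inj_onI)
   fix F F' assume F: "F \<in> ?S" "F' \<in> ?S" "\<phi> F = \<phi> F'"
   obtain e e' where e: "(F, e) \<in> rt Q" "at_node G e (\<phi> F)" "(F', e') \<in> rt Q" "at_node G e' (\<phi> F)"
    using \<phi>[of F] \<phi>[of F'] F by auto
   show "F = F'" using inner_points_distinct[OF rigid_all[of "prank Q"] Q _ e(1,3) _ _ e(2,4)] F by auto
  qed
  moreover have "\<phi> ` ?S \<subseteq> Y Int tail_nodes G (Seq \<mu> In h) m"
  proof
   fix v assume "v \<in> \<phi> ` ?S"
   then obtain F where F: "F \<in> ?S" "v = \<phi> F" by blast
   then obtain e where e: "(F, e) \<in> rt Q" "at_node G e v" "v \<in> Y" using \<phi>[of F] by auto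
   have "F \<subset> E Un pre In h (- int m)" using F lt by blast
   thus "v \<in> Y Int tail_nodes G (Seq \<mu> In h) m"
    using tail_point[OF Q U[unfolded Seq s] e(1) _ _ e(2)] F e(3) by auto
  qed
  ultimately show False using inf fin by (meson finite_imageD finite_subset)
 qed
 thus ?thesis using Seq s gU by auto
qed

text \<open>\<open>X\<close> consists of points of \<open>P\<close> at nodes of \<open>Q\<close>, up
  to the exceptional nodes \<open>N\<close> and the right end of \<open>P\<close>. If there is no
  first one, the points accumulate at their infimum, where \<open>P\<close> has an open tip
  \<open>q\<close>. Almost all of the nodes found lie in any given tail of \<open>q\<close>, and
  they accumulate in \<open>Q\<close> at an open tip \<open>U\<close>; so representatives of both
  tips always share infinitely many nodes.\<close>

lemma infinite_meeting:
 assumes P: "gpath G P" and Q: "gpath G Q" and X: "X \<subseteq> pt P" "X ~= {}" "\<Inter>X ~: X"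
  and node: "!!D. D \<in> X ==> D ~= pbranches P ==> D ~= {} & (EX e v. (D, e) \<in> rt P & at_node G e v & v \<in> inner G Q Un N)"
  and N: "finite N"
 shows "EX q E U. (\<Inter>X, q) \<in> rt P & ((E, U) \<in> rt Q \<or> (E, U) \<in> rt (prev Q)) & gpath G q & gpath G U & entangled G q U"
proof -
 let ?D = "\<Inter>X"
 have Dpt: "?D \<in> pt P"
 proof (rule pt_maximal[OF P])
  show "?D \<subseteq> pbranches P" using X(1,2) pt_subset[OF P] by blast
  fix F assume F: "F \<in> pt P"
  have "D \<subseteq> F \<or> F \<subseteq> D" if "D \<in> X" for D using pt_chain[OF P] F X(1) that by blast
  thus "?D \<subseteq> F \<or> F \<subseteq> ?D" by blast
 qed
 have Dlt: "?D \<subset> D" if "D \<in> X" for D using that X(3) by blast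
 have "?D ~= pbranches P" using Dlt X pt_subset[OF P] by blast
 then obtain q where q: "(?D, q) \<in> rt P" using pt_rt Dpt by blast
 obtain \<mu> s h where qs: "q = Seq \<mu> s h"
 proof (cases q)
  case (Br b s)
  from not_Br_limit[OF P q[unfolded Br]] obtain E where E: "E \<in> pt P" "?D \<subset> E" "\<forall>F\<in>pt P. ?D \<subset> F --> E \<subseteq> F"
   by (elim bexE conjE)
  have "E \<subseteq> F" if "F \<in> X" for F using E(3) X(1) Dlt[OF that] that by (meson subsetD)
  hence "E \<subseteq> ?D" by (rule Inter_greatest)
  thus ?thesis using E(2) by (meson leD)
 qed
 note t = tail_pt[OF P q[unfolded qs]]
 have s: "s = In" and gq: "gpath G (Seq \<mu> In h)" using t[of "-1"] by auto
 have qI: "q = Seq \<mu> In h" using qs s by simp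
 have ex: "EX D. D \<in> X & D \<subset> ?D Un pre In h k" if "k < 0" for k
 proof (rule ccontr)
  assume "\<not> ?thesis"
  hence "?D Un pre In h k \<subseteq> D" if "D \<in> X" for D using pt_chain[OF P t(1)[OF \<open>k < 0\<close>]] X(1) that by blast
  hence "?D Un pre In h k \<subseteq> ?D" by blast
  thus False using t(2)[OF \<open>k < 0\<close>] by blast
 qed
 have "EX D v. D \<in> X & D \<subset> ?D Un pre In h (- int k - 1) & (EX e. (D, e) \<in> rt P & at_node G e v) & v \<in> inner G Q Un N" for k :: nat
 proof -
  obtain D where D: "D \<in> X" "D \<subset> ?D Un pre In h (- int k - 1)" using ex[of "- int k - 1"] by auto
  have "?D Un pre In h (- int k - 1) \<subseteq> pbranches P" using pt_subset[OF P t(1)[of "- int k - 1"]] by simp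
  hence "D ~= pbranches P" using D(2) by blast
  thus ?thesis using node[OF D(1)] D by blast
 qed
 then obtain Dk vk where k: "!!k. Dk k \<in> X" "!!k. Dk k \<subset> ?D Un pre In h (- int k - 1)"
  "!!k. EX e. (Dk k, e) \<in> rt P & at_node G e (vk k)" "!!k. vk k \<in> inner G Q Un N" by metis
 have vt: "vk k \<in> tail_nodes G q m" if "m <= k" for k m
 proof -
  obtain e where e: "(Dk k, e) \<in> rt P" "at_node G e (vk k)" using k(3) by blast
  have "pre In h (- int k - 1) \<subseteq> pre In h (- int m)" using that by (intro pre_mono) simp
  hence "Dk k \<subset> ?D Un pre In h (- int m)" using k(2)[of k] by blast
  thus ?thesis unfolding qI using tail_point[OF P q[unfolded qI] e(1) Dlt[OF k(1)] _ e(2)] by blast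
 qed
 \<comment> \<open>A node occurring for infinitely many \<open>k\<close> would, by
   \<open>inner_points_distinct\<close>, give one point inside all tails, and these shrink to the
   infimum.\<close>
 have infv: "infinite (range vk)"
 proof
  assume "finite (range vk)"
  then obtain w where w: "infinite {k. vk k = w}"
   using pigeonhole_infinite[of "UNIV :: nat set" vk] by auto
  then obtain k0 where k0: "vk k0 = w" by (metis (mono_tags, lifting) empty_Collect_eq finite.emptyI)
  have eqD: "Dk k = Dk k0" if kw: "vk k = w" for k
  proof -
   obtain e e' where e: "(Dk k, e) \<in> rt P" "at_node G e w" "(Dk k0, e') \<in> rt P" "at_node G e' w"
    using k(3)[of k] k(3)[of k0] unfolding kw k0 by blast
   have "Dk k ~= {}" "Dk k0 ~= {}" using Dlt[OF k(1)] by blast+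
   thus ?thesis using inner_points_distinct[OF rigid_all[of "prank P"] P _ e(1,3) _ _ e(2,4)] by simp
  qed
  have "Dk k0 \<subseteq> ?D Un pre In h j" if "j < 0" for j
  proof -
   have "\<not> {k. vk k = w} \<subseteq> {..nat (- j)}" using w finite_subset by blast
   then obtain k where kk: "k > nat (- j)" "vk k = w" by (metis (mono_tags, lifting) atMost_iff mem_Collect_eq not_le subsetI)
   have "pre In h (- int k - 1) \<subseteq> pre In h j" using kk(1) that by (intro pre_mono) linarith
   thus ?thesis using k(2)[of k] eqD[OF kk(2)] by blast
  qed
  hence "Dk k0 \<subseteq> ?D Un (\<Inter>j\<in>{..<0}. pre In h j)" by blast
  thus False using t(5)[of "-1"] Dlt[OF k(1)[of k0]] by simp
 qed
 define Y where "Y = range vk Int inner G Q"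
 have "range vk \<subseteq> Y Un N" using k(4) unfolding Y_def by blast
 hence infY: "infinite Y" using infv N by (meson finite_UnI finite_subset)
 have cof: "finite (Y - tail_nodes G q m)" for m
 proof -
  have "Y - tail_nodes G q m \<subseteq> vk ` {..<m}"
  proof
   fix v assume "v \<in> Y - tail_nodes G q m"
   then obtain k where "v = vk k" "vk k ~: tail_nodes G q m" unfolding Y_def by blast
   moreover from this have "k < m" using vt[of m k] by (metis not_le)
   ultimately show "v \<in> vk ` {..<m}" by blast
  qed
  thus ?thesis by (rule finite_subset) simp
 qed
 have "infinite (ptsof G Q Y)"
 proof
  assume fin: "finite (ptsof G Q Y)"
  define \<psi> where "\<psi> F = (SOME v. EX e. (F, e) \<in> rt Q & at_node G e v)" for F
  have "Y \<subseteq> \<psi> ` ptsof G Q Y"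
  proof
   fix v assume v: "v \<in> Y"
   then obtain F e where F: "(F, e) \<in> rt Q" "F ~= {}" "at_node G e v" using inner_rt[OF Q] unfolding Y_def by blast
   hence "F \<in> ptsof G Q Y" using v unfolding ptsof_def by blast
   moreover have "EX e'. (F, e') \<in> rt Q & at_node G e' (\<psi> F)" unfolding \<psi>_def by (rule someI_ex) (use F in blast)
   hence "\<psi> F = v" using rt_unique[OF Q F(1)] F(3) at_node_inject by blast
   ultimately show "v \<in> \<psi> ` ptsof G Q Y" by blast
  qed
  thus False using infY fin finite_surj by blast
 qed
 from accumulation_point[OF Q this] obtain Q' E U where U: "Q' = Q \<or> Q' = prev Q" "(E, U) \<in> rt Q'"
  "\<forall>E'\<in>pt Q'. E \<subset> E' --> infinite {F \<in> ptsof G Q' Y. E \<subset> F & F \<subseteq> E'}" by blast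
 have Q': "gpath G Q'" using U(1) Q by auto
 obtain \<beta> g where Ub: "U = Seq \<beta> In g" "gpath G U" "!!m. infinite (Y Int tail_nodes G U m)"
  using accumulation_tip[OF Q' U(2,3)] by blast
 have "entangled G q U"
  unfolding entangled_def
 proof (intro conjI allI impI, goal_cases)
  case (3 R S)
  obtain m where m: "tail_nodes G q m \<subseteq> inner G R" using tail_nodes_inner[OF gq, of R] 3 qI by auto
  obtain n where n: "tail_nodes G U n \<subseteq> inner G S" using tail_nodes_inner[of \<beta> g S] 3 Ub by auto
  have "Y Int tail_nodes G U n \<subseteq> (inner G R Int inner G S) Un (Y - tail_nodes G q m)" using m n by blast
  thus ?case using Ub(3)[of n] cof[of m] by (meson finite_UnI finite_subset)
 qed (use qI Ub(1) in \<open>auto simp: one_ended_def\<close>)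
 thus ?thesis using q U(1,2) Ub(2) gq qI by blast
qed

lemma lend_shape: "gpath G P ==> (EX b s. lend P = Br b s) \<or> (EX \<mu> f. lend P = Seq \<mu> In f)"
 using rt_Seq_local[OF _ rt_lend] by (cases "lend P") auto

lemma tip_node_exists:
 assumes "gpath G p" "one_ended p \<or> (EX b s. p = Br b s)" "prank p < \<nu>" shows "EX w. at_node G p w"
proof (cases "one_ended p")
 case True
 let ?t = "tclass G (prank p) p"
 have "prank p ~= Elem" using True gpath_Elem[OF assms(1)] by (auto simp: one_ended_def)
 hence "?t \<in> tips G (prank p)" using True assms(1) unfolding tips_def tclass_def by auto
 then obtain w where "maxnode G w" "?t \<in> etips w" using tip_unique_maxnode assms(3) by blast
 moreover have "p \<in> ?t" using True assms(1) coincide_refl by (auto simp: tclass_def)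
 ultimately show ?thesis unfolding at_node_def by blast
next
 case False
 then obtain b s where "p = Br b s" using assms(2) by auto
 thus ?thesis using Br_node assms(1) by simp
qed

lemma end_nodes_exist:
 assumes "gpath G P" "prank P < \<nu>" shows "EX x. at_node G (lend P) x" "EX y. at_node G (rend P) y"
proof -
 have *: "EX x. at_node G (lend P) x" if g: "gpath G P" "prank P < \<nu>" for P
 proof (rule tip_node_exists)
  show "gpath G (lend P)" using gpath_ends[OF g(1)] by simp
  show "one_ended (lend P) \<or> (EX b s. lend P = Br b s)" using lend_shape[OF g(1)] by (auto simp: one_ended_def)
  show "prank (lend P) < \<nu>" using lend_prank[OF g(1)] g(2) by simp
 qed
 show "EX x. at_node G (lend P) x" using *[OF assms] .
 show "EX y. at_node G (rend P) y" using *[of "prev P"] assms at_node_trev_iff(2)[OF assms(1)] by (auto simp: lend_prev)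
qed

lemma lower_tip: "at_node G p w ==> nrank w < \<nu> ==> prank p < rpred \<nu>"
 using at_nodeE[of p w] less_imp_le_rpred[of "nrank w" \<nu>] nu_valid(2) by (metis order_less_le_trans)

lemma at_node_maxnode: "at_node G p w ==> maxnode G w" by (simp add: at_node_def)

lemma at_node_nrank: "at_node G p w ==> nrank w <= \<nu>"
 using node_valid(3) maxnode_node at_node_maxnode by blast

end

section \<open>Ranks of nodes and tips in a pristine graph\<close>

locale pristine_graph = tfg +
 assumes pristine: "pristine \<nu> G" and nu_ge1: "Rk 1 <= \<nu>"
begin

lemma top_etips: "maxnode G w ==> nrank w = \<nu> ==> etips w = ntips w"
proof -
 assume w: "maxnode G w" "nrank w = \<nu>"
 hence "nexc w = None" using pristine maxnode_node unfolding pristine_def by blast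
 thus ?thesis by (cases w) auto
qed

lemma top_tip:
 assumes "at_node G p w" "nrank w = \<nu>" shows "prank p = rpred \<nu>"
proof -
 obtain t where t: "t \<in> etips w" "p \<in> t" "maxnode G w" using assms by (auto simp: at_node_def)
 hence "t \<in> tips G (rpred \<nu>)" using top_etips[OF t(3) assms(2)] node_valid(5)[OF maxnode_node[OF t(3)]] assms(2) by auto
 thus ?thesis using tips_prank t by blast
qed

lemma tip_lower: "at_node G p w ==> prank p < rpred \<nu> ==> nrank w < \<nu>"
 using top_tip at_node_nrank by (metis order_le_less less_irrefl)

lemma tip_top: "at_node G p w ==> prank p = rpred \<nu> ==> nrank w = \<nu>"
 using lower_tip at_node_nrank by (metis order_le_less less_irrefl)

text \<open>Hence a path of rank below \<open>\<nu>\<close> meets no \<open>\<nu>\<close>-node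
  inside, although its open ends may lie at \<open>\<nu>\<close>-nodes.\<close>

lemma inner_tip_rank:
 assumes "gpath G P" "prank P < \<nu>" "(D, q) \<in> rt P" "D ~= {}" shows "prank q < rpred \<nu>"
proof -
 have "prank P ~= Elem" using assms gpath_Elem[OF assms(1)] by auto
 hence "prank q < prank P" using tip_ranks_less[OF rt_tip_rank[OF assms(1,3,4)]] by simp
 thus ?thesis using less_imp_le_rpred[OF assms(2) nu_valid(2)] by simp
qed

lemma inner_lower: "gpath G P ==> prank P < \<nu> ==> w \<in> inner G P ==> nrank w < \<nu> & maxnode G w"
 using inner_rt inner_tip_rank tip_lower at_node_maxnode by blast

text \<open>
  If no two tips at distinct nodes of a set are nondisconnectable, then two paths with a common
  end node contain a path between their other ends: the first node at which the first path meets
  the second one exists, since otherwise the meeting nodes would accumulate at a tip of the first and at a tip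
  of the second path.
\<close>

lemma arc_trans:
 assumes OK: "!!u v p q. u \<in> OK ==> v \<in> OK ==> u ~= v ==> at_node G p u ==> at_node G q v ==> \<not> entangled G p q"
  and inn: "!!R. gpath G R ==> prank R < \<nu> ==> inner G R \<subseteq> OK"
  and P: "arc x P z" "prank P < \<nu>" and Q: "arc z Q y" "prank Q < \<nu>"
  and xyz: "x \<in> OK" "y \<in> OK" "z \<in> OK" "x ~= y" "nrank z < \<nu>"
 shows "EX R. arc x R y & prank R < \<nu> & pbranches R \<subseteq> pbranches P Un pbranches Q"
proof -
 have gP: "gpath G P" "at_node G (lend P) x" "at_node G (rend P) z" "x ~= z" "x ~: inner G P" "z ~: inner G P"
  and gQ: "gpath G Q" "at_node G (lend Q) z" "at_node G (rend Q) y" "z ~= y" "z ~: inner G Q" "y ~: inner G Q"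
  using P(1) Q(1) by (auto simp: arc_def)
 have suf: "EX R. arc w R y & prank R < \<nu> & pbranches R \<subseteq> pbranches Q & inner G R \<subseteq> inner G Q" if w: "w \<in> inner G Q" for w
 proof -
  obtain E e where E: "(E, e) \<in> rt Q" "E ~= {}" "at_node G e w" using inner_rt[OF gQ(1) w] by blast
  obtain R where R: "gpath G R" "prank R <= prank Q" "pbranches R = pbranches Q - E" "inner G R = beyond Q E"
   "at_node G (lend R) w" "at_node G (rend R) y" using suffix[OF gQ(1) E(1,3) gQ(3)] by blast
  have "inner G R \<subseteq> inner G Q" using beyond_inner[OF gQ(1)] R(4) by simp
  moreover have "w ~: inner G R" using beyond_not[OF gQ(1) E] R(4) by simp
  moreover have "w ~= y" using w gQ by auto
  ultimately show ?thesis using R gQ Q(2) unfolding arc_def by (intro exI[of _ R]) auto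
 qed
 show ?thesis
 proof (cases "x \<in> inner G Q")
  case True thus ?thesis using suf[OF True] by blast
 next
  case xQ: False
  let ?B = "pbranches P" and ?Y = "inner G Q Un {y}"
  \<comment> \<open>The right end \<open>?B\<close> is included to make \<open>X\<close> nonempty;
    if it is the least member, then \<open>P\<close> meets \<open>Q\<close> nowhere before
    \<open>z\<close>.\<close>
  define X where "X = {D \<in> pt P. D = ?B \<or> (D ~= {} & (EX e v. (D, e) \<in> rt P & at_node G e v & v \<in> ?Y))}"
  have X: "X \<subseteq> pt P" "?B \<in> X" unfolding X_def by auto
  have XI: "D \<in> X" if "D ~= {}" "(D, e) \<in> rt P" "at_node G e v" "v \<in> inner G Q Un {y}" for D e v
   using that rt_pt[OF that(2)] unfolding X_def by blast
  have Xnode: "D ~= {} & (EX e v. (D, e) \<in> rt P & at_node G e v & v \<in> inner G Q Un {y})" if "D \<in> X" "D ~= ?B" for D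
   using that unfolding X_def by blast
  have Bne: "?B ~= {}" using pbranches_nonempty[OF gP(1)] .
  show ?thesis
  proof (cases "\<Inter>X \<in> X")
   case False
   obtain q E U where q: "(\<Inter>X, q) \<in> rt P" "(E, U) \<in> rt Q \<or> (E, U) \<in> rt (prev Q)" "entangled G q U"
    using infinite_meeting[OF gP(1) gQ(1) X(1) _ False Xnode] X(2) by blast
   \<comment> \<open>The infimum lies at a node off \<open>Q\<close>, since otherwise it would
     belong to \<open>X\<close>; the tip found in \<open>Q\<close> lies at a node of
     \<open>Q\<close>. So entangled tips lie at distinct nodes, which is excluded.\<close>
   have "\<exists>u\<in>OK. at_node G q u & u ~: insert z ?Y"
   proof (cases "\<Inter>X = {}")
    case True
    hence "q = lend P" using q(1) rt_empty[OF gP(1)] by simp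
    thus ?thesis using gP xyz xQ by auto
   next
    case Xne: False
    obtain u where u: "at_node G q u" using inner_tip_node[OF gP(1) q(1) Xne] by blast
    have ui: "u \<in> inner G P" using rt_inner[OF gP(1) q(1) Xne u] .
    have "u ~: ?Y"
    proof
     assume "u \<in> ?Y"
     hence "\<Inter>X \<in> X" using XI[OF Xne q(1) u] by simp
     thus False using False by simp
    qed
    moreover have "u ~= z" using ui gP by auto
    ultimately show ?thesis using u ui inn[OF gP(1) P(2)] by blast
   qed
   then obtain u where u: "u \<in> OK" "at_node G q u" "u ~: insert z ?Y" by blast
   have "\<exists>v\<in>OK. at_node G U v & v \<in> insert z ?Y"
   proof -
    consider (a) "(E, U) \<in> rt Q" "E = {}" | (b) "(E, U) \<in> rt Q" "E ~= {}" | (c) "(E, U) \<in> rt (prev Q)" "E = {}"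
     | (d) "(E, U) \<in> rt (prev Q)" "E ~= {}" using q(2) by blast
    thus ?thesis
    proof cases
     case a hence "U = lend Q" using rt_empty[OF gQ(1)] by simp
     thus ?thesis using gQ xyz by auto
    next
     case b
     then obtain v where v: "at_node G U v" using inner_tip_node[OF gQ(1)] by blast
     thus ?thesis using rt_inner[OF gQ(1) b v] inn[OF gQ(1) Q(2)] by blast
    next
     case c hence "U = lend (prev Q)" using rt_empty[of "prev Q" U] gQ(1) by simp
     thus ?thesis using gQ xyz at_node_trev_iff(2)[OF gQ(1)] by (auto simp: lend_prev)
    next
     case d
     have g: "gpath G (prev Q)" using gQ by simp
     obtain v where v: "at_node G U v" using inner_tip_node[OF g d] by blast
     thus ?thesis using rt_inner[OF g d v] inn[OF gQ(1) Q(2)] inner_prev[OF gQ(1)] by blast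
    qed
   qed
   then obtain v where v: "v \<in> OK" "at_node G U v" "v \<in> insert z ?Y" by blast
   thus ?thesis using OK[OF u(1) v(1) _ u(2) v(2)] q(3) u(3) by blast
  next
   case True
   have lowest: "\<Inter>X \<subseteq> D" if "D \<in> X" for D using that by blast
   have zlow: "prank (rend P) < rpred \<nu>" "prank (lend Q) < rpred \<nu>" using lower_tip gP(3) gQ(2) xyz(5) by blast+
   show ?thesis
   proof (cases "\<Inter>X = ?B")
    case XB: True
    have none: "v ~: ?Y" if v: "v \<in> inner G P" for v
    proof
     assume vY: "v \<in> ?Y"
     obtain D e where D: "(D, e) \<in> rt P" "D ~= {}" "at_node G e v" using inner_rt[OF gP(1) v] by blast
     hence "D \<in> X" using XI[OF D(2,1,3) vY] by simp
     hence "?B \<subseteq> D" using lowest XB by blast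
     thus False using rt_psubset[OF gP(1) D(1)] by blast
    qed
    have "joinable x z y P Q" unfolding joinable_def using P(1) Q(1) xyz(4) xQ none by blast
    from join[OF this P(2) Q(2) zlow] obtain R where R: "joined x z y P Q R" "prank R < \<nu>" by blast
    thus ?thesis using joined_arc[OF \<open>joinable x z y P Q\<close> R(1)] unfolding joined_def by blast
   next
    case XnB: False
    obtain e w where w: "\<Inter>X ~= {}" "(\<Inter>X, e) \<in> rt P" "at_node G e w" "w \<in> ?Y" using Xnode[OF True XnB] by blast
    \<comment> \<open>\<open>P\<close> up to its first meeting \<open>w\<close> with
      \<open>Q\<close> or \<open>y\<close>; by minimality nothing before \<open>w\<close> is on
      \<open>Q\<close>, so that the part of \<open>Q\<close> after \<open>w\<close> can be
      appended.\<close>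
    obtain R1 where R1: "gpath G R1" "prank R1 <= prank P" "pbranches R1 = \<Inter>X"
     "inner G R1 \<subseteq> {v. EX E e. (E, e) \<in> rt P & E ~= {} & E \<subset> \<Inter>X & at_node G e v}" "at_node G (lend R1) x" "at_node G (rend R1) w"
     using prefix[OF gP(1) w(2,1,3) gP(2)] by blast
    have wi: "w \<in> inner G P" using rt_inner[OF gP(1) w(2,1,3)] .
    have dis: "v ~: insert w ?Y" "v \<in> inner G P" if vR: "v \<in> inner G R1" for v
    proof -
     obtain E e' where E: "(E, e') \<in> rt P" "E ~= {}" "E \<subset> \<Inter>X" "at_node G e' v"
      using subsetD[OF R1(4) vR] by (elim CollectE exE conjE)
     show "v \<in> inner G P" using rt_inner[OF gP(1) E(1,2,4)] .
     have "v ~: ?Y"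
     proof
      assume "v \<in> ?Y"
      hence "E \<in> X" using XI[OF E(2,1,4)] by simp
      thus False using lowest E(3) by blast
     qed
     moreover have "v ~= w"
      using inner_points_distinct[OF rigid_all[of "prank P"] gP(1) _ E(1) w(2) E(2) w(1) E(4)] w(3) E(3) by auto
     ultimately show "v ~: insert w ?Y" by blast
    qed
    have a1: "arc x R1 w" unfolding arc_def using R1 dis wi gP by blast
    have r1: "prank R1 < \<nu>" using R1(2) P(2) by simp
    have s1: "pbranches R1 \<subseteq> ?B" using R1(3) rt_subset[OF w(2)] by simp
    show ?thesis
    proof (cases "w = y")
     case True thus ?thesis using a1 r1 s1 by blast
    next
     case False
     hence wQ: "w \<in> inner G Q" using w(4) by blast
     obtain Q2 where Q2: "arc w Q2 y" "prank Q2 < \<nu>" "pbranches Q2 \<subseteq> pbranches Q" "inner G Q2 \<subseteq> inner G Q" using suf[OF wQ] by blast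
     have jn: "joinable x w y R1 Q2" unfolding joinable_def using a1 Q2(1,4) xyz(4) xQ dis by blast
     have "nrank w < \<nu>" using inner_lower[OF gP(1) P(2) wi] by simp
     hence "prank (rend R1) < rpred \<nu>" "prank (lend Q2) < rpred \<nu>" using lower_tip R1(6) Q2(1) unfolding arc_def by blast+
     from join[OF jn r1 Q2(2) this] obtain R where R: "joined x w y R1 Q2 R" "prank R < \<nu>" by blast
     moreover have "pbranches R \<subseteq> ?B Un pbranches Q" using R(1) s1 Q2(3) unfolding joined_def by blast
     ultimately show ?thesis using joined_arc[OF jn R(1)] by blast
    qed
   qed
  qed
 qed
qed

end

section \<open>Appending end branches\<close>

abbreviation lift :: "'b tpath => ('b + 'b node) tpath" where
 "lift \<equiv> map_tpath Inl"

lemma lift_simps [simp]: "prank (lift P) = prank P" "pbranches (lift P) = Inl ` pbranches P"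
 by (induction P) auto

lemma lift_ends: "lend (lift P) = lift (lend P)" "rend (lift P) = lift (rend P)"
 by (induction P) (auto simp: comp_def split: shape.splits)

lemma one_ended_lift [simp]: "one_ended (lift P) = one_ended P"
 by (cases P) (auto simp: one_ended_def)

lemma tail_branches_lift: "tail_branches (lift P) m = Inl ` tail_branches P m"
 by (cases "(P, m)" rule: tail_branches.cases) (auto simp: comp_def)

lemma coincide_lift: "coincide (lift P) (lift Q) = coincide P Q"
 unfolding coincide_def tail_branches_lift lift_simps by (simp add: inj_image_subset_iff)

lemma scoin_lift: "scoin (lift P) (lift Q) = scoin P Q"
 unfolding scoin_def tail_branches_lift by (simp add: inj_image_subset_iff)

context tfg
begin

lemma inner_maxnode: "gpath G P ==> w \<in> inner G P ==> maxnode G w"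
 using inner_rt at_node_maxnode by blast

lemma tip_same:
 assumes "t \<in> tips G \<rho>" "p \<in> t" "q \<in> t" shows "same_tip G p q"
 using assms(1)
proof (cases rule: tipsE)
 case Elem thus ?thesis using assms by simp
next
 case (Seq P)
 hence *: "gpath G p" "one_ended p" "prank p = \<rho>" "coincide P p" "gpath G q" "one_ended q" "prank q = \<rho>" "coincide P q"
  using assms(2,3) by auto
 have "scoin P p" "scoin P q" using rigid[of \<rho>] Seq * unfolding tips_rigid_def by blast+
 thus ?thesis using * scoin_trans scoin_sym unfolding same_tip_def by metis
qed

lemma tips_eqI:
 assumes "t \<in> tips G \<rho>" "s \<in> tips G \<rho>" "p \<in> t" "q \<in> s" "same_tip G p q" shows "t = s"
proof -
 have *: "t \<subseteq> s" if ts: "t \<in> tips G \<rho>" "s \<in> tips G \<rho>" "p \<in> t" "q \<in> s" "same_tip G p q" for s t p q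
 proof
  fix r assume r: "r \<in> t"
  have "same_tip G q r" using tip_same[OF ts(1,3) r] ts(5) same_tip_sym same_tip_trans by blast
  show "r \<in> s" using ts(2)
  proof (cases rule: tipsE)
   case Elem
   hence "gpath G r" "prank r = Elem" "q = r"
    using tips_gpath[OF ts(1) r] tips_prank[OF ts(1) r] \<open>same_tip G q r\<close> ts(4) by (auto simp: same_tip_def one_ended_def)
   thus ?thesis using ts(4) by simp
  next
   case (Seq P)
   hence q: "gpath G q" "one_ended q" "prank q = \<rho>" "coincide P q" using ts(4) by auto
   have r': "gpath G r" "one_ended r" "prank r = \<rho>"
    using tips_gpath[OF ts(1) r] tips_one_ended[OF ts(1) r] tips_prank[OF ts(1) r] Seq by auto
   have "scoin P q" using rigid[of \<rho>] Seq q unfolding tips_rigid_def by blast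
   moreover have "scoin q r" using \<open>same_tip G q r\<close> by (auto simp: same_tip_def)
   ultimately have "coincide P r" using scoin_coincide scoin_trans Seq r' by blast
   thus ?thesis using Seq r' by auto
  qed
 qed
 show ?thesis using *[OF assms] *[OF assms(2,1,4,3) same_tip_sym[OF assms(5)]] by blast
qed

lemma rt_tip_branches:
 assumes "gpath G P" "(D, q) \<in> rt P" shows "pbranches q Int D = {} & pbranches q \<subseteq> pbranches P"
proof (cases q)
 case (Br b s) thus ?thesis using rt_Br[OF assms(1)] assms(2) by auto
next
 case (Seq \<beta> s h) thus ?thesis using rt_Seq_local[OF assms Seq] by blast
qed

text \<open>At an inner point the node embraces the tips on both sides. If it had one tip only,
  their representatives would share branches, yet one consists of branches before the point and the
  other of branches after it.\<close>

lemma inner_nonsingleton: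
 assumes g: "gpath G P" and w: "w \<in> inner G P" shows "\<not> singleton_node w"
proof
 assume sg: "singleton_node w"
 obtain D q where D: "(D, q) \<in> rt P" "D ~= {}" "at_node G q w" using inner_rt[OF g w] by blast
 have gp: "gpath G (prev P)" using g by simp
 have Ds: "D \<subset> pbranches P" using rt_psubset[OF g D(1)] .
 obtain p where p: "(pbranches P - D, p) \<in> rt (prev P)" using left_tip[OF gp rt_pt[OF D(1)] D(2)] Ds by blast
 obtain w' where w': "at_node G p w'" using inner_tip_node[OF gp p] Ds by blast
 have "at_node G q w'" using left_right_node[OF rigid_all[of "prank P"] g _ D(1) p D(2) w'] by simp
 hence "w' = w" using at_node_inject D(3) by blast
 obtain t where t: "etips w = {t}" using sg by (cases w rule: etips.cases) (auto simp: singleton_node_def)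
 hence qt: "q \<in> t" "p \<in> t" using D(3) w' \<open>w' = w\<close> unfolding at_node_def by auto
 obtain \<rho> where "t \<in> tips G \<rho>" using at_nodeE[OF D(3)] t by (metis singletonD)
 hence "pbranches p Int pbranches q ~= {}" using same_tip_overlap tip_same qt tips_gpath by blast
 moreover have "pbranches p Int (pbranches P - D) = {}" "pbranches p \<subseteq> pbranches P" using rt_tip_branches[OF gp p] by auto
 moreover have "pbranches q Int D = {}" using rt_tip_branches[OF g D(1)] by simp
 ultimately show False by blast
qed

lemma tail_inner:
 assumes q: "gpath G (Seq \<mu> In h)" and P: "gpath G P" "one_ended P" "prank P = \<mu>" "scoin (Seq \<mu> In h) P"
 shows "EX m. inner G (Seq \<mu> In (%i. h (i - int m))) \<subseteq> inner G P"
proof -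
 obtain m where m: "tail_branches (Seq \<mu> In h) m \<subseteq> pbranches P"
  using P(4) tail_branches_0[OF P(2)] unfolding scoin_def by metis
 let ?d = "Seq \<mu> In (%i. h (i - int m))"
 have gd: "gpath G ?d" using gpath_In_shift[OF q] .
 have "pbranches ?d \<subseteq> tail_branches (Seq \<mu> In h) m"
 proof
  fix b assume "b \<in> pbranches ?d"
  then obtain i where "i < 0" "b \<in> pbranches (h (i - int m))" by auto
  thus "b \<in> tail_branches (Seq \<mu> In h) m"
   unfolding tail_branches_In by (intro UN_I[of "i - int m"]) auto
 qed
 hence sub: "pbranches ?d \<subseteq> pbranches P" using m by blast
 obtain s f where Pf: "P = Seq \<mu> s f" using P(2,3) one_endedE by (metis prank.simps(2))
 obtain D Q where Q: "emb G ?d Q D" "Q = P \<or> Q = prev P"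
  using gpath_subset_emb[OF rigid_all P(1)[unfolded Pf] gd _ sub[unfolded Pf]] Pf by auto
 have Qg: "gpath G Q" "inner G Q = inner G P" using Q(2) P(1) inner_prev by auto
 have "inner G ?d \<subseteq> inner G P"
 proof
  fix v assume "v \<in> inner G ?d"
  then obtain E e where E: "(E, e) \<in> rt ?d" "E ~= {}" "at_node G e v" using inner_rt[OF gd] by blast
  obtain e' where e': "(D Un E, e') \<in> rt Q" "same_tip G e e'" using Q(1) E(1) unfolding emb_def semb_def by blast
  have "at_node G e' v" using at_node_same_tip[OF rigid e'(2) E(3)] .
  thus "v \<in> inner G P" using rt_inner[OF Qg(1) e'(1)] E(2) Qg by blast
 qed
 thus ?thesis by blast
qed

lemma In_form:
 assumes "gpath G p" "one_ended p" shows "EX h. gpath G (Seq (prank p) In h) & scoin p (Seq (prank p) In h)"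
proof -
 from assms(2) obtain \<mu> s f where p: "p = Seq \<mu> s f" "s = Out \<or> s = In" by (rule one_endedE)
 show ?thesis
 proof (cases "s = In")
  case True thus ?thesis using p assms by (intro exI[of _ f]) simp
 next
  case False
  hence pp: "prev p = Seq \<mu> In (%i. prev (f (ridx Out i)))" using p by (simp add: prev.simps)
  have "scoin p (trev p)" by simp
  moreover have "trev p = prev p" using p by simp
  moreover have "gpath G (prev p)" using assms by simp
  ultimately show ?thesis using p pp by (metis prank.simps(2))
 qed
qed

end

locale appended = tfg G \<nu> + ext: tfg G' \<nu> for G :: "'b tgraph" and \<nu> and G' :: "('b + 'b node) tgraph" +
 fixes S :: "'b node set" and \<phi>
 assumes S: "S \<subseteq> {x. maxnode G x & singleton_node x}"
  and brs: "branches G' = Inl ` branches G Un Inr ` S"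
  and inj: "inj_on \<phi> (nodes G)"
  and nds: "nodes G' = \<phi> ` nodes G Un {end_node x True | x. x \<in> S} Un {end_node x False | x. x \<in> S & nrank x ~= Rk 0}"
  and phi: "!!x. x \<in> nodes G ==> nrank (\<phi> x) = nrank x &
      ntips (\<phi> x) = {t'. \<exists>\<rho><\<nu>. t' \<in> tips G' \<rho> & (\<exists>t\<in>ntips x. lift ` t \<subseteq> t')} Un
       (if x \<in> S & nrank x = Rk 0 then {{Br (Inr x) False}} else {}) &
      nexc (\<phi> x) = (if x \<in> S & nrank x ~= Rk 0 then Some (end_node x False) else map_option \<phi> (nexc x))"
begin

lemma tip_ext:
 assumes t: "t \<in> tips G \<rho>" and l: "!!Q. Q \<in> t ==> gpath G' (lift Q)"
 shows "EX t'. t' \<in> tips G' \<rho> & lift ` t \<subseteq> t'"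
 using t
proof (cases rule: tipsE)
 case (Elem b s)
 hence "{Br (Inl b) s} \<in> tips G' \<rho>" using brs unfolding tips_def by auto
 thus ?thesis using Elem by auto
next
 case (Seq P)
 hence "P \<in> t" by (auto intro: coincide_refl)
 have "tclass G' \<rho> (lift P) \<in> tips G' \<rho>" using Seq l[OF \<open>P \<in> t\<close>] unfolding tips_def tclass_def by auto
 moreover have "lift ` t \<subseteq> tclass G' \<rho> (lift P)" using Seq l unfolding tclass_def by (auto simp: coincide_lift)
 ultimately show ?thesis by blast
qed

lemma etips_ext:
 assumes "x \<in> nodes G" "t \<in> etips x" "t' \<in> tips G' \<rho>" "\<rho> < \<nu>" "lift ` t \<subseteq> t'" shows "t' \<in> etips (\<phi> x)"
 using assms(1,2)
proof (induction x rule: etips.induct)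
 case (1 \<mu> T)
 hence "t' \<in> ntips (\<phi> (Node \<mu> T None))" using phi[OF 1(1)] assms by auto
 thus ?case using ntips_etips by blast
next
 case (2 \<mu> T y)
 let ?x = "Node \<mu> T (Some y)"
 consider "t \<in> T" | "t \<in> etips y" using 2(3) by auto
 thus ?case
 proof cases
  case 1
  hence "t' \<in> ntips (\<phi> ?x)" using phi[OF 2(2)] assms by auto
  thus ?thesis using ntips_etips by blast
 next
  case y: 2
  have "?x ~: S" using S by (auto simp: singleton_node_def)
  hence "nexc (\<phi> ?x) = Some (\<phi> y)" using phi[OF 2(2)] by simp
  moreover have "t' \<in> etips (\<phi> y)" using 2(1)[OF _ y] nexc_node[OF 2(2)] by simp
  ultimately show ?thesis by (cases "\<phi> ?x") auto
 qed
qed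

text \<open>The only new nodes that are embraced are the ends \<open>False\<close> of appended
  branches. \<open>\<phi> x\<close> is none of them: it would be a 0-node, and then it would contain
  an elementary tip of an old branch.\<close>

lemma maxnode_ext:
 assumes "maxnode G x" shows "maxnode G' (\<phi> x)"
 unfolding maxnode_def
proof (intro conjI ballI notI)
 have x: "x \<in> nodes G" using maxnode_node[OF assms] .
 show "\<phi> x \<in> nodes G'" using nds x by blast
 fix y' assume y': "y' \<in> nodes G'" "nexc y' = Some (\<phi> x)"
 then obtain y where y: "y \<in> nodes G" "y' = \<phi> y" using nds by (auto simp: end_node_def)
 show False
 proof (cases "y \<in> S & nrank y ~= Rk 0")
  case True
  hence e: "\<phi> x = end_node y False" using phi[OF y(1)] y y' by simp
  hence "nrank x = Rk 0" using phi[OF x] by (simp add: end_node_def)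
  hence "ntips x \<subseteq> tips G Elem" "ntips x ~= {}" using node_valid[OF x] by auto
  then obtain t where t: "t \<in> ntips x" "t \<in> tips G Elem" by blast
  have "gpath G' (lift Q)" if "Q \<in> t" for Q
   using tips_gpath[OF t(2) that] tips_prank[OF t(2) that] gpath_Elem brs by (metis Un_iff gpath_Br imageI tpath.map(1) gpath_Br)
  then obtain t' where t': "t' \<in> tips G' Elem" "lift ` t \<subseteq> t'" using tip_ext[OF t(2)] by blast
  have "Elem < \<nu>" using nu_valid by (cases \<nu>) auto
  hence "t' \<in> ntips (\<phi> x)" using phi[OF x] t t' by blast
  hence t'e: "t' = {Br (Inr y) False}" using e by (simp add: end_node_def)
  obtain Q where "Q \<in> t" using tips_nonempty[OF t(2)] by blast
  hence "lift Q \<in> t'" using t'(2) by blast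
  hence "pbranches (lift Q) = {Inr y}" using t'e by simp
  hence "Inr y \<in> Inl ` pbranches Q" unfolding lift_simps by simp
  thus False by (elim imageE) simp
 next
  case False
  have "nexc (\<phi> y) = map_option \<phi> (nexc y)" using phi[OF y(1)] unfolding if_not_P[OF False] by blast
  hence "map_option \<phi> (nexc y) = Some (\<phi> x)" using y y' by metis
  then obtain z where z: "nexc y = Some z" "\<phi> z = \<phi> x" by auto
  hence "z = x" using inj nexc_node[OF y(1)] x by (metis inj_onD)
  thus False using assms y z unfolding maxnode_def by blast
 qed
qed

lemma at_node_ext:
 assumes "!!Q. gpath G Q ==> prank Q = prank p ==> gpath G' (lift Q)" "at_node G p x"
 shows "at_node G' (lift p) (\<phi> x)"
proof -
 obtain t where t: "t \<in> etips x" "p \<in> t" "t \<in> tips G (prank p)" "prank p < \<nu>" "maxnode G x" using at_nodeE[OF assms(2)] by metis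
 have "gpath G' (lift Q)" if "Q \<in> t" for Q using assms(1) tips_gpath[OF t(3) that] tips_prank[OF t(3) that] by simp
 then obtain t' where t': "t' \<in> tips G' (prank p)" "lift ` t \<subseteq> t'" using tip_ext[OF t(3)] by blast
 have "t' \<in> etips (\<phi> x)" using etips_ext[OF maxnode_node[OF t(5)] t(1) t'(1) t(4) t'(2)] .
 thus ?thesis using maxnode_ext[OF t(5)] t(2) t'(2) unfolding at_node_def by blast
qed

text \<open>Induction on the rank and not on the path: to carry a junction over, all representatives
  of its tips must be paths of the new graph, and these are other paths of smaller rank.\<close>

lemma lift_gpath: "gpath G P ==> gpath G' (lift P) & inner G' (lift P) = \<phi> ` inner G P"
proof (induction "prank P" arbitrary: P rule: wf_induct_rule[OF rank_wf])
 case (1 P)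
 show ?case
 proof (cases P)
  case (Br b s) thus ?thesis using 1(2) brs by auto
 next
  case (Seq \<mu> s f)
  note g = gpath_SeqD[OF 1(2)[unfolded Seq]]
  have IH: "gpath G' (lift Q)" "inner G' (lift Q) = \<phi> ` inner G Q" if "gpath G Q" "prank Q < \<mu>" for Q
   using 1(1)[of Q] that Seq by auto
  have nd: "at_node G' (lift p) (\<phi> w)" if "at_node G p w" "prank p < \<mu>" for p w
   using at_node_ext[OF IH(1) that(1)] that(2) by simp
  have er: "prank (lend (f i)) < \<mu>" "prank (rend (f i)) < \<mu>" if "i \<in> idx s" for i
   using lend_prank[OF g(3)[OF that]] rend_prank[OF g(3)[OF that]] g(4)[OF that] by auto
  let ?I = "idx s Un (%i. i + 1) ` idx s" and ?f = "lift \<circ> f"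
  obtain x where x: "\<forall>i\<in>idx s. at_node G (lend (f i)) (x i) & at_node G (rend (f i)) (x (i + 1))"
   "inj_on x ?I" "\<forall>i\<in>?I. \<forall>j\<in>idx s. x i ~: inner G (f j)"
   "\<forall>i\<in>idx s. \<forall>j\<in>idx s. i ~= j --> inner G (f i) Int inner G (f j) = {}"
   using g(6) by (auto simp: tracing_def)
  have xn: "x ` ?I \<subseteq> nodes G" using x(1) at_node_maxnode maxnode_node by blast
  have inn: "inner G (f i) \<subseteq> nodes G" if "i \<in> idx s" for i using inner_maxnode[OF g(3)[OF that]] maxnode_node by blast
  have fi: "inner G' (?f i) = \<phi> ` inner G (f i)" if "i \<in> idx s" for i using IH g(3,4) that by simp
  have "tracing G' s ?f" unfolding tracing_def
  proof (intro exI[of _ "\<phi> \<circ> x"] conjI ballI impI)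
   fix i assume i: "i \<in> idx s"
   show "at_node G' (lend (?f i)) ((\<phi> \<circ> x) i)" "at_node G' (rend (?f i)) ((\<phi> \<circ> x) (i + 1))"
    using nd x(1) er i by (auto simp: lift_ends)
  next
   show "inj_on (\<phi> \<circ> x) ?I" using x(2) inj xn by (meson comp_inj_on inj_on_subset)
  next
   fix i j assume i: "i \<in> ?I" "j \<in> idx s"
   have "x i \<in> nodes G" using xn i(1) by blast
   thus "(\<phi> \<circ> x) i ~: inner G' (?f j)"
    using x(3) i inn[OF i(2)] inj unfolding fi[OF i(2)] by (auto dest: inj_onD)
  next
   fix i j assume i: "i \<in> idx s" "j \<in> idx s" "i ~= j"
   thus "inner G' (?f i) Int inner G' (?f j) = {}"
    using x(4) inn fi inj inj_on_image_Int[OF inj, of "inner G (f i)" "inner G (f j)"] by simp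
  qed
  moreover have "junction_ranks \<mu> s ?f"
  proof -
   have "jrank ?f = jrank f" by (auto simp: jrank_def lift_ends)
   thus ?thesis using g(7) by (simp add: junction_ranks_def)
  qed
  ultimately have "gpath G' (Seq \<mu> s ?f)" using g IH(1) by (intro gpath.sequence) auto
  moreover have "inner G' (Seq \<mu> s ?f) = \<phi> ` inner G P"
  proof -
   have *: "{w. EX i. i - 1 \<in> idx s & i \<in> idx s & at_node G' (lend (?f i)) w} =
    \<phi> ` {w. EX i. i - 1 \<in> idx s & i \<in> idx s & at_node G (lend (f i)) w}" (is "?L = \<phi> ` ?R")
   proof (intro equalityI subsetI)
    fix w assume "w \<in> ?L"
    then obtain i where i: "i - 1 \<in> idx s" "i \<in> idx s" "at_node G' (lend (?f i)) w" by blast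
    have "at_node G (lend (f i)) (x i)" using x(1) i(2) by blast
    hence "at_node G' (lend (?f i)) (\<phi> (x i))" using nd er i(2) by (simp add: lift_ends)
    hence "w = \<phi> (x i)" using ext.at_node_inject i(3) by blast
    thus "w \<in> \<phi> ` ?R" using i x(1) by blast
   next
    fix w assume "w \<in> \<phi> ` ?R"
    then obtain i v where "i - 1 \<in> idx s" "i \<in> idx s" "at_node G (lend (f i)) v" "w = \<phi> v" by blast
    thus "w \<in> ?L" using nd er by (auto simp: lift_ends)
   qed
   show ?thesis unfolding Seq inner.simps(2) * using fi by (auto simp: image_UN image_Un)
  qed
  ultimately show ?thesis using Seq by simp
 qed
qed

lemma tip_ext':
 assumes "at_node G p u"
 shows "EX t t'. t \<in> etips u & p \<in> t & t \<in> tips G (prank p) & prank p < \<nu> & maxnode G u & gpath G p &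
   t' \<in> tips G' (prank p) & lift ` t \<subseteq> t' & t' \<in> etips (\<phi> u)"
proof -
 obtain t where t: "t \<in> etips u" "p \<in> t" "t \<in> tips G (prank p)" "prank p < \<nu>" "maxnode G u" "gpath G p"
  using at_nodeE[OF assms] by metis
 obtain t' where t': "t' \<in> tips G' (prank p)" "lift ` t \<subseteq> t'" using tip_ext[OF t(3)] tips_gpath[OF t(3)] lift_gpath by blast
 thus ?thesis using etips_ext[OF maxnode_node[OF t(5)] t(1) t'(1) t(4) t'(2)] t by blast
qed

text \<open>If \<open>u\<close> is in \<open>S\<close>, its image also embraces an end of the
  appended branch. Otherwise distinct tips of \<open>u\<close> have distinct images by rigidity, so
  an open image makes \<open>u\<close> a singleton whose only tip \<open>t\<close> is not
  elementary.\<close>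

lemma not_open:
 assumes u: "maxnode G u" "t \<in> etips u" "t \<in> tips G \<rho>" "\<rho> < \<nu>" "\<rho> ~= Elem" "t' \<in> tips G' \<rho>" "lift ` t \<subseteq> t'" "t' \<in> etips (\<phi> u)"
  and OK: "u \<in> S \<or> \<not> singleton_node u \<or> (EX b s. {Br b s} \<in> etips u)"
 shows "\<not> open_tip G' t'"
proof
 assume "open_tip G' t'"
 then obtain x where x: "maxnode G' x" "nexc x = None" "ntips x = {t'}" by (auto simp: open_tip_def)
 hence "x = \<phi> u" using ext.tip_unique_maxnode[OF u(4,6)] u(8) maxnode_ext[OF u(1)] ntips_etips[of x] by blast
 note x = x[unfolded this]
 have un: "u \<in> nodes G" using maxnode_node[OF u(1)] .
 have tE: "t' ~= {Br b s}" for b s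
  using tips_prank[OF u(6), of "Br b s"] u(5) by auto
 have uS: "u ~: S" using phi[OF un] x tE by (auto split: if_splits)
 hence "nexc u = None" using phi[OF un] x by simp
 hence et: "etips u = ntips u" by (cases u) auto
 have "s = t" if s: "s \<in> ntips u" for s
 proof -
  obtain \<sigma> where \<sigma>: "\<sigma> < \<nu>" "s \<in> tips G \<sigma>" using etips_tips[OF un] s et by blast
  obtain s' where s': "s' \<in> tips G' \<sigma>" "lift ` s \<subseteq> s'" using tip_ext[OF \<sigma>(2)] tips_gpath[OF \<sigma>(2)] lift_gpath by blast
  hence "s' \<in> ntips (\<phi> u)" using phi[OF un] \<sigma>(1) s by blast
  hence s't: "s' = t'" using x by simp
  obtain P Q where PQ: "P \<in> t" "Q \<in> s" using tips_nonempty u(3) \<sigma>(2) by blast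
  hence lPQ: "lift P \<in> t'" "lift Q \<in> t'" using u(7) s'(2) s't by auto
  have "\<sigma> = \<rho>" using tips_prank[OF u(6) lPQ(2)] tips_prank[OF \<sigma>(2) PQ(2)] by simp
  have "same_tip G' (lift P) (lift Q)" using ext.tip_same[OF u(6) lPQ] .
  moreover have "one_ended P" "one_ended Q" "gpath G P" "gpath G Q" "prank P = prank Q"
   using tips_one_ended tips_gpath tips_prank u(3,5) \<sigma>(2) PQ \<open>\<sigma> = \<rho>\<close> by metis+
  ultimately have "same_tip G P Q" unfolding same_tip_def using scoin_lift[of P Q] scoin_refl[of "lift P"] by auto
  thus "s = t" using tips_eqI[OF u(3) _ PQ] \<sigma>(2) \<open>\<sigma> = \<rho>\<close> by simp
 qed
 hence tt: "ntips u = {t}" using u(2) et by blast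
 hence "singleton_node u" using \<open>nexc u = None\<close> by (simp add: singleton_node_def)
 then obtain b s where "{Br b s} \<in> etips u" using OK uS by blast
 hence "t = {Br b s}" using tt et by blast
 thus False using tips_prank[OF u(3)] u(5) by auto
qed

text \<open>In the extended graph a tip has further representatives, which may start with an end
  branch. Each of them still contains the image of a tail of an old representative.\<close>

lemma entangled_lift:
 assumes ent: "entangled G p q" and p: "gpath G p" and q: "gpath G q"
  and P: "gpath G' P" "one_ended P" "prank P = prank p" "scoin (lift p) P"
  and Q: "gpath G' Q" "one_ended Q" "prank Q = prank q" "scoin (lift q) Q"
 shows "infinite (inner G' P Int inner G' Q)"
proof -
 have *: "EX p0. gpath G p0 & one_ended p0 & prank p0 = prank p & scoin p p0 & inner G' (lift p0) \<subseteq> inner G' P"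
  if p: "gpath G p" "one_ended p" and P: "gpath G' P" "one_ended P" "prank P = prank p" "scoin (lift p) P" for p P
 proof -
  obtain h where h: "gpath G (Seq (prank p) In h)" "scoin p (Seq (prank p) In h)" using In_form[OF p] by blast
  have l: "lift (Seq (prank p) In h) = Seq (prank p) In (%i. lift (h i))" by (simp add: comp_def)
  have "scoin (lift (Seq (prank p) In h)) (lift p)" using h(2) scoin_lift scoin_sym by blast
  hence "scoin (Seq (prank p) In (%i. lift (h i))) P" using P(4) scoin_trans l by metis
  moreover have "gpath G' (Seq (prank p) In (%i. lift (h i)))" using lift_gpath[OF h(1)] l by simp
  ultimately obtain m where m: "inner G' (Seq (prank p) In (%i. lift (h (i - int m)))) \<subseteq> inner G' P"
   using ext.tail_inner[OF _ P(1-3)] by blast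
  let ?p = "Seq (prank p) In (%i. h (i - int m))"
  have "lift ?p = Seq (prank p) In (%i. lift (h (i - int m)))" by (simp add: comp_def)
  moreover have "scoin (Seq (prank p) In h) ?p" using scoin_shift[of 0 _ h "int m"] by simp
  ultimately show ?thesis using m gpath_In_shift[OF h(1)] scoin_trans[OF h(2)]
   by (intro exI[of _ ?p]) (auto simp: one_ended_def simp del: inner.simps)
 qed
 have oe: "one_ended p" "one_ended q" using ent by (auto simp: entangled_def)
 obtain p0 where p0: "gpath G p0" "one_ended p0" "prank p0 = prank p" "scoin p p0" "inner G' (lift p0) \<subseteq> inner G' P"
  using *[OF p oe(1) P] by blast
 obtain q0 where q0: "gpath G q0" "one_ended q0" "prank q0 = prank q" "scoin q q0" "inner G' (lift q0) \<subseteq> inner G' Q"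
  using *[OF q oe(2) Q] by blast
 have inf: "infinite (inner G p0 Int inner G q0)" using ent p0 q0 unfolding entangled_def by blast
 have "inner G p0 Int inner G q0 \<subseteq> nodes G" using inner_maxnode[OF p0(1)] maxnode_node by blast
 hence "inj_on \<phi> (inner G p0 Int inner G q0)" by (rule inj_on_subset[OF inj])
 hence "infinite (\<phi> ` (inner G p0 Int inner G q0))" using inf finite_imageD by blast
 moreover have "\<phi> ` (inner G p0 Int inner G q0) \<subseteq> inner G' P Int inner G' Q"
  using p0(5) q0(5) lift_gpath[OF p0(1)] lift_gpath[OF q0(1)] by blast
 ultimately show ?thesis using finite_subset by blast
qed

text \<open>The image tips would be nondisconnectable. Condition (C) then demands a common node,
  excluded by injectivity of \<open>\<phi>\<close>, or an open tip, excluded by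
  \<open>not_open\<close>. This is where appending end branches pays: it turns singleton nodes of
  the metrizable set into nodes that (C) does not exempt.\<close>

lemma not_entangled:
 assumes C: "condition_C \<nu> G'" and uv: "at_node G p u" "at_node G q v" "u ~= v"
  and OK: "!!w. w \<in> {u, v} ==> w \<in> S \<or> \<not> singleton_node w \<or> (EX b s. {Br b s} \<in> etips w)"
 shows "\<not> entangled G p q"
proof
 assume ent: "entangled G p q"
 obtain t t' where t: "t \<in> etips u" "p \<in> t" "t \<in> tips G (prank p)" "prank p < \<nu>" "maxnode G u" "gpath G p"
   "t' \<in> tips G' (prank p)" "lift ` t \<subseteq> t'" "t' \<in> etips (\<phi> u)" using tip_ext'[OF uv(1)] by blast
 obtain s s' where s: "s \<in> etips v" "q \<in> s" "s \<in> tips G (prank q)" "prank q < \<nu>" "maxnode G v" "gpath G q"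
   "s' \<in> tips G' (prank q)" "lift ` s \<subseteq> s'" "s' \<in> etips (\<phi> v)" using tip_ext'[OF uv(2)] by blast
 have oe: "one_ended p" "one_ended q" using ent by (auto simp: entangled_def)
 hence ne: "prank p ~= Elem" "prank q ~= Elem" using gpath_Elem t(6) s(6) by (auto simp: one_ended_def)
 have phn: "\<phi> u ~= \<phi> v" using inj uv(3) t(5) s(5) maxnode_node by (metis inj_onD)
 have diff: "\<not> (maxnode G' x & t' \<in> etips x & s' \<in> etips x)" for x
  using ext.tip_unique_maxnode[OF t(4,7)] ext.tip_unique_maxnode[OF s(4,7)] t(9) s(9) phn
   maxnode_ext[OF t(5)] maxnode_ext[OF s(5)] by metis
 have "t' ~= s'" using diff[of "\<phi> u"] t(9) maxnode_ext[OF t(5)] by blast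
 have "nondisconnectable G' t' s'" unfolding nondisconnectable_def
 proof (intro ballI)
  fix P Q assume PQ: "P \<in> t'" "Q \<in> s'"
  have P: "gpath G' P" "one_ended P" "prank P = prank p"
   using tips_gpath[OF t(7) PQ(1)] tips_one_ended[OF t(7) PQ(1) ne(1)] tips_prank[OF t(7) PQ(1)] by auto
  have Q: "gpath G' Q" "one_ended Q" "prank Q = prank q"
   using tips_gpath[OF s(7) PQ(2)] tips_one_ended[OF s(7) PQ(2) ne(2)] tips_prank[OF s(7) PQ(2)] by auto
  have "scoin (lift p) P" "scoin (lift q) Q"
   using ext.tip_same[OF t(7) _ PQ(1), of "lift p"] ext.tip_same[OF s(7) _ PQ(2), of "lift q"] t(2,8) s(2,8)
   by (auto simp: same_tip_def image_subset_iff)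
  hence "infinite (inner G' P Int inner G' Q)" using entangled_lift[OF ent t(6) s(6) P _ Q] by blast
  moreover have "inner G' P Int inner G' Q \<subseteq> met G' P Int met G' Q" unfolding met_def by (intro Int_mono) blast+
  ultimately show "infinite (met G' P Int met G' Q)" by (rule infinite_super[rotated])
 qed
 hence "open_tip G' t' \<or> open_tip G' s'"
  using C t(4,7) s(4,7) \<open>t' ~= s'\<close> diff unfolding condition_C_def by blast
 thus False
  using not_open[OF t(5,1,3,4) ne(1) t(7,8,9)] not_open[OF s(5,1,3,4) ne(2) s(7,8,9)] OK by blast
qed

end

section \<open>Nodes at which entangled tips are excluded\<close>

locale metric_graph = pristine_graph +
 fixes M
 assumes metr: "metrizable \<nu> G M"
begin

text \<open>Sections are compared through end nodes of branches, which may be singletons outside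
  \<open>M\<close>. At such a node no entanglement occurs either, since an elementary tip is not
  one-ended.\<close>

definition OK :: "'a node set" where
 "OK = {x. maxnode G x & (x \<in> M \<or> (EX b s. {Br b s} \<in> etips x))}"

lemma nonsingleton_M: "maxnode G x ==> \<not> singleton_node x ==> x \<in> M"
 using metr unfolding metrizable_def by blast

lemma M_OK: "M \<subseteq> OK" using metr unfolding metrizable_def OK_def by blast

lemma inner_M: "gpath G P ==> inner G P \<subseteq> M"
 using inner_maxnode inner_nonsingleton nonsingleton_M by blast

lemma OK_Br: "at_node G (Br b s) x ==> x \<in> OK"
proof -
 assume a: "at_node G (Br b s) x"
 obtain t \<rho> where "t \<in> etips x" "Br b s \<in> t" "t \<in> tips G \<rho>" "prank (Br b s) = \<rho>" "maxnode G x" using at_nodeE[OF a] by metis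
 thus "x \<in> OK" unfolding OK_def by (auto elim!: tipsE)
qed

lemma OK_not_entangled:
 assumes "u \<in> OK" "v \<in> OK" "u ~= v" "at_node G p u" "at_node G q v" shows "\<not> entangled G p q"
proof -
 let ?S = "{x \<in> M. singleton_node x}"
 obtain G' where G': "append_end_branches \<nu> G ?S G'" "condition_C \<nu> G'" using metr unfolding metrizable_def by blast
 have S: "?S \<subseteq> {x. maxnode G x & singleton_node x}" using metr unfolding metrizable_def by blast
 note a = G'(1)[unfolded append_end_branches_def]
 have "EX \<phi>. appended G \<nu> G' ?S \<phi>"
  using conjunct2[OF conjunct2[OF a]]
 proof (elim exE conjE)
  fix \<phi>
  assume 1: "inj_on \<phi> (nodes G)"
   and 2: "nodes G' = \<phi> ` nodes G Un {end_node x True | x. x \<in> ?S} Un {end_node x False | x. x \<in> ?S & nrank x ~= Rk 0}"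
   and 3: "\<forall>x\<in>nodes G. nrank (\<phi> x) = nrank x &
      ntips (\<phi> x) = {t'. \<exists>\<rho><\<nu>. t' \<in> tips G' \<rho> & (\<exists>t\<in>ntips x. lift ` t \<subseteq> t')} Un
       (if x \<in> ?S & nrank x = Rk 0 then {{Br (Inr x) False}} else {}) &
      nexc (\<phi> x) = (if x \<in> ?S & nrank x ~= Rk 0 then Some (end_node x False) else map_option \<phi> (nexc x))"
  have "appended G \<nu> G' ?S \<phi>"
  proof (unfold_locales, goal_cases)
   case 1 show ?case using conjunct1[OF a] .
  next
   case 2 show ?case using S .
  next
   case 3 show ?case using conjunct1[OF conjunct2[OF a]] .
  next
   case 4 show ?case by fact
  next
   case 5 show ?case by fact
  next
   case (6 x) show ?case by (rule bspec[OF 3 6])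
  qed
  thus ?thesis by blast
 qed
 then obtain \<phi> where phi: "appended G \<nu> G' ?S \<phi>" by blast
 show ?thesis by (rule appended.not_entangled[OF phi G'(2) assms(4,5,3)]) (use assms(1,2) in \<open>auto simp: OK_def\<close>)
qed

lemma arcs_trans:
 assumes "arc x P z" "prank P < \<nu>" "arc z Q y" "prank Q < \<nu>" "x \<in> OK" "y \<in> OK" "z \<in> OK" "x ~= y" "nrank z < \<nu>"
 shows "EX R. arc x R y & prank R < \<nu> & pbranches R \<subseteq> pbranches P Un pbranches Q"
 by (rule arc_trans[of OK, OF OK_not_entangled _ assms]) (use inner_M M_OK in blast)+

end

section \<open>Sections\<close>

context metric_graph
begin

definition low :: "'a node => bool" where "low x \<longleftrightarrow> x \<in> OK & nrank x < \<nu>"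

definition linked :: "'a set => 'a node => 'a node => bool" where
 "linked S x y \<longleftrightarrow> x = y \<or> (EX P. arc x P y & prank P < \<nu> & pbranches P \<subseteq> S)"

lemma linked_sym: "linked S x y ==> linked S y x"
 unfolding linked_def using arc_prev by (metis prank_prev pbranches_prev)

lemma linked_mono: "linked S x y ==> S \<subseteq> T ==> linked T x y"
 unfolding linked_def by blast

lemma linked_refl [simp]: "linked S x x" by (simp add: linked_def)

text \<open>The intermediate node must have rank below \<open>\<nu>\<close>, so that
  \<open>join\<close> stays below rank \<open>\<nu>\<close>; paths arriving at a
  \<open>\<nu>\<close>-node do so through \<open>(\<nu> - 1)\<close>-tips.\<close>

lemma linked_trans:
 assumes "linked S x z" "linked S z y" "x \<in> OK" "y \<in> OK" "low z" shows "linked S x y"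
proof (cases "x = y \<or> x = z \<or> z = y")
 case True thus ?thesis using assms by auto
next
 case False
 then obtain P Q where PQ: "arc x P z" "prank P < \<nu>" "pbranches P \<subseteq> S" "arc z Q y" "prank Q < \<nu>" "pbranches Q \<subseteq> S"
  using assms(1,2) unfolding linked_def by blast
 obtain R where "arc x R y" "prank R < \<nu>" "pbranches R \<subseteq> pbranches P Un pbranches Q"
  using arcs_trans[OF PQ(1,2,4,5) assms(3,4)] assms(5) False unfolding low_def OK_def by blast
 thus ?thesis using PQ(3,6) unfolding linked_def by blast
qed

lemma rpred_nu: "Elem < rpred \<nu>" "rpred \<nu> < \<nu>" "rpred \<nu> ~= Om" "Elem < \<nu>"
 using nu_ge1 nu_valid by (cases \<nu>; auto split: nat.splits)+

lemma Br_low: "at_node G (Br b s) x ==> low x"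
 unfolding low_def using OK_Br tip_lower rpred_nu(1) by (metis prank.simps(1))

text \<open>The node of an open end of \<open>R\<close> may occur inside \<open>R\<close> as well,
  so \<open>R\<close> need not be an arc. Each node is met inside at one point only, and cutting
  there makes it one.\<close>

lemma link_ends:
 assumes g: "gpath G R" "prank R < \<nu>" and e: "at_node G (lend R) x" "at_node G (rend R) y"
 shows "linked (pbranches R) x y"
proof (cases "x = y")
 case xy: False
 have "EX R1. gpath G R1 & prank R1 <= prank R & pbranches R1 \<subseteq> pbranches R & at_node G (lend R1) x & at_node G (rend R1) y & x ~: inner G R1"
 proof (cases "x \<in> inner G R")
  case True
  then obtain D q where D: "(D, q) \<in> rt R" "D ~= {}" "at_node G q x" using inner_rt[OF g(1)] by blast
  have nb: "x ~: beyond R D" using beyond_not[OF g(1) D] .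
  obtain R1 where "gpath G R1" "prank R1 <= prank R" "pbranches R1 = pbranches R - D" "inner G R1 = beyond R D"
   "at_node G (lend R1) x" "at_node G (rend R1) y" using suffix[OF g(1) D(1,3) e(2)] by blast
  thus ?thesis using nb by (intro exI[of _ R1]) auto
 qed (use g e in blast)
 then obtain R1 where R1: "gpath G R1" "prank R1 <= prank R" "pbranches R1 \<subseteq> pbranches R" "at_node G (lend R1) x" "at_node G (rend R1) y"
  "x ~: inner G R1" by blast
 show ?thesis
 proof (cases "y \<in> inner G R1")
  case False
  hence "arc x R1 y" using R1 xy unfolding arc_def by blast
  thus ?thesis using R1 g unfolding linked_def by (meson le_less_trans)
 next
  case True
  then obtain D q where D: "(D, q) \<in> rt R1" "D ~= {}" "at_node G q y" using inner_rt[OF R1(1)] by blast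
  obtain R2 where R2: "gpath G R2" "prank R2 <= prank R1" "pbranches R2 = D"
   "inner G R2 \<subseteq> {v. EX E e. (E, e) \<in> rt R1 & E ~= {} & E \<subset> D & at_node G e v}" "at_node G (lend R2) x" "at_node G (rend R2) y"
   using prefix[OF R1(1) D R1(4)] by blast
  have "v \<in> inner G R1 & v ~= y" if v: "v \<in> inner G R2" for v
  proof -
   obtain E e' where E: "(E, e') \<in> rt R1" "E ~= {}" "E \<subset> D" "at_node G e' v"
    using subsetD[OF R2(4) v] by (elim CollectE exE conjE)
   have "v ~= y" using inner_points_distinct[OF rigid_all[of "prank R1"] R1(1) _ E(1) D(1) E(2) D(2) E(4)] D(3) E(3) by auto
   thus ?thesis using rt_inner[OF R1(1) E(1,2,4)] by simp
  qed
  hence "arc x R2 y" using R2 R1 xy unfolding arc_def by blast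
  moreover have "prank R2 < \<nu>" "pbranches R2 \<subseteq> pbranches R" using R2 R1 g rt_subset[OF D(1)] by auto
  ultimately show ?thesis unfolding linked_def by blast
 qed
qed simp

lemma path_linked:
 assumes g: "gpath G P" "prank P < \<nu>" and D: "(D, q) \<in> rt P" "at_node G q x" and E: "(E, r) \<in> rt P" "at_node G r y"
 shows "linked (pbranches P) x y"
proof -
 have *: "linked (pbranches P) x y" if sub: "D \<subseteq> E" and D: "(D, q) \<in> rt P" "at_node G q x" and E: "(E, r) \<in> rt P" "at_node G r y"
  for D E q r x y
 proof (cases "D = E")
  case True
  hence "x = y" using rt_unique[OF g(1) D(1)] E at_node_inject D(2) by metis
  thus ?thesis by simp
 next
  case False
  obtain v where v: "at_node G (rend P) v" using end_nodes_exist[OF g] by blast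
  obtain R where R: "gpath G R" "prank R <= prank P" "pbranches R = pbranches P - D" "inner G R = beyond P D"
   "at_node G (lend R) x" using suffix[OF g(1) D v] by blast
  have "y \<in> inner G R" unfolding R(4) beyond_def using E False sub by blast
  then obtain F e where F: "(F, e) \<in> rt R" "F ~= {}" "at_node G e y" using inner_rt[OF R(1)] by blast
  obtain R' where R': "gpath G R'" "prank R' <= prank R" "pbranches R' = F" "at_node G (lend R') x" "at_node G (rend R') y"
   using prefix[OF R(1) F R(5)] by blast
  have "linked (pbranches R') x y" using link_ends[OF R'(1) _ R'(4,5)] R'(2) R(2) g(2) by simp
  thus ?thesis using linked_mono rt_subset[OF F(1)] R(3) R'(3) by blast
 qed
 have "D \<subseteq> E \<or> E \<subseteq> D" using pt_chain[OF g(1)] rt_pt D E by blast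
 thus ?thesis using *[OF _ D E] *[OF _ E D] linked_sym by blast
qed

lemma path_linked_end:
 assumes g: "gpath G P" "prank P < \<nu>" and D: "(D, q) \<in> rt P" "at_node G q x" and v: "at_node G (rend P) v"
 shows "linked (pbranches P) x v"
proof -
 obtain R where R: "gpath G R" "prank R <= prank P" "pbranches R = pbranches P - D"
  "at_node G (lend R) x" "at_node G (rend R) v" using suffix[OF g(1) D v] by blast
 have "linked (pbranches R) x v" using link_ends[OF R(1) _ R(4,5)] R(2) g(2) by simp
 thus ?thesis using linked_mono R(3) by blast
qed

lemma Br_linked:
 assumes "at_node G (Br b s) x" "at_node G (Br b r) y" shows "linked {b} x y"
proof (cases "s = r")
 case True
 hence "x = y" using at_node_Br_unique[OF assms(1), of y] assms(2) by simp
 thus ?thesis by simp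
next
 case False
 hence sr: "s = (\<not> r)" by auto
 have "x ~= y" using Br_nodes_distinct assms sr by blast
 moreover have "gpath G (Br b r)" using at_nodeE[OF assms(2)] by metis
 ultimately have "arc x (Br b r) y" using assms sr unfolding arc_def by simp
 thus ?thesis using rpred_nu(4) unfolding linked_def by (intro disjI2 exI[of _ "Br b r"]) simp
qed

definition sec :: "'a => 'a set" where
 "sec b = {c \<in> branches G. EX x y s r. at_node G (Br b s) x & at_node G (Br c r) y & linked UNIV x y}"

text \<open>The two end nodes of a branch are linked by that branch and low, so it does not matter
  which ends are compared.\<close>

lemma sec_iff:
 assumes "at_node G (Br b s) x" "at_node G (Br c r) y" shows "c \<in> sec b \<longleftrightarrow> linked UNIV x y"
proof
 assume "c \<in> sec b"
 then obtain x' y' s' r' where *: "at_node G (Br b s') x'" "at_node G (Br c r') y'" "linked UNIV x' y'" unfolding sec_def by blast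
 have l: "linked UNIV x x'" "linked UNIV y' y" using Br_linked linked_mono assms *(1,2) by blast+
 have "low x" "low y" "low x'" "low y'" using Br_low assms * by blast+
 thus "linked UNIV x y" using linked_trans l *(3) unfolding low_def by meson
next
 assume "linked UNIV x y"
 moreover have "c \<in> branches G" using at_nodeE[OF assms(2)] by (metis gpath_Br)
 ultimately show "c \<in> sec b" unfolding sec_def using assms by blast
qed

lemma sec_refl: "b \<in> branches G ==> b \<in> sec b"
 using Br_node[of b True] sec_iff by fastforce

lemma sec_sub: "sec b \<subseteq> branches G" unfolding sec_def by blast

lemma sec_eq: assumes "c \<in> sec b" shows "sec c = sec b"
proof -
 obtain x y s r where *: "at_node G (Br b s) x" "at_node G (Br c r) y" "linked UNIV x y" using assms unfolding sec_def by blast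
 have xy: "low x" "low y" using Br_low * by blast+
 have "d \<in> sec c \<longleftrightarrow> d \<in> sec b" if d: "d \<in> branches G" for d
 proof -
  obtain z where z: "at_node G (Br d True) z" using Br_node[OF d] by blast
  have "low z" using Br_low[OF z] .
  thus ?thesis using sec_iff[OF *(2) z] sec_iff[OF *(1) z] xy linked_trans *(3) linked_sym[OF *(3)] unfolding low_def by meson
 qed
 thus ?thesis using sec_sub by blast
qed

lemma path_sec:
 assumes g: "gpath G P" "prank P < \<nu>" "b \<in> pbranches P" shows "pbranches P \<subseteq> sec b"
proof
 fix c assume c: "c \<in> pbranches P"
 obtain D s where D: "(D, Br b s) \<in> rt P" using branch_pt[OF g(1,3)] by blast
 obtain E r where E: "(E, Br c r) \<in> rt P" using branch_pt[OF g(1) c] by blast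
 obtain x y where xy: "at_node G (Br b s) x" "at_node G (Br c r) y"
  using Br_node pbranches_branches[OF g(1)] g(3) c by blast
 have "linked UNIV x y" using path_linked[OF g(1,2) D xy(1) E xy(2)] linked_mono by blast
 thus "c \<in> sec b" using sec_iff[OF xy] by simp
qed

definition secs :: "'a set set" where "secs = sec ` branches G"

lemma secs_sec: "S \<in> secs ==> b \<in> S ==> S = sec b" unfolding secs_def using sec_eq by blast

lemma secs_nonempty: "S \<in> secs ==> S ~= {}" unfolding secs_def using sec_refl by blast

lemma secs_disjoint: "S \<in> secs ==> T \<in> secs ==> S Int T ~= {} ==> S = T" using secs_sec by blast

lemma secs_sub: "S \<in> secs ==> S \<subseteq> branches G" unfolding secs_def using sec_sub by blast

lemma path_secs: "gpath G P ==> prank P < \<nu> ==> \<exists>S\<in>secs. pbranches P \<subseteq> S"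
proof -
 assume g: "gpath G P" "prank P < \<nu>"
 obtain b where b: "b \<in> pbranches P" using pbranches_nonempty[OF g(1)] by blast
 have "sec b \<in> secs" using pbranches_branches[OF g(1)] b unfolding secs_def by blast
 thus ?thesis using path_sec[OF g b] by blast
qed

lemma path_secs': "gpath G P ==> prank P < \<nu> ==> S \<in> secs ==> pbranches P Int S ~= {} ==> pbranches P \<subseteq> S"
 using path_sec secs_sec by blast

definition touch :: "'a node => 'a set => bool" where
 "touch x S \<longleftrightarrow> (EX p. at_node G p x & pbranches p \<subseteq> S)"

lemma at_node_path: "at_node G p x ==> gpath G p & prank p < \<nu>"
 by (metis at_nodeE)

text \<open>The representative is turned so that it starts at \<open>x\<close>: an elementary tip
  and a path of shape \<open>Out\<close> have \<open>x\<close> at their right end.\<close>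

lemma touch_path:
 assumes "touch x S" shows "EX P. gpath G P & prank P < \<nu> & at_node G (lend P) x & pbranches P \<subseteq> S"
proof -
 obtain p where p: "at_node G p x" "pbranches p \<subseteq> S" using assms unfolding touch_def by blast
 obtain t where t: "p \<in> t" "t \<in> tips G (prank p)" using at_nodeE[OF p(1)] by metis
 have g: "gpath G p" "prank p < \<nu>" using at_node_path[OF p(1)] by auto
 show ?thesis
 proof (cases p)
  case (Br b s)
  thus ?thesis using p g by (intro exI[of _ "Br b (\<not> s)"]) auto
 next
  case (Seq \<mu> s f)
  hence "one_ended p" using tips_one_ended[OF t(2,1)] gpath_SeqD(1) g(1) by auto
  hence "s = In \<or> s = Out" using Seq by (auto simp: one_ended_def)
  thus ?thesis
  proof
   assume "s = In" thus ?thesis using Seq g p by (intro exI[of _ p]) simp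
  next
   assume s: "s = Out"
   have gp: "gpath G (prev p)" using g by simp
   have "prev p = trev p" using Seq by simp
   moreover have "at_node G (trev p) x" using at_node_trev[OF p(1)] gp \<open>prev p = trev p\<close> by metis
   moreover have "lend (prev p) = trev p" using lend_prev[of p] Seq s by (simp add: rend_open)
   ultimately show ?thesis using gp g p by (intro exI[of _ "prev p"]) simp
  qed
 qed
qed

lemma end_touch: "gpath G P ==> at_node G (lend P) x ==> pbranches P \<subseteq> S ==> touch x S"
 unfolding touch_def using rt_tip_branches[OF _ rt_lend] by blast

lemma end_touch': "gpath G P ==> at_node G (rend P) x ==> pbranches P \<subseteq> S ==> touch x S"
 using end_touch[of "prev P"] at_node_trev_iff(2)[of P x] by (simp add: lend_prev)

lemma inner_touch: "gpath G P ==> x \<in> inner G P ==> pbranches P \<subseteq> S ==> touch x S"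
proof -
 assume g: "gpath G P" "x \<in> inner G P" "pbranches P \<subseteq> S"
 obtain D q where D: "(D, q) \<in> rt P" "at_node G q x" using inner_rt[OF g(1,2)] by blast
 thus ?thesis using rt_tip_branches[OF g(1) D(1)] g(3) unfolding touch_def by blast
qed

lemma touch_linked:
 assumes "touch x S" shows "\<exists>c\<in>S. EX s y. at_node G (Br c s) y & linked S x y"
proof -
 obtain P where P: "gpath G P" "prank P < \<nu>" "at_node G (lend P) x" "pbranches P \<subseteq> S" using touch_path[OF assms] by blast
 obtain c where c: "c \<in> pbranches P" using pbranches_nonempty[OF P(1)] by blast
 obtain D s where D: "(D, Br c s) \<in> rt P" using branch_pt[OF P(1) c] by blast
 obtain y where y: "at_node G (Br c s) y" using Br_node c pbranches_branches[OF P(1)] by blast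
 have "linked S x y" using path_linked[OF P(1,2) rt_lend[OF P(1)] P(3) D y] linked_mono P(4) by blast
 thus ?thesis using c P(4) y by blast
qed

text \<open>An arc between branches of one section contains a branch linked to both, and a path of
  rank below \<open>\<nu>\<close> stays in one section; so the arc cannot leave
  \<open>S\<close>.\<close>

lemma Br_linked_sec:
 assumes S: "S \<in> secs" "b \<in> S" "c \<in> S" and xy: "at_node G (Br b s) x" "at_node G (Br c r) y"
 shows "linked S x y"
proof (cases "x = y")
 case False
 have "linked UNIV x y" using sec_iff[OF xy] secs_sec[OF S(1,2)] S(3) by simp
 then obtain P where P: "arc x P y" "prank P < \<nu>" using False unfolding linked_def by blast
 hence g: "gpath G P" "at_node G (lend P) x" unfolding arc_def by auto
 obtain d where d: "d \<in> pbranches P" using pbranches_nonempty[OF g(1)] by blast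
 obtain D t where D: "(D, Br d t) \<in> rt P" using branch_pt[OF g(1) d] by blast
 obtain z where z: "at_node G (Br d t) z" using Br_node d pbranches_branches[OF g(1)] by blast
 have "linked UNIV x z" using path_linked[OF g(1) P(2) rt_lend[OF g(1)] g(2) D z] linked_mono by blast
 hence "d \<in> S" using sec_iff[OF xy(1) z] secs_sec[OF S(1,2)] by simp
 hence "pbranches P \<subseteq> S" using path_secs'[OF g(1) P(2) S(1)] d by blast
 thus ?thesis using P unfolding linked_def by blast
qed simp

lemma touch_linked_all:
 assumes "x \<in> OK" "touch x S" "S \<in> secs" "c \<in> S" "at_node G (Br c r) y" shows "linked S x y"
proof -
 obtain b s z where b: "b \<in> S" "at_node G (Br b s) z" "linked S x z" using touch_linked[OF assms(2)] by blast
 have "linked S z y" using Br_linked_sec[OF assms(3) b(1) assms(4) b(2) assms(5)] .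
 thus ?thesis using linked_trans b(3) assms(1) Br_low[OF b(2)] Br_low[OF assms(5)] unfolding low_def by blast
qed

lemma touch_arc:
 assumes "x \<in> OK" "y \<in> OK" "touch x S" "touch y S" "S \<in> secs" "x ~= y"
 shows "EX P. arc x P y & prank P < \<nu> & pbranches P \<subseteq> S"
proof -
 obtain b s z where b: "b \<in> S" "at_node G (Br b s) z" "linked S y z" using touch_linked[OF assms(4)] by blast
 have "linked S x z" using touch_linked_all[OF assms(1,3,5) b(1,2)] .
 hence "linked S x y" using linked_trans linked_sym[OF b(3)] assms Br_low[OF b(2)] by blast
 thus ?thesis using assms(6) unfolding linked_def by blast
qed

text \<open>Links can be composed at a node of rank below \<open>\<nu>\<close>, so it cannot lie
  between different sections. Sections meet only at \<open>\<nu>\<close>-nodes.\<close>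

lemma low_touch_unique:
 assumes "low x" "touch x S" "touch x T" "S \<in> secs" "T \<in> secs" shows "S = T"
proof -
 obtain b s z where b: "b \<in> S" "at_node G (Br b s) z" "linked S x z" using touch_linked[OF assms(2)] by blast
 obtain c r y where c: "c \<in> T" "at_node G (Br c r) y" "linked T x y" using touch_linked[OF assms(3)] by blast
 have "linked UNIV z y"
  using linked_trans[of UNIV z x y] linked_sym linked_mono b(3) c(3) assms(1) Br_low[OF b(2)] Br_low[OF c(2)]
  unfolding low_def by blast
 hence "c \<in> S" using sec_iff[OF b(2) c(2)] secs_sec[OF assms(4) b(1)] by simp
 thus ?thesis using secs_disjoint assms(4,5) c(1) by blast
qed

lemma touch_exists:
 assumes "maxnode G x" shows "\<exists>S\<in>secs. touch x S"
proof -
 obtain t where t: "t \<in> etips x" using node_valid(4)[OF maxnode_node[OF assms]] ntips_etips by blast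
 obtain \<rho> where "\<rho> < \<nu>" "t \<in> tips G \<rho>" using etips_tips[OF maxnode_node[OF assms] t] by blast
 then obtain p where "p \<in> t" using tips_nonempty by blast
 hence p: "at_node G p x" using assms t unfolding at_node_def by blast
 then obtain S where "S \<in> secs" "pbranches p \<subseteq> S" using path_secs at_node_path by blast
 thus ?thesis using p unfolding touch_def by blast
qed

text \<open>The end tips have rank below \<open>\<nu> - 1\<close>, so a path of rank
  \<open>\<nu> - 1\<close> can have no open end. A path of smaller rank may be open and is wrapped
  as the only constituent of a two-ended one.\<close>

lemma two_ended_wrap:
 assumes "arc x P y" "prank P < \<nu>" "nrank x < \<nu>" "nrank y < \<nu>"
 shows "EX n \<mu> f. gpath G (Seq \<mu> (Two n) f) & \<mu> <= rpred \<nu> & pbranches (Seq \<mu> (Two n) f) = pbranches P &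
  at_node G (lend (Seq \<mu> (Two n) f)) x & at_node G (rend (Seq \<mu> (Two n) f)) y"
proof -
 have e: "at_node G (lend P) x" "at_node G (rend P) y" and g: "gpath G P" using assms(1) unfolding arc_def by auto
 have le: "prank (lend P) < rpred \<nu>" "prank (rend P) < rpred \<nu>" using lower_tip e assms(3,4) by blast+
 have lt: ?thesis if pr: "prank P < rpred \<nu>"
 proof -
  obtain \<mu> where m: "prank P < \<mu>" "prank P = Elem ==> \<mu> = Rk 0" "\<mu> ~= Arr" "\<mu> <= rpred \<nu>"
  proof (cases "prank P")
   case Elem thus ?thesis using that[of "Rk 0"] pr rpred_nu by (cases "rpred \<nu>") auto
  next
   case (Rk n) thus ?thesis using that[of "Rk (Suc n)"] pr rpred_nu by (cases "rpred \<nu>") auto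
  next
   case Arr thus ?thesis using pr rpred_nu by (cases "rpred \<nu>") auto
  next
   case Om thus ?thesis using pr rpred_nu by (cases "rpred \<nu>") auto
  qed
  show ?thesis using raise_one[OF assms(1) m(1-3)] m(4) e by metis
 qed
 show ?thesis
 proof (cases P)
  case (Br b s) thus ?thesis using lt rpred_nu by simp
 next
  case (Seq \<mu> s f)
  have mu: "\<mu> <= rpred \<nu>" using less_imp_le_rpred[OF assms(2) nu_valid(2)] Seq by simp
  show ?thesis
  proof (cases "EX n. s = Two n")
   case True thus ?thesis using Seq g e mu by metis
  next
   case False
   hence "prank (lend P) = \<mu> \<or> prank (rend P) = \<mu>" using Seq by (cases s) auto
   thus ?thesis using lt le Seq by auto
  qed
 qed
qed

lemma meets_Br: "meets_branch G P b \<longleftrightarrow> (EX s x. at_node G (Br b s) x & x \<in> met G P)" if "gpath G P"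
proof -
 have "maxnode G x" if "x \<in> met G P" for x
  using that inner_maxnode[OF \<open>gpath G P\<close>] at_node_maxnode unfolding met_def left_terminal_def right_terminal_def by blast
 moreover have "{Br b s} \<in> etips x" if a: "at_node G (Br b s) x" for s x
 proof -
  obtain t where "t \<in> etips x" "Br b s \<in> t" "t \<in> tips G Elem" using at_nodeE[OF a] by (metis prank.simps(1))
  thus ?thesis by (auto elim!: tipsE)
 qed
 ultimately show ?thesis unfolding meets_branch_def at_node_def by blast
qed

lemma met_point:
 assumes "gpath G P" "x \<in> met G P" shows "(EX D q. (D, q) \<in> rt P & at_node G q x) \<or> at_node G (rend P) x"
 using assms inner_rt rt_lend unfolding met_def left_terminal_def right_terminal_def by blast

lemma terminal_met: "at_node G (lend (Seq \<mu> (Two n) f)) x ==> x \<in> met G (Seq \<mu> (Two n) f)"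
 "at_node G (rend (Seq \<mu> (Two n) f)) x ==> x \<in> met G (Seq \<mu> (Two n) f)"
 unfolding met_def left_terminal_def right_terminal_def by blast+

lemma met_sec:
 assumes "gpath G P" "prank P < \<nu>" "meets_branch G P b" "meets_branch G P c" shows "c \<in> sec b"
proof -
 obtain s x where x: "at_node G (Br b s) x" "x \<in> met G P" using assms meets_Br by blast
 obtain r y where y: "at_node G (Br c r) y" "y \<in> met G P" using assms meets_Br by blast
 have "linked (pbranches P) x y"
  using met_point[OF assms(1) x(2)] met_point[OF assms(1) y(2)] path_linked[OF assms(1,2)] path_linked_end[OF assms(1,2)]
   linked_sym at_node_inject linked_refl by metis
 thus ?thesis using sec_iff[OF x(1) y(1)] linked_mono by blast
qed

lemma sec_connected:
 assumes S: "S \<in> secs" "b \<in> S" "c \<in> S"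
 shows "EX P. gpath G P & two_ended P & prank P <= rpred \<nu> & pbranches P \<subseteq> S & meets_branch G P b & meets_branch G P c"
proof -
 have bB: "b \<in> branches G" "c \<in> branches G" using secs_sub S by blast+
 obtain x y where x: "at_node G (Br b True) x" and y: "at_node G (Br c True) y" using Br_node bB by blast
 have "EX u v P. arc u P v & prank P < \<nu> & pbranches P \<subseteq> S & nrank u < \<nu> & nrank v < \<nu> & x \<in> {u, v} & y \<in> {u, v}"
 proof (cases "x = y")
  case True
  obtain z where z: "at_node G (Br b False) z" using Br_node bB by blast
  have "z ~= x" using Br_nodes_distinct[OF x] z by auto
  thus ?thesis using Br_linked[OF z x] S(2) True Br_low[OF x] Br_low[OF z] unfolding linked_def low_def by blast
 next
  case False
  thus ?thesis using Br_linked_sec[OF S x y] Br_low[OF x] Br_low[OF y] unfolding linked_def low_def by blast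
 qed
 then obtain u v P where P: "arc u P v" "prank P < \<nu>" "pbranches P \<subseteq> S" "nrank u < \<nu>" "nrank v < \<nu>" "x \<in> {u, v}" "y \<in> {u, v}" by blast
 obtain n \<mu> f where Q: "gpath G (Seq \<mu> (Two n) f)" "\<mu> <= rpred \<nu>" "pbranches (Seq \<mu> (Two n) f) = pbranches P"
  "at_node G (lend (Seq \<mu> (Two n) f)) u" "at_node G (rend (Seq \<mu> (Two n) f)) v" using two_ended_wrap[OF P(1,2,4,5)] by blast
 have "x \<in> met G (Seq \<mu> (Two n) f)" "y \<in> met G (Seq \<mu> (Two n) f)" using terminal_met Q(4,5) P(6,7) by blast+
 hence "meets_branch G (Seq \<mu> (Two n) f) b" "meets_branch G (Seq \<mu> (Two n) f) c" using meets_Br[OF Q(1)] x y by blast+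
 moreover have "two_ended (Seq \<mu> (Two n) f)" by (simp add: two_ended_def)
 ultimately show ?thesis using Q(1,2,3) P(3) by (metis prank.simps(2))
qed

text \<open>Identifies the classes of linked branches with the sections of the definition of
  \<open>boundary_node\<close>, whose finiteness is assumed.\<close>

lemma rsection_sec:
 assumes S: "S \<in> secs" shows "rsection (rpred \<nu>) G S"
 unfolding rsection_def component_def connected_within_def
proof (intro conjI allI impI ballI)
 show "S \<subseteq> branches G" using secs_sub[OF S] .
 show "EX P. gpath G P & two_ended P & prank P <= rpred \<nu> & pbranches P \<subseteq> branches G & meets_branch G P b & meets_branch G P c"
  if "b \<in> S" "c \<in> S" for b c using sec_connected[OF S that] secs_sub[OF S] by blast
 fix D assume D: "S \<subseteq> D & D \<subseteq> branches G & (\<forall>b\<in>D. \<forall>c\<in>D. EX P. gpath G P & two_ended P & prank P <= rpred \<nu> &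
   pbranches P \<subseteq> branches G & meets_branch G P b & meets_branch G P c)"
 obtain b where b: "b \<in> S" using secs_nonempty[OF S] by blast
 have "d \<in> S" if d: "d \<in> D" for d
 proof -
  have "b \<in> D" using b D by blast
  then obtain P where "gpath G P" "prank P <= rpred \<nu>" "meets_branch G P b" "meets_branch G P d" using D d by meson
  hence "d \<in> sec b" using met_sec rpred_nu(2) by (meson le_less_trans)
  thus ?thesis using secs_sec[OF S b] by simp
 qed
 thus "D = S" using D by blast
qed

end

section \<open>Walks through sections\<close>

context metric_graph
begin

definition NU :: "'a node set" where "NU = {u. maxnode G u & nrank u = \<nu>}"

text \<open>For \<open>W = NU - {v}\<close> this describes the components after the removal of
  \<open>v\<close>: sections joined by chains through other \<open>\<nu>\<close>-nodes.\<close>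

definition conn :: "'a node set => 'a set => 'a set => bool" where
 "conn W = (%S T. S \<in> secs & T \<in> secs & (\<exists>u\<in>W. touch u S & touch u T))\<^sup>*\<^sup>*"

lemma conn_refl [simp]: "conn W S S" by (simp add: conn_def)
lemma conn_trans: "conn W S T ==> conn W T U ==> conn W S U" unfolding conn_def by (rule rtranclp_trans)
lemma conn_step: "S \<in> secs ==> T \<in> secs ==> u \<in> W ==> touch u S ==> touch u T ==> conn W S T"
 unfolding conn_def by (intro r_into_rtranclp) blast
lemma conn_sym: "conn W S T ==> conn W T S"
 unfolding conn_def by (rule sympD[OF symp_rtranclp]) (auto intro!: sympI)
lemma conn_secs: "conn W S T ==> S \<in> secs ==> T \<in> secs"
 unfolding conn_def by (induction rule: rtranclp_induct) auto

lemma NU_nodes: assumes "x \<in> nodes G" "nrank x = \<nu>" shows "x \<in> NU"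
proof -
 have "nexc y ~= Some x" if "y \<in> nodes G" for y
  using nexc_node[OF that, of x] node_valid(3)[OF that] assms(2) by auto
 thus ?thesis using assms unfolding NU_def maxnode_def by simp
qed

lemma not_NU: "x \<in> OK ==> x ~: NU ==> low x"
 unfolding NU_def low_def OK_def using node_valid(3) maxnode_node by (metis (mono_tags, lifting) mem_Collect_eq order_le_less)

lemma touch_same:
 assumes "c \<in> OK" "c ~= v" "touch c S" "touch c T" "S \<in> secs" "T \<in> secs" shows "conn (NU - {v}) S T"
proof (cases "c \<in> NU")
 case True thus ?thesis using conn_step[OF assms(5,6), of c "NU - {v}"] assms(2,3,4) by simp
next
 case False thus ?thesis using low_touch_unique[OF not_NU[OF assms(1) False] assms(3-6)] by simp
qed

text \<open>Tips reaching different sections have no common branches and are distinct, so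
  \<open>u\<close> is not a singleton and hence in \<open>M\<close>.\<close>

lemma boundary:
 assumes u: "u \<in> NU" and S: "touch u S" "touch u T" "S \<in> secs" "T \<in> secs" "S ~= T"
 shows "u \<in> M" "boundary_node \<nu> G u"
proof -
 have um: "maxnode G u" "nrank u = \<nu>" using u unfolding NU_def by auto
 obtain p q where p: "at_node G p u" "pbranches p \<subseteq> S" and q: "at_node G q u" "pbranches q \<subseteq> T" using S(1,2) unfolding touch_def by blast
 obtain t s where t: "t \<in> etips u" "p \<in> t" "t \<in> tips G (prank p)" and s: "s \<in> etips u" "q \<in> s" using at_nodeE[OF p(1)] at_nodeE[OF q(1)] by metis
 have "t ~= s"
 proof
  assume "t = s"
  hence "same_tip G p q" using tip_same[OF t(3,2)] s(2) by blast
  hence "pbranches p Int pbranches q ~= {}" using same_tip_overlap at_node_path[OF p(1)] by blast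
  thus False using secs_disjoint[OF S(3,4)] S(5) p(2) q(2) by blast
 qed
 hence ns: "\<not> singleton_node u" using t(1) s(1) top_etips[OF um] unfolding singleton_node_def by auto
 show "u \<in> M" using nonsingleton_M[OF um(1) ns] .
 have "rsection (rpred \<nu>) G S" "rsection (rpred \<nu>) G T" using rsection_sec S by blast+
 thus "boundary_node \<nu> G u" unfolding boundary_node_def tip_of_subgraph_def
  using t s p(2) q(2) S(5) um maxnode_node[OF um(1)] top_etips[OF um] by blast
qed

section \<open>Walks, their minimal forms, and the paths along them\<close>

definition walk :: "'a node set => 'a node => 'a node => nat => (nat => 'a node) => (nat => 'a set) => bool" where
 "walk W x y k w \<Sigma> \<longleftrightarrow> w 0 = x & w (Suc k) = y & (\<forall>i\<le>k. \<Sigma> i \<in> secs & touch (w i) (\<Sigma> i) & touch (w (Suc i)) (\<Sigma> i)) &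
   (ALL i. 1 <= i & i <= k --> w i \<in> W)"

text \<open>Distinct nodes and distinct sections are what turns a walk into a path: arcs in
  different sections have no inner node in common.\<close>

definition mwalk :: "'a node set => 'a node => 'a node => nat => (nat => 'a node) => (nat => 'a set) => bool" where
 "mwalk W x y k w \<Sigma> \<longleftrightarrow> walk W x y k w \<Sigma> & inj_on w {..Suc k} & inj_on \<Sigma> {..k}"

lemma conn_walk:
 assumes "conn W S T" "S \<in> secs" "touch x S" "touch y T" shows "EX k w \<Sigma>. walk W x y k w \<Sigma>"
 using assms unfolding conn_def
proof (induction arbitrary: y rule: rtranclp_induct)
 case base
 thus ?case by (intro exI[of _ 0] exI[of _ "%i. if i = 0 then x else y"] exI[of _ "%_. S"]) (auto simp: walk_def)
next
 case (step T U)
 then obtain u where u: "u \<in> W" "touch u T" "touch u U" "U \<in> secs" by blast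
 then obtain k w \<Sigma> where w: "walk W x u k w \<Sigma>" using step by blast
 show ?case
  by (intro exI[of _ "Suc k"] exI[of _ "%i. if i <= Suc k then w i else y"] exI[of _ "%i. if i <= k then \<Sigma> i else U"])
   (use w u step.prems in \<open>auto simp: walk_def le_Suc_eq\<close>)
qed

lemma walk_conn:
 assumes w: "walk W x y k w \<Sigma>" and j: "i <= j" "j <= k" "!!l. i < l ==> l <= j ==> w l \<in> W'"
 shows "conn W' (\<Sigma> i) (\<Sigma> j)"
 using j
proof (induction j rule: dec_induct)
 case (step j)
 have "touch (w (Suc j)) (\<Sigma> j)" "touch (w (Suc j)) (\<Sigma> (Suc j))" "\<Sigma> j \<in> secs" "\<Sigma> (Suc j) \<in> secs"
  using w step.prems(1) unfolding walk_def by (auto simp: Suc_le_eq)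
 hence "conn W' (\<Sigma> j) (\<Sigma> (Suc j))" using conn_step[of "\<Sigma> j" "\<Sigma> (Suc j)" "w (Suc j)"] step by simp
 moreover have "conn W' (\<Sigma> i) (\<Sigma> j)" using step by simp
 ultimately show ?case using conn_trans by blast
qed simp

lemma walk_cut_section:
 assumes w: "walk W x y k w \<Sigma>" and ij: "i < j" "j <= k" "\<Sigma> i = \<Sigma> j"
 shows "EX k' w \<Sigma>. k' < k & walk W x y k' w \<Sigma>"
proof -
 let ?d = "j - i"
 have t: "touch (w (Suc (m + ?d))) (\<Sigma> (m + ?d)) & touch (w (m + ?d)) (\<Sigma> (m + ?d)) & \<Sigma> (m + ?d) \<in> secs" if "m <= k - ?d" for m
 proof -
  have "m + ?d <= k" using that ij by linarith
  thus ?thesis using w unfolding walk_def by blast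
 qed
 have "i + ?d = j" using ij by simp
 hence ti: "touch (w (Suc (i + ?d))) (\<Sigma> i)" using t[of i] ij by simp
 have "walk W x y (k - ?d) (%m. if m <= i then w m else w (m + ?d)) (%m. if m <= i then \<Sigma> m else \<Sigma> (m + ?d))"
  unfolding walk_def
 proof (intro conjI allI impI, goal_cases)
  case 1 thus ?case using w by (simp add: walk_def)
 next
  case 2
  have "Suc (k - ?d) + ?d = Suc k" "\<not> Suc (k - ?d) <= i" using ij by linarith+
  thus ?case using w by (simp add: walk_def)
 next
  case (3 m) thus ?case using w t[OF 3] ij by (simp add: walk_def)
 next
  case (4 m) thus ?case using w t[OF 4] ij by (simp add: walk_def)
 next
  case (5 m)
  consider "Suc m <= i" | "m = i" | "i < m" by linarith
  thus ?case
  proof cases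
   case 1 thus ?thesis using w ij by (simp add: walk_def)
  next
   case 2 thus ?thesis using ti by simp
  next
   case 3 thus ?thesis using t[OF 5] by simp
  qed
 next
  case (6 m)
  have "m + ?d <= k" "m <= k" using 6 ij by linarith+
  thus ?case using w 6 by (simp add: walk_def)
 qed
 moreover have "k - ?d < k" using ij by linarith
 ultimately show ?thesis by blast
qed

lemma walk_cut_node:
 assumes w: "walk W x y k w \<Sigma>" and ij: "i < j" "j <= Suc k" "w i = w j" "x ~= y"
 shows "EX k' w \<Sigma>. k' < k & walk W x y k' w \<Sigma>"
proof -
 let ?d = "j - i"
 \<comment> \<open>Since \<open>x ~= y\<close>, the part cut out is not the whole walk.\<close>
 have nij: "i ~= 0 \<or> j ~= Suc k" using w ij unfolding walk_def by metis
 hence dk: "?d <= k" using ij by linarith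
 have id: "i + ?d = j" using ij by simp
 have t: "touch (w (Suc (m + ?d))) (\<Sigma> (m + ?d)) & touch (w (m + ?d)) (\<Sigma> (m + ?d)) & \<Sigma> (m + ?d) \<in> secs" if "m <= k - ?d" for m
 proof -
  have "m + ?d <= k" using that dk by linarith
  thus ?thesis using w unfolding walk_def by blast
 qed
 have "walk W x y (k - ?d) (%m. if m <= i then w m else w (m + ?d)) (%m. if m < i then \<Sigma> m else \<Sigma> (m + ?d))"
  unfolding walk_def
 proof (intro conjI allI impI, goal_cases)
  case 1 thus ?case using w by (simp add: walk_def)
 next
  case 2
  have e: "Suc (k - ?d) + ?d = Suc k" using dk by linarith
  show ?case
  proof (cases "Suc (k - ?d) <= i")
   case True
   hence "Suc (k - ?d) = i" "j = Suc k" using ij dk by linarith+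
   thus ?thesis using w ij by (simp add: walk_def)
  qed (use w e in \<open>simp add: walk_def\<close>)
 next
  case (3 m) thus ?case using w t[OF 3] ij by (simp add: walk_def)
 next
  case (4 m)
  consider "m < i" | "m = i" | "i < m" by linarith
  thus ?case
  proof cases
   case 1 thus ?thesis using w ij by (simp add: walk_def)
  next
   case 2 thus ?thesis using t[OF 4] ij id by simp
  next
   case 3 thus ?thesis using t[OF 4] by simp
  qed
 next
  case (5 m) thus ?case using w t[OF 5] ij by (simp add: walk_def)
 next
  case (6 m)
  have "m + ?d <= k" "m <= k" using 6 dk by linarith+
  thus ?case using w 6 by (simp add: walk_def)
 qed
 moreover have "k - ?d < k" using ij dk by linarith
 ultimately show ?thesis by blast
qed

lemma walk_minimal:
 assumes "walk W x y k w \<Sigma>" "x ~= y" shows "EX k w \<Sigma>. mwalk W x y k w \<Sigma>"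
proof -
 define k0 where "k0 = (LEAST k. EX w \<Sigma>. walk W x y k w \<Sigma>)"
 have ex: "EX w \<Sigma>. walk W x y k w \<Sigma>" using assms(1) by blast
 have "EX w \<Sigma>. walk W x y k0 w \<Sigma>" unfolding k0_def by (rule LeastI[where P = "%k. EX w \<Sigma>. walk W x y k w \<Sigma>", OF ex])
 then obtain w \<Sigma> where w: "walk W x y k0 w \<Sigma>" by blast
 have least: "\<not> (EX k' w \<Sigma>. k' < k0 & walk W x y k' w \<Sigma>)" using not_less_Least unfolding k0_def by blast
 have "inj_on w {..Suc k0}"
 proof (rule linorder_inj_onI')
  fix i j assume "i < j" "j \<in> {..Suc k0}"
  thus "w i ~= w j" using walk_cut_node[OF w _ _ _ assms(2), of i j] least by blast
 qed
 moreover have "inj_on \<Sigma> {..k0}"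
 proof (rule linorder_inj_onI')
  fix i j assume "i < j" "j \<in> {..k0}"
  thus "\<Sigma> i ~= \<Sigma> j" using walk_cut_section[OF w, of i j] least by blast
 qed
 ultimately show ?thesis using w unfolding mwalk_def by blast
qed

text \<open>An inner node lies between two consecutive sections, which are distinct in a minimal
  walk; so it is a boundary node, and the boundary bounds the length of minimal walks.\<close>

lemma mwalk_inner:
 assumes w: "mwalk W x y k w \<Sigma>" and W: "W \<subseteq> NU" and i: "1 <= i" "i <= k"
 shows "w i \<in> NU" "w i \<in> M" "boundary_node \<nu> G (w i)"
proof -
 obtain j where j: "i = Suc j" using i by (cases i) auto
 have wi: "w i \<in> W" "touch (w i) (\<Sigma> i)" "\<Sigma> i \<in> secs" "touch (w i) (\<Sigma> j)" "\<Sigma> j \<in> secs"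
  using w i j unfolding mwalk_def walk_def by auto
 have "\<Sigma> i ~= \<Sigma> j" using w i j unfolding mwalk_def by (auto dest: inj_onD)
 thus "w i \<in> NU" "w i \<in> M" "boundary_node \<nu> G (w i)" using boundary[of "w i" "\<Sigma> i" "\<Sigma> j"] wi W by blast+
qed

lemma mwalk_bound:
 assumes w: "mwalk W x y k w \<Sigma>" and W: "W \<subseteq> NU" and fin: "finite {x. boundary_node \<nu> G x}"
 shows "k <= card {x. boundary_node \<nu> G x}"
proof -
 have "inj_on w {1..k}" by (rule inj_on_subset[of w "{..Suc k}"]) (use w in \<open>auto simp: mwalk_def\<close>)
 hence "card (w ` {1..k}) = k" by (simp add: card_image)
 moreover have "w ` {1..k} \<subseteq> {x. boundary_node \<nu> G x}" using mwalk_inner(3)[OF w W] by auto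
 ultimately show ?thesis using card_mono[OF fin] by metis
qed

text \<open>In Cantor normal form: no exponent exceeds \<open>\<nu>\<close>, which is
  \<open>expo (rpred \<nu>)\<close>, and the coefficient of \<omega>^\<nu> is at most
  \<open>N\<close>.\<close>

definition short :: "nat => 'a tpath => bool" where
 "short N P \<longleftrightarrow> (\<forall>e\<in>#plength P. e <= expo (rpred \<nu>)) & count (plength P) (expo (rpred \<nu>)) <= N"

text \<open>The coefficient 2 comes from endless paths; a two-ended path has only smaller exponents
  than its one-ended counterpart.\<close>

lemma plength_le:
 "gpath G P ==> (\<forall>e\<in>#plength P. e <= expo (prank P)) & count (plength P) (expo (prank P)) <= 2"
proof (induction rule: gpath.induct)
 case (sequence \<mu> s f)
 show ?case
 proof (cases "EX n. s = Two n")
  case True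
  then obtain n where n: "s = Two n" by blast
  have "e < expo \<mu>" if i: "i \<in> {0..<int n}" "e \<in># plength (f i)" for i e
  proof -
   have "e <= expo (prank (f i))" "prank (f i) < \<mu>" using sequence.IH i n by auto
   thus ?thesis unfolding less_rank_def by simp
  qed
  hence "\<forall>e\<in>#(\<Sum>i\<in>{0..<int n}. plength (f i)). e < expo \<mu>" by (auto simp: set_mset_sum)
  thus ?thesis unfolding n by (auto simp: count_eq_zero_iff[THEN iffD2] order_less_imp_le not_in_iff)
 qed (cases s; auto)
qed simp

lemma gpath_short: assumes g: "gpath G P" "prank P < \<nu>" shows "short 2 P"
proof -
 have r: "prank P <= rpred \<nu>" using less_imp_le_rpred[OF g(2) nu_valid(2)] .
 show ?thesis
 proof (cases "prank P = rpred \<nu>")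
  case True thus ?thesis using plength_le[OF g(1)] unfolding short_def by simp
 next
  case False
  hence lt: "expo (prank P) < expo (rpred \<nu>)" using r unfolding less_rank_def[symmetric] by simp
  hence "\<forall>e\<in>#plength P. e < expo (rpred \<nu>)" using plength_le[OF g(1)] by fastforce
  thus ?thesis unfolding short_def by (auto simp: order_less_imp_le count_eq_zero_iff[THEN iffD2])
 qed
qed

lemma short_less: "short N P ==> plength P < replicate_mset (Suc N) (expo (rpred \<nu>))"
 unfolding short_def less_multiset\<^sub>H\<^sub>O
proof (elim conjE, intro conjI allI impI)
 assume *: "\<forall>e\<in>#plength P. e <= expo (rpred \<nu>)" "count (plength P) (expo (rpred \<nu>)) <= N"
 show "plength P ~= replicate_mset (Suc N) (expo (rpred \<nu>))" using *(2) by auto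
 fix y assume y: "count (replicate_mset (Suc N) (expo (rpred \<nu>))) y < count (plength P) y"
 hence "y \<in># plength P" by (metis count_greater_zero_iff gr_zeroI not_less_zero)
 hence "y <= expo (rpred \<nu>)" using *(1) by blast
 moreover have "y ~= expo (rpred \<nu>)" using y *(2) by auto
 ultimately show "\<exists>x>y. count (plength P) x < count (replicate_mset (Suc N) (expo (rpred \<nu>))) x"
  using *(2) by (intro exI[of _ "expo (rpred \<nu>)"]) auto
qed

text \<open>Consecutive nodes are joined by arcs inside the sections. An inner node of an arc is low
  and touches one section only, so different arcs do not meet inside, and each junction is a
  \<open>\<nu>\<close>-node, entered through tips of the right rank.\<close>

lemma walk_path:
 assumes w: "mwalk W x y k w \<Sigma>" and W: "W \<subseteq> NU" and xy: "x \<in> OK" "y \<in> OK" "x ~= y"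
 shows "EX \<mu> n f. gpath G (Seq \<mu> (Two n) f) & \<mu> <= \<nu> & pbranches (Seq \<mu> (Two n) f) \<subseteq> (\<Union>i\<le>k. \<Sigma> i) &
  at_node G (lend (Seq \<mu> (Two n) f)) x & at_node G (rend (Seq \<mu> (Two n) f)) y &
  inner G (Seq \<mu> (Two n) f) Int NU \<subseteq> W & short (2 * Suc k) (Seq \<mu> (Two n) f)"
proof -
 have wk: "w 0 = x" "w (Suc k) = y" "!!i. i <= k ==> \<Sigma> i \<in> secs & touch (w i) (\<Sigma> i) & touch (w (Suc i)) (\<Sigma> i)"
  "!!i. 1 <= i ==> i <= k ==> w i \<in> W" and injw: "inj_on w {..Suc k}" and injS: "inj_on \<Sigma> {..k}"
  using w unfolding mwalk_def walk_def by auto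
 have wOK: "w i \<in> OK" if "i <= Suc k" for i
 proof -
  have "i = 0 \<or> i = Suc k \<or> 1 <= i & i <= k" using that by linarith
  thus ?thesis using wk xy mwalk_inner(2)[OF w W, of i] M_OK by auto
 qed
 have "EX P. arc (w i) P (w (Suc i)) & prank P < \<nu> & pbranches P \<subseteq> \<Sigma> i" if i: "i <= k" for i
 proof -
  have "w i ~= w (Suc i)" using injw i by (auto dest: inj_onD)
  thus ?thesis using touch_arc[of "w i" "w (Suc i)" "\<Sigma> i"] wOK wk(3)[OF i] i by auto
 qed
 then obtain P where P: "!!i. i <= k ==> arc (w i) (P i) (w (Suc i)) & prank (P i) < \<nu> & pbranches (P i) \<subseteq> \<Sigma> i" by metis
 have gP: "gpath G (P i)" "at_node G (lend (P i)) (w i)" "at_node G (rend (P i)) (w (Suc i))"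
  "w i ~: inner G (P i)" "w (Suc i) ~: inner G (P i)" "prank (P i) < \<nu>" "pbranches (P i) \<subseteq> \<Sigma> i" if "i <= k" for i
  using P[OF that] unfolding arc_def by auto
 have inlow: "low u" "touch u (\<Sigma> i)" if "i <= k" "u \<in> inner G (P i)" for i u
  using inner_lower[OF gP(1) gP(6)] inner_M[OF gP(1)] M_OK that inner_touch[OF gP(1) _ gP(7)] unfolding low_def by blast+
 have low_eq: "i = j" if "low u" "touch u (\<Sigma> i)" "touch u (\<Sigma> j)" "i <= k" "j <= k" for u i j
  using low_touch_unique[OF that(1-3)] wk(3) that(4,5) injS by (auto dest: inj_onD)
 have not_low: "\<not> low u" if "u \<in> NU" for u using that unfolding NU_def low_def by simp
 show ?thesis
 \<comment> \<open>With no \<open>\<nu>\<close>-node involved, the only arc may even be a single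
   branch, which is no constituent of a \<open>\<nu>\<close>-path; the required path is then one of
   rank at most \<open>\<nu> - 1\<close>.\<close>
 proof (cases "k = 0 & low x & low y")
  case True
  hence "arc x (P 0) y" "prank (P 0) < \<nu>" using P[of 0] wk by auto
  then obtain n \<mu> f where Q: "gpath G (Seq \<mu> (Two n) f)" "\<mu> <= rpred \<nu>" "pbranches (Seq \<mu> (Two n) f) = pbranches (P 0)"
   "at_node G (lend (Seq \<mu> (Two n) f)) x" "at_node G (rend (Seq \<mu> (Two n) f)) y"
   using two_ended_wrap[of x "P 0" y] True unfolding low_def by blast
  have r: "\<mu> < \<nu>" using Q(2) rpred_nu(2) by simp
  hence "inner G (Seq \<mu> (Two n) f) Int NU = {}" using inner_lower[OF Q(1)] unfolding NU_def by auto
  moreover have "short (2 * Suc k) (Seq \<mu> (Two n) f)" using gpath_short[OF Q(1)] r True by simp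
  ultimately show ?thesis using Q r gP(7)[of 0] True by (intro exI[of _ \<mu>] exI[of _ n] exI[of _ f]) (auto simp del: lend.simps rend.simps pbranches.simps inner.simps)
 next
  case nlow: False
  have NUw: "w i \<in> NU" if "1 <= i" "i <= k" for i using mwalk_inner(1)[OF w W that] .
  have endNU: "w i \<in> NU \<or> w (Suc i) \<in> NU" if "i <= k" for i
  proof (cases "k = 0")
   case True thus ?thesis using nlow not_NU xy wk that by auto
  next
   case False
   hence "1 <= i & i <= k \<or> 1 <= Suc i & Suc i <= k" using that by auto
   thus ?thesis using NUw by blast
  qed
  let ?f = "%i. P (nat i)" and ?x = "%i. w (nat i)" and ?s = "Two (Suc k)"
  have idx: "i \<in> idx ?s \<longleftrightarrow> 0 <= i & nat i <= k" for i by auto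
  have idx': "i \<in> idx ?s Un (%i. i + 1) ` idx ?s \<longleftrightarrow> 0 <= i & nat i <= Suc k" for i
  proof -
   have "i \<in> (%i. i + 1) ` idx ?s \<longleftrightarrow> i - 1 \<in> idx ?s" by (auto simp: image_iff algebra_simps)
   thus ?thesis by auto
  qed
  have S: "nat (i + 1) = Suc (nat i)" if "0 <= i" for i :: int using that by linarith
  have wn: "w i ~: inner G (P j)" if ij: "i <= Suc k" "j <= k" for i j
  proof
   assume a: "w i \<in> inner G (P j)"
   have l: "low (w i)" "touch (w i) (\<Sigma> j)" using inlow[OF ij(2) a] by auto
   hence "i = 0 \<or> i = Suc k" using NUw not_low ij(1) by (metis One_nat_def Suc_leI le_SucE neq0_conv)
   thus False
   proof
    assume i: "i = 0"
    hence "j = 0" using low_eq[OF l(1) l(2)] wk(3)[of 0] ij by auto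
    thus False using gP(4)[of 0] a i by simp
   next
    assume i: "i = Suc k"
    hence "j = k" using low_eq[OF l(1) l(2)] wk(3)[of k] ij by auto
    thus False using gP(5)[of k] a i by simp
   qed
  qed
  have tr: "tracing G ?s ?f" unfolding tracing_def
  proof (intro exI[of _ ?x] conjI ballI impI)
   fix i assume "i \<in> idx ?s"
   hence i: "0 <= i" "nat i <= k" using idx by auto
   show "at_node G (lend (?f i)) (?x i)" "at_node G (rend (?f i)) (?x (i + 1))" using gP[OF i(2)] S[OF i(1)] by auto
  next
   show "inj_on ?x (idx ?s Un (%i. i + 1) ` idx ?s)"
    by (rule inj_onI) (use injw in \<open>unfold idx', auto dest!: inj_onD\<close>)
  next
   fix i j assume "i \<in> idx ?s Un (%i. i + 1) ` idx ?s" "j \<in> idx ?s"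
   thus "?x i ~: inner G (?f j)" using wn unfolding idx idx' by simp
  next
   fix i j assume ij: "i \<in> idx ?s" "j \<in> idx ?s" "i ~= j"
   show "inner G (?f i) Int inner G (?f j) = {}"
   proof (rule equals0I)
    fix u assume u: "u \<in> inner G (?f i) Int inner G (?f j)"
    have "nat i = nat j" by (rule low_eq[of u]) (use u inlow ij idx in auto)
    thus False using ij idx by auto
   qed
  qed
  have top: "prank (lend (P i)) = rpred \<nu>" if "i <= k" "w i \<in> NU" for i
   using top_tip[OF gP(2)[OF that(1)]] that(2) unfolding NU_def by simp
  have top': "prank (rend (P i)) = rpred \<nu>" if "i <= k" "w (Suc i) \<in> NU" for i
   using top_tip[OF gP(3)[OF that(1)]] that(2) unfolding NU_def by simp
  have jr: "junction_ranks \<nu> ?s ?f" unfolding junction_ranks_def using nu_valid(2)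
  proof (simp, intro ballI)
   fix i assume "i \<in> junctions ?s"
   hence i: "1 <= i" "nat i <= k" unfolding junctions_def by auto
   hence n: "nat (i - 1) <= k" "Suc (nat (i - 1)) = nat i" "1 <= nat i" by auto
   show "jrank ?f i = rpred \<nu>" unfolding jrank_def using top[of "nat i"] top'[of "nat (i - 1)"] NUw[of "nat i"] i n by simp
  qed
  have ne: "prank (P i) ~= Elem" if i: "i <= k" for i
  proof
   assume "prank (P i) = Elem"
   then obtain b s where "P i = Br b s" using gpath_Elem gP(1)[OF i] by blast
   thus False using endNU[OF i] top[OF i] top'[OF i] rpred_nu(1) by auto
  qed
  have g: "gpath G (Seq \<nu> ?s ?f)"
   by (rule gpath.sequence) (use nu_valid gP(1,6) ne tr jr idx in auto)
  have "inner G (Seq \<nu> ?s ?f) Int NU \<subseteq> W"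
  proof
   fix u assume u: "u \<in> inner G (Seq \<nu> ?s ?f) Int NU"
   then consider i where "i \<in> idx ?s" "u \<in> inner G (?f i)" | i where "i - 1 \<in> idx ?s" "i \<in> idx ?s" "at_node G (lend (?f i)) u"
    unfolding inner.simps(2) by blast
   thus "u \<in> W"
   proof cases
    case 1 thus ?thesis using inlow(1)[of "nat i" u] u not_low idx by auto
   next
    case 2
    hence i: "nat i <= k" "1 <= nat i" using idx by auto
    hence "u = w (nat i)" using at_node_inject[OF gP(2)[OF i(1)]] 2(3) by blast
    thus ?thesis using wk(4) i by simp
   qed
  qed
  moreover have "pbranches (Seq \<nu> ?s ?f) \<subseteq> (\<Union>i\<le>k. \<Sigma> i)"
  proof
   fix b assume "b \<in> pbranches (Seq \<nu> ?s ?f)"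
   then obtain i where "i \<in> idx ?s" "b \<in> pbranches (P (nat i))" unfolding pbranches.simps by blast
   thus "b \<in> (\<Union>i\<le>k. \<Sigma> i)" using gP(7)[of "nat i"] idx by blast
  qed
  moreover have "at_node G (lend (Seq \<nu> ?s ?f)) x" "at_node G (rend (Seq \<nu> ?s ?f)) y"
   using gP(2)[of 0] gP(3)[of k] wk(1,2) by auto
  moreover have "short (2 * Suc k) (Seq \<nu> ?s ?f)"
  proof -
   have sh: "short 2 (P i)" if "i <= k" for i using gpath_short gP(1,6) that by blast
   have pl: "plength (Seq \<nu> ?s ?f) = (\<Sum>i\<in>{0..<int (Suc k)}. plength (P (nat i)))" by simp
   have "count (plength (Seq \<nu> ?s ?f)) (expo (rpred \<nu>)) <= (\<Sum>i\<in>{0..<int (Suc k)}. 2)"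
    unfolding pl count_sum by (rule sum_mono) (use sh in \<open>auto simp: short_def\<close>)
   hence "count (plength (Seq \<nu> ?s ?f)) (expo (rpred \<nu>)) <= 2 * Suc k" by simp
   moreover have "e <= expo (rpred \<nu>)" if e: "e \<in># plength (Seq \<nu> ?s ?f)" for e
   proof -
    obtain i where "i \<in> {0..<int (Suc k)}" "e \<in># plength (P (nat i))" using e unfolding pl by (auto simp: set_mset_sum)
    thus ?thesis using sh[of "nat i"] unfolding short_def by (metis idx idx.simps(1))
   qed
   ultimately show ?thesis unfolding short_def by blast
  qed
  ultimately show ?thesis using g by blast
 qed
qed

end

section \<open>Removing a node\<close>

lemma gpath_Seq_iff:
 "gpath G (Seq \<mu> s f) \<longleftrightarrow> \<mu> ~= Elem & s ~= Two 0 &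
  (\<forall>i\<in>idx s. gpath G (f i) & prank (f i) < \<mu> & (prank (f i) = Elem --> \<mu> = Rk 0)) & tracing G s f & junction_ranks \<mu> s f"
 by (subst gpath.simps) auto

lemma inner_maxnode': "x \<in> inner G P ==> maxnode G x"
 by (induction P) (auto simp: at_node_def inner.simps(2))

lemma (in tfg) rend_branches: "gpath G P ==> pbranches (rend P) \<subseteq> pbranches P"
proof -
 assume g: "gpath G P"
 hence gp: "gpath G (prev P)" by simp
 have "pbranches (lend (prev P)) \<subseteq> pbranches (prev P)" using rt_tip_branches[OF gp rt_lend[OF gp]] by simp
 thus ?thesis by (cases "rend P") (auto simp: lend_prev)
qed

context metric_graph
begin

text \<open>Besides proper \<open>\<nu>\<close>-nodes this admits a dummy node without tips, whose
  removal changes nothing. Results on \<open>G - v\<close> then apply to \<open>G\<close>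
  itself.\<close>

definition removable :: "'a node => bool" where
 "removable v \<longleftrightarrow> nrank v = \<nu> & nexc v = None & (v \<in> nodes G \<or> ntips v = {})"

context
 fixes v :: "'a node"
 assumes v: "removable v"
begin

abbreviation (input) H where "H \<equiv> remove_node G v"

lemma branches_remove [simp]: "branches H = branches G" by (simp add: remove_node_def)

lemma nodes_remove: "nodes H = (nodes G - {v}) Un {Node \<nu> {t} None | t. t \<in> ntips v}"
 using v by (simp add: remove_node_def removable_def)

lemma remove_tip: assumes "t \<in> ntips v" shows "v \<in> NU" "t \<in> tips G (rpred \<nu>)"
proof -
 have "v \<in> nodes G" "nrank v = \<nu>" using assms v unfolding removable_def by auto
 thus "v \<in> NU" "t \<in> tips G (rpred \<nu>)" using NU_nodes node_valid(5) assms by auto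
qed

lemma maxnode_remove: "maxnode H x \<longleftrightarrow> maxnode G x & x ~= v \<or> (\<exists>t\<in>ntips v. x = Node \<nu> {t} None)"
proof
 assume m: "maxnode H x"
 show "maxnode G x & x ~= v \<or> (\<exists>t\<in>ntips v. x = Node \<nu> {t} None)"
 proof (cases "x \<in> nodes G - {v}")
  case True
  have "nexc y ~= Some x" if "y \<in> nodes G" for y
   using m that v unfolding maxnode_def nodes_remove removable_def by (cases "y = v") auto
  thus ?thesis using True unfolding maxnode_def by blast
 next
  case False thus ?thesis using m unfolding maxnode_def nodes_remove by blast
 qed
next
 assume "maxnode G x & x ~= v \<or> (\<exists>t\<in>ntips v. x = Node \<nu> {t} None)"
 thus "maxnode H x"
 proof
  assume "maxnode G x & x ~= v"
  thus ?thesis unfolding maxnode_def nodes_remove by auto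
 next
  assume "\<exists>t\<in>ntips v. x = Node \<nu> {t} None"
  then obtain t where t: "t \<in> ntips v" "x = Node \<nu> {t} None" by blast
  have "nexc y ~= Some x" if "y \<in> nodes G" for y
   using nexc_node[OF that, of x] node_valid(3)[OF that] t by auto
  thus ?thesis using t unfolding maxnode_def nodes_remove by auto
 qed
qed

lemma at_node_remove: "at_node H p x \<longleftrightarrow> at_node G p x & x ~= v \<or> (\<exists>t\<in>ntips v. p \<in> t & x = Node \<nu> {t} None)"
proof (cases "\<exists>t\<in>ntips v. x = Node \<nu> {t} None")
 case True
 then obtain t where t: "t \<in> ntips v" "x = Node \<nu> {t} None" by blast
 have "p \<in> t" if "at_node G p x" using that t(2) unfolding at_node_def by auto
 moreover have "p \<in> t ==> at_node H p x" using t maxnode_remove[of x] unfolding at_node_def by auto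
 moreover have "at_node H p x ==> p \<in> t" using t(2) unfolding at_node_def by auto
 ultimately show ?thesis using t by blast
next
 case False thus ?thesis using maxnode_remove[of x] unfolding at_node_def by blast
qed

lemma at_remove_low: "nrank x < \<nu> ==> at_node H p x \<longleftrightarrow> at_node G p x"
 unfolding at_node_remove using v unfolding removable_def by auto

lemma at_remove: assumes "prank p < rpred \<nu>" shows "at_node H p x \<longleftrightarrow> at_node G p x"
proof -
 have "prank p = rpred \<nu>" if "t \<in> ntips v" "p \<in> t" for t
  using tips_prank[OF remove_tip(2)[OF that(1)] that(2)] .
 moreover have "prank p = rpred \<nu>" if "at_node G p v" using top_tip[OF that] v unfolding removable_def by simp
 ultimately show ?thesis unfolding at_node_remove using assms by (metis less_irrefl)
qed

text \<open>The constituents of such a path have end tips of rank below \<open>\<nu> - 1\<close>,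
  and the removal affects only tips of rank \<open>\<nu> - 1\<close>.\<close>

lemma gpath_remove: "prank P < \<nu> ==> (gpath H P \<longleftrightarrow> gpath G P) & (gpath G P --> inner H P = inner G P)"
proof (induction "prank P" arbitrary: P rule: wf_induct_rule[OF rank_wf])
 case (1 P)
 show ?case
 proof (cases P)
  case (Br b s)
  have "gpath H (Br b s) \<longleftrightarrow> b \<in> branches H" by (rule gpath_Br)
  thus ?thesis using Br by simp
 next
  case (Seq \<mu> s f)
  have mu: "\<mu> < \<nu>" "\<mu> <= rpred \<nu>" using 1(2) less_imp_le_rpred[of \<mu> \<nu>] nu_valid(2) Seq by auto
  show ?thesis
  proof (cases "\<forall>i\<in>idx s. gpath G (f i) & prank (f i) < \<mu>")
   case True
   have IH: "gpath H (f i) = gpath G (f i)" "inner H (f i) = inner G (f i)" if "i \<in> idx s" for i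
    using 1(1)[of "f i"] True that Seq mu by auto
   have "prank (lend (f i)) < rpred \<nu>" "prank (rend (f i)) < rpred \<nu>" if "i \<in> idx s" for i
   proof -
    have gi: "gpath G (f i)" "prank (f i) < rpred \<nu>" using True that mu by auto
    show "prank (lend (f i)) < rpred \<nu>" "prank (rend (f i)) < rpred \<nu>"
     using lend_prank[OF gi(1)] rend_prank[OF gi(1)] gi(2) by auto
   qed
   hence e: "at_node H (lend (f i)) = at_node G (lend (f i))" "at_node H (rend (f i)) = at_node G (rend (f i))" if "i \<in> idx s" for i
    using at_remove that by blast+
   have "tracing H s f \<longleftrightarrow> tracing G s f" unfolding tracing_def by (simp add: e IH cong: ball_cong_simp)
   moreover have "inner H (Seq \<mu> s f) = inner G (Seq \<mu> s f)"
    unfolding inner.simps(2) by (simp add: e IH cong: conj_cong SUP_cong_simp)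
   ultimately show ?thesis unfolding Seq gpath_Seq_iff using IH by auto
  next
   case False
   then obtain i where i: "i \<in> idx s" "\<not> (gpath G (f i) & prank (f i) < \<mu>)" by blast
   have "\<not> (gpath H (f i) & prank (f i) < \<mu>)"
   proof (cases "prank (f i) < \<mu>")
    case True thus ?thesis using 1(1)[of "f i"] i mu Seq by auto
   qed simp
   thus ?thesis unfolding Seq gpath_Seq_iff using i by blast
  qed
 qed
qed

lemma inner_remove: "x \<in> inner G P ==> x ~= v ==> x \<in> inner H P"
 by (induction P) (auto simp: inner.simps(2) at_node_remove)

lemma meets_remove:
 assumes "gpath G P" "meets_branch G P b" shows "meets_branch H P b"
proof -
 obtain s x where x: "at_node G (Br b s) x" "x \<in> met G P" using meets_Br[OF assms(1)] assms(2) by blast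
 have "x ~= v" using Br_low[OF x(1)] v unfolding low_def removable_def by auto
 hence "x \<in> met H P" using x(2) inner_remove unfolding met_def left_terminal_def right_terminal_def
  by (auto simp: at_node_remove)
 moreover have "{Br b s} \<in> etips x"
 proof -
  obtain t where "t \<in> etips x" "Br b s \<in> t" "t \<in> tips G Elem" using at_nodeE[OF x(1)] by (metis prank.simps(1))
  thus ?thesis by (auto elim!: tipsE)
 qed
 ultimately show ?thesis unfolding meets_branch_def by blast
qed

lemma meets_removeD:
 assumes "meets_branch H P b" shows "EX s x. at_node G (Br b s) x & x \<in> met H P"
proof -
 obtain s x where x: "x \<in> met H P" "{Br b s} \<in> etips x" using assms unfolding meets_branch_def by blast
 have "maxnode H x" using x(1) inner_maxnode' unfolding met_def left_terminal_def right_terminal_def at_node_def by blast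
 hence "at_node H (Br b s) x" using x(2) unfolding at_node_def by blast
 thus ?thesis using at_remove[of "Br b s" x] rpred_nu(1) x(1) by auto
qed

text \<open>The constituents of a \<open>\<nu>\<close>-path each lie in one section, and consecutive
  ones are connected through the \<open>\<nu>\<close>-node between them, which is not
  \<open>v\<close>. As \<open>H\<close> is not known to be a graph in the full sense, the path is
  analysed with the facts about \<open>G\<close>.\<close>

lemma path_remove_conn:
 assumes P: "gpath H P" "two_ended P" "prank P <= \<nu>" and bc: "meets_branch H P b" "meets_branch H P c"
 shows "conn (NU - {v}) (sec b) (sec c)"
proof -
 obtain s x where x: "at_node G (Br b s) x" "x \<in> met H P" using meets_removeD[OF bc(1)] by blast
 obtain r y where y: "at_node G (Br c r) y" "y \<in> met H P" using meets_removeD[OF bc(2)] by blast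
 have lxy: "low x" "low y" using Br_low x(1) y(1) by blast+
 have ends: "at_node H p z \<longleftrightarrow> at_node G p z" if "low z" for p z using at_remove_low that unfolding low_def by blast
 obtain \<mu> n f where Pf: "P = Seq \<mu> (Two n) f" using P(2) unfolding two_ended_def by blast
 show ?thesis
 proof (cases "prank P < \<nu>")
  case True
  hence g: "gpath G P" "inner H P = inner G P" using gpath_remove P(1) by blast+
  have met: "z \<in> met G P" if "z \<in> met H P" "low z" for z
   using that g(2) ends[OF that(2)] unfolding met_def left_terminal_def right_terminal_def by auto
  have "meets_branch G P b" "meets_branch G P c" using meets_Br[OF g(1)] x y met lxy by blast+
  hence "c \<in> sec b" using met_sec[OF g(1) True] by blast
  thus ?thesis using sec_eq by simp
 next
  case False
  hence mu: "\<mu> = \<nu>" using P(3) Pf by simp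
  have g': "n ~= 0" "!!i. i \<in> {0..<int n} ==> gpath H (f i) & prank (f i) < \<nu>" "tracing H (Two n) f" "junction_ranks \<nu> (Two n) f"
   using P(1) unfolding Pf gpath_Seq_iff mu by auto
  have g: "gpath G (f i)" "prank (f i) < \<nu>" "inner H (f i) = inner G (f i)" if "i \<in> {0..<int n}" for i
   using g'(2)[OF that] gpath_remove by blast+
  hence "\<exists>S\<in>secs. pbranches (f i) \<subseteq> S" if "i \<in> {0..<int n}" for i using path_secs that by blast
  then obtain \<Sigma> where S: "!!i. i \<in> {0..<int n} ==> \<Sigma> i \<in> secs & pbranches (f i) \<subseteq> \<Sigma> i" by metis
  have place: "\<exists>i\<in>{0..<int n}. sec d = \<Sigma> i" if z: "at_node G (Br d t) z" "z \<in> met H P" for d t z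
  proof -
   have l: "low z" using Br_low z(1) by blast
   have "\<exists>i\<in>{0..<int n}. z \<in> inner G (f i) \<or> at_node G (lend (f i)) z \<or> at_node G (rend (f i)) z"
   proof -
    have P': "lend P = lend (f 0)" "rend P = rend (f (int n - 1))" using Pf by auto
    have 0: "0 \<in> {0..<int n}" "int n - 1 \<in> {0..<int n}" using g'(1) by auto
    consider "z \<in> inner H P" | "at_node G (lend (f 0)) z" | "at_node G (rend (f (int n - 1))) z"
     using z(2) ends[OF l] unfolding met_def left_terminal_def right_terminal_def P' by blast
    thus ?thesis
    proof cases
     case 1
     then consider i where "i \<in> {0..<int n}" "z \<in> inner H (f i)" | i where "i \<in> {0..<int n}" "at_node H (lend (f i)) z"
      unfolding Pf inner.simps(2) by auto
     thus ?thesis using g(3) ends[OF l] by cases blast+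
    qed (use 0 in blast)+
   qed
   then obtain i where i: "i \<in> {0..<int n}" "z \<in> inner G (f i) \<or> at_node G (lend (f i)) z \<or> at_node G (rend (f i)) z" by blast
   have Si: "pbranches (f i) \<subseteq> \<Sigma> i" using S[OF i(1)] by simp
   have "touch z (\<Sigma> i)" using i(2) inner_touch[OF g(1)[OF i(1)] _ Si] end_touch[OF g(1)[OF i(1)] _ Si] end_touch'[OF g(1)[OF i(1)] _ Si]
    by (elim disjE)
   moreover have db: "d \<in> branches G" using at_node_path[OF z(1)] by simp
   hence "touch z (sec d)" unfolding touch_def using z(1) sec_refl[OF db] by (intro exI[of _ "Br d t"]) simp
   ultimately have "sec d = \<Sigma> i" using low_touch_unique[OF l] S[OF i(1)] db unfolding secs_def by blast
   thus ?thesis using i(1) by blast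
  qed
  have junc: "conn (NU - {v}) (\<Sigma> (i - 1)) (\<Sigma> i)" if i: "i - 1 \<in> {0..<int n}" "i \<in> {0..<int n}" for i
  proof -
   have "EX u. at_node H (rend (f (i - 1))) u & at_node H (lend (f i)) u"
    using g'(3) i unfolding tracing_def by (metis diff_add_cancel idx.simps(1))
   then obtain u where u: "at_node H (rend (f (i - 1))) u" "at_node H (lend (f i)) u" by blast
   show ?thesis
   proof (cases "\<exists>t\<in>ntips v. u = Node \<nu> {t} None")
    case True
    \<comment> \<open>At a replacing singleton node the path would arrive and leave through the same
      tip; both constituents then share branches and so lie in one section.\<close>
    then obtain t where t: "t \<in> ntips v" "u = Node \<nu> {t} None" by blast
    hence "rend (f (i - 1)) \<in> t" "lend (f i) \<in> t" using u unfolding at_node_def by auto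
    hence "pbranches (rend (f (i - 1))) Int pbranches (lend (f i)) ~= {}"
     using same_tip_overlap tip_same remove_tip(2)[OF t(1)] tips_gpath by blast
    moreover have "pbranches (rend (f (i - 1))) \<subseteq> \<Sigma> (i - 1)" using rend_branches[OF g(1)[OF i(1)]] S[OF i(1)] by blast
    moreover have "pbranches (lend (f i)) \<subseteq> \<Sigma> i" using rt_tip_branches[OF g(1)[OF i(2)] rt_lend[OF g(1)[OF i(2)]]] S[OF i(2)] by blast
    ultimately have "\<Sigma> (i - 1) = \<Sigma> i" using secs_disjoint[of "\<Sigma> (i - 1)" "\<Sigma> i"] S i by blast
    thus ?thesis by simp
   next
    case False
    hence uG: "at_node G (rend (f (i - 1))) u" "at_node G (lend (f i)) u" "u ~= v" using u unfolding at_node_remove by blast+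
    have "jrank f i = rpred \<nu>" using g'(4) i nu_valid(2) unfolding junction_ranks_def junctions_def by auto
    hence "prank (rend (f (i - 1))) = rpred \<nu> \<or> prank (lend (f i)) = rpred \<nu>" unfolding jrank_def by (metis max_def)
    hence "nrank u = \<nu>" using tip_top uG by blast
    hence "u \<in> NU - {v}" using uG at_node_maxnode unfolding NU_def by blast
    moreover have "touch u (\<Sigma> (i - 1))" using end_touch'[OF g(1)[OF i(1)] uG(1)] S[OF i(1)] by simp
    moreover have "touch u (\<Sigma> i)" using end_touch[OF g(1)[OF i(2)] uG(2)] S[OF i(2)] by simp
    ultimately show ?thesis using conn_step[of "\<Sigma> (i - 1)" "\<Sigma> i" u "NU - {v}"] S[OF i(1)] S[OF i(2)] by simp
   qed
  qed
  have c0: "conn (NU - {v}) (\<Sigma> 0) (\<Sigma> (int i))" if "i < n" for i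
   using that
  proof (induction i)
   case (Suc i)
   hence "conn (NU - {v}) (\<Sigma> (int (Suc i) - 1)) (\<Sigma> (int (Suc i)))" by (intro junc) auto
   thus ?case using Suc conn_trans by simp
  qed simp
  obtain i where i: "i \<in> {0..<int n}" "sec b = \<Sigma> i" using place[OF x] by blast
  obtain j where j: "j \<in> {0..<int n}" "sec c = \<Sigma> j" using place[OF y] by blast
  have "conn (NU - {v}) (\<Sigma> 0) (\<Sigma> i)" "conn (NU - {v}) (\<Sigma> 0) (\<Sigma> j)" using c0[of "nat i"] c0[of "nat j"] i j by auto
  thus ?thesis using i j conn_trans conn_sym by metis
 qed
qed

text \<open>The terminal nodes are low and the inner \<open>\<nu>\<close>-nodes differ from
  \<open>v\<close>, so the path does not meet \<open>v\<close> and its nodes are unchanged.\<close>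

lemma path_remove:
 assumes g: "gpath G (Seq \<mu> (Two n) f)" and mu: "\<mu> <= \<nu>" and inn: "inner G (Seq \<mu> (Two n) f) Int NU \<subseteq> NU - {v}"
  and x: "at_node G (lend (Seq \<mu> (Two n) f)) x" "low x" and y: "at_node G (rend (Seq \<mu> (Two n) f)) y" "low y"
 shows "gpath H (Seq \<mu> (Two n) f)"
proof (cases "\<mu> < \<nu>")
 case True thus ?thesis using gpath_remove[of "Seq \<mu> (Two n) f"] g by simp
next
 case False
 hence mu: "\<mu> = \<nu>" using mu by simp
 note gg = gpath_SeqD[OF g]
 let ?s = "Two n"
 have f: "gpath H (f i)" "inner H (f i) = inner G (f i)" if "i \<in> idx ?s" for i
  using gpath_remove[of "f i"] gg(3,4)[OF that] mu by auto
 obtain z where z: "\<forall>i\<in>idx ?s. at_node G (lend (f i)) (z i) & at_node G (rend (f i)) (z (i + 1))"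
   "inj_on z (idx ?s Un (%i. i + 1) ` idx ?s)"
   "\<forall>i\<in>idx ?s Un (%i. i + 1) ` idx ?s. \<forall>j\<in>idx ?s. z i ~: inner G (f j)"
   "\<forall>i\<in>idx ?s. \<forall>j\<in>idx ?s. i ~= j --> inner G (f i) Int inner G (f j) = {}"
  using gg(6) by (auto simp: tracing_def)
 have nv: "w ~= v" if "low w" for w using that v unfolding low_def removable_def by auto
 have iv: "w ~= v" if "w \<in> inner G (Seq \<mu> ?s f)" for w
  using that inn inner_maxnode' v unfolding removable_def NU_def by blast
 have zl: "z i ~= v" if i: "i \<in> idx ?s" for i
 proof (cases "i - 1 \<in> idx ?s")
  case True
  hence "z i \<in> inner G (Seq \<mu> ?s f)" using i z(1) unfolding inner.simps(2) by blast
  thus ?thesis using iv by blast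
 next
  case False
  hence "z i = x" using lend_Seq[OF i, of \<mu> f] x(1) z(1) i at_node_inject by metis
  thus ?thesis using nv x(2) by blast
 qed
 have zr: "z (i + 1) ~= v" if i: "i \<in> idx ?s" for i
 proof (cases "i + 1 \<in> idx ?s")
  case True thus ?thesis using zl by blast
 next
  case False
  hence "z (i + 1) = y" using rend_Seq[OF i, of \<mu> f] y(1) z(1) i at_node_inject by metis
  thus ?thesis using nv y(2) by blast
 qed
 have "tracing H ?s f" unfolding tracing_def
  by (intro exI[of _ z]) (use z zl zr f(2) in \<open>simp add: at_node_remove\<close>)
 thus ?thesis unfolding gpath_Seq_iff using gg f(1) by blast
qed

lemma conn_remove_path:
 assumes c: "conn (NU - {v}) S T" and S: "S \<in> secs" "b \<in> S" and T: "c \<in> T"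
 shows "EX P. gpath H P & two_ended P & prank P <= \<nu> & pbranches P \<subseteq> branches G & meets_branch H P b & meets_branch H P c"
proof -
 have Ts: "T \<in> secs" using conn_secs[OF c S(1)] .
 have bB: "b \<in> branches G" "c \<in> branches G" using secs_sub S Ts T by blast+
 obtain x y where x: "at_node G (Br b True) x" and y: "at_node G (Br c True) y" using Br_node bB by blast
 have lxy: "low x" "low y" using Br_low x y by blast+
 have txy: "touch x S" "touch y T" unfolding touch_def using x y S(2) T by (metis empty_subsetI insert_subset pbranches.simps(1))+
 show ?thesis
 proof (cases "x = y")
  case True
  hence "S = T" using low_touch_unique[OF lxy(1) txy(1)] txy(2) S Ts by simp
  then obtain P where P: "gpath G P" "two_ended P" "prank P <= rpred \<nu>" "pbranches P \<subseteq> S" "meets_branch G P b" "meets_branch G P c"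
   using sec_connected[OF S] T by blast
  have "prank P < \<nu>" using P(3) rpred_nu(2) by simp
  moreover have "gpath H P" using gpath_remove calculation P(1) by blast
  ultimately show ?thesis using P meets_remove[OF P(1)] secs_sub[OF S(1)] by (meson order_less_imp_le subset_trans)
 next
  case False
  obtain k0 w0 \<Sigma>0 where w0: "walk (NU - {v}) x y k0 w0 \<Sigma>0" using conn_walk[OF c S(1) txy] by blast
  obtain k w \<Sigma> where w: "mwalk (NU - {v}) x y k w \<Sigma>" using walk_minimal[OF w0 False] by blast
  obtain \<mu> n f where P: "gpath G (Seq \<mu> (Two n) f)" "\<mu> <= \<nu>" "at_node G (lend (Seq \<mu> (Two n) f)) x" "at_node G (rend (Seq \<mu> (Two n) f)) y"
   "inner G (Seq \<mu> (Two n) f) Int NU \<subseteq> NU - {v}"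
   using walk_path[OF w _ _ _ False] lxy unfolding low_def by blast
  have "gpath H (Seq \<mu> (Two n) f)" using path_remove[OF P(1,2,5,3) lxy(1) P(4) lxy(2)] .
  moreover have "meets_branch H (Seq \<mu> (Two n) f) b" "meets_branch H (Seq \<mu> (Two n) f) c"
   using meets_remove[OF P(1)] meets_Br[OF P(1)] terminal_met P(3,4) x y by blast+
  moreover have "two_ended (Seq \<mu> (Two n) f)" unfolding two_ended_def by blast
  moreover have "pbranches (Seq \<mu> (Two n) f) \<subseteq> branches G" using pbranches_branches[OF P(1)] .
  moreover have "prank (Seq \<mu> (Two n) f) <= \<nu>" using P(2) by simp
  ultimately show ?thesis by blast
 qed
qed

lemma component_remove:
 assumes S: "S \<in> secs" shows "component H \<nu> (branches G) (\<Union>{T. conn (NU - {v}) S T})"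
 unfolding component_def connected_within_def
proof (intro conjI allI impI ballI)
 let ?C = "\<Union>{T. conn (NU - {v}) S T}"
 show "?C \<subseteq> branches G" using conn_secs[OF _ S] secs_sub by blast
 fix b c assume "b \<in> ?C" "c \<in> ?C"
 then obtain T U where T: "conn (NU - {v}) S T" "b \<in> T" "conn (NU - {v}) S U" "c \<in> U" by blast
 hence "conn (NU - {v}) T U" using conn_sym conn_trans by blast
 thus "EX P. gpath H P & two_ended P & prank P <= \<nu> & pbranches P \<subseteq> branches G & meets_branch H P b & meets_branch H P c"
  using conn_remove_path conn_secs[OF T(1) S] T(2,4) by blast
next
 let ?C = "\<Union>{T. conn (NU - {v}) S T}"
 fix D assume D: "?C \<subseteq> D & D \<subseteq> branches G & (\<forall>b\<in>D. \<forall>c\<in>D. EX P. gpath H P & two_ended P & prank P <= \<nu> &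
   pbranches P \<subseteq> branches G & meets_branch H P b & meets_branch H P c)"
 obtain b where b: "b \<in> S" using secs_nonempty[OF S] by blast
 have bD: "b \<in> D" using D b conn_refl by blast
 have "d \<in> ?C" if d: "d \<in> D" for d
 proof -
  obtain P where "gpath H P" "two_ended P" "prank P <= \<nu>" "meets_branch H P b" "meets_branch H P d" using D bD d by meson
  hence "conn (NU - {v}) (sec b) (sec d)" using path_remove_conn by blast
  hence "conn (NU - {v}) S (sec d)" using secs_sec[OF S b] by simp
  thus ?thesis using sec_refl D d by blast
 qed
 thus "D = ?C" using D by blast
qed

end

lemma removable_NU: "v \<in> nodes G ==> nrank v = \<nu> ==> removable v"
 using pristine unfolding removable_def pristine_def by blast

lemma conn_all:
 assumes con: "nu_connected \<nu> G" and ST: "S \<in> secs" "T \<in> secs" shows "conn NU S T"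
proof -
 \<comment> \<open>The dummy node: no node of \<open>G\<close> has an empty set of tips, so removing
   it leaves \<open>G\<close> and \<open>NU\<close> unchanged.\<close>
 let ?v = "Node \<nu> {} None"
 have v: "removable ?v" unfolding removable_def by simp
 have nv: "?v ~: nodes G" using node_valid(4) by fastforce
 hence H: "remove_node G ?v = G" and W: "NU - {?v} = NU"
  unfolding remove_node_def NU_def maxnode_def by auto
 obtain b c where bc: "b \<in> S" "c \<in> T" using secs_nonempty ST by blast
 then obtain P where "gpath G P" "two_ended P" "prank P <= \<nu>" "meets_branch G P b" "meets_branch G P c"
  using con secs_sub ST unfolding nu_connected_def connected_within_def by (meson subsetD)
 hence "conn (NU - {?v}) (sec b) (sec c)" using path_remove_conn[OF v] unfolding H by blast
 thus ?thesis unfolding W using secs_sec ST bc by metis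
qed

end

section \<open>Distances and the center\<close>

lemma plength_prev: "plength (prev P) = plength P"
proof (induction P)
 case (Seq \<mu> s f)
 show ?case
 proof (cases s)
  case (Two n)
  have "(\<Sum>i\<in>{0..<int n}. plength (prev (f (int n - 1 - i)))) = (\<Sum>i\<in>{0..<int n}. plength (f i))"
   by (rule sum.reindex_bij_witness[of _ "%i. int n - 1 - i" "%i. int n - 1 - i"]) (auto simp: Seq)
  thus ?thesis using Two by (simp add: prev.simps)
 qed (simp_all add: prev.simps)
qed simp

lemma replicate_mset_less: "replicate_mset k e < replicate_mset m e ==> k < m"
proof (rule ccontr)
 assume *: "replicate_mset k e < replicate_mset m e" "\<not> k < m"
 hence "replicate_mset m e \<subseteq># replicate_mset k e" by (auto simp: subseteq_mset_def)
 thus False using subset_eq_imp_le_multiset *(1) leD by blast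
qed

lemma sum_replicate_mset:
 assumes "finite A" "A ~= {}" "!!i. i \<in> A ==> \<exists>k\<ge>1. g i = replicate_mset k e"
 shows "\<exists>k\<ge>1. sum g A = replicate_mset k e"
 using assms
proof (induction rule: finite_ne_induct)
 case (insert a A)
 then obtain k l where "1 <= k" "g a = replicate_mset k e" "sum g A = replicate_mset l e" by (metis insert_iff)
 thus ?case using insert by (intro exI[of _ "k + l"]) (simp add: multiset_eq_iff)
qed simp

section \<open>Lengths of paths and distances at \<nu>-nodes\<close>

locale center_graph = metric_graph +
 assumes con: "nu_connected \<nu> G" and fin: "finite {x. boundary_node \<nu> G x}"
begin

definition path_between :: "'a node => 'a node => 'a tpath => bool" where
 "path_between x y P \<longleftrightarrow> gpath G P & two_ended P & prank P <= \<nu> & terminates G P x y"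

lemma path_between_I:
 assumes "gpath G (Seq \<mu> (Two n) f)" "\<mu> <= \<nu>" "at_node G (lend (Seq \<mu> (Two n) f)) x" "at_node G (rend (Seq \<mu> (Two n) f)) y"
 shows "path_between x y (Seq \<mu> (Two n) f)"
 using assms unfolding path_between_def two_ended_def terminates_def left_terminal_def right_terminal_def
 by (simp del: lend.simps rend.simps)

lemma path_between_D:
 assumes "path_between x y P"
 shows "EX \<mu> n f. gpath G (Seq \<mu> (Two n) f) & \<mu> <= \<nu> & at_node G (lend (Seq \<mu> (Two n) f)) x &
  at_node G (rend (Seq \<mu> (Two n) f)) y & plength (Seq \<mu> (Two n) f) = plength P"
proof -
 obtain \<mu> n f where P: "P = Seq \<mu> (Two n) f" using assms unfolding path_between_def two_ended_def by blast
 have g: "gpath G P" "\<mu> <= \<nu>" using assms P unfolding path_between_def by auto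
 show ?thesis
 proof (cases "left_terminal G P x & right_terminal G P y")
  case True thus ?thesis using g P unfolding left_terminal_def right_terminal_def by blast
 next
  case False
  hence "at_node G (lend P) y" "at_node G (rend P) x"
   using assms unfolding path_between_def terminates_def left_terminal_def right_terminal_def by blast+
  hence "at_node G (lend (prev P)) x" "at_node G (rend (prev P)) y" using at_node_trev_iff[OF g(1)] by (simp_all add: lend_prev rend_prev)
  moreover have "EX h. prev P = Seq \<mu> (Two n) h" using P by (simp add: prev.simps)
  ultimately show ?thesis using g plength_prev[of P] gpath_prev[of P] by metis
 qed
qed

text \<open>A minimal walk has at most as many inner nodes as there are boundary nodes, hence at
  most one more arc, and each arc contributes \<omega>^\<nu> at most twice.\<close>

abbreviation N where "N \<equiv> 2 * Suc (card {x. boundary_node \<nu> G x})"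

lemma OK_maxnode: "x \<in> OK ==> maxnode G x" unfolding OK_def by blast

lemma minimal_walk:
 assumes "S \<in> secs" "T \<in> secs" "touch x S" "touch y T" "x ~= y" shows "EX k w \<Sigma>. mwalk NU x y k w \<Sigma>"
 using conn_walk[OF conn_all[OF con assms(1,2)] assms(1,3,4)] walk_minimal assms(5) by blast

lemma path_exists:
 assumes xy: "x \<in> OK" "y \<in> OK" "x ~= y" shows "EX P. path_between x y P & short N P"
proof -
 obtain S where S: "S \<in> secs" "touch x S" using touch_exists[OF OK_maxnode[OF xy(1)]] by blast
 obtain T where T: "T \<in> secs" "touch y T" using touch_exists[OF OK_maxnode[OF xy(2)]] by blast
 obtain k w \<Sigma> where w: "mwalk NU x y k w \<Sigma>" using minimal_walk[OF S(1) T(1) S(2) T(2) xy(3)] by (elim exE)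
 obtain \<mu> n f where P: "gpath G (Seq \<mu> (Two n) f)" "\<mu> <= \<nu>" "at_node G (lend (Seq \<mu> (Two n) f)) x" "at_node G (rend (Seq \<mu> (Two n) f)) y"
  "short (2 * Suc k) (Seq \<mu> (Two n) f)" using walk_path[OF w _ xy] by blast
 have "k <= card {x. boundary_node \<nu> G x}" using mwalk_bound[OF w _ fin] by simp
 hence "short N (Seq \<mu> (Two n) f)" using P(5) unfolding short_def by auto
 thus ?thesis using path_between_I[OF P(1-4)] by blast
qed

lemma ndist_alt: "x ~= y ==> ndist \<nu> G x y = (LEAST l. EX P. path_between x y P & l = plength P)"
 by (simp add: ndist_def path_between_def conj_assoc)

lemma ndist_attained:
 assumes xy: "x \<in> OK" "y \<in> OK" "x ~= y" shows "EX P. path_between x y P & ndist \<nu> G x y = plength P"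
proof -
 obtain P where "path_between x y P" using path_exists[OF xy] by blast
 hence ex: "EX P'. path_between x y P' & plength P = plength P'" by blast
 show ?thesis unfolding ndist_alt[OF xy(3)]
  by (rule LeastI[where P = "%l. EX P. path_between x y P & l = plength P", OF ex])
qed

lemma ndist_le: "x ~= y ==> path_between x y P ==> ndist \<nu> G x y <= plength P"
 unfolding ndist_alt by (rule Least_le) blast

lemma ndist_bound:
 assumes "x \<in> OK" "y \<in> OK" shows "ndist \<nu> G x y < replicate_mset (Suc N) (expo (rpred \<nu>))"
proof (cases "x = y")
 case True
 hence "ndist \<nu> G x y = {#}" by (simp add: ndist_def)
 moreover have "{#} \<subset># replicate_mset (Suc N) (expo (rpred \<nu>))" by (simp add: subset_mset.less_le)
 ultimately show ?thesis using subset_imp_less_mset by metis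
next
 case False
 thus ?thesis using path_exists[OF assms False] ndist_le short_less by (meson le_less_trans)
qed

text \<open>\<open>ecc\<close> is a \<open>LEAST\<close>, which is informative only if some upper
  bound exists; \<open>ndist_bound\<close> supplies one.\<close>

lemma ecc_ge: assumes "x \<in> OK" "y \<in> M" shows "ndist \<nu> G x y <= ecc \<nu> G M x"
proof -
 have "\<forall>y\<in>M. ndist \<nu> G x y <= replicate_mset (Suc N) (expo (rpred \<nu>))"
  using ndist_bound[OF assms(1)] M_OK by (meson less_imp_le subsetD)
 hence "\<forall>y\<in>M. ndist \<nu> G x y <= ecc \<nu> G M x" unfolding ecc_def
  by (rule LeastI[where P = "%u. \<forall>y\<in>M. ndist \<nu> G x y <= u"])
 thus ?thesis using assms(2) by blast
qed

lemma ecc_le: "\<forall>y\<in>M. ndist \<nu> G x y <= u ==> ecc \<nu> G M x <= u"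
 unfolding ecc_def by (rule Least_le)

text \<open>A path of rank below \<open>\<nu>\<close> with a \<open>(\<nu> - 1)\<close>-tip on its
  left is itself one-ended or endless of rank \<open>\<nu> - 1\<close>, so its length is
  \<omega>^\<nu> or twice that.\<close>

lemma length_top:
 assumes g: "gpath G P" "prank P < \<nu>" and top: "prank (lend P) = rpred \<nu>"
 shows "\<exists>k\<ge>1. plength P = replicate_mset k (expo (rpred \<nu>))"
proof (cases P)
 case (Br b s) thus ?thesis using top rpred_nu(1) by simp
next
 case (Seq \<mu> s f)
 have le: "\<mu> <= rpred \<nu>" using less_imp_le_rpred[OF g(2) nu_valid(2)] Seq by simp
 have "s = In \<or> s = Endless"
 proof (rule ccontr)
  assume s: "\<not> (s = In \<or> s = Endless)"
  hence 0: "0 \<in> idx s" "- 1 ~: idx s" using first_idx[of s] gpath_SeqD(2) g(1) Seq by auto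
  hence "lend P = lend (f 0)" using lend_Seq[of 0 s \<mu> f] Seq by simp
  moreover have "prank (lend (f 0)) < \<mu>"
   using lend_prank[of G "f 0"] gpath_SeqD(3,4)[OF g(1)[unfolded Seq] 0(1)] by simp
  ultimately show False using top le by simp
 qed
 hence "\<mu> = rpred \<nu>" using top Seq by auto
 thus ?thesis using Seq \<open>s = In \<or> s = Endless\<close> by (auto intro: exI[of _ 1] exI[of _ 2] simp: numeral_2_eq_2)
qed

lemma junction_node:
 assumes g: "gpath G (Seq \<nu> (Two n) f)" and i: "i - 1 \<in> {0..<int n}" "i \<in> {0..<int n}"
 shows "\<exists>u\<in>NU. at_node G (rend (f (i - 1))) u & at_node G (lend (f i)) u"
proof -
 obtain u where u: "at_node G (rend (f (i - 1))) u" "at_node G (lend (f i)) u" using tracing_junction[OF g] i by auto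
 have "jrank f i = rpred \<nu>" using gpath_SeqD(7)[OF g] i nu_valid(2) unfolding junction_ranks_def junctions_def by auto
 hence "prank (rend (f (i - 1))) = rpred \<nu> \<or> prank (lend (f i)) = rpred \<nu>" unfolding jrank_def by (metis max_def)
 hence "nrank u = \<nu>" using tip_top u by blast
 thus ?thesis using u at_node_maxnode unfolding NU_def by blast
qed

lemma NU_top: "u \<in> NU ==> at_node G p u ==> prank p = rpred \<nu>"
 using top_tip unfolding NU_def by blast

text \<open>The path has rank \<open>\<nu>\<close>, because smaller ranks cannot start at
  \<open>v\<close>. Every constituent then starts at a \<open>\<nu>\<close>-node, so
  \<open>length_top\<close> applies to each.\<close>

lemma length_NU:
 assumes v: "v \<in> NU" and P: "gpath G (Seq \<mu> (Two n) f)" "\<mu> <= \<nu>" "at_node G (lend (Seq \<mu> (Two n) f)) v"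
 shows "\<exists>k\<ge>1. plength (Seq \<mu> (Two n) f) = replicate_mset k (expo (rpred \<nu>))"
proof -
 have n: "0 \<in> {0..<int n}" using gpath_SeqD(2)[OF P(1)] by auto
 have l: "prank (lend (f 0)) = rpred \<nu>" using NU_top[OF v P(3)] by simp
 have f0: "gpath G (f 0)" "prank (f 0) < \<mu>" using gpath_SeqD(3,4)[OF P(1)] n by auto
 have "\<mu> = \<nu>"
 proof (rule ccontr)
  assume "\<mu> ~= \<nu>"
  hence "\<mu> <= rpred \<nu>" using less_imp_le_rpred[of \<mu> \<nu>] P(2) nu_valid(2) by simp
  thus False using l lend_prank[OF f0(1)] f0(2) by simp
 qed
 note g = P(1)[unfolded this]
 have "\<exists>k\<ge>1. plength (f i) = replicate_mset k (expo (rpred \<nu>))" if i: "i \<in> {0..<int n}" for i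
 proof -
  have "prank (lend (f i)) = rpred \<nu>"
  proof (cases "i = 0")
   case False
   hence "i - 1 \<in> {0..<int n}" using i by auto
   thus ?thesis using junction_node[OF g _ i] NU_top by blast
  qed (use l in simp)
  thus ?thesis using length_top gpath_SeqD(3,4)[OF g] i by simp
 qed
 thus ?thesis using sum_replicate_mset[of "{0..<int n}" "%i. plength (f i)"] n by auto
qed

lemma ndist_NU:
 assumes "v \<in> NU" "v \<in> OK" "y \<in> OK" "v ~= y" shows "\<exists>k\<ge>1. ndist \<nu> G v y = replicate_mset k (expo (rpred \<nu>))"
proof -
 obtain P where P: "path_between v y P" "ndist \<nu> G v y = plength P" using ndist_attained assms by blast
 show ?thesis using path_between_D[OF P(1)] length_NU[OF assms(1)] P(2) by metis
qed

lemma farthest: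
 assumes v: "v \<in> NU" "v \<in> M" shows "\<exists>y\<in>M. \<forall>z\<in>M. ndist \<nu> G v z <= ndist \<nu> G v y"
proof -
 let ?D = "ndist \<nu> G v ` M"
 have "?D \<subseteq> (%k. replicate_mset k (expo (rpred \<nu>))) ` {..<Suc N}"
 proof
  fix d assume "d \<in> ?D"
  then obtain z where z: "z \<in> M" "d = ndist \<nu> G v z" by blast
  have "EX k. d = replicate_mset k (expo (rpred \<nu>))"
  proof (cases "z = v")
   case True thus ?thesis using z by (intro exI[of _ 0]) (simp add: ndist_def)
  next
   case False thus ?thesis using ndist_NU[of v z] v z M_OK by blast
  qed
  then obtain k where k: "d = replicate_mset k (expo (rpred \<nu>))" by blast
  have "d < replicate_mset (Suc N) (expo (rpred \<nu>))" using ndist_bound[of v z] v z M_OK by blast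
  hence "k < Suc N" using k replicate_mset_less by metis
  thus "d \<in> (%k. replicate_mset k (expo (rpred \<nu>))) ` {..<Suc N}" using k by blast
 qed
 hence f: "finite ?D" using finite_surj[of "{..<Suc N}"] by blast
 have ne: "?D ~= {}" using v by blast
 obtain y where y: "y \<in> M" "Max ?D = ndist \<nu> G v y" using Max_in[OF f ne] by blast
 have "ndist \<nu> G v z <= ndist \<nu> G v y" if "z \<in> M" for z using Max_ge[OF f, of "ndist \<nu> G v z"] that y(2) by simp
 thus ?thesis using y(1) by blast
qed

lemma gpath_split:
 assumes g: "gpath G (Seq \<nu> (Two n) f)" and i: "i < n"
 shows "gpath G (Seq \<nu> (Two (n - i)) (%j. f (j + int i)))"
proof -
 note gg = gpath_SeqD[OF g]
 let ?f = "%j. f (j + int i)" and ?s = "Two (n - i)"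
 have id: "j + int i \<in> idx (Two n)" if "j \<in> idx ?s" for j using that i by auto
 obtain z where z: "\<forall>i\<in>idx (Two n). at_node G (lend (f i)) (z i) & at_node G (rend (f i)) (z (i + 1))"
   "inj_on z (idx (Two n) Un (%i. i + 1) ` idx (Two n))"
   "\<forall>i\<in>idx (Two n) Un (%i. i + 1) ` idx (Two n). \<forall>j\<in>idx (Two n). z i ~: inner G (f j)"
   "\<forall>i\<in>idx (Two n). \<forall>j\<in>idx (Two n). i ~= j --> inner G (f i) Int inner G (f j) = {}"
  using gg(6) by (auto simp: tracing_def)
 have id': "j + int i \<in> idx (Two n) Un (%i. i + 1) ` idx (Two n)" if j: "j \<in> idx ?s Un (%i. i + 1) ` idx ?s" for j
 proof -
  have "j \<in> idx ?s \<or> j - 1 \<in> idx ?s" using j by force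
  hence "j + int i \<in> idx (Two n) \<or> j + int i - 1 \<in> idx (Two n)" using id[of j] id[of "j - 1"] by (auto simp: algebra_simps)
  thus ?thesis by (auto simp: image_iff intro: bexI[of _ "j + int i - 1"])
 qed
 have "tracing G ?s ?f" unfolding tracing_def
 proof (intro exI[of _ "%j. z (j + int i)"] conjI ballI impI)
  fix j assume "j \<in> idx ?s"
  thus "at_node G (lend (?f j)) (z (j + int i))" "at_node G (rend (?f j)) (z (j + 1 + int i))"
   using z(1) id by (auto simp: algebra_simps simp del: idx.simps)
 next
  show "inj_on (%j. z (j + int i)) (idx ?s Un (%i. i + 1) ` idx ?s)"
   by (rule inj_onI) (use z(2) id' in \<open>auto dest!: inj_onD simp del: idx.simps\<close>)
 next
  fix j l assume "j \<in> idx ?s Un (%i. i + 1) ` idx ?s" "l \<in> idx ?s"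
  thus "z (j + int i) ~: inner G (?f l)" using z(3) id id' by blast
 next
  fix j l assume "j \<in> idx ?s" "l \<in> idx ?s" "j ~= l"
  thus "inner G (?f j) Int inner G (?f l) = {}" using z(4) id by (metis add_right_cancel)
 qed
 moreover have "junction_ranks \<nu> ?s ?f"
 proof -
  have "jrank ?f j = rpred \<nu>" if "j \<in> junctions ?s" for j
  proof -
   have "j + int i \<in> junctions (Two n)" using that i unfolding junctions_def by auto
   hence "jrank f (j + int i) = rpred \<nu>" using gg(7) nu_valid(2) unfolding junction_ranks_def by simp
   thus ?thesis unfolding jrank_def by (simp add: algebra_simps)
  qed
  thus ?thesis using nu_valid(2) unfolding junction_ranks_def by simp
 qed
 moreover have "gpath G (?f j) & prank (?f j) < \<nu> & (prank (?f j) = Elem --> \<nu> = Rk 0)" if "j \<in> idx ?s" for j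
  using gg(3-5)[OF id[OF that]] by blast
 ultimately show ?thesis using gg(1) i unfolding gpath_Seq_iff by (simp del: idx.simps)
qed

text \<open>A shortest path from \<open>c\<close> to \<open>y\<close> must pass \<open>v\<close> at
  a junction. Its part from \<open>v\<close> on competes for the distance from \<open>v\<close>, and
  the constituent arriving at \<open>v\<close> alone has length at least \<omega>^\<nu>, whence
  strictness.\<close>

lemma separated_dist:
 assumes v: "v \<in> NU" "v \<in> OK" and c: "c \<in> OK" "c ~= v" "touch c S" "S \<in> secs" and y: "y \<in> OK" "y ~= v" "touch y T" "T \<in> secs"
  and nc: "\<not> conn (NU - {v}) S T" and cy: "c ~= y"
 shows "ndist \<nu> G v y < ndist \<nu> G c y"
proof -
 obtain P where P: "path_between c y P" "ndist \<nu> G c y = plength P" using ndist_attained[OF c(1) y(1) cy] by blast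
 obtain \<mu> n f where Q: "gpath G (Seq \<mu> (Two n) f)" "\<mu> <= \<nu>" "at_node G (lend (Seq \<mu> (Two n) f)) c"
  "at_node G (rend (Seq \<mu> (Two n) f)) y" "plength (Seq \<mu> (Two n) f) = ndist \<nu> G c y" using path_between_D[OF P(1)] P(2) by auto
 \<comment> \<open>\<open>c\<close> and \<open>y\<close> may touch several sections, but those
   touched by \<open>c\<close> are connected through \<open>c\<close> itself, which is not
   \<open>v\<close>; likewise for \<open>y\<close>.\<close>
 have join: False if "conn (NU - {v}) U U'" "touch c U" "touch y U'" "U \<in> secs" "U' \<in> secs" for U U'
  using touch_same[OF c(1,2,3) that(2) c(4) that(4)] touch_same[OF y(1,2) that(3) y(3) that(5) y(4)] that(1) conn_trans nc by blast
 have "\<mu> = \<nu>"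
 proof (rule ccontr)
  assume "\<mu> ~= \<nu>"
  hence "prank (Seq \<mu> (Two n) f) < \<nu>" using Q(2) by simp
  then obtain U where U: "U \<in> secs" "pbranches (Seq \<mu> (Two n) f) \<subseteq> U" using path_secs[OF Q(1)] by blast
  thus False using join[OF conn_refl] end_touch[OF Q(1,3)] end_touch'[OF Q(1,4)] by blast
 qed
 note Q = Q[unfolded this]
 have n: "0 \<in> {0..<int n}" "int n - 1 \<in> {0..<int n}" using gpath_SeqD(2)[OF Q(1)] by auto
 have f: "gpath G (f i)" "prank (f i) < \<nu>" if "i \<in> {0..<int n}" for i using gpath_SeqD(3,4)[OF Q(1)] that by auto
 have "\<exists>U\<in>secs. pbranches (f i) \<subseteq> U" if "i \<in> {0..<int n}" for i using path_secs f that by blast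
 then obtain \<Sigma> where S: "!!i. i \<in> {0..<int n} ==> \<Sigma> i \<in> secs & pbranches (f i) \<subseteq> \<Sigma> i" by metis
 have le: "lend (Seq \<nu> (Two n) f) = lend (f 0)" "rend (Seq \<nu> (Two n) f) = rend (f (int n - 1))" by auto
 \<comment> \<open>If \<open>v\<close> were no junction, the sections of the constituents would form
   a chain avoiding \<open>v\<close>.\<close>
 have "EX i. 0 < i & i < n & at_node G (rend (f (int i - 1))) v & at_node G (lend (f (int i))) v"
 proof (rule ccontr)
  assume no: "\<nexists>i. 0 < i & i < n & at_node G (rend (f (int i - 1))) v & at_node G (lend (f (int i))) v"
  have "conn (NU - {v}) (\<Sigma> 0) (\<Sigma> (int i))" if "i < n" for i
   using that
  proof (induction i)
   case (Suc i)
   have i: "int (Suc i) - 1 \<in> {0..<int n}" "int (Suc i) \<in> {0..<int n}" using Suc.prems by auto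
   obtain u where u: "u \<in> NU" "at_node G (rend (f (int (Suc i) - 1))) u" "at_node G (lend (f (int (Suc i)))) u"
    using junction_node[OF Q(1) i] by blast
   have "u ~= v" using no Suc.prems u(2,3) by (metis zero_less_Suc)
   hence "conn (NU - {v}) (\<Sigma> (int (Suc i) - 1)) (\<Sigma> (int (Suc i)))"
    using conn_step[of "\<Sigma> (int (Suc i) - 1)" "\<Sigma> (int (Suc i))" u "NU - {v}"] S[OF i(1)] S[OF i(2)] u(1)
     end_touch'[OF f(1)[OF i(1)] u(2)] end_touch[OF f(1)[OF i(2)] u(3)] by blast
   moreover have "conn (NU - {v}) (\<Sigma> 0) (\<Sigma> (int (Suc i) - 1))" using Suc by simp
   ultimately show ?case using conn_trans by blast
  qed simp
  from this[of "n - 1"] have "conn (NU - {v}) (\<Sigma> 0) (\<Sigma> (int n - 1))" using n by (simp add: of_nat_diff)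
  moreover have "touch c (\<Sigma> 0)" using end_touch[OF f(1)[OF n(1)]] Q(3) le S[OF n(1)] by simp
  moreover have "touch y (\<Sigma> (int n - 1))" using end_touch'[OF f(1)[OF n(2)]] Q(4) le S[OF n(2)] by simp
  ultimately show False using join S[OF n(1)] S[OF n(2)] by blast
 qed
 then obtain i where i: "0 < i" "i < n" "at_node G (rend (f (int i - 1))) v" "at_node G (lend (f (int i))) v" by blast
 let ?Q = "Seq \<nu> (Two (n - i)) (%j. f (j + int i))"
 have gQ: "gpath G ?Q" using gpath_split[OF Q(1) i(2)] .
 have "at_node G (lend ?Q) v" "at_node G (rend ?Q) y" using i Q(4) by (auto simp: of_nat_diff)
 hence "path_between v y ?Q" using path_between_I[OF gQ] by simp
 hence "ndist \<nu> G v y <= plength ?Q" by (rule ndist_le[OF y(2)[symmetric]])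
 also have "plength ?Q < plength (Seq \<nu> (Two n) f)"
 proof -
  have j: "int i - 1 \<in> {0..<int n}" "int i - 1 \<in> {0..<int i}" using i by auto
  have "prank (lend (prev (f (int i - 1)))) = rpred \<nu>" using NU_top[OF v(1) i(3)] by (simp add: lend_prev)
  then obtain k where k: "k \<ge> 1" "plength (f (int i - 1)) = replicate_mset k (expo (rpred \<nu>))"
   using length_top[of "prev (f (int i - 1))"] f[OF j(1)] by (auto simp: plength_prev)
  have "plength (Seq \<nu> (Two n) f) = (\<Sum>j\<in>{0..<int i}. plength (f j)) + (\<Sum>j\<in>{int i..<int n}. plength (f j))"
  proof -
   have "{0..<int n} = {0..<int i} Un {int i..<int n}" using i(2) by auto
   thus ?thesis by (simp add: sum.union_disjoint)
  qed
  also have "(\<Sum>j\<in>{int i..<int n}. plength (f j)) = plength ?Q"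
  proof -
   have "(\<Sum>j\<in>{int i..<int n}. plength (f j)) = (\<Sum>j\<in>{0..<int (n - i)}. plength (f (j + int i)))"
    by (rule sum.reindex_bij_witness[of _ "%j. j + int i" "%j. j - int i"]) (use i in \<open>auto simp: of_nat_diff\<close>)
   thus ?thesis by simp
  qed
  also have "(\<Sum>j\<in>{0..<int i}. plength (f j)) = plength (f (int i - 1)) + (\<Sum>j\<in>{0..<int i} - {int i - 1}. plength (f j))"
   by (rule sum.remove[OF _ j(2)]) simp
  finally have "plength ?Q \<subseteq># plength (Seq \<nu> (Two n) f)" "plength ?Q ~= plength (Seq \<nu> (Two n) f)" using k by auto
  thus ?thesis by (intro subset_imp_less_mset) (simp add: subset_mset.less_le)
 qed
 finally show ?thesis using Q(5) by simp
qed

section \<open>Center nodes are not separated\<close>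

lemma conn_avoid:
 assumes "!!S T. S \<in> secs ==> T \<in> secs ==> touch v S ==> touch v T ==> S = T" "conn NU S T"
 shows "conn (NU - {v}) S T"
 using assms(2) unfolding conn_def[of NU]
proof (induction rule: rtranclp_induct)
 case (step T U)
 then obtain u where u: "u \<in> NU" "touch u T" "touch u U" "T \<in> secs" "U \<in> secs" by blast
 have "conn (NU - {v}) T U"
 proof (cases "u = v")
  case True
  hence "T = U" using assms(1)[OF u(4,5)] u(2,3) by simp
  thus ?thesis by simp
 next
  case False thus ?thesis using conn_step u by simp
 qed
 thus ?case using conn_trans step.IH by blast
qed simp

lemma center_conn:
 assumes c1: "c1 \<in> center \<nu> G M" "c1 ~= v" "touch c1 S1" "S1 \<in> secs"
  and c2: "c2 \<in> center \<nu> G M" "c2 ~= v" "touch c2 S2" "S2 \<in> secs" and v: "v \<in> NU"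
 shows "conn (NU - {v}) S1 S2"
proof (rule ccontr)
 assume nc: "\<not> conn (NU - {v}) S1 S2"
 have cM: "c1 \<in> M" "c2 \<in> M" using c1(1) c2(1) unfolding center_def by auto
 have "EX S T. S \<in> secs & T \<in> secs & touch v S & touch v T & S ~= T"
  using conn_avoid[of v S1 S2] conn_all[OF con c1(4) c2(4)] nc by blast
 \<comment> \<open>A \<open>\<nu>\<close>-node that separates sections touches two of them.
   Membership in \<open>M\<close> is needed to compare its eccentricity with that of center
   nodes.\<close>
 hence vM: "v \<in> M" using boundary(1)[OF v] by blast
 hence vO: "v \<in> OK" using M_OK by blast
 obtain y where y: "y \<in> M" "\<forall>z\<in>M. ndist \<nu> G v z <= ndist \<nu> G v y" using farthest[OF v vM] by blast
 have yO: "y \<in> OK" using y(1) M_OK by blast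
 \<comment> \<open>Otherwise all distances from \<open>v\<close> would vanish, in particular the one
   to \<open>c1\<close>, which differs from \<open>v\<close>.\<close>
 have yv: "y ~= v"
 proof
  assume "y = v"
  hence "ndist \<nu> G v c1 <= {#}" using y(2) cM(1) by (auto simp: ndist_def)
  hence "ndist \<nu> G v c1 = {#}" by (metis le_multiset_empty_right order_le_less)
  moreover have "c1 \<in> OK" using cM M_OK by blast
  ultimately show False using ndist_NU[OF v vO, of c1] c1(2) by auto
 qed
 obtain T where T: "T \<in> secs" "touch y T" using touch_exists[OF OK_maxnode[OF yO]] by blast
 have *: "conn (NU - {v}) S T" if c: "c \<in> center \<nu> G M" "c ~= v" "touch c S" "S \<in> secs" for c S
 proof (rule ccontr)
  assume n: "\<not> conn (NU - {v}) S T"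
  have cO: "c \<in> OK" using c(1) M_OK unfolding center_def by blast
  have "c ~= y" using touch_same[OF cO c(2,3) _ c(4) T(1)] T(2) n by blast
  hence "ndist \<nu> G v y < ndist \<nu> G c y" using separated_dist[OF v vO cO c(2-4) yO yv T(2,1) n] by blast
  also have "\<dots> <= ecc \<nu> G M c" using ecc_ge[OF cO y(1)] .
  also have "\<dots> <= ecc \<nu> G M v" using c(1) vM unfolding center_def by blast
  also have "\<dots> <= ndist \<nu> G v y" using ecc_le y(2) by blast
  finally show False by simp
 qed
 show False using nc *[OF c1] *[OF c2] conn_sym conn_trans by blast
qed

section \<open>Blocks\<close>

text \<open>Not being separated by any single \<open>\<nu>\<close>-node is an equivalence between
  sections; this is the union of the class of \<open>S\<close>.\<close>

definition block :: "'a set => 'a set" where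
 "block S = \<Union>{T \<in> secs. \<forall>v\<in>NU. conn (NU - {v}) S T}"

text \<open>A minimal walk between two sections of the block stays in it: \<open>v\<close> occurs on
  the walk at most once, so each section of the walk is connected to one of its two ends without
  passing \<open>v\<close>.\<close>

lemma block_connected:
 assumes S: "S \<in> secs" shows "connected_within G \<nu> (block S) (block S)"
 unfolding connected_within_def
proof (intro ballI)
 fix b c assume "b \<in> block S" "c \<in> block S"
 then obtain T U where T: "T \<in> secs" "\<forall>v\<in>NU. conn (NU - {v}) S T" "b \<in> T" and U: "U \<in> secs" "\<forall>v\<in>NU. conn (NU - {v}) S U" "c \<in> U"
  unfolding block_def by blast
 have bB: "b \<in> branches G" "c \<in> branches G" using secs_sub T U by blast+
 obtain x y where x: "at_node G (Br b True) x" and y: "at_node G (Br c True) y" using Br_node bB by blast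
 have lxy: "low x" "low y" using Br_low x y by blast+
 hence xyO: "x \<in> OK" "y \<in> OK" unfolding low_def by blast+
 have txy: "touch x T" "touch y U" unfolding touch_def using x y T(3) U(3) by (metis empty_subsetI insert_subset pbranches.simps(1))+
 show "EX P. gpath G P & two_ended P & prank P <= \<nu> & pbranches P \<subseteq> block S & meets_branch G P b & meets_branch G P c"
 proof (cases "x = y")
  case True
  hence "T = U" using low_touch_unique[OF lxy(1) txy(1)] txy(2) T U by simp
  then obtain P where P: "gpath G P" "two_ended P" "prank P <= rpred \<nu>" "pbranches P \<subseteq> T" "meets_branch G P b" "meets_branch G P c"
   using sec_connected[OF T(1,3)] U(3) by blast
  moreover have "prank P <= \<nu>" using P(3) rpred_nu(2) by simp
  moreover have "T \<subseteq> block S" unfolding block_def using T by blast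
  ultimately show ?thesis by blast
 next
  case False
  obtain k w \<Sigma> where w: "mwalk NU x y k w \<Sigma>" using minimal_walk[OF T(1) U(1) txy False] by blast
  hence wk: "walk NU x y k w \<Sigma>" "inj_on w {..Suc k}" unfolding mwalk_def by auto
  have \<Sigma>: "\<Sigma> 0 = T" "\<Sigma> k = U"
   using wk(1) low_touch_unique[OF lxy(1) txy(1)] low_touch_unique[OF lxy(2) txy(2)] T(1) U(1) unfolding walk_def by blast+
  have "\<Sigma> i \<subseteq> block S" if i: "i <= k" for i
  proof -
   have "conn (NU - {v}) S (\<Sigma> i)" if v: "v \<in> NU" for v
   proof (cases "EX l. 0 < l & l <= i & w l = v")
    case True
    then obtain l where l: "0 < l" "l <= i" "w l = v" by blast
    have "conn (NU - {v}) (\<Sigma> i) (\<Sigma> k)"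
    proof (rule walk_conn[OF wk(1) i])
     fix m assume m: "i < m" "m <= k"
     hence "w m ~= w l" using wk(2) l(2) by (auto dest: inj_onD)
     moreover have "w m \<in> NU" using wk(1) m unfolding walk_def by auto
     ultimately show "w m \<in> NU - {v}" using l(3) by simp
    qed simp
    thus ?thesis using U(2) v \<Sigma>(2) conn_sym conn_trans by blast
   next
    case no: False
    have "conn (NU - {v}) (\<Sigma> 0) (\<Sigma> i)"
    proof (rule walk_conn[OF wk(1) _ i])
     fix m assume m: "0 < m" "m <= i"
     hence "w m \<in> NU" using wk(1) i unfolding walk_def by auto
     thus "w m \<in> NU - {v}" using no m by blast
    qed simp
    thus ?thesis using T(2) v \<Sigma>(1) conn_trans by blast
   qed
   moreover have "\<Sigma> i \<in> secs" using wk(1) i unfolding walk_def by blast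
   ultimately show ?thesis unfolding block_def by blast
  qed
  hence sub: "(\<Union>i\<le>k. \<Sigma> i) \<subseteq> block S" by blast
  obtain \<mu> n f where P: "gpath G (Seq \<mu> (Two n) f)" "\<mu> <= \<nu>" "pbranches (Seq \<mu> (Two n) f) \<subseteq> (\<Union>i\<le>k. \<Sigma> i)"
   "at_node G (lend (Seq \<mu> (Two n) f)) x" "at_node G (rend (Seq \<mu> (Two n) f)) y"
   using walk_path[OF w _ xyO False] by blast
  have "meets_branch G (Seq \<mu> (Two n) f) b" "meets_branch G (Seq \<mu> (Two n) f) c"
   using meets_Br[OF P(1)] terminal_met P(4,5) x y by blast+
  moreover have "two_ended (Seq \<mu> (Two n) f)" unfolding two_ended_def by blast
  moreover have "prank (Seq \<mu> (Two n) f) <= \<nu>" using P(2) by simp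
  ultimately show ?thesis using P(1) subset_trans[OF P(3) sub] by blast
 qed
qed

text \<open>For maximality, a branch of an unseparated superset lies in one component with a branch
  of \<open>S\<close> after the removal of any \<open>\<nu>\<close>-node, and
  \<open>path_remove_conn\<close> turns this into the defining condition of the block.\<close>

lemma nu_block_block:
 assumes S: "S \<in> secs" shows "nu_block \<nu> G (block S)"
 unfolding nu_block_def
proof (intro conjI allI impI)
 have sub: "block S \<subseteq> branches G" unfolding block_def using secs_sub by blast
 have SB: "S \<subseteq> block S" unfolding block_def using S by auto
 show "unseparated \<nu> G (block S)" unfolding unseparated_def
 proof (intro conjI ballI impI sub block_connected[OF S])
  fix v assume v: "v \<in> nodes G" "nrank v = \<nu>"
  have "block S \<subseteq> \<Union>{T. conn (NU - {v}) S T}" unfolding block_def using NU_nodes[OF v] by blast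
  thus "EX C. component (remove_node G v) \<nu> (branches G) C & block S \<subseteq> C"
   using component_remove[OF removable_NU[OF v] S] by blast
 qed
 fix K assume K: "block S \<subseteq> K & unseparated \<nu> G K"
 obtain b where b: "b \<in> S" using secs_nonempty[OF S] by blast
 have "c \<in> block S" if c: "c \<in> K" for c
 proof -
  have cB: "c \<in> branches G" using K c unfolding unseparated_def by blast
  have "conn (NU - {v}) S (sec c)" if v: "v \<in> NU" for v
  proof -
   have v': "v \<in> nodes G" "nrank v = \<nu>" using v maxnode_node unfolding NU_def by auto
   obtain C where C: "component (remove_node G v) \<nu> (branches G) C" "K \<subseteq> C" using K v' unfolding unseparated_def by blast
   have "b \<in> C" "c \<in> C" using C(2) K c b SB by blast+
   then obtain P where "gpath (remove_node G v) P" "two_ended P" "prank P <= \<nu>"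
    "meets_branch (remove_node G v) P b" "meets_branch (remove_node G v) P c"
    using C(1) unfolding component_def connected_within_def by meson
   hence "conn (NU - {v}) (sec b) (sec c)" using path_remove_conn[OF removable_NU[OF v']] by blast
   thus ?thesis using secs_sec[OF S b] by simp
  qed
  thus ?thesis unfolding block_def secs_def using sec_refl[OF cB] cB by blast
 qed
 thus "K = block S" using K by blast
qed

lemma touch_subgraph:
 assumes "touch x T" "T \<subseteq> B" shows "x \<in> subgraph_nodes G B"
proof -
 obtain p where p: "at_node G p x" "pbranches p \<subseteq> T" using assms(1) unfolding touch_def by blast
 thus ?thesis using assms(2) unfolding subgraph_nodes_def tip_of_subgraph_def at_node_def by blast
qed

text \<open>If \<open>c\<close> is a \<open>\<nu>\<close>-node, it may touch several sections that
  its own removal separates, so the right one must be chosen. The first and the last section of a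
  minimal walk do, as its inner nodes avoid both \<open>c\<close> and \<open>d\<close>.\<close>

lemma end_sections:
 assumes "c \<in> OK" "d \<in> OK" "c ~= d"
 shows "\<exists>S\<in>secs. \<exists>T\<in>secs. touch c S & touch d T & conn (NU - {c}) S T & conn (NU - {d}) S T"
proof -
 obtain S where S: "S \<in> secs" "touch c S" using touch_exists[OF OK_maxnode[OF assms(1)]] by blast
 obtain T where T: "T \<in> secs" "touch d T" using touch_exists[OF OK_maxnode[OF assms(2)]] by blast
 obtain k w \<Sigma> where w: "mwalk NU c d k w \<Sigma>" using minimal_walk[OF S(1) T(1) S(2) T(2) assms(3)] by (elim exE)
 hence wk: "walk NU c d k w \<Sigma>" and inj: "inj_on w {..Suc k}" unfolding mwalk_def by auto
 have e: "w 0 = c" "w (Suc k) = d" using wk unfolding walk_def by auto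
 have wl: "w l \<in> NU - {c}" "w l \<in> NU - {d}" if "0 < l" "l <= k" for l
 proof -
  have "w l \<in> NU" using wk that unfolding walk_def by auto
  moreover have "w l ~= w 0" "w l ~= w (Suc k)" using inj that by (auto dest: inj_onD)
  ultimately show "w l \<in> NU - {c}" "w l \<in> NU - {d}" using e by auto
 qed
 have "conn (NU - {c}) (\<Sigma> 0) (\<Sigma> k)" "conn (NU - {d}) (\<Sigma> 0) (\<Sigma> k)" using walk_conn[OF wk, of 0 k] wl by auto
 moreover have "\<Sigma> 0 \<in> secs" "\<Sigma> k \<in> secs" "touch c (\<Sigma> 0)" "touch d (\<Sigma> k)" using wk e unfolding walk_def by (metis le0 order_refl)+
 ultimately show ?thesis by blast
qed

text \<open>The block is that of the section \<open>S\<close> in which a walk from a center node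
  \<open>c\<close> to another one \<open>c'\<close> starts. The second node serves to deal with the
  removal of \<open>c\<close> itself, where \<open>center_conn\<close> says nothing about
  \<open>c\<close>.\<close>

theorem center_block: "EX B. nu_block \<nu> G B & center \<nu> G M \<subseteq> subgraph_nodes G B"
proof -
 let ?Z = "center \<nu> G M"
 have ZO: "?Z \<subseteq> OK" using M_OK unfolding center_def by blast
 have reduce: ?thesis if S: "S \<in> secs" "!!c. c \<in> ?Z ==> \<exists>T\<in>secs. touch c T & (\<forall>v\<in>NU. conn (NU - {v}) S T)" for S
 proof -
  have "?Z \<subseteq> subgraph_nodes G (block S)"
  proof
   fix c assume "c \<in> ?Z"
   then obtain T where T: "T \<in> secs" "touch c T" "\<forall>v\<in>NU. conn (NU - {v}) S T" using S(2) by blast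
   have "T \<subseteq> block S" unfolding block_def using T by blast
   thus "c \<in> subgraph_nodes G (block S)" using touch_subgraph T(2) by blast
  qed
  thus ?thesis using nu_block_block[OF S(1)] by blast
 qed
 show ?thesis
 proof (cases "EX c c'. c \<in> ?Z & c' \<in> ?Z & c ~= c'")
  case False
  obtain x where x: "maxnode G x" using tfg maxnode_above unfolding transfinite_graph_def by blast
  show ?thesis
  proof (cases "?Z = {}")
   case True
   obtain S where "S \<in> secs" using touch_exists[OF x] by blast
   thus ?thesis using reduce True by blast
  next
   case nonempty: False
   then obtain c where c: "c \<in> ?Z" by blast
   then obtain S where "S \<in> secs" "touch c S" using touch_exists OK_maxnode ZO by blast
   thus ?thesis using reduce[of S] False c by (metis conn_refl)
  qed
 next
  case True
  then obtain c c' where c: "c \<in> ?Z" "c' \<in> ?Z" "c ~= c'" by blast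
  obtain S S' where S: "S \<in> secs" "S' \<in> secs" "touch c S" "touch c' S'" "conn (NU - {c}) S S'"
   using end_sections[of c c'] c ZO by blast
  show ?thesis
  proof (rule reduce[OF S(1)])
   fix d assume d: "d \<in> ?Z"
   show "\<exists>T\<in>secs. touch d T & (\<forall>v\<in>NU. conn (NU - {v}) S T)"
   proof (cases "d = c")
    case True thus ?thesis using S(1,3) by auto
   next
    case False
    have dO: "d \<in> OK" "c \<in> OK" using d c ZO by blast+
    obtain U T where T: "U \<in> secs" "T \<in> secs" "touch c U" "touch d T" "conn (NU - {d}) U T"
     using end_sections[OF dO(2,1)] False by blast
    \<comment> \<open>For \<open>v = d\<close>, the walk from \<open>c\<close> to \<open>d\<close>
      avoids \<open>d\<close>, and sections at \<open>c\<close> are connected through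
      \<open>c\<close>. For \<open>v = c\<close>, the connection goes from \<open>S\<close> to
      \<open>S'\<close> and from there, by \<open>center_conn\<close> for \<open>c'\<close> and
      \<open>d\<close>, to \<open>T\<close>.\<close>
    have "conn (NU - {v}) S T" if v: "v \<in> NU" for v
    proof -
     consider "v = d" | "v = c" | "v ~= c" "v ~= d" by blast
     thus ?thesis
     proof cases
      case 1
      have "conn (NU - {d}) S U" using touch_same[OF dO(2) _ S(3) T(3) S(1) T(1), of d] False by simp
      thus ?thesis using T(5) 1 conn_trans by blast
     next
      case 2
      have "conn (NU - {c}) S' T" using center_conn[OF c(2) _ S(4,2) d False T(4,2)] c(3) v 2 by blast
      thus ?thesis using S(5) 2 conn_trans by blast
     next
      case 3 thus ?thesis using center_conn[OF c(1) _ S(3,1) d _ T(4,2) v] by blast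
     qed
    qed
    thus ?thesis using T(2,4) by blast
   qed
  qed
 qed
qed

end

theorem theorem9p5:
  fixes G :: "'b tgraph" and \<nu> :: rank and M :: "'b node set"
  assumes "Rk 1 \<le> \<nu>" and "\<nu> \<noteq> Arr"
    and "transfinite_graph \<nu> G"
    and "nu_connected \<nu> G"
    and "condition_C \<nu> G"
    and "metrizable \<nu> G M"
    and "pristine \<nu> G"
    and "finite {x. boundary_node \<nu> G x}"
  shows "\<exists>H. nu_block \<nu> G H \<and> center \<nu> G M \<subseteq> subgraph_nodes G H"
proof -
  interpret center_graph G \<nu> M by unfold_locales (use assms in auto)
  show ?thesis using center_block .
qed

end
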